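(* Let $L>0$, $\gamma<0$, $1<p<3$ and $m>0$. Then there exists a real-valued and positive energy ground state, i.e. a real-valued positive minimizer for $$e_{m,\gamma}=\inf\{E_\gamma(u): u\in H^1(\mathbb S_L),\ M(u)=m\}.$$ Moreover, there exists $\omega=\omega(m)>\frac{\gamma^2}{4}$ such that this minimizer satisfies the equation $$-\partial_{xx}u-\partial_{yy}u+\omega u+\gamma\delta_0(x)u-|u|^{p-1}u=0\ \text{ in }\mathbb S_L,\qquad \partial_\nu u=0\ \text{ on }\partial\mathbb S_L=\mathbb R\times\{0,L\}.$$
   Context: For $L>0$, $\mathbb S_L=\mathbb R\times[0,L]$, and $H^1(\mathbb S_L)$ is the usual Sobolev space of complex-valued functions; $u(0,y)$ denotes the trace of $u$ on $\{x=0\}$, which belongs to $L^2(0,L)$. The symbol $\delta_0(x)$ is defined by $(\delta_0(x)u,v)=\int_0^L \mathrm{Re}\big(u(0,y)\overline{v(0,y)}\big)dy$ for $u,v\in H^1(\mathbb S_L)$. The equation is understood in the weak sense: for all $v\in H^1(\mathbb S_L)$, $$\mathrm{Re}\int_{\mathbb S_L}\big(\nabla u\cdot\overline{\nabla v}+\omega u\bar v-|u|^{p-1}u\bar v\big)dxdy+\gamma\int_0^L\mathrm{Re}\big(u(0,y)\overline{v(0,y)}\big)dy=0 .$$ The energy and mass are $$E_\gamma(u)=\tfrac12\|\nabla u\|_{L^2(\mathbb S_L)}^2+\tfrac{\gamma}{2}\int_0^L|u(0,y)|^2dy-\tfrac1{p+1}\|u\|_{L^{p+1}(\mathbb S_L)}^{p+1},\qquad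 M(u)=\|u\|_{L^2(\mathbb S_L)}^2.$$ *)

theory Defs
  imports "HOL-Analysis.Analysis"
begin

definition strip :: "real \<Rightarrow> (real \<times> real) set" where
  "strip L = UNIV \<times> {0..L}"

text \<open>
  Elements of the Lebesgue and Sobolev spaces are represented by functions on the whole plane (or
  line); only their values almost everywhere on the set \<open>A\<close> in question matter. Every class of
  almost everywhere equal Lebesgue measurable functions has a Borel representative, so Borel
  measurability is no restriction.
\<close>

definition L2 :: "'a::euclidean_space set \<Rightarrow> ('a \<Rightarrow> complex) set" where
  "L2 A = {f. set_borel_measurable lborel A f \<and> set_integrable lborel A (\<lambda>z. (cmod (f z))\<^sup>2)}"

primrec C_k :: "nat \<Rightarrow> (real \<times> real \<Rightarrow> complex) \<Rightarrow> bool" where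
  "C_k 0 f \<longleftrightarrow> continuous_on UNIV f"
| "C_k (Suc k) f \<longleftrightarrow>
     (\<forall>z. f differentiable at z) \<and> (\<forall>d. C_k k (\<lambda>z. frechet_derivative f (at z) d))"

definition Cc_infinity :: "(real \<times> real) set \<Rightarrow> (real \<times> real \<Rightarrow> complex) set" where
  "Cc_infinity U =
     {\<phi>. (\<forall>k. C_k k \<phi>) \<and> (\<exists>K. compact K \<and> K \<subseteq> U \<and> (\<forall>z. z \<notin> K \<longrightarrow> \<phi> z = 0))}"

text \<open>
  Weak derivatives in direction \<open>d\<close>, which below is one of the two coordinate directions. The test
  functions are supported in the open strip, so nothing is imposed on the boundary.
\<close>

definition has_weak_partial ::
    "real \<Rightarrow> real \<times> real \<Rightarrow> (real \<times> real \<Rightarrow> complex) \<Rightarrow> (real \<times> real \<Rightarrow> complex) \<Rightarrow> bool" where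
  "has_weak_partial L d u g \<longleftrightarrow>
     (\<forall>\<phi>\<in>Cc_infinity (interior (strip L)).
        (LINT z:strip L|lborel. u z * frechet_derivative \<phi> (at z) d) =
        - (LINT z:strip L|lborel. g z * \<phi> z))"

definition H1 :: "real \<Rightarrow> (real \<times> real \<Rightarrow> complex) set" where
  "H1 L = {u \<in> L2 (strip L).
     (\<exists>g\<in>L2 (strip L). has_weak_partial L (1, 0) u g) \<and>
     (\<exists>g\<in>L2 (strip L). has_weak_partial L (0, 1) u g)}"

text \<open>For \<open>u\<close> in \<open>H1 L\<close> the choices are unique up to a null set.\<close>

definition wdx :: "real \<Rightarrow> (real \<times> real \<Rightarrow> complex) \<Rightarrow> real \<times> real \<Rightarrow> complex" where
  "wdx L u = (SOME g. g \<in> L2 (strip L) \<and> has_weak_partial L (1, 0) u g)"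

definition wdy :: "real \<Rightarrow> (real \<times> real \<Rightarrow> complex) \<Rightarrow> real \<times> real \<Rightarrow> complex" where
  "wdy L u = (SOME g. g \<in> L2 (strip L) \<and> has_weak_partial L (0, 1) u g)"

definition grad_norm_sq :: "real \<Rightarrow> (real \<times> real \<Rightarrow> complex) \<Rightarrow> real" where
  "grad_norm_sq L u =
     (LINT z:strip L|lborel. (cmod (wdx L u z))\<^sup>2 + (cmod (wdy L u z))\<^sup>2)"

definition mass :: "real \<Rightarrow> (real \<times> real \<Rightarrow> complex) \<Rightarrow> real" where
  "mass L u = (LINT z:strip L|lborel. (cmod (u z))\<^sup>2)"

definition H1_norm :: "real \<Rightarrow> (real \<times> real \<Rightarrow> complex) \<Rightarrow> real" where
  "H1_norm L u = sqrt (mass L u + grad_norm_sq L u)"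

text \<open>
  The trace on \<open>{0} \<times> {0..L}\<close>: the continuous extension to \<open>H1 L\<close>, with values in
  \<open>L2 {0..L}\<close>, of the restriction map on smooth functions.
\<close>

definition has_trace :: "real \<Rightarrow> (real \<times> real \<Rightarrow> complex) \<Rightarrow> (real \<Rightarrow> complex) \<Rightarrow> bool" where
  "has_trace L u t \<longleftrightarrow> t \<in> L2 {0..L} \<and>
     (\<exists>\<phi> :: nat \<Rightarrow> real \<times> real \<Rightarrow> complex.
        (\<forall>n. \<phi> n \<in> Cc_infinity UNIV) \<and>
        (\<lambda>n. H1_norm L (\<lambda>z. \<phi> n z - u z)) \<longlonglongrightarrow> 0 \<and>
        (\<lambda>n. LINT y:{0..L}|lborel. (cmod (\<phi> n (0, y) - t y))\<^sup>2) \<longlonglongrightarrow> 0)"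

definition trace0 :: "real \<Rightarrow> (real \<times> real \<Rightarrow> complex) \<Rightarrow> real \<Rightarrow> complex" where
  "trace0 L u = (SOME t. has_trace L u t)"

definition delta0 ::
    "real \<Rightarrow> (real \<times> real \<Rightarrow> complex) \<Rightarrow> (real \<times> real \<Rightarrow> complex) \<Rightarrow> real" where
  "delta0 L u v = (LINT y:{0..L}|lborel. Re (trace0 L u y * cnj (trace0 L v y)))"

definition energy :: "real \<Rightarrow> real \<Rightarrow> real \<Rightarrow> (real \<times> real \<Rightarrow> complex) \<Rightarrow> real" where
  "energy L \<gamma> p u =
     1 / 2 * grad_norm_sq L u
     + \<gamma> / 2 * (LINT y:{0..L}|lborel. (cmod (trace0 L u y))\<^sup>2)
     - 1 / (p + 1) * (LINT z:strip L|lborel. cmod (u z) powr (p + 1))"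

text \<open>
  The infimum is taken in the extended reals, where it is meaningful also without a priori
  boundedness from below.
\<close>

definition min_energy :: "real \<Rightarrow> real \<Rightarrow> real \<Rightarrow> real \<Rightarrow> ereal" where
  "min_energy L \<gamma> p m = (INF u\<in>{u \<in> H1 L. mass L u = m}. ereal (energy L \<gamma> p u))"

definition energy_ground_state ::
    "real \<Rightarrow> real \<Rightarrow> real \<Rightarrow> real \<Rightarrow> (real \<times> real \<Rightarrow> complex) \<Rightarrow> bool" where
  "energy_ground_state L \<gamma> p m u \<longleftrightarrow>
     u \<in> H1 L \<and> mass L u = m \<and> ereal (energy L \<gamma> p u) = min_energy L \<gamma> p m"

text \<open>
  The weak form of \<open>- u\<^sub>x\<^sub>x - u\<^sub>y\<^sub>y + \<omega> u + \<gamma> \<delta>\<^sub>0(x) u - |u|\<^bsup>p-1\<^esup> u = 0\<close> in the strip. The Neumann condition on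
  \<open>UNIV \<times> {0, L}\<close> is contained in it, because \<open>v\<close> need not vanish there.
\<close>

definition weak_solution ::
    "real \<Rightarrow> real \<Rightarrow> real \<Rightarrow> real \<Rightarrow> (real \<times> real \<Rightarrow> complex) \<Rightarrow> bool" where
  "weak_solution L \<gamma> p \<omega> u \<longleftrightarrow> u \<in> H1 L \<and>
     (\<forall>v\<in>H1 L.
        Re (LINT z:strip L|lborel.
              wdx L u z * cnj (wdx L v z) + wdy L u z * cnj (wdy L v z)
              + of_real \<omega> * u z * cnj (v z)
              - of_real (cmod (u z) powr (p - 1)) * u z * cnj (v z))
        + \<gamma> * delta0 L u v = 0)"

end

theory Submission
  imports Defs "HOL-Library.Diagonal_Subsequence"
begin

text \<open>
  All variational quantities are computed on nonnegative \<open>C\<^sup>1\<close> functions with bounded support in \<open>x\<close>;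
  smoothing \<open>\<bar>v\<bar>\<close> extends every inequality to the Sobolev space. The bottom of the quadratic form is that
  of the delta potential on the line, so the infimum of the energy is at most \<open>- \<gamma>\<^sup>2 m / 8\<close> and the
  multiplier exceeds \<open>\<gamma>\<^sup>2 / 4\<close> because the nonlinear term contributes strictly.

  A minimizing sequence, translated so that its trace at \<open>x = 0\<close> is almost maximal, does not vanish near
  \<open>x = 0\<close>: translation does not increase the energy because \<open>\<gamma> < 0\<close>. Since the mass exponent of the nonlinear term
  is greater than 1, splitting off mass towards infinity would cost energy, so the sequence is tight and
  hence precompact in \<open>L\<^sup>2\<close>; the parallelogram identity for the quadratic part upgrades this to
  convergence in \<open>H\<^sup>1\<close>. Testing the minimality along \<open>u + t v\<close> gives the equation. The limit is a nonnegative
  supersolution, and testing with \<open>\<chi>\<^sup>2 / (u + \<epsilon>)\<close> bounds the gradient of \<open>log (u + \<epsilon>)\<close> uniformly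
  in \<open>\<epsilon>\<close>, which forces \<open>u > 0\<close> almost everywhere.
\<close>

text \<open>The weak derivatives and the trace in the statement are choices, fixed only up to null
  sets, so nothing is estimated on them directly: \<open>approx\<close> ties a Sobolev function, its
  gradient and its trace to one sequence of C^1 functions, and inequalities pass to the limit. The
  mass constraint is removed by scaling: multiplying a function by a constant to reach mass m turns
  minimality into an inequality valid for every positive mass (\<open>scaling\<close>,
  \<open>key_inequality\<close>), and minimality is used only in this form. It gives the strict loss
  on splitting mass (\<open>FF_ge\<close>). Along u + t v it becomes a cubic polynomial in t that is
  nonnegative near 0 and at most 0 at t = 0, so the nonlinear term never has to be differentiated.
  The hypothesis p < 3 enters through q = p + 1 < 4: the power q is interpolated between 2 and 4
  with an arbitrarily small weight on the fourth power, whose integral is at most linear in the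
  squared gradient norm. Although the strip has a boundary, no extension operator occurs: the strip
  is contracted slightly in y before mollifying.\<close>

type_synonym plane = "real \<times> real"

lemmas DERIV_iff_vec = has_real_derivative_iff_has_vector_derivative

section \<open>Elementary inequalities for powers\<close>

text \<open>Below \<open>K\<close> the factor \<open>w powr (q - 2)\<close> is at most
  \<open>K powr (q - 2)\<close>, above \<open>K\<close> the factor \<open>w powr (q - 4)\<close> is
  at most \<open>K powr (q - 4)\<close>. For \<open>q < 4\<close> a large \<open>K\<close> makes the
  weight of the fourth power as small as desired.\<close>

lemma powr_interpolation:
 fixes w K q :: real
 assumes "0 <= w" "0 < K" "2 <= q" "q <= 4"
 shows "w powr q <= K powr (q - 2) * w^2 + K powr (q - 4) * w ^ 4"
proof (cases "w = 0")
 case False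
 then have w: "0 < w" using assms by simp
 have e2: "w powr q = w powr (q - 2) * w^2"
  using w by (simp add: powr_diff powr_numeral)
 have e4: "w powr q = w powr (q - 4) * w ^ 4"
  using w by (simp add: powr_diff powr_numeral)
 show ?thesis
 proof (cases "w <= K")
  case True
  then have "w powr (q - 2) <= K powr (q - 2)" using assms by (intro powr_mono2) auto
  then have "w powr q <= K powr (q - 2) * w^2" unfolding e2 by (intro mult_right_mono) auto
  then show ?thesis by (simp add: add_increasing2)
 next
  case False
  then have "w powr (q - 4) <= K powr (q - 4)" using assms by (intro powr_mono2') auto
  then have "w powr q <= K powr (q - 4) * w ^ 4" unfolding e4 by (intro mult_right_mono) auto
  then show ?thesis by (simp add: add_increasing)
 qed
qed (use assms in auto)

text \<open>Turns a lower bound on the square integral over a set of finite measure into one on the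
  integral of the power \<open>q\<close>: values below \<open>K\<close> contribute at most
  \<open>K^2\<close> times the measure.\<close>

lemma square_le_powr:
 fixes w K q :: real
 assumes "0 <= w" "0 < K" "2 <= q"
 shows "w^2 <= K^2 + K powr (2 - q) * w powr q"
proof (cases "w <= K")
 case True
 then have "w^2 <= K^2" using assms by (intro power_mono) auto
 then show ?thesis by (simp add: add_increasing2)
next
 case False
 then have w: "0 < w" using assms by simp
 have "K powr (q - 2) <= w powr (q - 2)" using False assms by (intro powr_mono2) auto
 then have "1 <= K powr (2 - q) * w powr (q - 2)"
  using assms powr_minus_divide[of K "q - 2"] by (simp add: le_divide_eq)
 then have "w^2 * 1 <= w^2 * (K powr (2 - q) * w powr (q - 2))" by (intro mult_left_mono) auto
 also have "\<dots> = K powr (2 - q) * w powr q"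
  using w by (simp add: powr_diff powr_numeral)
 finally show ?thesis by (simp add: add_increasing)
qed

text \<open>With \<open>\<eta>\<close> such that \<open>(1 + \<eta>) powr q = 1 + \<delta>\<close>,
  either \<open>a\<close> exceeds \<open>b\<close> by at most the factor \<open>1 + \<eta>\<close>,
  or both numbers are controlled by their difference.\<close>

lemma powr_perturbation:
 fixes \<delta> q :: real
 assumes "0 < \<delta>" "0 < q"
 obtains C where "0 <= C" "\<And>a b. 0 <= a ==> 0 <= b ==> a powr q <= (1 + \<delta>) * b powr q + C * \<bar>a - b\<bar> powr q"
proof
 define \<eta> where "\<eta> = (1 + \<delta>) powr (1 / q) - 1"
 have "(1::real) powr (1 / q) < (1 + \<delta>) powr (1 / q)"
  using assms by (intro powr_less_mono2) auto
 then have \<eta>: "0 < \<eta>" by (simp add: \<eta>_def)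
 have \<eta>q: "(1 + \<eta>) powr q = 1 + \<delta>" using assms by (simp add: \<eta>_def powr_powr)
 show "0 <= (1 + 1 / \<eta>) powr q" by simp
 fix a b :: real assume ab: "0 <= a" "0 <= b"
 show "a powr q <= (1 + \<delta>) * b powr q + (1 + 1 / \<eta>) powr q * \<bar>a - b\<bar> powr q"
 proof (cases "\<bar>a - b\<bar> <= \<eta> * b")
  case True
  then have "a <= (1 + \<eta>) * b" by (simp add: algebra_simps)
  then have "a powr q <= ((1 + \<eta>) * b) powr q" using ab assms by (intro powr_mono2) auto
  also have "\<dots> = (1 + \<delta>) * b powr q" using ab \<eta> by (simp add: powr_mult \<eta>q)
  finally show ?thesis by (simp add: add_increasing2)
 next
  case False
  then have "b <= \<bar>a - b\<bar> / \<eta>" using \<eta> by (simp add: field_simps)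
  then have "a <= (1 + 1 / \<eta>) * \<bar>a - b\<bar>" by (simp add: algebra_simps)
  then have "a powr q <= ((1 + 1 / \<eta>) * \<bar>a - b\<bar>) powr q" using ab assms by (intro powr_mono2) auto
  also have "\<dots> = (1 + 1 / \<eta>) powr q * \<bar>a - b\<bar> powr q" using \<eta> by (simp add: powr_mult)
  finally show ?thesis using assms by (simp add: add_increasing)
 qed
qed

lemma powr_tangent:
 fixes r s q :: real
 assumes "0 <= r" "0 < s" "1 <= q"
 shows "s powr q + q * s powr (q - 1) * (r - s) <= r powr q"
\<comment> \<open>The tangent argument runs on the open half-line, where the power is
  differentiable, so the endpoint is treated apart.\<close>
proof (cases "r = 0")
 case True
 have "s powr q = s powr (q - 1) * s" using assms by (simp add: powr_diff)
 then show ?thesis using True assms by (simp add: algebra_simps)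
next
 case False
 have "convex_on {0<..} (%x::real. x powr q)"
  using powr_convex[OF \<open>1 <= q\<close>] by (rule convex_on_subset) auto
 then have "r powr q - s powr q \<ge> (q * s powr (q - 1)) * (r - s)"
 proof (rule convex_on_imp_above_tangent)
  show "((%x. x powr q) has_field_derivative q * s powr (q - 1)) (at s within {0<..})"
   using assms by (auto intro!: derivative_eq_intros)
 qed (use assms False in \<open>auto simp: interior_open\<close>)
 then show ?thesis by simp
qed

text \<open>Cauchy-Schwarz reduces convexity of a power of the norm to the scalar tangent
  inequality. This one-sided bound replaces differentiation under the integral in the Euler-Lagrange
  equation.\<close>

lemma powr_norm_tangent:
 fixes a b :: "'a::real_inner"
 assumes "2 <= q"
 shows "norm a powr q + q * (norm a powr (q - 2) * inner a b) <= norm (a + b) powr q"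
proof (cases "a = 0")
 case False
 have i: "inner a (a + b) = norm a ^ 2 + inner a b" by (simp add: inner_add_right power2_norm_eq_inner)
 have "inner a (a + b) <= norm a * norm (a + b)" by (rule norm_cauchy_schwarz)
 then have "norm a + inner a b / norm a <= norm (a + b)"
  using False by (simp add: i field_simps power2_eq_square)
 then have "norm a powr (q - 1) * (inner a b / norm a) <= norm a powr (q - 1) * (norm (a + b) - norm a)"
  by (intro mult_left_mono) auto
 moreover have "norm a powr (q - 1) * (inner a b / norm a) = norm a powr (q - 2) * inner a b"
  using False by (simp add: powr_diff power2_eq_square powr_numeral)
 ultimately have "q * (norm a powr (q - 2) * inner a b) <= q * (norm a powr (q - 1) * (norm (a + b) - norm a))"
  using assms by (intro mult_left_mono) auto
 moreover have "norm a powr q + q * norm a powr (q - 1) * (norm (a + b) - norm a) <= norm (a + b) powr q"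
  using False assms by (intro powr_tangent) auto
 ultimately show ?thesis by (simp add: algebra_simps)
qed auto

section \<open>Square integrable functions\<close>

text \<open>The codomain is any Euclidean space, so that real trial functions, complex Sobolev
  functions and traces share one set of lemmas.\<close>

definition sqi :: "'a measure => ('a => 'b::euclidean_space) set" where
 "sqi M = {f \<in> borel_measurable M. integrable M (%x. (norm (f x))^2)}"

definition l2 :: "'a measure => ('a => 'b::euclidean_space) => real" where
 "l2 M f = sqrt (LINT x|M. (norm (f x))^2)"

lemma sqiD [measurable_dest]: "f \<in> sqi M ==> f \<in> borel_measurable M"
 by (simp add: sqi_def)

lemma sqi_integrable: "f \<in> sqi M ==> integrable M (%x. (norm (f x))^2)"
 by (simp add: sqi_def)

lemma sqiI: "f \<in> borel_measurable M ==> integrable M (%x. (norm (f x))^2) ==> f \<in> sqi M"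
 by (simp add: sqi_def)

lemma l2_nonneg [simp]: "0 <= l2 M f"
 by (simp add: l2_def)

lemma l2_sq: "(l2 M f)^2 = (LINT x|M. (norm (f x))^2)"
 by (simp add: l2_def)

lemma l2_cong_AE:
 assumes "f \<in> borel_measurable M" "g \<in> borel_measurable M" "AE x in M. f x = g x"
 shows "l2 M f = l2 M g"
 unfolding l2_def using assms by (intro arg_cong[where f = sqrt] integral_cong_AE) auto

lemma sqi_dominated:
 assumes "g \<in> sqi M" "f \<in> borel_measurable M" "AE x in M. norm (f x) <= norm (g x)"
 shows "f \<in> sqi M" "l2 M f <= l2 M g"
proof -
 have [measurable]: "f \<in> borel_measurable M" "g \<in> borel_measurable M" using assms by (auto simp: sqi_def)
 have ae: "AE x in M. (norm (f x))^2 <= (norm (g x))^2"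
  using assms(3) by eventually_elim (auto intro: power_mono)
 have i: "integrable M (%x. (norm (f x))^2)"
  by (rule Bochner_Integration.integrable_bound[OF sqi_integrable[OF assms(1)]]) (use ae in auto)
 then show "f \<in> sqi M" by (simp add: sqi_def)
 show "l2 M f <= l2 M g"
  unfolding l2_def using ae by (intro real_sqrt_le_mono integral_mono_AE i sqi_integrable assms)
qed

lemma sqi_add:
 assumes "f \<in> sqi M" "g \<in> sqi M" shows "(%x. f x + g x) \<in> sqi M"
proof (rule sqiI)
 have [measurable]: "f \<in> borel_measurable M" "g \<in> borel_measurable M" using assms by (auto simp: sqi_def)
 show "(%x. f x + g x) \<in> borel_measurable M" by simp
 have *: "(norm (a + b))^2 <= 2 * (norm a)^2 + 2 * (norm b)^2" for a b :: 'b
 proof -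
  have "(norm (a + b))^2 <= (norm a + norm b)^2" by (intro power_mono norm_triangle_ineq) auto
  also have "\<dots> <= 2 * (norm a)^2 + 2 * (norm b)^2"
   using sum_squares_bound[of "norm a" "norm b"] by (simp add: power2_sum)
  finally show ?thesis .
 qed
 show "integrable M (%x. (norm (f x + g x))^2)"
  by (rule Bochner_Integration.integrable_bound[of _ "%x. 2 * (norm (f x))^2 + 2 * (norm (g x))^2"])
   (use assms * in \<open>auto intro!: sqi_integrable\<close>)
qed

lemma sqi_scale: "f \<in> sqi M ==> (%x. c *\<^sub>R f x) \<in> sqi M"
 by (auto simp: sqi_def power_mult_distrib)

lemma l2_scale: "l2 M (%x. c *\<^sub>R f x) = \<bar>c\<bar> * l2 M f"
 by (simp add: l2_def power_mult_distrib real_sqrt_mult)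

lemma sqi_minus: "f \<in> sqi M ==> (%x. - f x) \<in> sqi M"
 by (auto simp: sqi_def)

lemma l2_minus: "l2 M (%x. - f x) = l2 M f"
 by (simp add: l2_def)

lemma l2_minus_commute: "l2 M (%x. f x - g x) = l2 M (%x. g x - f x)"
 by (simp add: l2_def norm_minus_commute)

lemma sqi_diff: "f \<in> sqi M ==> g \<in> sqi M ==> (%x. f x - g x) \<in> sqi M"
 using sqi_add[of f M "%x. - g x"] by (simp add: sqi_minus)

lemma sqi_norm: "f \<in> sqi M ==> (%x. norm (f x)) \<in> sqi M"
 by (auto simp: sqi_def)

lemma l2_norm: "l2 M (%x. norm (f x)) = l2 M f"
 by (simp add: l2_def)

lemma sqi_mult_integrable:
 assumes "f \<in> sqi M" "g \<in> sqi M"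
 shows "integrable M (%x. norm (f x) * norm (g x))"
proof (rule Bochner_Integration.integrable_bound[of _ "%x. (norm (f x))^2 + (norm (g x))^2"])
 show "integrable M (%x. (norm (f x))^2 + (norm (g x))^2)" using assms by (auto intro: sqi_integrable)
 show "(%x. norm (f x) * norm (g x)) \<in> borel_measurable M" using assms by (auto simp: sqi_def)
 have "a * b <= a^2 + b^2" if "0 <= a" "0 <= b" for a b :: real
  using sum_squares_bound[of a b] that mult_nonneg_nonneg[OF that] by linarith
 then show "AE x in M. norm (norm (f x) * norm (g x)) <= norm ((norm (f x))^2 + (norm (g x))^2)" by simp
qed

lemma L2_Cauchy_Schwarz:
 assumes "f \<in> sqi M" "g \<in> sqi M"
 shows "(LINT x|M. norm (f x) * norm (g x)) <= l2 M f * l2 M g"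
proof -
 let ?I = "\<integral>x. norm (f x) * norm (g x) \<partial>M"
 have [measurable]: "f \<in> borel_measurable M" "g \<in> borel_measurable M" using assms by (auto simp: sqi_def)
 have "(\<integral>\<^sup>+x. ennreal (norm (f x)) * ennreal (norm (g x)) \<partial>M)^2
   <= (\<integral>\<^sup>+x. ennreal (norm (f x)) ^ 2 \<partial>M) * (\<integral>\<^sup>+x. ennreal (norm (g x)) ^ 2 \<partial>M)"
  by (rule Cauchy_Schwarz_nn_integral) auto
 moreover have "(\<integral>\<^sup>+x. ennreal (norm (f x)) * ennreal (norm (g x)) \<partial>M) = ennreal ?I"
  by (simp add: ennreal_mult[symmetric] nn_integral_eq_integral sqi_mult_integrable assms)
 moreover have "(\<integral>\<^sup>+x. ennreal (norm (f x)) ^ 2 \<partial>M) = ennreal ((l2 M f)^2)"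
  by (simp add: ennreal_power l2_sq nn_integral_eq_integral sqi_integrable assms)
 moreover have "(\<integral>\<^sup>+x. ennreal (norm (g x)) ^ 2 \<partial>M) = ennreal ((l2 M g)^2)"
  by (simp add: ennreal_power l2_sq nn_integral_eq_integral sqi_integrable assms)
 ultimately have "ennreal (?I^2) <= ennreal ((l2 M f * l2 M g)^2)"
  by (simp add: ennreal_power ennreal_mult[symmetric] power_mult_distrib)
 then have "?I^2 <= (l2 M f * l2 M g)^2" by (subst (asm) ennreal_le_iff) auto
 then show ?thesis by (rule power2_le_imp_le) auto
qed

lemma norm_integral_le:
 fixes f :: "'a => 'b::{banach,second_countable_topology}"
 assumes "integrable M g" "AE x in M. norm (f x) <= g x"
 shows "norm (LINT x|M. f x) <= (LINT x|M. g x)"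
proof -
 have "norm (LINT x|M. f x) <= (LINT x|M. norm (f x))" by (rule integral_norm_bound)
 also have "\<dots> <= (LINT x|M. g x)"
 proof (rule integral_mono_AE'[OF assms])
  show "AE x in M. 0 <= g x" using assms(2) by eventually_elim (meson norm_ge_zero order_trans)
 qed
 finally show ?thesis .
qed

lemma L2_inner_integrable:
 assumes "f \<in> sqi M" "g \<in> sqi M"
 shows "integrable M (%x. inner (f x) (g x))"
proof (rule Bochner_Integration.integrable_bound[OF sqi_mult_integrable[OF assms]])
 have [measurable]: "f \<in> borel_measurable M" "g \<in> borel_measurable M" using assms by (auto simp: sqi_def)
 show "(%x. inner (f x) (g x)) \<in> borel_measurable M" by simp
 show "AE x in M. norm (inner (f x) (g x)) <= norm (norm (f x) * norm (g x))"
  by (simp add: Cauchy_Schwarz_ineq2)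
qed

lemma L2_inner_le:
 assumes "f \<in> sqi M" "g \<in> sqi M"
 shows "\<bar>\<integral>x. inner (f x) (g x) \<partial>M\<bar> <= l2 M f * l2 M g"
proof -
 have "\<bar>\<integral>x. inner (f x) (g x) \<partial>M\<bar> <= (LINT x|M. norm (f x) * norm (g x))"
  unfolding real_norm_def[symmetric]
  by (rule norm_integral_le[OF sqi_mult_integrable[OF assms]]) (simp add: Cauchy_Schwarz_ineq2)
 also have "\<dots> <= l2 M f * l2 M g" by (rule L2_Cauchy_Schwarz[OF assms])
 finally show ?thesis .
qed

lemma L2_mult_integrable:
 fixes f g :: "'a => complex"
 assumes "f \<in> sqi M" "g \<in> sqi M"
 shows "integrable M (%x. f x * g x)"
proof (rule Bochner_Integration.integrable_bound[OF sqi_mult_integrable[OF assms]])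
 have [measurable]: "f \<in> borel_measurable M" "g \<in> borel_measurable M" using assms by (auto simp: sqi_def)
 show "(%x. f x * g x) \<in> borel_measurable M" by simp
qed (auto simp: norm_mult)

lemma L2_mult_le:
 fixes f g :: "'a => complex"
 assumes "f \<in> sqi M" "g \<in> sqi M"
 shows "norm (LINT x|M. f x * g x) <= l2 M f * l2 M g"
proof -
 have "norm (LINT x|M. f x * g x) <= (LINT x|M. norm (f x) * norm (g x))"
  by (rule norm_integral_le[OF sqi_mult_integrable[OF assms]]) (simp add: norm_mult)
 also have "\<dots> <= l2 M f * l2 M g" by (rule L2_Cauchy_Schwarz[OF assms])
 finally show ?thesis .
qed

lemma l2_add_sq:
 assumes "f \<in> sqi M" "g \<in> sqi M"
 shows "(l2 M (%x. f x + g x))^2 = (l2 M f)^2 + 2 * (LINT x|M. inner (f x) (g x)) + (l2 M g)^2"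
proof -
 have "(norm (f x + g x))^2 = (norm (f x))^2 + 2 * inner (f x) (g x) + (norm (g x))^2" for x
  by (simp add: power2_norm_eq_inner inner_add_left inner_add_right inner_commute)
 then show ?thesis using assms
  by (simp add: l2_sq sqi_integrable L2_inner_integrable)
qed

lemma l2_triangle:
 assumes "f \<in> sqi M" "g \<in> sqi M"
 shows "l2 M (%x. f x + g x) <= l2 M f + l2 M g"
proof (rule power2_le_imp_le)
 show "(l2 M (%x. f x + g x))^2 <= (l2 M f + l2 M g)^2"
  unfolding l2_add_sq[OF assms] using L2_inner_le[OF assms] by (simp add: power2_sum)
qed simp

lemma l2_triangle_diff:
 assumes "f \<in> sqi M" "g \<in> sqi M" "h \<in> sqi M"
 shows "l2 M (%x. f x - h x) <= l2 M (%x. f x - g x) + l2 M (%x. g x - h x)"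
 using l2_triangle[OF sqi_diff[OF assms(1,2)] sqi_diff[OF assms(2,3)]] by simp

lemma l2_diff_le:
 assumes "f \<in> sqi M" "g \<in> sqi M"
 shows "\<bar>l2 M f - l2 M g\<bar> <= l2 M (%x. f x - g x)"
 using l2_triangle[OF sqi_diff[OF assms] assms(2)] l2_triangle[OF sqi_diff[OF assms(2,1)] assms(1)]
  l2_minus_commute[of M f g] by simp

lemma l2_tendsto:
 assumes "\<And>n. f n \<in> sqi M" "g \<in> sqi M" "(%n. l2 M (%x. f n x - g x)) \<longlonglongrightarrow> 0"
 shows "(%n. l2 M (f n)) \<longlonglongrightarrow> l2 M g"
proof -
 have "(%n. l2 M (f n) - l2 M g) \<longlonglongrightarrow> 0"
  by (rule Lim_null_comparison[OF _ assms(3)]) (use l2_diff_le[OF assms(1) assms(2)] in \<open>auto intro: always_eventually\<close>)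
 then show ?thesis by (simp add: LIM_zero_iff)
qed

lemma L2_inner_tendsto:
 assumes f: "\<And>n. f n \<in> sqi M" "f' \<in> sqi M" "(%n. l2 M (%x. f n x - f' x)) \<longlonglongrightarrow> 0"
  and g: "\<And>n. g n \<in> sqi M" "g' \<in> sqi M" "(%n. l2 M (%x. g n x - g' x)) \<longlonglongrightarrow> 0"
 shows "(%n. \<integral>x. inner (f n x) (g n x) \<partial>M) \<longlonglongrightarrow> (LINT x|M. inner (f' x) (g' x))"
proof -
 have "(%n. (LINT x|M. inner (f n x) (g n x)) - (LINT x|M. inner (f' x) (g' x))) \<longlonglongrightarrow> 0"
 proof (rule Lim_null_comparison)
  show "\<forall>\<^sub>F n in sequentially. norm ((LINT x|M. inner (f n x) (g n x)) - (LINT x|M. inner (f' x) (g' x)))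
    <= l2 M (%x. f n x - f' x) * l2 M (g n) + l2 M f' * l2 M (%x. g n x - g' x)"
  proof (intro always_eventually allI)
   fix n
   have "(LINT x|M. inner (f n x) (g n x)) - (LINT x|M. inner (f' x) (g' x))
    = (LINT x|M. inner (f n x - f' x) (g n x)) + (LINT x|M. inner (f' x) (g n x - g' x))"
    by (simp add: inner_diff_left inner_diff_right L2_inner_integrable f g)
   then show "norm ((LINT x|M. inner (f n x) (g n x)) - (LINT x|M. inner (f' x) (g' x)))
    <= l2 M (%x. f n x - f' x) * l2 M (g n) + l2 M f' * l2 M (%x. g n x - g' x)"
    using L2_inner_le[OF sqi_diff[OF f(1)[of n] f(2)] g(1)[of n]]
     L2_inner_le[OF f(2) sqi_diff[OF g(1)[of n] g(2)]] by simp
  qed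
  have "(%n. l2 M (%x. f n x - f' x) * l2 M (g n) + l2 M f' * l2 M (%x. g n x - g' x)) \<longlonglongrightarrow> 0 * l2 M g' + l2 M f' * 0"
   by (intro tendsto_intros f g l2_tendsto[of g M g'])
  then show "(%n. l2 M (%x. f n x - f' x) * l2 M (g n) + l2 M f' * l2 M (%x. g n x - g' x)) \<longlonglongrightarrow> 0" by simp
 qed
 then show ?thesis by (simp add: LIM_zero_iff)
qed

lemma L2_mult_tendsto:
 fixes g :: "'a => complex"
 assumes f: "\<And>n. f n \<in> sqi M" "f' \<in> sqi M" "(%n. l2 M (%x. f n x - f' x)) \<longlonglongrightarrow> 0"
  and g: "g \<in> sqi M"
 shows "(%n. \<integral>x. f n x * g x \<partial>M) \<longlonglongrightarrow> (LINT x|M. f' x * g x)"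
proof -
 have "(%n. (LINT x|M. f n x * g x) - (LINT x|M. f' x * g x)) \<longlonglongrightarrow> 0"
 proof (rule Lim_null_comparison)
  show "\<forall>\<^sub>F n in sequentially. norm ((LINT x|M. f n x * g x) - (LINT x|M. f' x * g x))
    <= l2 M (%x. f n x - f' x) * l2 M g"
  proof (intro always_eventually allI)
   fix n
   have "(LINT x|M. f n x * g x) - (LINT x|M. f' x * g x) = (LINT x|M. (f n x - f' x) * g x)"
    by (simp add: left_diff_distrib L2_mult_integrable f g)
   then show "norm ((LINT x|M. f n x * g x) - (LINT x|M. f' x * g x)) <= l2 M (%x. f n x - f' x) * l2 M g"
    using L2_mult_le[OF sqi_diff[OF f(1)[of n] f(2)] g] by simp
  qed
  show "(%n. l2 M (%x. f n x - f' x) * l2 M g) \<longlonglongrightarrow> 0"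
   using tendsto_mult[OF f(3) tendsto_const[of "l2 M g"]] by simp
 qed
 then show ?thesis by (simp add: LIM_zero_iff)
qed

lemma l2_eq_0_iff:
 assumes "f \<in> sqi M" shows "l2 M f = 0 \<longleftrightarrow> (AE x in M. f x = 0)"
 using assms integral_nonneg_eq_0_iff_AE[OF sqi_integrable[OF assms]] by (simp add: l2_def)

text \<open>Fatou's lemma in a form that also yields integrability of the limit, as needed for
  \<open>norm (u z) powr q\<close>, where nothing is known beforehand.\<close>

lemma integral_Fatou:
 fixes h :: "nat => 'a => real"
 assumes int: "\<And>k. integrable M (h k)" and nn: "\<And>k x. 0 <= h k x"
  and [measurable]: "g \<in> borel_measurable M"
  and lim: "AE x in M. (%k. h k x) \<longlonglongrightarrow> g x"
  and le: "\<forall>\<^sub>F k in sequentially. (LINT x|M. h k x) <= C"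
 shows "integrable M g" "(LINT x|M. g x) <= C"
proof -
 have [measurable]: "h k \<in> borel_measurable M" for k using int[of k] by simp
 have C: "0 <= C"
 proof -
  obtain k where "(LINT x|M. h k x) <= C" using le eventually_happens' sequentially_bot by blast
  moreover have "0 <= (LINT x|M. h k x)" using nn by simp
  ultimately show ?thesis by linarith
 qed
 have g0: "AE x in M. 0 <= g x" using lim
  by eventually_elim (rule LIMSEQ_le_const, auto intro: nn)
 have "(\<integral>\<^sup>+x. ennreal (g x) \<partial>M) = (\<integral>\<^sup>+x. liminf (%k. ennreal (h k x)) \<partial>M)"
 proof (rule nn_integral_cong_AE, use lim in eventually_elim)
  fix x assume "(%k. h k x) \<longlonglongrightarrow> g x"
  then have "(%k. ennreal (h k x)) \<longlonglongrightarrow> ennreal (g x)" by (intro tendsto_ennrealI)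
  then show "ennreal (g x) = liminf (%k. ennreal (h k x))" by (intro lim_imp_Liminf[symmetric]) auto
 qed
 also have "\<dots> <= liminf (%k. \<integral>\<^sup>+x. ennreal (h k x) \<partial>M)" by (rule nn_integral_liminf) auto
 also have "\<dots> <= ennreal C"
 proof (rule Liminf_le)
  show "\<forall>\<^sub>F k in sequentially. (\<integral>\<^sup>+x. ennreal (h k x) \<partial>M) <= ennreal C"
   using le by eventually_elim (auto simp: nn_integral_eq_integral int nn intro: ennreal_leI)
 qed simp
 finally have *: "(\<integral>\<^sup>+x. ennreal (g x) \<partial>M) <= ennreal C" .
 show i: "integrable M g"
 proof (rule integrableI_nonneg)
  show "(\<integral>\<^sup>+x. ennreal (g x) \<partial>M) < \<infinity>" using * by (auto simp: top.not_eq_extremum intro: le_less_trans)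
 qed (use g0 in auto)
 show "(LINT x|M. g x) <= C"
  using * g0 C by (simp add: nn_integral_eq_integral i ennreal_le_iff)
qed

lemma L2_tendsto_AE_subseq:
 assumes f: "\<And>n. f n \<in> sqi M" "g \<in> sqi M" "(%n. l2 M (%x. f n x - g x)) \<longlonglongrightarrow> 0"
 obtains r where "strict_mono (r::nat => nat)" "AE x in M. (%k. f (r k) x) \<longlonglongrightarrow> g x"
proof -
 have "\<exists>r::nat=>nat. strict_mono r \<and> (AE x in M. (%n. (norm (f (r n) x - g x))^2) \<longlonglongrightarrow> 0)"
 proof (rule tendsto_L1_AE_subseq)
  show "integrable M (%x. (norm (f n x - g x))^2)" for n by (intro sqi_integrable sqi_diff f)
  have "(%n. (l2 M (%x. f n x - g x))^2) \<longlonglongrightarrow> 0^2" by (intro tendsto_power f)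
  then show "(%n. \<integral>x. norm ((norm (f n x - g x))^2) \<partial>M) \<longlonglongrightarrow> 0" by (simp add: l2_sq)
 qed
 then obtain r :: "nat => nat" where r: "strict_mono r"
  and ae: "AE x in M. (%n. (norm (f (r n) x - g x))^2) \<longlonglongrightarrow> 0" by auto
 have "AE x in M. (%k. f (r k) x) \<longlonglongrightarrow> g x" using ae
 proof eventually_elim
  fix x assume "(%n. (norm (f (r n) x - g x))^2) \<longlonglongrightarrow> 0"
  then have "(%n. sqrt ((norm (f (r n) x - g x))^2)) \<longlonglongrightarrow> sqrt 0" by (rule tendsto_real_sqrt)
  then have "(%n. f (r n) x - g x) \<longlonglongrightarrow> 0" by (simp add: tendsto_norm_zero_iff)
  then show "(%k. f (r k) x) \<longlonglongrightarrow> g x" by (simp add: LIM_zero_iff)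
 qed
 then show ?thesis using r that by blast
qed

text \<open>Riesz-Fischer: along a subsequence whose increments have norm at most
  \<open>(1/4) ^ j\<close> the limit exists almost everywhere, and Fatou transfers the Cauchy
  condition to it.\<close>

lemma L2_complete:
 fixes f :: "nat => 'a => 'b::euclidean_space"
 assumes f: "\<And>n. f n \<in> sqi M"
  and cauchy: "\<And>e. 0 < e ==> \<exists>N. \<forall>n\<ge>N. \<forall>k\<ge>N. l2 M (%x. f n x - f k x) < e"
 obtains g where "g \<in> sqi M" "(%n. l2 M (%x. f n x - g x)) \<longlonglongrightarrow> 0"
proof -
 have [measurable]: "f n \<in> borel_measurable M" for n using f by (auto simp: sqi_def)
 have "\<exists>N. \<forall>n\<ge>N. \<forall>k\<ge>N. l2 M (%x. f n x - f k x) < (1/4) ^ j" for j :: nat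
  by (rule cauchy) simp
 then obtain N where N: "\<And>j n k. n \<ge> N j ==> k \<ge> N j ==> l2 M (%x. f n x - f k x) < (1/4) ^ j" by metis
 define r where "r = rec_nat (N 0) (%j m. max (Suc m) (N (Suc j)))"
 have r0: "r 0 = N 0" and rS: "r (Suc j) = max (Suc (r j)) (N (Suc j))" for j by (simp_all add: r_def)
 have rN: "N j <= r j" for j by (cases j) (auto simp: r0 rS)
 have r: "strict_mono r" unfolding strict_mono_Suc_iff by (auto simp: rS)
 define d where "d = (%j x. f (r (Suc j)) x - f (r j) x)"
 have dm[measurable]: "d j \<in> borel_measurable M" for j by (simp add: d_def)
 have dsq: "d j \<in> sqi M" for j unfolding d_def by (intro sqi_diff f)
 have dl: "l2 M (d j) <= (1/4) ^ j" for j
  using N[of j "r (Suc j)" "r j"] rN[of j] strict_monoD[OF r, of j "Suc j"] by (simp add: d_def)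
 \<comment> \<open>The weight \<open>4 ^ j\<close> still leaves the integrals summable, while
   finiteness of the weighted sum at a point forces the increments there to decay like
   \<open>(1/2) ^ j\<close>.\<close>
 let ?h = "%j x. 4 ^ j * (norm (d j x))^2"
 have hb: "(\<integral>\<^sup>+x. ennreal (?h j x) \<partial>M) <= ennreal ((1/4) ^ j)" for j
 proof -
  have i: "integrable M (?h j)" by (intro integrable_mult_right sqi_integrable dsq)
  have "(l2 M (d j))^2 <= ((1/4) ^ j)^2" by (intro power_mono dl) auto
  then have "4 ^ j * (l2 M (d j))^2 <= 4 ^ j * ((1/4) ^ j)^2" by (intro mult_left_mono) auto
  also have "4 ^ j * ((1/4) ^ j)^2 = ((1/4)::real) ^ j"
   by (simp add: power2_eq_square power_divide)
  finally show ?thesis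
   by (subst nn_integral_eq_integral[OF i]) (auto simp: l2_sq intro: ennreal_leI)
 qed
 have "(\<integral>\<^sup>+x. (\<Sum>j. ennreal (?h j x)) \<partial>M) = (\<Sum>j. \<integral>\<^sup>+x. ennreal (?h j x) \<partial>M)"
  by (rule nn_integral_suminf) auto
 also have "\<dots> <= (\<Sum>j. ennreal ((1/4) ^ j))" by (intro suminf_le hb) auto
 also have "\<dots> = ennreal (\<Sum>j. (1/4) ^ j)" by (rule suminf_ennreal2) (auto intro: summable_geometric)
 also have "\<dots> < \<infinity>" by simp
 finally have fin: "(\<integral>\<^sup>+x. (\<Sum>j. ennreal (?h j x)) \<partial>M) < \<infinity>" .
 have "AE x in M. (\<Sum>j. ennreal (?h j x)) \<noteq> \<infinity>"
 proof (rule nn_integral_PInf_AE)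
  show "(%x. \<Sum>j. ennreal (?h j x)) \<in> borel_measurable M"
   by (rule borel_measurable_suminf_order) measurable
  show "(\<integral>\<^sup>+x. (\<Sum>j. ennreal (?h j x)) \<partial>M) \<noteq> \<infinity>" using fin by (rule less_imp_neq)
 qed
 then have ae: "AE x in M. convergent (%k. f (r k) x)"
 proof eventually_elim
  fix x assume *: "(\<Sum>j. ennreal (?h j x)) \<noteq> \<infinity>"
  have "summable (%j. ?h j x)" using * by (intro summable_suminf_not_top) auto
  then have "bounded (range (%j. ?h j x))" by (metis summable_imp_bounded)
  then obtain C where C: "\<And>j. \<bar>?h j x\<bar> <= C" by (auto simp: bounded_iff)
  have C0: "0 <= C" using C[of 0] by (meson abs_ge_zero order_trans)
  have b: "norm (d j x) <= sqrt C * (1/2) ^ j" for j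
  proof (rule power2_le_imp_le)
   have "4 ^ j * (norm (d j x))^2 <= C" using C[of j] by linarith
   moreover have "((1/2)^j)^2 = (1::real) / 4 ^ j"
   proof -
    have "((1/2)^j)^2 = ((1/2)^2::real) ^ j" by (simp only: power_mult[symmetric] mult.commute)
    then show ?thesis by (simp add: power_divide)
   qed
   ultimately show "(norm (d j x))^2 <= (sqrt C * (1/2) ^ j)^2"
    using C0 by (simp add: power_mult_distrib field_simps)
  qed (use C0 in simp)
  have "summable (%j. norm (d j x))"
   by (rule summable_comparison_test[of _ "%j. sqrt C * (1/2) ^ j"]) (use b in \<open>auto intro!: summable_mult summable_geometric\<close>)
  then have "summable (%j. d j x)" by (rule summable_norm_cancel)
  then have "convergent (%k. \<Sum>j<k. d j x)" by (simp add: summable_iff_convergent)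
  moreover have "(\<Sum>j<k. d j x) = f (r k) x - f (r 0) x" for k
   unfolding d_def by (rule sum_lessThan_telescope)
  ultimately have "convergent (%k. f (r k) x - f (r 0) x)" by simp
  then have "convergent (%k. (f (r k) x - f (r 0) x) + f (r 0) x)" by (intro convergent_add convergent_const)
  then show "convergent (%k. f (r k) x)" by simp
 qed
 define g where "g = (%x. lim (%k. f (r k) x))"
 have g[measurable]: "g \<in> borel_measurable M" unfolding g_def by (rule borel_measurable_lim_metric) simp
 have lim: "AE x in M. (%k. f (r k) x) \<longlonglongrightarrow> g x"
  using ae by eventually_elim (simp add: g_def convergent_LIMSEQ_iff)
 have key: "integrable M (%x. (norm (f n x - g x))^2) \<and> (LINT x|M. (norm (f n x - g x))^2) <= e^2"
  if "0 < e" and N: "\<And>k. k \<ge> N ==> l2 M (%x. f n x - f k x) < e" for n e N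
 proof -
  have *: "integrable M (%x. (norm (f n x - f (r k) x))^2)" for k by (intro sqi_integrable sqi_diff f)
  have le: "\<forall>\<^sub>F k in sequentially. (LINT x|M. (norm (f n x - f (r k) x))^2) <= e^2"
  proof (rule eventually_sequentiallyI[of N])
   fix k assume "N <= k"
   then have "N <= r k" using seq_suble[OF r, of k] by linarith
   then have "(l2 M (%x. f n x - f (r k) x))^2 <= e^2" using N[of "r k"] by (intro power_mono) auto
   then show "(LINT x|M. (norm (f n x - f (r k) x))^2) <= e^2" by (simp add: l2_sq)
  qed
  have l: "AE x in M. (%k. (norm (f n x - f (r k) x))^2) \<longlonglongrightarrow> (norm (f n x - g x))^2"
   using lim by eventually_elim (intro tendsto_intros)
  show ?thesis using integral_Fatou[OF * _ _ l le] by simp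
 qed
 obtain N0 where N0: "\<forall>n\<ge>N0. \<forall>k\<ge>N0. l2 M (%x. f n x - f k x) < 1" using cauchy[of 1] by auto
 have "(%x. f N0 x - g x) \<in> sqi M" using key[of 1 N0 N0] N0 by (intro sqiI) auto
 from sqi_diff[OF f[of N0] this] have gs: "g \<in> sqi M" by simp
 moreover have "(%n. l2 M (%x. f n x - g x)) \<longlonglongrightarrow> 0"
 proof (rule LIMSEQ_I)
  fix e :: real assume e: "0 < e"
  obtain N1 where N1: "\<And>n k. n\<ge>N1 ==> k\<ge>N1 ==> l2 M (%x. f n x - f k x) < e/2" using cauchy[of "e/2"] e by auto
  show "\<exists>no. \<forall>n\<ge>no. norm (l2 M (%x. f n x - g x) - 0) < e"
  proof (intro exI allI impI)
   fix n assume "n \<ge> N1"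
   then have "(l2 M (%x. f n x - g x))^2 <= (e/2)^2" using key[of "e/2" N1 n] N1 e by (auto simp: l2_sq)
   then have "l2 M (%x. f n x - g x) <= e/2" by (rule power2_le_imp_le) (use e in auto)
   then show "norm (l2 M (%x. f n x - g x) - 0) < e" using e by simp
  qed
 qed
 ultimately show ?thesis using that by blast
qed

section \<open>The measure of the strip\<close>

definition Ival :: "real => real => real measure" where
 "Ival a b = restrict_space lborel {a..b}"

lemma space_Ival [simp]: "space (Ival a b) = {a..b}"
 by (simp add: Ival_def space_restrict_space)

lemma integrable_Ival:
 fixes f :: "real => 'b::{banach,second_countable_topology}"
 shows "integrable (Ival a b) f \<longleftrightarrow> integrable lborel (%x. indicator {a..b} x *\<^sub>R f x)"
 by (simp add: Ival_def integrable_restrict_space)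

lemma integral_Ival:
 fixes f :: "real => 'b::{banach,second_countable_topology}"
 shows "integral\<^sup>L (Ival a b) f = (LINT x|lborel. indicator {a..b} x *\<^sub>R f x)"
 by (simp add: Ival_def integral_restrict_space)

lemma finite_measure_Ival: "finite_measure (Ival a b)"
 by (rule finite_measureI) (simp add: Ival_def space_restrict_space emeasure_restrict_space emeasure_lborel_Icc_eq)

lemma measure_Ival: "a <= b ==> measure (Ival a b) {a..b} = b - a"
 by (simp add: Ival_def measure_restrict_space)

lemma measurable_Ival_continuous:
 fixes f :: "real => 'b::topological_space"
 shows "continuous_on UNIV f ==> f \<in> borel_measurable (Ival a b)"
 unfolding Ival_def by (intro measurable_restrict_space1) (simp add: borel_measurable_continuous_onI)

lemma integrable_Ival_continuous:
 fixes f :: "real => 'b::{banach,second_countable_topology}"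
 shows "continuous_on UNIV f ==> integrable (Ival a b) f"
 unfolding integrable_Ival by (intro borel_integrable_compact) (auto intro: continuous_on_subset)

lemma sqi_Ival_continuous: "continuous_on UNIV f ==> f \<in> sqi (Ival a b)"
 by (intro sqiI measurable_Ival_continuous integrable_Ival_continuous continuous_intros)

lemma restrict_space_lborel_UNIV: "restrict_space lborel UNIV = (lborel :: real measure)"
 by (rule measure_eqI) (auto simp: sets_restrict_space emeasure_restrict_space)

text \<open>The statement integrates over a subset of the plane, Fubini wants a product measure. One
  inclusion of the sigma-algebras goes by generators, the other by measurability of the identity
  into the unrestricted product.\<close>

lemma pair_measure_restrict_lborel:
 fixes A B :: "real set"
 assumes A[measurable]: "A \<in> sets borel" and B[measurable]: "B \<in> sets borel"
 shows "restrict_space lborel A \<Otimes>\<^sub>M restrict_space lborel B = restrict_space (lborel :: (plane) measure) (A \<times> B)"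
proof (rule pair_measure_eqI)
 show "sigma_finite_measure (restrict_space lborel A)" "sigma_finite_measure (restrict_space lborel B)"
  by (rule sigma_finite_measure_restrict_space[OF lborel.sigma_finite_measure_axioms], simp)+
 have AB: "A \<times> B \<in> sets (lborel \<Otimes>\<^sub>M lborel)" by (intro pair_measureI) auto
 then have AB': "A \<times> B \<in> sets borel" unfolding lborel_prod by simp
 show "sets (restrict_space lborel A \<Otimes>\<^sub>M restrict_space lborel B) = sets (restrict_space lborel (A \<times> B))"
 proof
  show "sets (restrict_space lborel A \<Otimes>\<^sub>M restrict_space lborel B) \<subseteq> sets (restrict_space lborel (A \<times> B))"
   unfolding sets_pair_measure
  proof (rule sets.sigma_sets_subset')
   show "space (restrict_space lborel A) \<times> space (restrict_space lborel B) \<in> sets (restrict_space lborel (A \<times> B))"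
    using AB' by (simp add: space_restrict_space sets_restrict_space_iff)
   show "{a \<times> b |a b. a \<in> sets (restrict_space lborel A) \<and> b \<in> sets (restrict_space lborel B)}
    \<subseteq> sets (restrict_space lborel (A \<times> B))"
    using AB by (auto simp: sets_restrict_space_iff lborel_prod[symmetric])
  qed
  show "sets (restrict_space lborel (A \<times> B)) \<subseteq> sets (restrict_space lborel A \<Otimes>\<^sub>M restrict_space lborel B)"
  proof
   fix Y assume "Y \<in> sets (restrict_space (lborel :: (plane) measure) (A \<times> B))"
   then obtain X where X: "X \<in> sets (lborel \<Otimes>\<^sub>M lborel)" "Y = (A \<times> B) \<inter> X"
    by (auto simp: sets_restrict_space lborel_prod[symmetric])
   have "(%z. (fst z, snd z)) \<in> (restrict_space lborel A \<Otimes>\<^sub>M restrict_space lborel B) \<rightarrow>\<^sub>M (lborel \<Otimes>\<^sub>M lborel)"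
    by (intro measurable_Pair measurable_compose[OF measurable_fst] measurable_compose[OF measurable_snd]
      measurable_restrict_space1) auto
   from measurable_sets[OF this X(1)]
   show "Y \<in> sets (restrict_space lborel A \<Otimes>\<^sub>M restrict_space lborel B)"
    by (simp add: X(2) space_pair_measure space_restrict_space vimage_def Int_def conj_commute)
  qed
 qed
 fix X Y assume X: "X \<in> sets (restrict_space lborel A)" and Y: "Y \<in> sets (restrict_space lborel B)"
 then have *: "X \<in> sets borel" "Y \<in> sets borel" "X \<subseteq> A" "Y \<subseteq> B" by (auto simp: sets_restrict_space_iff)
 have "emeasure (restrict_space (lborel \<Otimes>\<^sub>M lborel) (A \<times> B)) (X \<times> Y) = emeasure (lborel \<Otimes>\<^sub>M lborel) (X \<times> Y)"
  using AB * by (intro emeasure_restrict_space) (auto simp: lborel_prod)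
 also have "\<dots> = emeasure lborel X * emeasure lborel Y"
  using * by (intro lborel.emeasure_pair_measure_Times) auto
 finally show "emeasure (restrict_space lborel A) X * emeasure (restrict_space lborel B) Y =
   emeasure (restrict_space lborel (A \<times> B)) (X \<times> Y)"
  using * by (simp add: emeasure_restrict_space lborel_prod)
qed

text \<open>A product by definition, so that both orders of iterated integration apply;
  \<open>SL_eq\<close> is the link to the strip of the statement.\<close>

definition SL :: "real => (plane) measure" where
 "SL L = lborel \<Otimes>\<^sub>M Ival 0 L"

lemma SL_eq: "SL L = restrict_space lborel (strip L)"
 using pair_measure_restrict_lborel[of UNIV "{0..L}"] restrict_space_lborel_UNIV by (simp add: SL_def Ival_def strip_def)

lemma strip_sets [measurable]: "strip L \<in> sets borel"
 unfolding strip_def by (intro borel_closed closed_Times) auto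

lemma space_SL [simp]: "space (SL L) = strip L"
 by (simp add: SL_eq space_restrict_space)

lemma box_eq: "Ival a b \<Otimes>\<^sub>M Ival c d = restrict_space lborel ({a..b} \<times> {c..d})"
 unfolding Ival_def by (rule pair_measure_restrict_lborel) auto

lemma box_sets [measurable]: "{a..b::real} \<times> {c..d::real} \<in> sets borel"
 by (intro borel_closed closed_Times) auto

lemma integral_SL:
 fixes f :: "plane => 'b::{banach,second_countable_topology}"
 shows "integral\<^sup>L (SL L) f = (LINT z|lborel. indicator (strip L) z *\<^sub>R f z)"
 by (simp add: SL_eq integral_restrict_space)

lemma integrable_SL:
 fixes f :: "plane => 'b::{banach,second_countable_topology}"
 shows "integrable (SL L) f \<longleftrightarrow> integrable lborel (%z. indicator (strip L) z *\<^sub>R f z)"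
 by (simp add: SL_eq integrable_restrict_space)

lemma set_integral_strip:
 fixes f :: "plane => 'b::{banach,second_countable_topology}"
 shows "(LINT z:strip L|lborel. f z) = integral\<^sup>L (SL L) f"
 by (simp add: integral_SL set_lebesgue_integral_def)

lemma set_integral_Ival:
 fixes f :: "real => 'b::{banach,second_countable_topology}"
 shows "(LINT z:{a..b}|lborel. f z) = integral\<^sup>L (Ival a b) f"
 by (simp add: integral_Ival set_lebesgue_integral_def)

lemma L2_strip: "L2 (strip L) = sqi (SL L)"
 unfolding L2_def sqi_def set_borel_measurable_def set_integrable_def integrable_SL
 by (simp add: SL_eq borel_measurable_restrict_space_iff)

lemma L2_Ival: "L2 {a..b::real} = sqi (Ival a b)"
 unfolding L2_def sqi_def set_borel_measurable_def set_integrable_def integrable_Ival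
 by (simp add: Ival_def borel_measurable_restrict_space_iff)

lemma box_integral_SL:
 fixes f :: "plane => 'b::{banach,second_countable_topology}"
 assumes "0 <= c" "d <= L"
 shows "integral\<^sup>L (Ival a b \<Otimes>\<^sub>M Ival c d) f = (LINT z|SL L. indicator ({a..b} \<times> {c..d}) z *\<^sub>R f z)"
proof -
 have "indicator ({a..b} \<times> {c..d}) z *\<^sub>R f z = indicator (strip L) z *\<^sub>R (indicator ({a..b} \<times> {c..d}) z *\<^sub>R f z)" for z
  using assms by (auto simp: indicator_def strip_def)
 then have "(LINT z|lborel. indicator ({a..b} \<times> {c..d}) z *\<^sub>R f z)
   = (LINT z|lborel. indicator (strip L) z *\<^sub>R (indicator ({a..b} \<times> {c..d}) z *\<^sub>R f z))"
  by (rule Bochner_Integration.integral_cong[OF refl])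
 then show ?thesis
  unfolding box_eq integral_SL by (subst integral_restrict_space) auto
qed

lemma integrable_box:
 fixes f :: "plane => 'b::{banach,second_countable_topology}"
 assumes "continuous_on UNIV f"
 shows "integrable (Ival a b \<Otimes>\<^sub>M Ival c d) f"
 unfolding box_eq using assms
 by (auto simp: integrable_restrict_space intro!: borel_integrable_compact compact_Times intro: continuous_on_subset)

lemma measurable_SL_continuous:
 fixes f :: "plane => 'b::topological_space"
 shows "continuous_on UNIV f ==> f \<in> borel_measurable (SL L)"
 unfolding SL_eq by (intro measurable_restrict_space1) (simp add: borel_measurable_continuous_onI)

lemma sigma_finite_Ival: "sigma_finite_measure (Ival a b)"
 using finite_measure_Ival by (simp add: finite_measure.axioms(1))

lemma pair_SL: "pair_sigma_finite lborel (Ival a b)"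
 by (intro pair_sigma_finite.intro sigma_finite_Ival lborel.sigma_finite_measure_axioms)

lemma pair_box: "pair_sigma_finite (Ival a b) (Ival c d)"
 by (intro pair_sigma_finite.intro sigma_finite_Ival)

section \<open>Functions of class \<open>C\<^sup>1\<close>\<close>

definition xsupp :: "(plane => 'b::real_normed_vector) => bool" where
 "xsupp f \<longleftrightarrow> (\<exists>R. \<forall>x y. R < \<bar>x\<bar> \<longrightarrow> f (x, y) = 0)"

text \<open>Compact support is only required in the unbounded direction of the strip.\<close>

definition C1c :: "(plane => 'b::real_normed_vector) => (plane => 'b) => (plane => 'b) => bool" where
 "C1c f fx fy \<longleftrightarrow> continuous_on UNIV f \<and> continuous_on UNIV fx \<and> continuous_on UNIV fy \<and>
  xsupp f \<and> xsupp fx \<and> xsupp fy \<and>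
  (\<forall>x y. ((%s. f (s, y)) has_vector_derivative fx (x, y)) (at x)) \<and>
  (\<forall>x y. ((%t. f (x, t)) has_vector_derivative fy (x, y)) (at y))"

lemma C1cD:
 assumes "C1c f fx fy"
 shows "continuous_on UNIV f" "continuous_on UNIV fx" "continuous_on UNIV fy"
  "xsupp f" "xsupp fx" "xsupp fy"
  "((%s. f (s, y)) has_vector_derivative fx (x, y)) (at x)"
  "((%t. f (x, t)) has_vector_derivative fy (x, y)) (at y)"
 using assms by (auto simp: C1c_def)

lemma xsupp_map: "xsupp f ==> (\<And>z. f z = 0 ==> g z = 0) ==> xsupp g"
 unfolding xsupp_def by blast

lemma xsupp_map2:
 assumes "xsupp f" "xsupp g" "\<And>z. f z = 0 ==> g z = 0 ==> h z = 0"
 shows "xsupp h"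
proof -
 obtain R R' where "\<forall>x y. R < \<bar>x\<bar> \<longrightarrow> f (x, y) = 0" "\<forall>x y. R' < \<bar>x\<bar> \<longrightarrow> g (x, y) = 0"
  using assms(1,2) by (auto simp: xsupp_def)
 then have "\<forall>x y. max R R' < \<bar>x\<bar> \<longrightarrow> h (x, y) = 0" using assms(3) by auto
 then show ?thesis unfolding xsupp_def by blast
qed

lemma integrable_SL_continuous:
 fixes f :: "plane => 'b::{banach,second_countable_topology}"
 assumes "continuous_on UNIV f" "xsupp f"
 shows "integrable (SL L) f"
proof -
 obtain R where R: "\<And>x y. R < \<bar>x\<bar> ==> f (x, y) = 0" using assms(2) by (auto simp: xsupp_def)
 have eq: "indicator (strip L) z *\<^sub>R f z = indicator ({-R..R} \<times> {0..L}) z *\<^sub>R f z" for z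
  using R[of "fst z" "snd z"] by (cases z) (auto simp: indicator_def strip_def abs_le_iff not_less)
 have "integrable lborel (%z. indicator ({-R..R} \<times> {0..L}) z *\<^sub>R f z)"
  using assms(1) by (intro borel_integrable_compact compact_Times) (auto intro: continuous_on_subset)
 then show ?thesis by (simp only: integrable_SL eq)
qed

lemma sqi_SL_continuous: "continuous_on UNIV f ==> xsupp f ==> f \<in> sqi (SL L)"
 by (intro sqiI measurable_SL_continuous integrable_SL_continuous continuous_intros) (auto intro: xsupp_map)

lemma continuous_slice_x:
 "continuous_on UNIV f ==> continuous_on UNIV (%x. f (x, y))" for f :: "plane => 'b::topological_space"
 by (rule continuous_on_compose2[where t = UNIV]) (auto intro!: continuous_intros)

lemma continuous_slice_y:
 "continuous_on UNIV f ==> continuous_on UNIV (%y. f (x, y))" for f :: "plane => 'b::topological_space"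
 by (rule continuous_on_compose2[where t = UNIV]) (auto intro!: continuous_intros)

lemma integral_SL_fst:
 fixes f :: "plane => 'b::{banach,second_countable_topology}"
 assumes "integrable (SL L) f"
 shows "integral\<^sup>L (SL L) f = (LINT x|lborel. (LINT y|Ival 0 L. f (x, y)))"
  "integrable lborel (%x. \<integral>y. f (x, y) \<partial>Ival 0 L)"
 using pair_sigma_finite.integral_fst'[OF pair_SL, where f = f] pair_sigma_finite.integrable_fst'[OF pair_SL, where f = f] assms
 by (simp_all add: SL_def)

lemma integral_SL_snd:
 fixes f :: "plane => 'b::{banach,second_countable_topology}"
 assumes "integrable (SL L) f"
 shows "integral\<^sup>L (SL L) f = (LINT y|Ival 0 L. (LINT x|lborel. f (x, y)))"
  "integrable (Ival 0 L) (%y. \<integral>x. f (x, y) \<partial>lborel)"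
 using pair_sigma_finite.integral_snd[OF pair_SL, where f = "%x y. f (x, y)"]
  pair_sigma_finite.integrable_snd[OF pair_SL, where f = "%x y. f (x, y)"] assms
 by (simp_all add: SL_def)

lemma integral_box_fst:
 fixes f :: "plane => 'b::{banach,second_countable_topology}"
 assumes "continuous_on UNIV f"
 shows "integral\<^sup>L (Ival a b \<Otimes>\<^sub>M Ival c d) f = (LINT x|Ival a b. (LINT y|Ival c d. f (x, y)))"
  "integrable (Ival a b) (%x. \<integral>y. f (x, y) \<partial>Ival c d)"
 using pair_sigma_finite.integral_fst'[OF pair_box integrable_box[OF assms]]
  pair_sigma_finite.integrable_fst'[OF pair_box integrable_box[OF assms]]
 by simp_all

lemma integral_box_snd:
 fixes f :: "plane => 'b::{banach,second_countable_topology}"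
 assumes "continuous_on UNIV f"
 shows "integral\<^sup>L (Ival a b \<Otimes>\<^sub>M Ival c d) f = (LINT y|Ival c d. (LINT x|Ival a b. f (x, y)))"
  "integrable (Ival c d) (%y. \<integral>x. f (x, y) \<partial>Ival a b)"
 using pair_sigma_finite.integral_snd[OF pair_box, where f = "%x y. f (x, y)"]
  pair_sigma_finite.integrable_snd[OF pair_box, where f = "%x y. f (x, y)"] integrable_box[OF assms]
 by simp_all

section \<open>Inequalities in one variable\<close>

lemma FTC_bound:
 fixes g :: "real => 'b::euclidean_space"
 assumes d: "\<And>x. (g has_vector_derivative g' x) (at x)" and c: "continuous_on UNIV g'"
  and s: "s \<in> {a..b}" and x: "x \<in> {a..b}"
 shows "norm (g x - g s) <= (LINT t|Ival a b. norm (g' t))"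
proof -
 have *: "norm (g x - g s) <= (LINT t|Ival a b. norm (g' t))" if "s <= x" "a <= s" "x <= b" for s x
 proof -
  have "g x - g s = (LINT t|lborel. indicator {s..x} t *\<^sub>R g' t)"
   by (rule integral_FTC_atLeastAtMost[symmetric])
    (use that d c in \<open>auto intro: has_vector_derivative_at_within continuous_on_subset\<close>)
  also have "norm \<dots> <= (LINT t|lborel. indicator {a..b} t *\<^sub>R norm (g' t))"
  proof (rule norm_integral_le)
   show "integrable lborel (%t. indicator {a..b} t *\<^sub>R norm (g' t))"
    using integrable_Ival_continuous[OF continuous_on_norm[OF c]] by (simp add: integrable_Ival)
  qed (use that in \<open>auto simp: indicator_def\<close>)
  finally show ?thesis by (simp add: integral_Ival)
 qed
 show ?thesis
 proof (cases "s <= x")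
  case True then show ?thesis using * s x by auto
 next
  case False then show ?thesis using *[of x s] s x by (auto simp: norm_minus_commute)
 qed
qed

lemma inner_self_derivative:
 fixes g :: "real => 'b::euclidean_space"
 assumes "(g has_vector_derivative g') (at x)"
 shows "((%s. inner (g s) (g s)) has_vector_derivative (2 * inner (g x) g')) (at x)"
proof -
 have "((%s. inner (g s) (g s)) has_derivative (%h. inner (g x) (h *\<^sub>R g') + inner (h *\<^sub>R g') (g x))) (at x)"
  using assms unfolding has_vector_derivative_def by (intro has_derivative_inner)
 then show ?thesis
  unfolding has_vector_derivative_def by (simp add: inner_commute algebra_simps)
qed

lemma norm_sq_diff_le:
 fixes g :: "real => 'b::euclidean_space"
 assumes d: "\<And>x. (g has_vector_derivative g' x) (at x)" and c: "continuous_on UNIV g'"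
  and s: "s \<in> {a..b}" and x: "x \<in> {a..b}"
 shows "(norm (g x))^2 <= (norm (g s))^2 + 2 * (LINT t|Ival a b. norm (g t) * norm (g' t))"
proof -
 have cg: "continuous_on UNIV g"
  by (rule continuous_at_imp_continuous_on) (auto intro: has_vector_derivative_continuous[OF d])
 have "norm (inner (g x) (g x) - inner (g s) (g s)) <= (LINT t|Ival a b. norm (2 * inner (g t) (g' t)))"
  by (rule FTC_bound[OF inner_self_derivative[OF d] _ s x]) (intro continuous_intros c cg)
 also have "\<dots> <= (LINT t|Ival a b. 2 * (norm (g t) * norm (g' t)))"
  by (intro integral_mono integrable_Ival_continuous continuous_intros c cg) (simp add: abs_mult Cauchy_Schwarz_ineq2)
 finally show ?thesis by (simp add: power2_norm_eq_inner)
qed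

lemma norm_sq_le_integral:
 fixes g :: "real => 'b::euclidean_space"
 assumes d: "\<And>x. (g has_vector_derivative g' x) (at x)" and c: "continuous_on UNIV g'"
  and supp: "\<And>x. R < \<bar>x\<bar> ==> g x = 0"
 shows "(norm (g x))^2 <= 2 * (LINT t|lborel. norm (g t) * norm (g' t))"
proof -
 have cg: "continuous_on UNIV g"
  by (rule continuous_at_imp_continuous_on) (auto intro: has_vector_derivative_continuous[OF d])
 \<comment> \<open>Beyond both the support and \<open>x\<close>: \<open>g\<close> vanishes at
   \<open>R'\<close>, and the interval contains \<open>x\<close>.\<close>
 define R' where "R' = \<bar>R\<bar> + \<bar>x\<bar> + 1"
 have "(norm (g x))^2 <= (norm (g R'))^2 + 2 * (LINT t|Ival (-R') R'. norm (g t) * norm (g' t))"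
  by (rule norm_sq_diff_le[OF d c]) (auto simp: R'_def)
 also have "g R' = 0" by (rule supp) (auto simp: R'_def)
 also have "(LINT t|Ival (-R') R'. norm (g t) * norm (g' t)) = (LINT t|lborel. norm (g t) * norm (g' t))"
  unfolding integral_Ival
 proof (rule Bochner_Integration.integral_cong)
  fix t show "indicator {- R'..R'} t *\<^sub>R (norm (g t) * norm (g' t)) = norm (g t) * norm (g' t)"
   using supp[of t] by (cases "t \<in> {-R'..R'}") (auto simp: R'_def indicator_def abs_if split: if_splits)
 qed simp
 finally show ?thesis by simp
qed

text \<open>Averages \<open>norm_sq_diff_le\<close> over the base point; the first term is the price
  for functions that need not vanish anywhere on the interval.\<close>

lemma norm_sq_le_average:
 fixes g :: "real => 'b::euclidean_space"
 assumes d: "\<And>x. (g has_vector_derivative g' x) (at x)" and c: "continuous_on UNIV g'"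
  and x: "x \<in> {a..b}" and ab: "a < b"
 shows "(norm (g x))^2 <= 1 / (b - a) * (LINT t|Ival a b. (norm (g t))^2) + 2 * (LINT t|Ival a b. norm (g t) * norm (g' t))"
  (is "_ <= 1 / (b - a) * ?A + 2 * ?B")
proof -
 have cg: "continuous_on UNIV g"
  by (rule continuous_at_imp_continuous_on) (auto intro: has_vector_derivative_continuous[OF d])
 interpret finite_measure "Ival a b" by (rule finite_measure_Ival)
 have "(LINT s|Ival a b. (norm (g x))^2) <= (LINT s|Ival a b. (norm (g s))^2 + 2 * ?B)"
 proof (rule integral_mono)
  show "integrable (Ival a b) (%s. (norm (g s))^2 + 2 * ?B)"
   by (intro integrable_Ival_continuous continuous_intros cg)
  fix s assume "s \<in> space (Ival a b)"
  then show "(norm (g x))^2 <= (norm (g s))^2 + 2 * ?B" using x by (intro norm_sq_diff_le[OF d c]) auto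
 qed simp
 also have "(LINT s|Ival a b. (norm (g s))^2 + 2 * ?B) = ?A + (b - a) * (2 * ?B)"
  using ab by (subst Bochner_Integration.integral_add) (auto intro!: integrable_Ival_continuous continuous_intros cg simp: measure_Ival)
 finally have "(b - a) * (norm (g x))^2 <= ?A + (b - a) * (2 * ?B)"
  using ab by (simp add: measure_Ival)
 then show ?thesis using ab by (simp add: field_simps)
qed

lemma sq_diff_le_energy:
 fixes g :: "real => real"
 assumes d: "\<And>x. (g has_vector_derivative g' x) (at x)" and c: "continuous_on UNIV g'"
  and x: "x \<in> {a..b}" and s: "s \<in> {a..b}"
 shows "(g x - g s)^2 <= (b - a) * (LINT t|Ival a b. (g' t)^2)"
proof -
 have ab: "a <= b" using x by auto
 have "\<bar>g x - g s\<bar> <= (LINT t|Ival a b. \<bar>g' t\<bar>)"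
  using FTC_bound[OF d c s x] by simp
 also have "\<dots> = (LINT t|Ival a b. norm (1::real) * norm (g' t))" by simp
 also have "\<dots> <= l2 (Ival a b) (%t. 1::real) * l2 (Ival a b) g'"
  by (intro L2_Cauchy_Schwarz sqi_Ival_continuous continuous_intros c)
 finally have "\<bar>g x - g s\<bar>^2 <= (l2 (Ival a b) (%t. 1::real) * l2 (Ival a b) g')^2"
  by (intro power_mono) auto
 also have "\<dots> = (b - a) * (LINT t|Ival a b. (g' t)^2)"
  using ab by (simp add: power_mult_distrib l2_sq measure_Ival)
 finally show ?thesis by simp
qed

section \<open>Inequalities on the strip\<close>

text \<open>The trace inequality, for all cross-sections at once: on each line in the x-direction
  \<open>f\<close> vanishes far out, so its square is an integral of its derivative; Cauchy-Schwarz
  follows after integrating over \<open>y\<close>.\<close>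

lemma slice_bound:
 fixes f :: "plane => 'b::euclidean_space"
 assumes C: "C1c f fx fy"
 shows "(LINT y|Ival 0 L. (norm (f (x, y)))^2) <= 2 * (l2 (SL L) f * l2 (SL L) fx)"
proof -
 note D = C1cD[OF C]
 obtain R where R: "\<And>x y. R < \<bar>x\<bar> ==> f (x, y) = 0" using D(4) unfolding xsupp_def by blast
 have i: "integrable (SL L) (%z. norm (f z) * norm (fx z))"
  by (intro integrable_SL_continuous continuous_intros D(1-3)) (rule xsupp_map[OF D(4)], simp)
 have "(LINT y|Ival 0 L. (norm (f (x, y)))^2) <= (LINT y|Ival 0 L. 2 * (LINT t|lborel. norm (f (t, y)) * norm (fx (t, y))))"
 proof (rule integral_mono)
  show "integrable (Ival 0 L) (%y. (norm (f (x, y)))^2)"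
   by (intro integrable_Ival_continuous continuous_intros D(1-3)[THEN continuous_slice_y])
  show "integrable (Ival 0 L) (%y. 2 * (LINT t|lborel. norm (f (t, y)) * norm (fx (t, y))))"
   using integral_SL_snd(2)[OF i] by simp
  show "(norm (f (x, y)))^2 <= 2 * (LINT t|lborel. norm (f (t, y)) * norm (fx (t, y)))" for y
   by (rule norm_sq_le_integral[where g = "%x. f (x, y)" and g' = "%x. fx (x, y)" and R = R])
    (auto intro: D(1-2) D(7) R D(2)[THEN continuous_slice_x])
 qed
 also have "\<dots> = 2 * (LINT z|SL L. norm (f z) * norm (fx z))"
  using integral_SL_snd(1)[OF i] by simp
 also have "(LINT z|SL L. norm (f z) * norm (fx z)) <= l2 (SL L) f * l2 (SL L) fx"
  by (intro L2_Cauchy_Schwarz sqi_SL_continuous D(1-6))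
 finally show ?thesis by simp
qed

text \<open>A Ladyzhenskaya-type estimate: on each cross-section one factor
  \<open>(norm f)^2\<close> is replaced by the pointwise bound \<open>c x\<close>, and the other
  integrates to at most \<open>S\<close>. Keeping \<open>S\<close> free admits the universal bound
  of \<open>slice_bound\<close> and, for peaked functions, twice the trace.\<close>

lemma L4_bound:
 fixes f :: "plane => 'b::euclidean_space"
 assumes C: "C1c f fx fy" and L: "0 < L"
  and S: "\<And>x. (LINT y|Ival 0 L. (norm (f (x, y)))^2) <= S"
 shows "(LINT z|SL L. norm (f z) ^ 4) <= S * (1 / L * (l2 (SL L) f)^2 + 2 * (l2 (SL L) f * l2 (SL L) fy))"
proof -
 note D = C1cD[OF C]
 have i2: "integrable (SL L) (%z. (norm (f z))^2)"
  by (intro integrable_SL_continuous continuous_intros D(1-3)) (rule xsupp_map[OF D(4)], simp)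
 have i4: "integrable (SL L) (%z. norm (f z) ^ 4)"
  by (intro integrable_SL_continuous continuous_intros D(1-3)) (rule xsupp_map[OF D(4)], simp)
 have i: "integrable (SL L) (%z. norm (f z) * norm (fy z))"
  by (intro integrable_SL_continuous continuous_intros D(1-3)) (rule xsupp_map[OF D(4)], simp)
 have S0: "0 <= S"
  using S[of 0] order_trans[OF Bochner_Integration.integral_nonneg[of _ "%y. (norm (f (0, y)))^2"]] by simp
 define c where "c x = 1 / L * (LINT y|Ival 0 L. (norm (f (x, y)))^2) + 2 * (LINT y|Ival 0 L. norm (f (x, y)) * norm (fy (x, y)))" for x
 have c0: "0 <= c x" for x unfolding c_def using L by (intro add_nonneg_nonneg mult_nonneg_nonneg integral_nonneg_AE) auto
 have b: "(norm (f (x, y)))^2 <= c x" if "y \<in> {0..L}" for x y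
  using norm_sq_le_average[where g = "%y. f (x, y)" and g' = "%y. fy (x, y)", OF D(8) _ that L]
   continuous_slice_y[OF D(3)] by (simp add: c_def)
 have ic: "integrable lborel c"
  unfolding c_def using integral_SL_fst(2)[OF i2] integral_SL_fst(2)[OF i] by simp
 have "(LINT z|SL L. norm (f z) ^ 4) = (LINT x|lborel. (LINT y|Ival 0 L. norm (f (x, y)) ^ 4))"
  by (rule integral_SL_fst[OF i4])
 also have "\<dots> <= (LINT x|lborel. S * c x)"
 proof (rule integral_mono)
  show "integrable lborel (%x. \<integral>y. norm (f (x, y)) ^ 4 \<partial>Ival 0 L)" by (rule integral_SL_fst[OF i4])
  show "integrable lborel (%x. S * c x)" using ic by simp
  fix x
  have "(LINT y|Ival 0 L. norm (f (x, y)) ^ 4) <= (LINT y|Ival 0 L. c x * (norm (f (x, y)))^2)"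
  proof (rule integral_mono)
   show "integrable (Ival 0 L) (%y. norm (f (x, y)) ^ 4)" "integrable (Ival 0 L) (%y. c x * (norm (f (x, y)))^2)"
    by (intro integrable_Ival_continuous continuous_intros D(1-3)[THEN continuous_slice_y])+
   fix y assume "y \<in> space (Ival 0 L)"
   then have "(norm (f (x, y)))^2 * (norm (f (x, y)))^2 <= c x * (norm (f (x, y)))^2"
    using b by (intro mult_right_mono) auto
   then show "norm (f (x, y)) ^ 4 <= c x * (norm (f (x, y)))^2"
    by (simp flip: power_add)
  qed
  also have "\<dots> = c x * (LINT y|Ival 0 L. (norm (f (x, y)))^2)" by simp
  also have "\<dots> <= c x * S" using S c0 by (intro mult_left_mono) auto
  finally show "(LINT y|Ival 0 L. norm (f (x, y)) ^ 4) <= S * c x" by (simp add: mult.commute)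
 qed
 also have "\<dots> = S * (1 / L * (LINT z|SL L. (norm (f z))^2) + 2 * (LINT z|SL L. norm (f z) * norm (fy z)))"
  using integral_SL_fst[OF i2] integral_SL_fst[OF i] by (simp add: c_def)
 also have "\<dots> <= S * (1 / L * (l2 (SL L) f)^2 + 2 * (l2 (SL L) f * l2 (SL L) fy))"
  using S0 unfolding l2_sq
  by (intro mult_left_mono add_left_mono L2_Cauchy_Schwarz sqi_SL_continuous D(1-6)) auto
 finally show ?thesis .
qed

text \<open>Averaging over \<open>x\<close> in \<open>[0, 1]\<close> bounds the trace by the mass in
  that box, so a trace bounded from below keeps mass there.\<close>

lemma slice_local_bound:
 fixes f :: "plane => 'b::euclidean_space"
 assumes C: "C1c f fx fy" and L: "0 < L"
  and ml: "ml = (LINT z|SL L. indicator ({0..1} \<times> {0..L}) z * (norm (f z))^2)"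
 shows "(LINT y|Ival 0 L. (norm (f (0, y)))^2) <= ml + 2 * (sqrt ml * l2 (SL L) fx)"
proof -
 note D = C1cD[OF C]
 let ?B = "Ival 0 1 \<Otimes>\<^sub>M Ival 0 L"
 have c2: "continuous_on UNIV (%z. (norm (f z))^2)" "continuous_on UNIV (%z. norm (f z) * norm (fx z))"
  by (intro continuous_intros D(1-3))+
 have sb: "g \<in> sqi ?B" if "continuous_on UNIV g" for g :: "plane => 'b"
 proof (rule sqiI)
  show "integrable ?B (%x. (norm (g x))^2)" by (intro integrable_box continuous_intros that)
  show "g \<in> borel_measurable ?B"
   unfolding box_eq by (intro measurable_restrict_space1) (simp add: borel_measurable_continuous_onI that)
 qed
 have "(LINT y|Ival 0 L. (norm (f (0, y)))^2) <=
   (LINT y|Ival 0 L. (LINT x|Ival 0 1. (norm (f (x, y)))^2) + 2 * (LINT x|Ival 0 1. norm (f (x, y)) * norm (fx (x, y))))"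
 proof (rule integral_mono)
  show "integrable (Ival 0 L) (%y. (norm (f (0, y)))^2)"
   by (intro integrable_Ival_continuous continuous_intros D(1-3)[THEN continuous_slice_y])
  show "integrable (Ival 0 L) (%y. (LINT x|Ival 0 1. (norm (f (x, y)))^2) + 2 * (LINT x|Ival 0 1. norm (f (x, y)) * norm (fx (x, y))))"
   using integral_box_snd(2)[OF c2(1)] integral_box_snd(2)[OF c2(2)] by auto
  show "(norm (f (0, y)))^2 <= (LINT x|Ival 0 1. (norm (f (x, y)))^2) + 2 * (LINT x|Ival 0 1. norm (f (x, y)) * norm (fx (x, y)))" for y
   using norm_sq_le_average[where g = "%x. f (x, y)" and g' = "%x. fx (x, y)" and x = 0 and a = 0 and b = 1, OF D(7)]
    continuous_slice_x[OF D(2)] by simp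
 qed
 also have "\<dots> = (LINT z|?B. (norm (f z))^2) + 2 * (LINT z|?B. norm (f z) * norm (fx z))"
  using integral_box_snd[OF c2(1)] integral_box_snd[OF c2(2)] by simp
 also have "\<dots> <= (LINT z|?B. (norm (f z))^2) + 2 * (l2 ?B f * l2 ?B fx)"
  by (intro add_left_mono mult_left_mono L2_Cauchy_Schwarz sb D(1-3)) auto
 also have "(LINT z|?B. (norm (f z))^2) = ml" by (simp add: ml box_integral_SL[of 0 L L])
 also have "l2 ?B f = sqrt ml" by (simp add: l2_def ml box_integral_SL[of 0 L L])
 also have "l2 ?B fx <= l2 (SL L) fx"
 proof -
  have i: "integrable (SL L) (%z. (norm (fx z))^2)" by (intro sqi_integrable sqi_SL_continuous D(1-6))
  have "(LINT z|SL L. indicator ({0..1} \<times> {0..L}) z *\<^sub>R (norm (fx z))^2) <= (LINT z|SL L. (norm (fx z))^2)"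
   by (rule integral_mono_AE'[OF i]) (auto simp: indicator_def)
  then show ?thesis by (simp add: l2_def box_integral_SL[of 0 L L])
 qed
 finally show ?thesis by (simp add: mult_left_mono ml)
qed

text \<open>Integrating \<open>(f z - f w)^2\<close> over both points avoids subtracting the mean.
  The points are joined by a horizontal and then a vertical segment, so only energies on lines
  appear; multiplying by the area leaves degenerate boxes admissible.\<close>

lemma Poincare_box:
 fixes f :: "plane => real"
 assumes C: "C1c f fx fy" and ab: "a <= b" "c <= d"
 defines "B \<equiv> Ival a b \<Otimes>\<^sub>M Ival c d"
 shows "(b - a) * (d - c) * (LINT z|B. (f z)^2) <= (LINT z|B. f z)^2 +
  (b - a) * (d - c) * ((b - a)^2 + (d - c)^2) * (LINT z|B. (fx z)^2 + (fy z)^2)"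
proof -
 note D = C1cD[OF C]
 have ib: "integrable B g" if "continuous_on UNIV g" for g :: "plane => real"
  unfolding B_def by (rule integrable_box[OF that])
 have m: "measure B (space B) = (b - a) * (d - c)"
  using integral_box_fst(1)[where f = "%_. 1::real" and a = a and b = b and c = c and d = d] ab
  by (simp add: B_def measure_Ival)
 define P where "P y = (LINT x|Ival a b. (fx (x, y))^2)" for y
 define Q where "Q x = (LINT y|Ival c d. (fy (x, y))^2)" for x
 have cx: "continuous_on UNIV (%z. (fx z)^2)" and cy: "continuous_on UNIV (%z. (fy z)^2)"
  by (intro continuous_intros D(1-3))+
 have P: "integrable (Ival c d) P" "(LINT y|Ival c d. P y) = (LINT z|B. (fx z)^2)"
  unfolding P_def B_def using integral_box_snd[OF cx] by auto
 have Q: "integrable (Ival a b) Q" "(LINT x|Ival a b. Q x) = (LINT z|B. (fy z)^2)"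
  unfolding Q_def B_def using integral_box_fst[OF cy] by auto
 have iP: "integrable B (%z. P (snd z))" "(LINT z|B. P (snd z)) = (b - a) * (LINT z|B. (fx z)^2)"
 proof -
  interpret pair_sigma_finite "Ival a b" "Ival c d" by (rule pair_box)
  have [measurable]: "P \<in> borel_measurable (Ival c d)" using P(1) by simp
  show 1: "integrable B (%z. P (snd z))"
   unfolding B_def
  proof (rule Fubini_integrable)
   show "(%z. P (snd z)) \<in> borel_measurable (Ival a b \<Otimes>\<^sub>M Ival c d)" by measurable
   show "integrable (Ival a b) (%x. \<integral>y. norm (P (snd (x, y))) \<partial>Ival c d)"
    by (simp add: integrable_Ival_continuous)
   show "AE x in Ival a b. integrable (Ival c d) (%y. P (snd (x, y)))" using P by simp
  qed
  show "(LINT z|B. P (snd z)) = (b - a) * (LINT z|B. (fx z)^2)"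
   using integral_fst'[OF 1[unfolded B_def]] ab P(2) by (simp add: B_def[symmetric] measure_Ival)
 qed
 have iQ: "integrable B (%z. Q (fst z))" "(LINT z|B. Q (fst z)) = (d - c) * (LINT z|B. (fy z)^2)"
 proof -
  interpret pair_sigma_finite "Ival a b" "Ival c d" by (rule pair_box)
  have [measurable]: "Q \<in> borel_measurable (Ival a b)" using Q(1) by simp
  show 1: "integrable B (%z. Q (fst z))"
   unfolding B_def
  proof (rule Fubini_integrable)
   show "(%z. Q (fst z)) \<in> borel_measurable (Ival a b \<Otimes>\<^sub>M Ival c d)" by measurable
   show "integrable (Ival a b) (%x. \<integral>y. norm (Q (fst (x, y))) \<partial>Ival c d)"
    using Q(1) by (simp add: integrable_norm)
   show "AE x in Ival a b. integrable (Ival c d) (%y. Q (fst (x, y)))"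
    by (simp add: integrable_Ival_continuous)
  qed
  show "(LINT z|B. Q (fst z)) = (d - c) * (LINT z|B. (fy z)^2)"
   using integral_fst'[OF 1[unfolded B_def]] ab Q(2) by (simp add: B_def[symmetric] measure_Ival)
 qed
 \<comment> \<open>The horizontal segment lies at the height of \<open>z\<close>, the vertical one
   at the abscissa of \<open>w\<close>; hence the arguments of \<open>P\<close> and
   \<open>Q\<close>.\<close>
 have pt: "(f z - f w)^2 <= 2 * (b - a) * P (snd z) + 2 * (d - c) * Q (fst w)"
  if "z \<in> space B" "w \<in> space B" for z w
 proof -
  obtain x y x' y' where zw: "z = (x, y)" "w = (x', y')" by (cases z, cases w)
  have in_: "x \<in> {a..b}" "x' \<in> {a..b}" "y \<in> {c..d}" "y' \<in> {c..d}"
   using that zw by (auto simp: B_def space_pair_measure)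
  have 1: "(f (x, y) - f (x', y))^2 <= (b - a) * P y"
   unfolding P_def using in_ continuous_slice_x[OF D(2)]
   by (intro sq_diff_le_energy[where g = "%x. f (x, y)"] D) auto
  have 2: "(f (x', y) - f (x', y'))^2 <= (d - c) * Q x'"
   unfolding Q_def using in_ continuous_slice_y[OF D(3)]
   by (intro sq_diff_le_energy[where g = "%y. f (x', y)"] D) auto
  have "(f z - f w)^2 <= 2 * (f (x, y) - f (x', y))^2 + 2 * (f (x', y) - f (x', y'))^2"
   using sum_squares_bound[of "f (x, y) - f (x', y)" "f (x', y) - f (x', y')"]
    power2_sum[of "f (x, y) - f (x', y)" "f (x', y) - f (x', y')"] by (simp add: zw)
  then show ?thesis using 1 2 by (simp add: zw algebra_simps)
 qed
 let ?V = "(b - a) * (d - c)"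
 let ?F = "\<integral>z. f z \<partial>B" and ?F2 = "\<integral>z. (f z)^2 \<partial>B"
 let ?X = "\<integral>z. (fx z)^2 \<partial>B" and ?Y = "\<integral>z. (fy z)^2 \<partial>B"
 have fb: "finite_measure B"
  unfolding B_def using finite_measure_Ival by (intro finite_measure_pair_measure)
 interpret B: finite_measure B by (rule fb)
 have if1: "integrable B f" "integrable B (%z. (f z)^2)" by (intro ib continuous_intros D(1-3))+
 have inner: "?V * (f z)^2 - 2 * f z * ?F + ?F2 <= 2 * (b - a) * ?V * P (snd z) + 2 * (d - c) * ((d - c) * ?Y)"
  if z: "z \<in> space B" for z
 proof -
  have "?V * (f z)^2 - 2 * f z * ?F + ?F2 = (LINT w|B. (f z)^2 - 2 * f z * f w + (f w)^2)"
   using if1 by (simp add: m)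
  also have "\<dots> = (LINT w|B. (f z - f w)^2)" by (simp add: power2_diff algebra_simps)
  also have "\<dots> <= (LINT w|B. 2 * (b - a) * P (snd z) + 2 * (d - c) * Q (fst w))"
  proof (rule integral_mono)
   show "integrable B (%w. (f z - f w)^2)" by (intro ib continuous_intros D(1-3))
  qed (use iQ pt[OF z] in auto)
  also have "\<dots> = 2 * (b - a) * ?V * P (snd z) + 2 * (d - c) * ((d - c) * ?Y)"
   using iQ by (simp add: m)
  finally show ?thesis .
 qed
 have "(LINT z|B. ?V * (f z)^2 - 2 * f z * ?F + ?F2) <= (LINT z|B. 2 * (b - a) * ?V * P (snd z) + 2 * (d - c) * ((d - c) * ?Y))"
  by (rule integral_mono) (use if1 iP inner in auto)
 moreover have "(LINT z|B. ?V * (f z)^2 - 2 * f z * ?F + ?F2) = 2 * ?V * ?F2 - 2 * ?F^2"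
  using if1 by (simp add: m power2_eq_square)
 moreover have "(LINT z|B. 2 * (b - a) * ?V * P (snd z) + 2 * (d - c) * ((d - c) * ?Y))
  = 2 * ?V * ((b - a)^2 * ?X + (d - c)^2 * ?Y)"
 proof -
  have "(LINT z|B. 2 * (b - a) * ?V * P (snd z) + 2 * (d - c) * ((d - c) * ?Y))
   = 2 * (b - a) * ?V * (LINT z|B. P (snd z)) + 2 * (d - c) * ((d - c) * ?Y) * ?V"
   using iP(1) by (simp add: m)
  then show ?thesis unfolding iP(2) by algebra
 qed
 ultimately have "?V * ?F2 <= ?F^2 + ?V * ((b - a)^2 * ?X + (d - c)^2 * ?Y)" by (simp add: algebra_simps)
 also have "?V * ((b - a)^2 * ?X + (d - c)^2 * ?Y) <= ?V * (((b - a)^2 + (d - c)^2) * (?X + ?Y))"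
 proof (rule mult_left_mono)
  have "0 <= (b - a)^2 * ?Y" "0 <= (d - c)^2 * ?X" by simp_all
  then show "(b - a)^2 * ?X + (d - c)^2 * ?Y <= ((b - a)^2 + (d - c)^2) * (?X + ?Y)"
   by (simp add: algebra_simps)
 qed (use ab in simp)
 also have "?X + ?Y = (LINT z|B. (fx z)^2 + (fy z)^2)" by (simp add: ib cx cy)
 finally show ?thesis by (simp add: mult.assoc)
qed

section \<open>Smooth functions\<close>

text \<open>The derivative is quantified existentially, so that each induction step can exhibit it
  by a formula.\<close>

primrec sk :: "nat => (real => real) => bool" where
 "sk 0 f \<longleftrightarrow> continuous_on UNIV f"
| "sk (Suc k) f \<longleftrightarrow> (\<exists>f'. (\<forall>x. (f has_real_derivative f' x) (at x)) \<and> sk k f')"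

definition smooth :: "(real => real) => bool" where
 "smooth f \<longleftrightarrow> (\<forall>k. sk k f)"

lemma sk_continuous: "sk k f ==> continuous_on UNIV f"
 by (cases k) (auto intro!: continuous_at_imp_continuous_on intro: DERIV_isCont)

lemma sk_Suc_imp: "sk (Suc k) f ==> sk k f"
proof (induction k arbitrary: f)
 case 0 then show ?case by (intro sk_continuous[of "Suc 0", THEN sk.simps(1)[THEN iffD2]])
next
 case (Suc k)
 then obtain f' where "\<forall>x. (f has_real_derivative f' x) (at x)" "sk (Suc k) f'" by auto
 then show ?case using Suc.IH[of f'] by auto
qed

lemma sk_const: "sk k (%x. c)"
proof (induction k arbitrary: c)
 case (Suc k)
 show ?case using Suc[of 0] by (auto intro!: exI[of _ "%_. 0"] derivative_eq_intros)
qed (auto intro: continuous_intros)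

lemma sk_add: "sk k f ==> sk k g ==> sk k (%x. f x + g x)"
proof (induction k arbitrary: f g)
 case (Suc k)
 obtain f' where f: "\<forall>x. (f has_real_derivative f' x) (at x)" "sk k f'" using Suc.prems by auto
 obtain g' where g: "\<forall>x. (g has_real_derivative g' x) (at x)" "sk k g'" using Suc.prems by auto
 show ?case using Suc.IH[OF f(2) g(2)] f g
  by (auto intro!: exI[of _ "%x. f' x + g' x"] derivative_eq_intros)
qed (auto intro: continuous_intros)

lemma sk_mult: "sk k f ==> sk k g ==> sk k (%x. f x * g x)"
proof (induction k arbitrary: f g)
 case (Suc k)
 obtain f' where f: "\<forall>x. (f has_real_derivative f' x) (at x)" "sk k f'" using Suc.prems by auto
 obtain g' where g: "\<forall>x. (g has_real_derivative g' x) (at x)" "sk k g'" using Suc.prems by auto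
 have "sk k (%x. f' x * g x + f x * g' x)"
  by (intro sk_add Suc.IH f(2) g(2) Suc.prems[THEN sk_Suc_imp])
 moreover have "((%x. f x * g x) has_real_derivative f' x * g x + f x * g' x) (at x)" for x
  by (rule DERIV_cong[OF DERIV_mult[OF f(1)[rule_format] g(1)[rule_format]]]) (simp add: mult.commute)
 ultimately show ?case by (simp only: sk.simps) (rule exI[of _ "%x. f' x * g x + f x * g' x"], simp)
qed (auto intro: continuous_intros)

lemma sk_affine: "sk k f ==> sk k (%x. f (a * x + b))"
proof (induction k arbitrary: f)
 case 0
 then show ?case by (auto intro!: continuous_on_compose2[of UNIV f] continuous_intros)
next
 case (Suc k)
 obtain f' where f: "\<And>x. (f has_real_derivative f' x) (at x)" "sk k f'" using Suc.prems by auto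
 have "sk k (%x. a * f' (a * x + b))" by (intro sk_mult sk_const Suc.IH f)
 moreover have "((%x. f (a * x + b)) has_real_derivative a * f' (a * x + b)) (at x)" for x
  by (rule DERIV_chain2[OF f(1), THEN DERIV_cong]) (auto intro!: derivative_eq_intros)
 ultimately show ?case by (auto intro!: exI[of _ "%x. a * f' (a * x + b)"])
qed

lemma smooth_const: "smooth (%x. c)"
 by (simp add: smooth_def sk_const)

lemma smooth_mult: "smooth f ==> smooth g ==> smooth (%x. f x * g x)"
 by (simp add: smooth_def sk_mult)

lemma smooth_cmult: "smooth f ==> smooth (%x. c * f x)"
 by (intro smooth_mult smooth_const)

lemma smooth_affine: "smooth f ==> smooth (%x. f (a * x + b))"
 by (simp add: smooth_def sk_affine)

lemma smooth_continuous: "smooth f ==> continuous_on UNIV f"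
 by (metis smooth_def sk.simps(1))

lemma smooth_DERIV:
 assumes "smooth f"
 shows "(f has_real_derivative deriv f x) (at x)" "smooth (deriv f)"
proof -
 have *: "(f has_real_derivative deriv f x) (at x)" for x
 proof -
  have "sk (Suc 0) f" using assms by (simp add: smooth_def del: sk.simps)
  then show ?thesis by (auto simp: DERIV_deriv_iff_real_differentiable real_differentiable_def)
 qed
 then show "(f has_real_derivative deriv f x) (at x)" .
 show "smooth (deriv f)"
  unfolding smooth_def
 proof
  fix k
  have "sk (Suc k) f" using assms by (simp add: smooth_def del: sk.simps)
  then obtain f' where f': "\<forall>x. (f has_real_derivative f' x) (at x)" "sk k f'" by auto
  have "f' = deriv f" using f'(1) * DERIV_unique by (intro ext) blast
  then show "sk k (deriv f)" using f' by simp
 qed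
qed

lemma smooth_DERIV_I:
 assumes "\<And>x. (f has_real_derivative f' x) (at x)" "smooth f'"
 shows "smooth f"
 unfolding smooth_def
proof
 fix k show "sk k f"
 proof (cases k)
  case 0 then show ?thesis using assms by (auto intro!: continuous_at_imp_continuous_on intro: DERIV_isCont)
 next
  case (Suc j) then show ?thesis using assms by (auto simp: smooth_def)
 qed
qed

section \<open>A smooth step built from exp(-1/t)\<close>

text \<open>This family is closed under differentiation up to linear combinations, so smoothness
  follows from one induction over all \<open>n\<close> at once.\<close>

definition flat :: "nat => real => real" where
 "flat n t = (if 0 < t then exp (- (1 / t)) / t ^ n else 0)"

lemma flat_tendsto_0: "(flat n \<longlongrightarrow> 0) (at 0)"
proof -
 have "((%x::real. x ^ n / exp x) \<longlongrightarrow> 0) at_top" by (rule tendsto_power_div_exp_0)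
 then have "((%t::real. (inverse t) ^ n / exp (inverse t)) \<longlongrightarrow> 0) (at_right 0)"
  by (rule filterlim_compose[OF _ filterlim_inverse_at_top_right])
 then have "(flat n \<longlongrightarrow> 0) (at_right 0)"
 proof (rule Lim_transform_eventually)
  show "\<forall>\<^sub>F t in at_right 0. inverse t ^ n / exp (inverse t) = flat n t"
   using eventually_at_right_less[of "0::real"]
   by eventually_elim (simp add: flat_def exp_minus field_simps power_inverse)
 qed
 moreover have "(flat n \<longlongrightarrow> 0) (at_left 0)"
 proof (rule Lim_transform_eventually[OF tendsto_const])
  show "\<forall>\<^sub>F t in at_left 0. 0 = flat n t"
   by (auto simp: eventually_at_filter flat_def intro!: always_eventually)
 qed
 ultimately show ?thesis by (simp add: filterlim_at_split)
qed

lemma flat_DERIV: "(flat n has_real_derivative (flat (n + 2) t - n * flat (n + 1) t)) (at t)"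
proof (cases t "0::real" rule: linorder_cases)
 case greater
 have "((%t. exp (- (1 / t)) / t ^ n) has_real_derivative (flat (n + 2) t - n * flat (n + 1) t)) (at t)"
  using greater
  by (auto intro!: derivative_eq_intros simp: flat_def field_simps power2_eq_square)
   (cases n; simp add: field_simps)
 then show ?thesis
  by (rule has_field_derivative_transform_within_open[of _ _ _ "{0<..}"]) (use greater in \<open>auto simp: flat_def\<close>)
next
 case less
 have "((%_. 0) has_real_derivative (flat (n + 2) t - n * flat (n + 1) t)) (at t)"
  using less by (simp add: flat_def)
 then show ?thesis
  by (rule has_field_derivative_transform_within_open[of _ _ _ "{..<0}"]) (use less in \<open>auto simp: flat_def\<close>)
next
 case equal
 have "((%h. (flat n (0 + h) - flat n 0) / h) \<longlongrightarrow> 0) (at 0)"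
 proof (rule Lim_transform_eventually[OF flat_tendsto_0[of "Suc n"]])
  show "\<forall>\<^sub>F h in at 0. flat (Suc n) h = (flat n (0 + h) - flat n 0) / h"
   by (auto simp: flat_def)
 qed
 then show ?thesis using equal by (simp add: DERIV_def flat_def)
qed

lemma flat_smooth: "smooth (flat n)"
proof -
 have "sk k (flat n)" for k n
 proof (induction k arbitrary: n)
  case 0
  show ?case using flat_DERIV by (auto intro!: continuous_at_imp_continuous_on intro: DERIV_isCont)
 next
  case (Suc k)
  have "sk k (%t. flat (n + 2) t + (- real n) * flat (n + 1) t)"
   by (intro sk_add sk_mult sk_const Suc)
  then show ?case using flat_DERIV[of n] by (auto intro!: exI[of _ "%t. flat (n + 2) t + (- real n) * flat (n + 1) t"])
 qed
 then show ?thesis by (simp add: smooth_def)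
qed

text \<open>The normalized antiderivative of the bump \<open>flat 0 t * flat 0 (1 - t)\<close>,
  which is positive exactly on the open unit interval.\<close>

lemma smooth_step_exists:
 "\<exists>B. smooth B \<and> (\<forall>x\<le>0. B x = 0) \<and> (\<forall>x\<ge>1. B x = 1) \<and> (\<forall>x. 0 <= deriv B x)"
proof -
 define b where "b t = flat 0 t * flat 0 (1 - t)" for t
 have bs: "smooth b"
  unfolding b_def using smooth_mult[OF flat_smooth[of 0] smooth_affine[OF flat_smooth[of 0], of "-1" 1]] by simp
 have b0: "0 <= b t" for t by (auto simp: b_def flat_def)
 have bz: "b t = 0" if "t <= 0 \<or> 1 <= t" for t using that by (auto simp: b_def flat_def)
 have bp: "0 < b t" if "0 < t" "t < 1" for t using that by (auto simp: b_def flat_def)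
 have "\<exists>F. \<forall>x. - \<infinity> < ereal x \<longrightarrow> ereal x < \<infinity> \<longrightarrow> (F has_vector_derivative b x) (at x)"
  by (rule einterval_antiderivative) (use smooth_continuous[OF bs] in \<open>auto simp: continuous_on_eq_continuous_at\<close>)
 then obtain F where F: "\<And>x. (F has_real_derivative b x) (at x)"
  by (auto simp: DERIV_iff_vec)
 have F01: "F 0 < F 1"
 proof -
  obtain z where "0 < z" "z < 1" "F 1 - F 0 = (1 - 0) * b z"
   using MVT2[of 0 1 F b] F by auto
  then show ?thesis using bp[of z] by simp
 qed
 have Fl: "F x = F 0" if "x <= 0" for x
 proof (cases "x = 0")
  case False
  then have "\<exists>z>x. z < 0 \<and> F 0 - F x = (0 - x) * b z" using F that by (intro MVT2) auto
  then obtain z where "x < z" "z < 0" "F 0 - F x = (0 - x) * b z" by blast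
  then show ?thesis using bz[of z] by simp
 qed simp
 have Fr: "F x = F 1" if "1 <= x" for x
 proof (cases "x = 1")
  case False
  then have "\<exists>z>1. z < x \<and> F x - F 1 = (x - 1) * b z" using F that by (intro MVT2) auto
  then obtain z where "1 < z" "z < x" "F x - F 1 = (x - 1) * b z" by blast
  then show ?thesis using bz[of z] by simp
 qed simp
 define c where "c = 1 / (F 1 - F 0)"
 define B where "B x = c * (F x - F 0)" for x
 have DB: "(B has_real_derivative c * b x) (at x)" for x
  unfolding B_def by (auto intro!: derivative_eq_intros F)
 then have dB: "deriv B x = c * b x" for x by (rule DERIV_imp_deriv)
 have "smooth B" by (rule smooth_DERIV_I[OF DB smooth_cmult[OF bs]])
 moreover have "B x = 0" if "x <= 0" for x using Fl[OF that] by (simp add: B_def)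
 moreover have "B x = 1" if "1 <= x" for x using Fr[OF that] F01 by (simp add: B_def c_def)
 moreover have "0 <= deriv B x" for x using F01 b0 by (simp add: dB c_def)
 ultimately show ?thesis by blast
qed

definition smooth_step :: "real => real" where
 "smooth_step = (SOME B. smooth B \<and> (\<forall>x\<le>0. B x = 0) \<and> (\<forall>x\<ge>1. B x = 1) \<and> (\<forall>x. 0 <= deriv B x))"

lemma smooth_step: "smooth smooth_step" "x <= 0 ==> smooth_step x = 0" "1 <= x ==> smooth_step x = 1"
 "0 <= deriv smooth_step x"
 using someI_ex[OF smooth_step_exists] by (auto simp: smooth_step_def)

lemma smooth_step_bounds: "0 <= smooth_step x" "smooth_step x <= 1"
proof -
 have mono: "smooth_step x <= smooth_step y" if "x <= y" for x y
  by (rule DERIV_nonneg_imp_nondecreasing[OF that]) (use smooth_DERIV(1)[OF smooth_step(1)] smooth_step(4) in blast)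
 show "0 <= smooth_step x" using mono[of "min x 0" x] smooth_step(2)[of "min x 0"] by simp
 show "smooth_step x <= 1" using mono[of x "max x 1"] smooth_step(3)[of "max x 1"] by simp
qed

section \<open>Mollifier kernels\<close>

text \<open>A bump supported in \<open>[- r, r]\<close>; its integral is 1 because the step rises
  from 0 to 1.\<close>

definition ker :: "real => real => real" where
 "ker r s = 1 / (2 * r) * deriv smooth_step (1 / (2 * r) * s + 1 / 2)"

definition csmooth :: "(real => real) => bool" where
 "csmooth f \<longleftrightarrow> smooth f \<and> (\<exists>R. \<forall>x. R < \<bar>x\<bar> \<longrightarrow> f x = 0)"

lemma deriv_zero_outside:
 fixes f :: "real => real"
 assumes "open U" "x \<in> U" "\<And>y. y \<in> U ==> f y = c"
 shows "deriv f x = 0"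
proof (rule DERIV_imp_deriv)
 have "((%_. c) has_real_derivative 0) (at x)" by simp
 then show "(f has_real_derivative 0) (at x)"
  by (rule has_field_derivative_transform_within_open[OF _ assms(1,2)]) (simp add: assms(3))
qed

lemma csmooth_deriv:
 assumes "csmooth f" shows "csmooth (deriv f)"
proof -
 obtain R where R: "\<And>x. R < \<bar>x\<bar> ==> f x = 0" and s: "smooth f" using assms by (auto simp: csmooth_def)
 have "deriv f x = 0" if "R < \<bar>x\<bar>" for x
  by (rule deriv_zero_outside[of "{x. R < \<bar>x\<bar>}" _ _ 0])
   (use that R in \<open>auto intro!: open_Collect_less continuous_intros\<close>)
 then show ?thesis using smooth_DERIV(2)[OF s] by (auto simp: csmooth_def)
qed

lemma csmooth_bounded:
 assumes "csmooth f" obtains M where "\<And>x. \<bar>f x\<bar> <= M"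
proof -
 obtain R where R: "\<And>x. R < \<bar>x\<bar> ==> f x = 0" and s: "smooth f" using assms by (auto simp: csmooth_def)
 have "compact (f ` {-R..R})"
  by (intro compact_continuous_image continuous_on_subset[OF smooth_continuous[OF s]]) auto
 then obtain M where M: "\<forall>x\<in>{-R..R}. \<bar>f x\<bar> <= M"
  by (auto dest!: compact_imp_bounded simp: bounded_iff)
 have "\<bar>f x\<bar> <= max M 0" for x
  using M[rule_format, of x] R[of x] by (cases "R < \<bar>x\<bar>") (fastforce simp: abs_le_iff le_max_iff_disj)+
 then show ?thesis using that by blast
qed

text \<open>At the two endpoints the step is known to be constant on one side only, so the value
  there comes from continuity of the derivative.\<close>

lemma deriv_smooth_step_zero: "s <= 0 \<or> 1 <= s ==> deriv smooth_step s = 0"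
proof -
 have l: "deriv smooth_step s = 0" if "s < 0" for s
  by (rule deriv_zero_outside[of "{..<0}" _ _ 0]) (use that smooth_step(2) in auto)
 have r: "deriv smooth_step s = 0" if "1 < s" for s
  by (rule deriv_zero_outside[of "{1<..}" _ _ 1]) (use that smooth_step(3) in auto)
 have c: "isCont (deriv smooth_step) s" for s
  using smooth_continuous[OF smooth_DERIV(2)[OF smooth_step(1)]] by (simp add: continuous_on_eq_continuous_at)
 have "deriv smooth_step 0 = 0"
 proof (rule tendsto_unique[of "at_left 0"])
  show "(deriv smooth_step \<longlongrightarrow> deriv smooth_step 0) (at_left 0)"
   using c[of 0] by (auto simp: isCont_def intro: tendsto_within_subset)
  show "(deriv smooth_step \<longlongrightarrow> 0) (at_left 0)"
  proof (rule Lim_transform_eventually[OF tendsto_const])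
   show "\<forall>\<^sub>F t in at_left 0. 0 = deriv smooth_step t"
    by (auto simp: eventually_at_filter l intro!: always_eventually)
  qed
 qed simp
 moreover have "deriv smooth_step 1 = 0"
 proof (rule tendsto_unique[of "at_right 1"])
  show "(deriv smooth_step \<longlongrightarrow> deriv smooth_step 1) (at_right 1)"
   using c[of 1] by (auto simp: isCont_def intro: tendsto_within_subset)
  show "(deriv smooth_step \<longlongrightarrow> 0) (at_right 1)"
  proof (rule Lim_transform_eventually[OF tendsto_const])
   show "\<forall>\<^sub>F t in at_right 1. 0 = deriv smooth_step t"
    by (auto simp: eventually_at_filter r intro!: always_eventually)
  qed
 qed simp
 moreover assume "s <= 0 \<or> 1 <= s"
 ultimately show ?thesis using l[of s] r[of s] by (cases "s = 0 \<or> s = 1") auto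
qed

lemma deriv_smooth_step_integral:
 "integrable lborel (deriv smooth_step)" "(LINT s|lborel. deriv smooth_step s) = 1"
proof -
 have c: "continuous_on UNIV (deriv smooth_step)"
  using smooth_continuous[OF smooth_DERIV(2)[OF smooth_step(1)]] .
 have eq: "deriv smooth_step = (%s. indicator {0..1} s *\<^sub>R deriv smooth_step s)"
  using deriv_smooth_step_zero by (auto simp: fun_eq_iff indicator_def) (metis linear)+
 show "integrable lborel (deriv smooth_step)"
  by (subst eq, rule borel_integrable_compact) (auto intro: continuous_on_subset[OF c])
 have "integral\<^sup>L lborel (%s. indicator {0..1} s *\<^sub>R deriv smooth_step s) = smooth_step 1 - smooth_step 0"
  using smooth_DERIV(1)[OF smooth_step(1)]
  by (intro integral_FTC_atLeastAtMost)
   (auto simp: DERIV_iff_vec intro: has_vector_derivative_at_within continuous_on_subset[OF c])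
 then show "(LINT s|lborel. deriv smooth_step s) = 1"
  using smooth_step(2)[of 0] smooth_step(3)[of 1] unfolding eq[symmetric] by simp
qed

lemma ker_nonneg: "0 < r ==> 0 <= ker r s"
 by (simp add: ker_def smooth_step)

lemma ker_zero: "0 < r ==> r <= \<bar>s\<bar> ==> ker r s = 0"
proof -
 assume r: "0 < r" "r <= \<bar>s\<bar>"
 then have "1 / (2 * r) * s + 1 / 2 <= 0 \<or> 1 <= 1 / (2 * r) * s + 1 / 2"
  by (auto simp: field_simps abs_if split: if_splits)
 then show ?thesis by (simp add: ker_def deriv_smooth_step_zero)
qed

lemma ker_csmooth: "0 < r ==> csmooth (ker r)"
proof -
 assume r: "0 < r"
 have "smooth (ker r)"
  unfolding ker_def by (intro smooth_cmult smooth_affine smooth_DERIV smooth_step)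
 then show ?thesis using ker_zero[OF r] by (auto simp: csmooth_def intro!: exI[of _ r])
qed

lemma ker_integral:
 assumes "0 < r" "a \<noteq> 0"
 shows "integrable lborel (%s. ker r (a * s + b))" "(LINT s|lborel. ker r (a * s + b)) = 1 / \<bar>a\<bar>"
proof -
 let ?c = "1 / (2 * r) * a"
 have eq: "ker r (a * s + b) = 1 / (2 * r) * deriv smooth_step ((1 / (2 * r) * b + 1 / 2) + ?c * s)" for s
  by (simp add: ker_def algebra_simps add_divide_distrib)
 have c: "?c \<noteq> 0" using assms by simp
 have "integrable lborel (%s. deriv smooth_step ((1 / (2 * r) * b + 1 / 2) + ?c * s))"
  by (rule lborel_integrable_real_affine[OF deriv_smooth_step_integral(1) c])
 then show "integrable lborel (%s. ker r (a * s + b))" by (simp only: eq integrable_mult_right)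
 have "1 = \<bar>?c\<bar> *\<^sub>R (LINT s|lborel. deriv smooth_step ((1 / (2 * r) * b + 1 / 2) + ?c * s))"
  using lborel_integral_real_affine[OF c, of "deriv smooth_step"] deriv_smooth_step_integral(2) by simp
 then have *: "(LINT s|lborel. deriv smooth_step ((1 / (2 * r) * b + 1 / 2) + ?c * s)) = 1 / \<bar>?c\<bar>"
  using c by (auto simp: eq_divide_eq mult.commute)
 show "(LINT s|lborel. ker r (a * s + b)) = 1 / \<bar>a\<bar>"
  unfolding eq by (subst integral_mult_right_zero, subst *) (use assms in \<open>simp add: abs_mult field_simps\<close>)
qed

section \<open>Smoothness in the plane\<close>

lemma C_k_SucI:
 assumes "\<And>z. (f has_derivative D z) (at z)" "\<And>d. C_k k (%z. D z d)"
 shows "C_k (Suc k) f"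
proof -
 have "frechet_derivative f (at z) = D z" for z using frechet_derivative_at[OF assms(1)] by simp
 then show ?thesis using assms unfolding C_k.simps differentiable_def by (simp del: split_paired_All) blast
qed

lemma C_k_SucD:
 assumes "C_k (Suc k) f"
 shows "(f has_derivative frechet_derivative f (at z)) (at z)" "C_k k (%z. frechet_derivative f (at z) d)"
 using assms by (simp_all add: frechet_derivative_works del: split_paired_All)

lemma C_k_continuous: "C_k k f ==> continuous_on UNIV f"
 by (cases k) (auto simp: continuous_on_eq_continuous_at differentiable_imp_continuous_within)

lemma C_k_lin: "C_k k f ==> C_k k g ==> C_k k (%z. \<alpha> * f z + \<beta> * g z)"
proof (induction k arbitrary: f g)
 case 0 then show ?case by (auto intro!: continuous_intros)
next
 case (Suc k)
 show ?case
 proof (rule C_k_SucI)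
  show "((%z. \<alpha> * f z + \<beta> * g z) has_derivative
   (%d. \<alpha> * frechet_derivative f (at z) d + \<beta> * frechet_derivative g (at z) d)) (at z)" for z
   by (intro has_derivative_add has_derivative_mult_right C_k_SucD(1)[OF Suc.prems(1)] C_k_SucD(1)[OF Suc.prems(2)])
  show "C_k k (%z. \<alpha> * frechet_derivative f (at z) d + \<beta> * frechet_derivative g (at z) d)" for d
   by (rule Suc.IH[OF C_k_SucD(2)[OF Suc.prems(1)] C_k_SucD(2)[OF Suc.prems(2)]])
 qed
qed

text \<open>Products of functions of one variable suffice as test functions, because the
  mollification kernels have this form.\<close>

definition tens :: "(real => real) => (real => real) => plane => complex" where
 "tens P Q z = complex_of_real (P (fst z) * Q (snd z))"

lemma tens_has_derivative:
 assumes "smooth P" "smooth Q"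
 shows "(tens P Q has_derivative
  (%d. complex_of_real (fst d) * tens (deriv P) Q z + complex_of_real (snd d) * tens P (deriv Q) z)) (at z)"
proof -
 have P: "(P has_derivative (%h. deriv P (fst z) * h)) (at (fst z))"
  using smooth_DERIV(1)[OF assms(1)] by (simp add: has_field_derivative_def)
 have Q: "(Q has_derivative (%h. deriv Q (snd z) * h)) (at (snd z))"
  using smooth_DERIV(1)[OF assms(2)] by (simp add: has_field_derivative_def)
 have P': "((%z. P (fst z)) has_derivative (%d. deriv P (fst z) * fst d)) (at z)"
  by (rule has_derivative_compose[where f = fst and f' = fst and g = P, OF _ P]) (auto intro!: derivative_eq_intros)
 have Q': "((%z. Q (snd z)) has_derivative (%d. deriv Q (snd z) * snd d)) (at z)"
  by (rule has_derivative_compose[where f = snd and f' = snd and g = Q, OF _ Q]) (auto intro!: derivative_eq_intros)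
 have "((%z. complex_of_real (P (fst z) * Q (snd z))) has_derivative
  (%d. complex_of_real (P (fst z) * (deriv Q (snd z) * snd d) + deriv P (fst z) * fst d * Q (snd z)))) (at z)"
  by (intro has_derivative_of_real has_derivative_mult P' Q')
 then show ?thesis
  unfolding tens_def by (rule has_derivative_eq_rhs) (auto simp: fun_eq_iff algebra_simps)
qed

lemma C_k_tens: "smooth P ==> smooth Q ==> C_k k (tens P Q)"
proof (induction k arbitrary: P Q)
 case 0
 then show ?case
  unfolding C_k.simps by (intro continuous_at_imp_continuous_on ballI has_derivative_continuous[OF tens_has_derivative])
next
 case (Suc k)
 show ?case
  by (rule C_k_SucI[OF tens_has_derivative[OF Suc.prems] C_k_lin[OF Suc.IH Suc.IH]])
   (auto intro: Suc.prems smooth_DERIV(2))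
qed

section \<open>Mollification\<close>

text \<open>The kernels are arbitrary because differentiation replaces one of them by its
  derivative; the class is thus stable, and smoothness follows by induction.\<close>

definition moll ::
  "real => (real => real) => (real => real) => real => real => (plane => complex) => plane => complex" where
 "moll L P Q a b v z = (LINT w|SL L. complex_of_real (P (fst z - fst w) * Q (a * snd z + b - snd w)) * v w)"

lemma csmooth_smooth: "csmooth P ==> smooth P"
 by (simp add: csmooth_def)

text \<open>One constant serves for all bounds. The quadratic remainder makes differentiation under
  the integral an explicit estimate instead of a limit theorem.\<close>

lemma csmooth_Taylor:
 assumes "csmooth P"
 obtains M where "0 <= M" "\<And>x. \<bar>P x\<bar> <= M" "\<And>x. \<bar>deriv P x\<bar> <= M" "\<And>x y. \<bar>P y - P x\<bar> <= M * \<bar>y - x\<bar>"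
  "\<And>x y. \<bar>P y - P x - deriv P x * (y - x)\<bar> <= M * (y - x)^2"
proof -
 have c1: "csmooth (deriv P)" and c2: "csmooth (deriv (deriv P))" using assms csmooth_deriv by blast+
 obtain M0 where M0: "\<And>x. \<bar>P x\<bar> <= M0" using csmooth_bounded[OF assms] by blast
 obtain M1 where M1: "\<And>x. \<bar>deriv P x\<bar> <= M1" using csmooth_bounded[OF c1] by blast
 obtain M2 where M2: "\<And>x. \<bar>deriv (deriv P) x\<bar> <= M2" using csmooth_bounded[OF c2] by blast
 define M where "M = \<bar>M0\<bar> + \<bar>M1\<bar> + \<bar>M2\<bar>"
 have lip: "\<bar>f y - f x\<bar> <= M * \<bar>y - x\<bar>" if "csmooth f" "\<And>x. \<bar>deriv f x\<bar> <= M" for f :: "real => real" and x y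
 proof -
  have "norm (f y - f x) <= M * norm (y - x)"
   by (rule field_differentiable_bound[of UNIV f "deriv f" M])
    (use that smooth_DERIV(1)[OF csmooth_smooth[OF that(1)]] in auto)
  then show ?thesis by simp
 qed
 have b: "\<bar>P x\<bar> <= M" "\<bar>deriv P x\<bar> <= M" "\<bar>deriv (deriv P) x\<bar> <= M" for x
  using M0[of x] M1[of x] M2[of x] by (auto simp: M_def)
 have "\<bar>P y - P x - deriv P x * (y - x)\<bar> <= M * (y - x)^2" for x y
 proof -
  have "norm ((P y - deriv P x * y) - (P x - deriv P x * x)) <= (M * \<bar>y - x\<bar>) * norm (y - x)"
  proof (rule field_differentiable_bound[of "closed_segment x y" "%t. P t - deriv P x * t" "%t. deriv P t - deriv P x" "M * \<bar>y - x\<bar>"])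
   show "((%t. P t - deriv P x * t) has_field_derivative deriv P t - deriv P x) (at t within closed_segment x y)" for t
    by (rule DERIV_subset[of _ _ _ UNIV], rule derivative_eq_intros)
     (auto intro!: derivative_eq_intros smooth_DERIV(1)[OF csmooth_smooth[OF assms]])
   fix t assume t: "t \<in> closed_segment x y"
   have "\<bar>deriv P t - deriv P x\<bar> <= M * \<bar>t - x\<bar>" by (rule lip[OF c1 b(3)])
   also have "\<dots> <= M * \<bar>y - x\<bar>"
    using t by (intro mult_left_mono) (auto simp: closed_segment_eq_real_ivl M_def split: if_splits)
   finally show "norm (deriv P t - deriv P x) <= M * \<bar>y - x\<bar>" by simp
  qed auto
  then show ?thesis by (simp add: algebra_simps power2_eq_square flip: abs_mult)
 qed
 then show ?thesis using that[of M] b lip[OF assms b(2)] by (auto simp: M_def)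
qed

lemma csmooth_measurable [measurable]: "csmooth P ==> P \<in> borel_measurable borel"
 by (intro borel_measurable_continuous_onI smooth_continuous csmooth_smooth)

lemma SL_proj_measurable [measurable]: "fst \<in> borel_measurable (SL L)" "snd \<in> borel_measurable (SL L)"
 by (auto intro!: measurable_SL_continuous continuous_intros)

lemma moll_integrable:
 assumes P: "csmooth P" and Q: "csmooth Q" and v: "integrable (SL L) v"
 shows "integrable (SL L) (%w. complex_of_real (P (fst z - fst w) * Q (a * snd z + b - snd w)) * v w)"
proof -
 obtain M where M: "\<And>x. \<bar>P x\<bar> <= M" using csmooth_bounded[OF P] by blast
 obtain N where N: "\<And>x. \<bar>Q x\<bar> <= N" using csmooth_bounded[OF Q] by blast
 have [measurable]: "P \<in> borel_measurable borel" "Q \<in> borel_measurable borel" using P Q by auto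
 have [measurable]: "v \<in> borel_measurable (SL L)" using v by simp
 show ?thesis
 proof (rule Bochner_Integration.integrable_bound[of _ "%w. (M * N) * norm (v w)"])
  show "integrable (SL L) (%w. M * N * cmod (v w))" using v by simp
  show "(%w. complex_of_real (P (fst z - fst w) * Q (a * snd z + b - snd w)) * v w) \<in> borel_measurable (SL L)"
   by measurable
  have "\<bar>P x * Q y\<bar> <= \<bar>M * N\<bar>" for x y
   unfolding abs_mult using M[of x] N[of y] by (intro mult_mono) auto
  then show "AE w in SL L. norm (complex_of_real (P (fst z - fst w) * Q (a * snd z + b - snd w)) * v w) <= norm (M * N * cmod (v w))"
   by (auto simp: norm_mult abs_mult intro!: mult_right_mono)
 qed
qed

lemma integral_linear_combination:
 fixes F0 F1 F2 F3 :: "'a => complex"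
 assumes "integrable M F0" "integrable M F1" "integrable M F2" "integrable M F3"
 shows "(LINT x|M. F0 x) - (LINT x|M. F1 x) - (c * (LINT x|M. F2 x) + d * (LINT x|M. F3 x))
  = (LINT x|M. F0 x - F1 x - (c * F2 x + d * F3 x))"
 using assms by simp

text \<open>The Taylor remainder of the product kernel is quadratic in the increment, uniformly in
  the integration variable, so it can be integrated against \<open>norm (v w)\<close>.\<close>

lemma moll_has_derivative:
 assumes P: "csmooth P" and Q: "csmooth Q" and v: "integrable (SL L) v"
 shows "(moll L P Q a b v has_derivative
  (%d. complex_of_real (fst d) * moll L (deriv P) Q a b v z + complex_of_real (a * snd d) * moll L P (deriv Q) a b v z)) (at z)"
  (is "(_ has_derivative ?D) _")
proof -
 obtain M where M: "0 <= M" "\<And>x. \<bar>P x\<bar> <= M" "\<And>x. \<bar>deriv P x\<bar> <= M" "\<And>x y. \<bar>P y - P x\<bar> <= M * \<bar>y - x\<bar>"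
  "\<And>x y. \<bar>P y - P x - deriv P x * (y - x)\<bar> <= M * (y - x)^2" using csmooth_Taylor[OF P] by blast
 obtain N where N: "0 <= N" "\<And>x. \<bar>Q x\<bar> <= N" "\<And>x. \<bar>deriv Q x\<bar> <= N" "\<And>x y. \<bar>Q y - Q x\<bar> <= N * \<bar>y - x\<bar>"
  "\<And>x y. \<bar>Q y - Q x - deriv Q x * (y - x)\<bar> <= N * (y - x)^2" using csmooth_Taylor[OF Q] by blast
 note P' = csmooth_deriv[OF P] and Q' = csmooth_deriv[OF Q]
 have pt: "\<bar>P (s + h) * Q (t + k) - P s * Q t - (h * (deriv P s * Q t) + k * (P s * deriv Q t))\<bar> <= 2 * (M * N) * (h^2 + k^2)"
  for s t h k
 proof -
  let ?e1 = "P (s + h) - P s - deriv P s * h" and ?e2 = "Q (t + k) - Q t - deriv Q t * k"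
  have e1: "\<bar>?e1\<bar> <= M * h^2" using M(5)[where x = s and y = "s + h"] by simp
  have e2: "\<bar>?e2\<bar> <= N * k^2" using N(5)[where x = t and y = "t + k"] by simp
  have e3: "\<bar>Q (t + k) - Q t\<bar> <= N * \<bar>k\<bar>" using N(4)[where x = t and y = "t + k"] by simp
  have e4: "\<bar>deriv P s * h\<bar> <= M * \<bar>h\<bar>" unfolding abs_mult using M(3) by (intro mult_right_mono) auto
  have "P (s + h) * Q (t + k) - P s * Q t - (h * (deriv P s * Q t) + k * (P s * deriv Q t))
   = ?e1 * Q (t + k) + (deriv P s * h) * (Q (t + k) - Q t) + P s * ?e2" by (simp add: algebra_simps)
  also have "\<bar>\<dots>\<bar> <= \<bar>?e1\<bar> * \<bar>Q (t + k)\<bar> + \<bar>deriv P s * h\<bar> * \<bar>Q (t + k) - Q t\<bar> + \<bar>P s\<bar> * \<bar>?e2\<bar>"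
   unfolding abs_mult[symmetric] by linarith
  also have "\<dots> <= (M * h^2) * N + (M * \<bar>h\<bar>) * (N * \<bar>k\<bar>) + M * (N * k^2)"
   using M N e1 e2 e3 e4 by (intro add_mono mult_mono) auto
  also have "\<dots> = M * N * (h^2 + \<bar>h\<bar> * \<bar>k\<bar> + k^2)" by (simp add: algebra_simps)
  also have "\<dots> <= M * N * (2 * (h^2 + k^2))"
  proof (rule mult_left_mono)
   have "\<bar>h\<bar> * \<bar>k\<bar> <= h^2 + k^2"
    using sum_squares_bound[of "\<bar>h\<bar>" "\<bar>k\<bar>"] mult_nonneg_nonneg[OF abs_ge_zero abs_ge_zero, of h k]
    unfolding power2_abs by linarith
   then show "h^2 + \<bar>h\<bar> * \<bar>k\<bar> + k^2 <= 2 * (h^2 + k^2)" by simp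
  qed (use M N in simp)
  finally show ?thesis by (simp add: algebra_simps)
 qed
 define A where "A = 2 * (M * N) * (1 + a^2) * (LINT w|SL L. norm (v w))"
 note I = moll_integrable[OF _ _ v]
 have est: "norm (moll L P Q a b v (z + d) - moll L P Q a b v z - ?D d) <= A * (norm d)^2" for d
 proof -
  have E: "moll L P Q a b v (z + d) - moll L P Q a b v z - ?D d =
   (LINT w|SL L. complex_of_real (P ((fst z - fst w) + fst d) * Q ((a * snd z + b - snd w) + a * snd d)
    - P (fst z - fst w) * Q (a * snd z + b - snd w)
    - (fst d * (deriv P (fst z - fst w) * Q (a * snd z + b - snd w)) + (a * snd d) * (P (fst z - fst w) * deriv Q (a * snd z + b - snd w)))) * v w)"
  proof -
   have z': "moll L P Q a b v (z + d) = (LINT w|SL L. complex_of_real (P (fst z - fst w + fst d) * Q (a * snd z + b - snd w + a * snd d)) * v w)"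
    unfolding moll_def by (intro Bochner_Integration.integral_cong) (auto simp: algebra_simps)
   have i': "integrable (SL L) (%w. complex_of_real (P (fst z - fst w + fst d) * Q (a * snd z + b - snd w + a * snd d)) * v w)"
    using I[OF P Q, of "z + d" a b] by (simp add: algebra_simps)
   show ?thesis
    unfolding z' unfolding moll_def
    unfolding integral_linear_combination[OF i' I[OF P Q] I[OF P' Q] I[OF P Q']]
    by (intro Bochner_Integration.integral_cong) (auto simp: algebra_simps)
  qed
  have "norm (moll L P Q a b v (z + d) - moll L P Q a b v z - ?D d) <= (LINT w|SL L. (2 * (M * N) * ((fst d)^2 + (a * snd d)^2)) * norm (v w))"
   unfolding E by (rule norm_integral_le[OF integrable_mult_right[OF integrable_norm[OF v]]], rule AE_I2, unfold norm_mult norm_of_real)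
    (rule mult_right_mono[OF pt norm_ge_zero])
  also have "\<dots> = 2 * (M * N) * (LINT w|SL L. norm (v w)) * ((fst d)^2 + (a * snd d)^2)"
   unfolding integral_mult_right_zero by (simp only: mult_ac)
  also have "\<dots> <= 2 * (M * N) * (LINT w|SL L. norm (v w)) * ((1 + a^2) * (norm d)^2)"
  proof (rule mult_left_mono)
   have "(norm d)^2 = (fst d)^2 + (snd d)^2" by (cases d) (simp add: norm_Pair)
   then show "(fst d)^2 + (a * snd d)^2 <= (1 + a^2) * (norm d)^2"
    by (simp add: power_mult_distrib algebra_simps)
  qed (use M N in simp)
  finally show ?thesis by (simp add: A_def algebra_simps)
 qed
 have lin: "bounded_linear ?D"
  by (intro bounded_linear_add bounded_linear_mult_left[THEN bounded_linear_compose]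
    bounded_linear_of_real[THEN bounded_linear_compose] bounded_linear_fst bounded_linear_snd bounded_linear_const_mult)
 show ?thesis
  unfolding has_derivative_at
 proof (intro conjI lin)
  have "(%d. norm (moll L P Q a b v (z + d) - moll L P Q a b v z - ?D d) / norm d) \<midarrow>0\<rightarrow> 0"
  proof (rule Lim_null_comparison)
   show "\<forall>\<^sub>F d in at 0. norm (norm (moll L P Q a b v (z + d) - moll L P Q a b v z - ?D d) / norm d) <= A * norm d"
   proof (rule always_eventually, rule allI)
    fix d show "norm (norm (moll L P Q a b v (z + d) - moll L P Q a b v z - ?D d) / norm d) <= A * norm d"
     using est[of d] by (cases "d = 0") (simp_all add: divide_le_eq power2_eq_square mult.assoc)
   qed
   show "((%d. A * norm d) \<longlongrightarrow> 0) (at 0)" by (auto intro!: tendsto_eq_intros)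
  qed
  then show "(%d. norm (moll L P Q a b v (z + d) - moll L P Q a b v z - ?D d) / norm d) \<midarrow>0\<rightarrow> 0" .
 qed
qed

lemma C_k_moll:
 assumes v: "integrable (SL L) v"
 shows "csmooth P ==> csmooth Q ==> C_k k (moll L P Q a b v)"
proof (induction k arbitrary: P Q)
 case 0
 then show ?case
  unfolding C_k.simps by (intro continuous_at_imp_continuous_on ballI has_derivative_continuous[OF moll_has_derivative[OF _ _ v]])
next
 case (Suc k)
 show ?case
 proof (rule C_k_SucI[OF moll_has_derivative[OF Suc.prems v]])
  fix d
  show "C_k k (%z. complex_of_real (fst d) * moll L (deriv P) Q a b v z + complex_of_real (a * snd d) * moll L P (deriv Q) a b v z)"
   by (intro C_k_lin Suc.IH Suc.prems csmooth_deriv)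
 qed
qed

section \<open>Approximation in \<open>L^2\<close>\<close>

text \<open>Cauchy-Schwarz with the kernel split into two square roots. The column bound
  \<open>C\<close> differs from the row bound 1 because the contraction of the strip changes
  areas.\<close>

lemma Schur_test:
 fixes K :: "'a => 'a => real" and v :: "'a => complex"
 assumes sf: "sigma_finite_measure M"
  and [measurable]: "(%(z, w). K z w) \<in> borel_measurable (M \<Otimes>\<^sub>M M)"
  and K0: "\<And>z w. 0 <= K z w"
  and K1: "\<And>z. z \<in> space M ==> (\<integral>\<^sup>+w. K z w \<partial>M) <= 1"
  and K2: "\<And>w. w \<in> space M ==> (\<integral>\<^sup>+z. K z w \<partial>M) <= ennreal C" and C: "0 <= C"
  and v: "v \<in> sqi M"
 shows "(%z. \<integral>w. complex_of_real (K z w) * v w \<partial>M) \<in> sqi M"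
  "l2 M (%z. \<integral>w. complex_of_real (K z w) * v w \<partial>M) <= sqrt C * l2 M v"
proof -
 interpret sigma_finite_measure M by fact
 interpret pair_sigma_finite M M ..
 have [measurable]: "v \<in> borel_measurable M" using v by (rule sqiD)
 let ?T = "%z. \<integral>w. complex_of_real (K z w) * v w \<partial>M"
 have m[measurable]: "?T \<in> borel_measurable M" by measurable
 have pt: "ennreal ((norm (?T z))^2) <= (\<integral>\<^sup>+w. ennreal (K z w) * ennreal ((norm (v w))^2) \<partial>M)" if z: "z \<in> space M" for z
 proof -
  have [measurable]: "K z \<in> borel_measurable M"
   using measurable_Pair2[OF assms(2) z] by simp
  have "ennreal (norm (?T z)) <= (\<integral>\<^sup>+w. ennreal (norm (complex_of_real (K z w) * v w)) \<partial>M)"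
   by (cases "integrable M (%w. complex_of_real (K z w) * v w)")
    (auto simp: not_integrable_integral_eq intro: integral_norm_bound_ennreal)
  also have "\<dots> = (\<integral>\<^sup>+w. ennreal (sqrt (K z w)) * ennreal (sqrt (K z w) * norm (v w)) \<partial>M)"
   using K0 by (intro nn_integral_cong) (simp add: norm_mult ennreal_mult[symmetric] mult.assoc[symmetric])
  finally have "ennreal (norm (?T z)) ^ 2 <= (\<integral>\<^sup>+w. ennreal (sqrt (K z w)) * ennreal (sqrt (K z w) * norm (v w)) \<partial>M) ^ 2"
   by (intro power_mono) auto
  also have "\<dots> <= (\<integral>\<^sup>+w. ennreal (sqrt (K z w)) ^ 2 \<partial>M) * (\<integral>\<^sup>+w. ennreal (sqrt (K z w) * norm (v w)) ^ 2 \<partial>M)"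
   by (rule Cauchy_Schwarz_nn_integral) measurable
  also have "\<dots> = (\<integral>\<^sup>+w. K z w \<partial>M) * (\<integral>\<^sup>+w. ennreal (K z w) * ennreal ((norm (v w))^2) \<partial>M)"
   using K0 by (simp add: ennreal_power power_mult_distrib ennreal_mult)
  also have "\<dots> <= 1 * (\<integral>\<^sup>+w. ennreal (K z w) * ennreal ((norm (v w))^2) \<partial>M)"
   by (intro mult_right_mono K1 z) simp
  finally show ?thesis by (simp add: ennreal_power)
 qed
 have "(\<integral>\<^sup>+z. ennreal ((norm (?T z))^2) \<partial>M) <= (\<integral>\<^sup>+z. (\<integral>\<^sup>+w. ennreal (K z w) * ennreal ((norm (v w))^2) \<partial>M) \<partial>M)"
  by (intro nn_integral_mono pt)
 also have "\<dots> = (\<integral>\<^sup>+w. (\<integral>\<^sup>+z. ennreal (K z w) * ennreal ((norm (v w))^2) \<partial>M) \<partial>M)"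
  by (rule Fubini'[symmetric]) measurable
 also have "\<dots> <= (\<integral>\<^sup>+w. ennreal C * ennreal ((norm (v w))^2) \<partial>M)"
 proof (rule nn_integral_mono)
  fix w assume w: "w \<in> space M"
  have [measurable]: "(%z. K z w) \<in> borel_measurable M"
   using measurable_Pair1[OF assms(2) w] by simp
  have "(\<integral>\<^sup>+z. ennreal (K z w) * ennreal ((norm (v w))^2) \<partial>M) = (\<integral>\<^sup>+z. ennreal (K z w) \<partial>M) * ennreal ((norm (v w))^2)"
   by (rule nn_integral_multc) measurable
  also have "\<dots> <= ennreal C * ennreal ((norm (v w))^2)" by (intro mult_right_mono K2 w) simp
  finally show "(\<integral>\<^sup>+z. ennreal (K z w) * ennreal ((norm (v w))^2) \<partial>M) <= ennreal C * ennreal ((norm (v w))^2)" .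
 qed
 also have "\<dots> = ennreal (C * (l2 M v)^2)"
  using sqi_integrable[OF v] C by (simp add: nn_integral_cmult nn_integral_eq_integral l2_sq ennreal_mult)
 finally have *: "(\<integral>\<^sup>+z. ennreal ((norm (?T z))^2) \<partial>M) <= ennreal (C * (l2 M v)^2)" .
 have i: "integrable M (%z. (norm (?T z))^2)"
  by (rule integrableI_nonneg) (use * in \<open>auto intro: le_less_trans\<close>)
 then show s: "?T \<in> sqi M" by (intro sqiI m)
 have "(l2 M ?T)^2 <= C * (l2 M v)^2"
  using * C by (simp add: nn_integral_eq_integral[OF i] l2_sq[symmetric] ennreal_le_iff)
 then have "(l2 M ?T)^2 <= (sqrt C * l2 M v)^2" using C by (simp add: power_mult_distrib)
 then show "l2 M ?T <= sqrt C * l2 M v" by (rule power2_le_imp_le) (use C in simp)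
qed

lemma integrable_SL_box_indicator:
 assumes "A \<in> sets borel"
 shows "integrable (SL L) (%z. indicator ({-R..R} \<times> UNIV) z * (c::real))"
proof -
 have "integrable lborel (%z. indicator ({-R..R} \<times> {0..L}) z *\<^sub>R c)"
  by (intro borel_integrable_compact compact_Times continuous_on_const) auto
 moreover have "indicator (strip L) z *\<^sub>R (indicator ({-R..R} \<times> UNIV) z * c) = indicator ({-R..R} \<times> {0..L}) z *\<^sub>R c" for z :: "plane"
  by (auto simp: indicator_def strip_def)
 ultimately show ?thesis by (simp only: integrable_SL)
qed

lemma L2_dominated:
 fixes f :: "nat => 'a => 'b::euclidean_space"
 assumes m: "\<And>n. f n \<in> borel_measurable M" "g \<in> borel_measurable M" and w: "w \<in> sqi M"
  and lim: "AE x in M. (%n. f n x) \<longlonglongrightarrow> g x" and le: "\<And>n. AE x in M. norm (f n x - g x) <= norm (w x)"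
 shows "(%n. l2 M (%x. f n x - g x)) \<longlonglongrightarrow> 0"
proof -
 note [measurable] = m
 have "(%n. \<integral>x. (norm (f n x - g x))^2 \<partial>M) \<longlonglongrightarrow> (LINT x|M. 0)"
 proof (rule integral_dominated_convergence[OF _ _ sqi_integrable[OF w]])
  show "AE x in M. (%n. (norm (f n x - g x))^2) \<longlonglongrightarrow> 0"
   using lim
  proof eventually_elim
   case (elim x)
   have "(%n. (norm (f n x - g x))^2) \<longlonglongrightarrow> (norm (g x - g x))^2" by (intro tendsto_intros elim)
   then show ?case by simp
  qed
  show "AE x in M. norm ((norm (f n x - g x))^2) <= (norm (w x))^2" for n
   using le[of n] by eventually_elim (auto intro: power_mono)
 qed auto
 then have "(%n. sqrt (LINT x|M. (norm (f n x - g x))^2)) \<longlonglongrightarrow> sqrt 0" by (intro tendsto_real_sqrt) simp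
 then show ?thesis by (simp add: l2_def)
qed

text \<open>Measurability provides continuous functions converging almost everywhere. Truncating
  modulus and support makes the convergence dominated: first \<open>v\<close> is compared with its
  truncation, then that truncation with the truncated continuous functions.\<close>

lemma L2_dense:
 fixes v :: "plane => complex"
 assumes v: "v \<in> sqi (SL L)" and e: "0 < e"
 obtains \<phi> where "continuous_on UNIV \<phi>" "xsupp \<phi>" "l2 (SL L) (%z. v z - \<phi> z) < e"
proof -
 note vm = sqiD[OF v]
 have "(%z. indicator (strip L) z *\<^sub>R v z) \<in> borel_measurable lborel"
  using vm unfolding SL_eq by (subst (asm) borel_measurable_restrict_space_iff) auto
 then have "(%z. indicator (strip L) z *\<^sub>R v z) measurable_on UNIV"
  by (intro lebesgue_measurable_imp_measurable_on measurable_completion) auto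
 then obtain N and g :: "nat => plane => complex" where N: "negligible N" and g: "\<And>k. continuous_on UNIV (g k)"
  "\<And>z. z \<notin> N ==> (%k. g k z) \<longlonglongrightarrow> indicator (strip L) z *\<^sub>R v z"
  unfolding measurable_on_def by auto
 have "AE z in lebesgue. z \<notin> N" using N by (intro AE_not_in) (simp add: negligible_iff_null_sets)
 then have gN: "AE z in SL L. z \<notin> N" unfolding AE_completion_iff SL_eq by (subst AE_restrict_space_iff) auto
 have glim: "AE z in SL L. (%k. g k z) \<longlonglongrightarrow> v z"
  using gN AE_space
 proof eventually_elim
  case (elim z)
  then show ?case using g(2)[of z] by simp
 qed
 \<comment> \<open>\<open>h n w z\<close> retracts the value \<open>w\<close> radially onto the ball
   of radius \<open>n\<close> and cuts off linearly between \<open>n\<close> and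
   \<open>n + 1\<close> in the first coordinate. For \<open>n > 0\<close> it is continuous in
   \<open>w\<close>, so pointwise limits survive.\<close>
 define h :: "nat => complex => plane => complex" where
  "h n w z = (max 0 (min 1 (real n + 1 - \<bar>fst z\<bar>)) * (real n / max (real n) (norm w))) *\<^sub>R w" for n w z
 have h0: "0 <= max 0 (min 1 (real n + 1 - \<bar>fst z\<bar>)) * (real n / max (real n) (norm w))"
  "max 0 (min 1 (real n + 1 - \<bar>fst z\<bar>)) * (real n / max (real n) (norm w)) <= 1" for n w and z :: "plane"
 proof -
  have c: "0 <= real n / max (real n) (norm w)" "real n / max (real n) (norm w) <= 1"
   by (auto simp: divide_le_eq_1 le_max_iff_disj)
  show "0 <= max 0 (min 1 (real n + 1 - \<bar>fst z\<bar>)) * (real n / max (real n) (norm w))"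
   using c(1) by (intro mult_nonneg_nonneg) auto
  show "max 0 (min 1 (real n + 1 - \<bar>fst z\<bar>)) * (real n / max (real n) (norm w)) <= 1"
   using c by (intro mult_le_one) auto
 qed
 have hle: "norm (h n w z) <= norm w" for n w z
  unfolding h_def norm_scaleR abs_of_nonneg[OF h0(1)] by (rule mult_left_le_one_le[OF norm_ge_zero h0(1) h0(2)])
 have hn: "norm (h n w z) <= real n" for n w z
 proof -
  have "norm (h n w z) = max 0 (min 1 (real n + 1 - \<bar>fst z\<bar>)) * (real n / max (real n) (norm w) * norm w)"
   unfolding h_def norm_scaleR abs_of_nonneg[OF h0(1)] by (rule mult.assoc)
  also have "\<dots> <= 1 * real n" by (rule mult_mono) (auto simp: max_def field_simps)
  finally show ?thesis by simp
 qed
 have hz: "h n w z = 0" if "real n + 1 < \<bar>fst z\<bar>" for n w z using that by (simp add: h_def)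
 have hc: "continuous_on UNIV (%z. h n (f z) z)" if "continuous_on UNIV f" "0 < n" for f n
  unfolding h_def using that(2) by (intro continuous_intros that(1)) auto
 have hx: "xsupp (%z. h n (f z) z)" for f n
  unfolding xsupp_def by (rule exI[of _ "real n + 1"]) (simp add: hz)
 have hm: "(%z. h n (f z) z) \<in> borel_measurable (SL L)" if f: "f \<in> borel_measurable (SL L)" for f n
 proof -
  have 1: "(%z. real n / max (real n) (norm (f z))) \<in> borel_measurable (SL L)" using f by measurable
  have 2: "(%z::plane. max 0 (min 1 (real n + 1 - \<bar>fst z\<bar>))) \<in> borel_measurable (SL L)"
   by (rule measurable_SL_continuous) (intro continuous_intros)
  show ?thesis unfolding h_def by (intro borel_measurable_scaleR borel_measurable_times 1 2 f)
 qed
 have "(%n. l2 (SL L) (%z. h n (v z) z - v z)) \<longlonglongrightarrow> 0"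
 proof (rule L2_dominated[OF hm[OF vm] vm sqi_add[OF sqi_norm[OF v] sqi_norm[OF v]]])
  show "AE z in SL L. (%n. h n (v z) z) \<longlonglongrightarrow> v z"
  proof (rule AE_I2)
   fix z :: "plane"
   obtain n0 :: nat where n0: "max (norm (v z)) \<bar>fst z\<bar> + 1 <= real n0" using real_arch_simple by blast
   have "\<forall>\<^sub>F n in sequentially. v z = h n (v z) z"
    using eventually_ge_at_top[of n0]
   proof eventually_elim
    case (elim n)
    then have "norm (v z) <= real n" "\<bar>fst z\<bar> <= real n" "0 < real n" using n0 norm_ge_zero[of "v z"] by linarith+
    then show ?case by (simp add: h_def max_def min_def)
   qed
   then show "(%n. h n (v z) z) \<longlonglongrightarrow> v z" by (rule Lim_transform_eventually[OF tendsto_const])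
  qed
  show "AE z in SL L. norm (h n (v z) z - v z) <= norm (norm (v z) + norm (v z))" for n
  proof (rule AE_I2)
   fix z show "norm (h n (v z) z - v z) <= norm (norm (v z) + norm (v z))"
    using norm_triangle_ineq4[of "h n (v z) z" "v z"] hle[of n "v z" z] by simp
  qed
 qed
 then have "\<forall>\<^sub>F n in sequentially. l2 (SL L) (%z. h n (v z) z - v z) < e / 2" using e by (intro order_tendstoD) auto
 then have "\<forall>\<^sub>F n in sequentially. l2 (SL L) (%z. h n (v z) z - v z) < e / 2 \<and> 0 < n"
  using eventually_gt_at_top[of 0] by eventually_elim simp
 then obtain n where n: "l2 (SL L) (%z. h n (v z) z - v z) < e / 2" "0 < n" by (auto simp: eventually_sequentially)
 have hs: "(%z. h n (f z) z) \<in> sqi (SL L)" if "continuous_on UNIV f" for f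
  by (rule sqi_SL_continuous[OF hc[OF that n(2)] hx])
 have vs: "(%z. h n (v z) z) \<in> sqi (SL L)" by (rule sqi_dominated(1)[OF v hm[OF vm]]) (simp add: hle)
 \<comment> \<open>A continuous dominating function, equal to \<open>2 * n\<close> wherever the
   truncations can be nonzero.\<close>
 define B where "B = (%z::plane. max 0 (min 1 (real n + 2 - \<bar>fst z\<bar>)) * (2 * real n))"
 have Bs: "B \<in> sqi (SL L)"
 proof (rule sqi_SL_continuous)
  show "continuous_on UNIV B" unfolding B_def by (intro continuous_intros)
  show "xsupp B" unfolding B_def xsupp_def by (rule exI[of _ "real n + 2"]) simp
 qed
 have "(%k. l2 (SL L) (%z. h n (g k z) z - h n (v z) z)) \<longlonglongrightarrow> 0"
 proof (rule L2_dominated[OF hm[OF measurable_SL_continuous[OF g(1)]] hm[OF vm] Bs])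
  show "AE z in SL L. (%k. h n (g k z) z) \<longlonglongrightarrow> h n (v z) z"
   using glim
  proof eventually_elim
   case (elim z)
   show ?case unfolding h_def using n(2) by (intro tendsto_intros elim) (auto simp: max_def)
  qed
  show "AE z in SL L. norm (h n (g k z) z - h n (v z) z) <= norm (B z)" for k
  proof (rule AE_I2)
   fix z :: "plane"
   show "norm (h n (g k z) z - h n (v z) z) <= norm (B z)"
   proof (cases "real n + 1 < \<bar>fst z\<bar>")
    case False
    then have "B z = 2 * real n" by (simp add: B_def)
    then show ?thesis using norm_triangle_ineq4[of "h n (g k z) z" "h n (v z) z"] hn[of n "g k z" z] hn[of n "v z" z] by simp
   qed (simp add: hz)
  qed
 qed
 then have "\<forall>\<^sub>F k in sequentially. l2 (SL L) (%z. h n (g k z) z - h n (v z) z) < e / 2" using e by (intro order_tendstoD) auto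
 then obtain k where k: "l2 (SL L) (%z. h n (g k z) z - h n (v z) z) < e / 2" by (auto simp: eventually_sequentially)
 show ?thesis
 proof (rule that[OF hc[OF g(1) n(2)] hx])
  show "l2 (SL L) (%z. v z - h n (g k z) z) < e"
   using l2_triangle_diff[OF v vs hs[OF g(1)], of k] n(1) k
    l2_minus_commute[of "SL L" v "%z. h n (v z) z"] l2_minus_commute[of "SL L" "%z. h n (v z) z" "%z. h n (g k z) z"]
   by linarith
 qed
qed

lemma nn_integral_SL_product_le:
 fixes f g :: "real => real"
 assumes [measurable]: "f \<in> borel_measurable borel" "g \<in> borel_measurable borel"
  and nn: "\<And>x. 0 <= f x" "\<And>x. 0 <= g x"
 shows "(\<integral>\<^sup>+w. ennreal (f (fst w) * g (snd w)) \<partial>SL L) <= (\<integral>\<^sup>+x. f x \<partial>lborel) * (\<integral>\<^sup>+y. g y \<partial>lborel)"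
proof -
 have [measurable]: "f \<in> borel_measurable lborel" "g \<in> borel_measurable (Ival 0 L)"
  by (simp_all add: Ival_def measurable_restrict_space1)
 interpret I: sigma_finite_measure "Ival 0 L" by (rule sigma_finite_Ival)
 have "(\<integral>\<^sup>+w. ennreal (f (fst w) * g (snd w)) \<partial>SL L) = (\<integral>\<^sup>+x. (\<integral>\<^sup>+y. ennreal (f (fst (x, y)) * g (snd (x, y))) \<partial>Ival 0 L) \<partial>lborel)"
  unfolding SL_def by (rule I.nn_integral_fst[symmetric]) measurable
 also have "\<dots> = (\<integral>\<^sup>+x. f x * (\<integral>\<^sup>+y. g y \<partial>Ival 0 L) \<partial>lborel)"
  using nn by (simp add: ennreal_mult nn_integral_cmult)
 also have "\<dots> = (\<integral>\<^sup>+x. f x \<partial>lborel) * (\<integral>\<^sup>+y. g y \<partial>Ival 0 L)"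
  by (rule nn_integral_multc) measurable
 also have "\<dots> <= (\<integral>\<^sup>+x. f x \<partial>lborel) * (\<integral>\<^sup>+y. g y \<partial>lborel)"
 proof (rule mult_left_mono)
  show "(\<integral>\<^sup>+y. g y \<partial>Ival 0 L) <= (\<integral>\<^sup>+y. g y \<partial>lborel)"
   unfolding Ival_def by (subst nn_integral_restrict_space) (auto intro!: nn_integral_mono simp: indicator_def)
 qed simp
 finally show ?thesis .
qed

lemma ker_nn_integral:
 assumes "0 < r" "a \<noteq> 0"
 shows "(\<integral>\<^sup>+s. ennreal (ker r (a * s + b)) \<partial>lborel) = ennreal (1 / \<bar>a\<bar>)"
 using ker_integral[OF assms, of b] ker_nonneg[OF assms(1)] by (simp add: nn_integral_eq_integral)

lemma ker_continuous: "0 < r ==> continuous_on UNIV (ker r)"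
 by (intro smooth_continuous csmooth_smooth ker_csmooth)

lemma ker_measurable [measurable]: "0 < r ==> ker r \<in> borel_measurable borel"
 by (intro borel_measurable_continuous_onI ker_continuous)

lemma ker_continuous_comp:
 "0 < r ==> continuous_on UNIV f ==> continuous_on UNIV (%z. ker r (f z))"
 by (rule continuous_on_compose2[OF ker_continuous]) auto

lemma interior_strip: "interior (strip L) = UNIV \<times> {0<..<L}"
 by (simp add: strip_def interior_Times)

text \<open>The cutoff that equals 1 on \<open>[-R, R]\<close> and 0 outside \<open>[-R-1, R+1]\<close>.\<close>

definition cutoff :: "real => real => real" where
 "cutoff R x = smooth_step (x + (R + 1)) * smooth_step ((R + 1) - x)"

lemma cutoff_smooth: "smooth (cutoff R)"
 unfolding cutoff_def
 using smooth_mult[OF smooth_affine[OF smooth_step(1), of 1 "R + 1"] smooth_affine[OF smooth_step(1), of "-1" "R + 1"]]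
 by simp

lemma cutoff_bounds: "0 <= cutoff R x" "cutoff R x <= 1"
 unfolding cutoff_def using smooth_step_bounds by (auto intro: mult_le_one)

lemma cutoff_one: "\<bar>x\<bar> <= R ==> cutoff R x = 1"
 unfolding cutoff_def by (subst smooth_step(3), simp, subst smooth_step(3)) auto

lemma cutoff_zero: "R + 1 <= \<bar>x\<bar> ==> cutoff R x = 0"
 unfolding cutoff_def using smooth_step(2) by (cases "0 <= x") auto

lemma cutoff_csmooth: "csmooth (cutoff R)"
 unfolding csmooth_def using cutoff_smooth cutoff_zero by (auto intro!: exI[of _ "R + 1"])

text \<open>The constant does not depend on \<open>R\<close>, since every cutoff is a product of a
  translate of one fixed step and a translate of its reflection.\<close>

lemma deriv_cutoff_bound:
 obtains C where "0 <= C" "\<And>R x. \<bar>deriv (cutoff R) x\<bar> <= C" "\<And>R x. \<bar>x\<bar> < R ==> deriv (cutoff R) x = 0"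
  "\<And>R x. R + 1 < \<bar>x\<bar> ==> deriv (cutoff R) x = 0"
proof -
 have cs: "csmooth (deriv smooth_step)"
  unfolding csmooth_def using smooth_DERIV(2)[OF smooth_step(1)]
  by (auto intro!: exI[of _ 1] deriv_smooth_step_zero)
 obtain M where M: "\<And>x. \<bar>deriv smooth_step x\<bar> <= M" using csmooth_bounded[OF cs] by blast
 have M0: "0 <= M" using M[of 0] by linarith
 have D: "(cutoff R has_real_derivative deriv smooth_step (x + (R + 1)) * smooth_step ((R + 1) - x)
   - smooth_step (x + (R + 1)) * deriv smooth_step ((R + 1) - x)) (at x)" for R x
 proof -
  have 1: "((%x. smooth_step (x + (R + 1))) has_real_derivative deriv smooth_step (x + (R + 1)) * 1) (at x)"
   by (rule DERIV_chain2[OF smooth_DERIV(1)[OF smooth_step(1)]]) (auto intro!: derivative_eq_intros)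
  have 2: "((%x. smooth_step ((R + 1) - x)) has_real_derivative deriv smooth_step ((R + 1) - x) * (-1)) (at x)"
   by (rule DERIV_chain2[OF smooth_DERIV(1)[OF smooth_step(1)]]) (auto intro!: derivative_eq_intros)
  show ?thesis
   unfolding cutoff_def by (rule DERIV_cong[OF DERIV_mult[OF 1 2]]) simp
 qed
 have d: "deriv (cutoff R) x = deriv smooth_step (x + (R + 1)) * smooth_step ((R + 1) - x)
   - smooth_step (x + (R + 1)) * deriv smooth_step ((R + 1) - x)" for R x
  by (rule DERIV_imp_deriv[OF D])
 have "\<bar>deriv (cutoff R) x\<bar> <= 2 * M" for R x
 proof -
  have "\<bar>deriv smooth_step (x + (R + 1)) * smooth_step ((R + 1) - x)\<bar> <= M * 1"
   unfolding abs_mult using M smooth_step_bounds M0 by (intro mult_mono) auto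
  moreover have "\<bar>smooth_step (x + (R + 1)) * deriv smooth_step ((R + 1) - x)\<bar> <= 1 * M"
   unfolding abs_mult using M smooth_step_bounds M0 by (intro mult_mono) auto
  ultimately show ?thesis unfolding d by linarith
 qed
 moreover have "deriv (cutoff R) x = 0" if "\<bar>x\<bar> < R" for R x
  by (rule deriv_zero_outside[of "{x. \<bar>x\<bar> < R}" _ _ 1])
   (use that cutoff_one in \<open>auto intro!: open_Collect_less continuous_intros\<close>)
 moreover have "deriv (cutoff R) x = 0" if "R + 1 < \<bar>x\<bar>" for R x
  by (rule deriv_zero_outside[of "{x. R + 1 < \<bar>x\<bar>}" _ _ 0])
   (use that cutoff_zero in \<open>auto intro!: open_Collect_less continuous_intros\<close>)
 ultimately show ?thesis using that[of "2 * M"] M0 by auto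
qed

section \<open>Mollification up to the boundary of the strip\<close>

locale strip_width =
 fixes L :: real
 assumes L: "0 < L"
begin

text \<open>The factor 8 keeps \<open>aa n\<close> at least 1/2, so the inverse of the contraction
  stretches lengths by at most 2.\<close>

definition rr :: "nat => real" where "rr n = L / (8 * (real n + 2))"

definition aa :: "nat => real" where "aa n = 1 - 4 * rr n / L"

abbreviation "kk n \<equiv> ker (rr n)"

text \<open>The affine map \<open>y \<mapsto> aa n * y + 2 * rr n\<close> contracts \<open>[0, L]\<close> to its interior, so that the kernels of
 the mollification are test functions in the open strip.\<close>

definition TT :: "nat => (plane => complex) => plane => complex" where
 "TT n = moll L (kk n) (kk n) (aa n) (2 * rr n)"

lemma rr_pos: "0 < rr n"
 using L by (simp add: rr_def)

lemma rr_le: "8 * rr n <= L"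
proof -
 have "0 <= L * real n" using L by simp
 then show ?thesis using L by (simp add: rr_def pos_divide_le_eq algebra_simps)
qed

lemma rr_tendsto: "rr \<longlonglongrightarrow> 0"
proof -
 have "(%n. 1 / real (n + 2)) \<longlonglongrightarrow> 0" by (rule LIMSEQ_ignore_initial_segment[OF lim_1_over_n])
 then have "(%n. (L / 8) * (1 / real (n + 2))) \<longlonglongrightarrow> (L / 8) * 0" by (intro tendsto_intros)
 moreover have "(L / 8) * (1 / real (n + 2)) = rr n" for n by (simp add: rr_def)
 ultimately show ?thesis by simp
qed

lemma aa_bounds: "1 / 2 <= aa n" "aa n < 1"
 using rr_le[of n] rr_pos[of n] L by (auto simp: aa_def field_simps)

lemma aa_pos: "0 < aa n" "aa n \<noteq> 0"
 using aa_bounds[of n] by auto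

text \<open>The image keeps distance \<open>2 * rr n\<close> from the boundary, more than the kernel
  radius \<open>rr n\<close>.\<close>

lemma contraction:
 assumes "y \<in> {0..L}"
 shows "2 * rr n <= aa n * y + 2 * rr n" "aa n * y + 2 * rr n <= L - 2 * rr n" "\<bar>aa n * y + 2 * rr n - y\<bar> <= 2 * rr n"
proof -
 have e: "aa n * y = y - 4 * rr n * (y / L)" by (simp add: aa_def left_diff_distrib)
 have yl: "0 <= y / L" "y / L <= 1" using assms L by auto
 show "2 * rr n <= aa n * y + 2 * rr n" using aa_pos[of n] assms by simp
 have "aa n * y <= aa n * L" using aa_pos[of n] assms by (intro mult_left_mono) auto
 also have "aa n * L = L - 4 * rr n" using L by (simp add: aa_def left_diff_distrib)
 finally show "aa n * y + 2 * rr n <= L - 2 * rr n" by simp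
 have "rr n * (y / L) <= rr n * 1" by (rule mult_left_mono[OF yl(2) less_imp_le[OF rr_pos]])
 moreover have "0 <= rr n * (y / L)" by (rule mult_nonneg_nonneg[OF less_imp_le[OF rr_pos] yl(1)])
 ultimately show "\<bar>aa n * y + 2 * rr n - y\<bar> <= 2 * rr n" unfolding e by linarith
qed

definition KK :: "nat => plane => plane => real" where
 "KK n z w = kk n (fst z - fst w) * kk n (aa n * snd z + 2 * rr n - snd w)"

lemma TT_eq: "TT n v z = (LINT w|SL L. complex_of_real (KK n z w) * v w)"
 by (simp add: TT_def moll_def KK_def)

lemma KK_nonneg: "0 <= KK n z w"
 using ker_nonneg[OF rr_pos] by (simp add: KK_def)

lemma KK_continuous: "continuous_on UNIV (KK n z)"
 unfolding KK_def by (intro continuous_intros ker_continuous_comp rr_pos)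

lemma KK_xsupp: "xsupp (KK n z)"
 unfolding xsupp_def
proof (intro exI allI impI)
 fix x y :: real assume "\<bar>fst z\<bar> + rr n < \<bar>x\<bar>"
 then show "KK n z (x, y) = 0" by (simp add: KK_def ker_zero[OF rr_pos])
qed

lemma KK_sqi: "(%w. complex_of_real (KK n z w)) \<in> sqi (SL L)"
 by (intro sqi_SL_continuous continuous_intros KK_continuous) (auto intro: xsupp_map[OF KK_xsupp])

lemma KK_integrable: "integrable (SL L) (KK n z)"
 by (intro integrable_SL_continuous KK_continuous KK_xsupp)

lemma KK_nn_le1: "(\<integral>\<^sup>+w. ennreal (KK n z w) \<partial>SL L) <= 1"
proof -
 have "(\<integral>\<^sup>+w. ennreal (KK n z w) \<partial>SL L)
   <= (\<integral>\<^sup>+s. ennreal (kk n (fst z - s)) \<partial>lborel) * (\<integral>\<^sup>+s. ennreal (kk n (aa n * snd z + 2 * rr n - s)) \<partial>lborel)"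
  unfolding KK_def
  by (rule nn_integral_SL_product_le)
   (auto intro!: borel_measurable_continuous_onI ker_continuous_comp continuous_intros rr_pos ker_nonneg)
 also have "\<dots> = 1"
  using ker_nn_integral[OF rr_pos, of "-1" n "fst z"] ker_nn_integral[OF rr_pos, of "-1" n "aa n * snd z + 2 * rr n"]
  by simp
 finally show ?thesis .
qed

lemma KK_nn_le2: "(\<integral>\<^sup>+z. ennreal (KK n z w) \<partial>SL L) <= ennreal 2"
proof -
 have "(\<integral>\<^sup>+z. ennreal (KK n z w) \<partial>SL L)
   <= (\<integral>\<^sup>+s. ennreal (kk n (s - fst w)) \<partial>lborel) * (\<integral>\<^sup>+s. ennreal (kk n (aa n * s + 2 * rr n - snd w)) \<partial>lborel)"
  unfolding KK_def
  by (rule nn_integral_SL_product_le)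
   (auto intro!: borel_measurable_continuous_onI ker_continuous_comp continuous_intros rr_pos ker_nonneg)
 also have "\<dots> = ennreal (1 / aa n)"
  using ker_nn_integral[OF rr_pos, of 1 n "- fst w"] ker_nn_integral[OF rr_pos aa_pos(2), of n n "2 * rr n - snd w"] aa_pos[of n]
  by (simp add: add_diff_eq)
 also have "\<dots> <= ennreal 2" using aa_bounds[of n] by (intro ennreal_leI) (simp add: divide_le_eq)
 finally show ?thesis .
qed

lemma KK_integral:
 assumes "z \<in> strip L"
 shows "(LINT w|SL L. KK n z w) = 1"
proof -
 let ?\<eta> = "aa n * snd z + 2 * rr n"
 have y: "snd z \<in> {0..L}" using assms by (auto simp: strip_def)
 have in1: "(LINT t|Ival 0 L. kk n (?\<eta> - t)) = 1"
 proof -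
  have eq: "indicator {0..L} t *\<^sub>R kk n (?\<eta> - t) = kk n (?\<eta> - t)" for t
   using contraction(1,2)[OF y, of n] ker_zero[OF rr_pos, of n "?\<eta> - t"] rr_pos[of n]
   by (cases "t \<in> {0..L}") (auto simp: not_le)
  then show ?thesis using ker_integral(2)[OF rr_pos, of "-1" n ?\<eta>] unfolding integral_Ival eq by simp
 qed
 have "(LINT w|SL L. KK n z w) = (LINT x|lborel. (LINT t|Ival 0 L. kk n (fst z - x) * kk n (?\<eta> - t)))"
  using integral_SL_fst(1)[OF KK_integrable[of n z]] unfolding KK_def[abs_def] by simp
 also have "\<dots> = (LINT x|lborel. kk n (fst z - x))" using in1 by simp
 also have "\<dots> = 1" using ker_integral(2)[OF rr_pos, of "-1" n "fst z"] by simp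
 finally show ?thesis .
qed

lemma KK_near:
 assumes "z \<in> strip L" "KK n z w \<noteq> 0"
 shows "\<bar>fst z - fst w\<bar> < rr n" "\<bar>snd z - snd w\<bar> < 3 * rr n"
proof -
 have y: "snd z \<in> {0..L}" using assms by (auto simp: strip_def)
 have "\<not> rr n <= \<bar>fst z - fst w\<bar>" "\<not> rr n <= \<bar>aa n * snd z + 2 * rr n - snd w\<bar>"
  using assms ker_zero[OF rr_pos] by (auto simp: KK_def)
 then show "\<bar>fst z - fst w\<bar> < rr n" "\<bar>snd z - snd w\<bar> < 3 * rr n"
  using contraction(3)[OF y, of n] by linarith+
qed

lemma TT_L2: assumes "v \<in> sqi (SL L)" shows "TT n v \<in> sqi (SL L)" "l2 (SL L) (TT n v) <= sqrt 2 * l2 (SL L) v"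
proof -
 have sf: "sigma_finite_measure (SL L)"
  unfolding SL_eq by (intro sigma_finite_measure_restrict_space lborel.sigma_finite_measure_axioms) simp
 have fm: "(%p. fst (fst p)) \<in> borel_measurable (SL L \<Otimes>\<^sub>M SL L)" "(%p. snd (fst p)) \<in> borel_measurable (SL L \<Otimes>\<^sub>M SL L)"
  "(%p. fst (snd p)) \<in> borel_measurable (SL L \<Otimes>\<^sub>M SL L)" "(%p. snd (snd p)) \<in> borel_measurable (SL L \<Otimes>\<^sub>M SL L)"
  using measurable_compose[OF measurable_fst SL_proj_measurable(1)] measurable_compose[OF measurable_fst SL_proj_measurable(2)]
   measurable_compose[OF measurable_snd SL_proj_measurable(1)] measurable_compose[OF measurable_snd SL_proj_measurable(2)] by auto
 have [measurable]: "kk n \<in> borel_measurable borel" by (rule ker_measurable[OF rr_pos])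
 have m: "(%(z, w). KK n z w) \<in> borel_measurable (SL L \<Otimes>\<^sub>M SL L)"
  unfolding KK_def split_beta using fm by measurable
 note S = Schur_test[OF sf m KK_nonneg KK_nn_le1 KK_nn_le2 _ assms]
 show "TT n v \<in> sqi (SL L)" "l2 (SL L) (TT n v) <= sqrt 2 * l2 (SL L) v"
  using S unfolding TT_eq[abs_def] by auto
qed

lemma TT_diff:
 assumes "v \<in> sqi (SL L)" "w \<in> sqi (SL L)"
 shows "TT n (%z. v z - w z) z = TT n v z - TT n w z"
 unfolding TT_eq by (simp add: right_diff_distrib L2_mult_integrable[OF KK_sqi] assms)

lemma uniformly_continuous_strip:
 fixes \<phi> :: "plane => complex"
 assumes c: "continuous_on UNIV \<phi>" and x: "xsupp \<phi>" and e: "0 < e"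
 obtains d where "0 < d" "\<And>z w. z \<in> strip L ==> w \<in> strip L ==> \<bar>fst z - fst w\<bar> < d ==> \<bar>snd z - snd w\<bar> < d ==> norm (\<phi> z - \<phi> w) < e"
proof -
 obtain R where R: "\<And>x y. R < \<bar>x\<bar> ==> \<phi> (x, y) = 0" using x unfolding xsupp_def by blast
 let ?K = "{-R-1..R+1} \<times> {0..L}"
 have "uniformly_continuous_on ?K \<phi>"
  by (intro compact_uniformly_continuous continuous_on_subset[OF c] compact_Times) auto
 then obtain d where d: "0 < d" "\<And>z w. z \<in> ?K ==> w \<in> ?K ==> dist w z < d ==> dist (\<phi> w) (\<phi> z) < e"
  using e unfolding uniformly_continuous_on_def by metis
 define d' where "d' = min 1 (d / 2)"
 show ?thesis
 proof (rule that[of d'])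
  show "0 < d'" using d by (simp add: d'_def)
  fix z w assume zw: "z \<in> strip L" "w \<in> strip L" "\<bar>fst z - fst w\<bar> < d'" "\<bar>snd z - snd w\<bar> < d'"
  show "norm (\<phi> z - \<phi> w) < e"
  proof (cases "z \<in> ?K \<and> w \<in> ?K")
   case True
   have "dist z w <= \<bar>fst z - fst w\<bar> + \<bar>snd z - snd w\<bar>"
    by (cases z; cases w) (simp add: dist_Pair_Pair dist_real_def sqrt_sum_squares_le_sum_abs)
   also have "\<dots> < d" using zw by (auto simp: d'_def)
   finally show ?thesis using d(2)[of w z] True by (simp add: dist_norm norm_minus_commute dist_commute)
  next
   case False
   then have "R < \<bar>fst z\<bar> \<and> R < \<bar>fst w\<bar>" using zw by (auto simp: strip_def d'_def abs_if split: if_splits)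
   then show ?thesis using R[of "fst z" "snd z"] R[of "fst w" "snd w"] e by simp
  qed
 qed
qed

text \<open>Uniform continuity, together with kernels of total mass 1 at points of the strip.
  Outside a fixed box both functions vanish, so a uniform pointwise error is an error in
  \<open>L^2\<close>.\<close>

lemma TT_tendsto_continuous:
 fixes \<phi> :: "plane => complex"
 assumes c: "continuous_on UNIV \<phi>" and x: "xsupp \<phi>"
 shows "(%n. l2 (SL L) (%z. TT n \<phi> z - \<phi> z)) \<longlonglongrightarrow> 0"
proof (rule LIMSEQ_I)
 fix e :: real assume e: "0 < e"
 have \<phi>s: "\<phi> \<in> sqi (SL L)" by (rule sqi_SL_continuous[OF c x])
 obtain R where R: "\<And>x y. R < \<bar>x\<bar> ==> \<phi> (x, y) = 0" using x unfolding xsupp_def by blast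
 let ?ind = "%z::plane. indicator ({-(R+L)..R+L} \<times> UNIV) z * (1::real)"
 define A where "A = l2 (SL L) ?ind"
 define e' where "e' = e / (A + 1)"
 have A0: "0 <= A" by (simp add: A_def)
 have e': "0 < e'" using e A0 by (simp add: e'_def)
 obtain d where d: "0 < d" "\<And>z w. z \<in> strip L ==> w \<in> strip L ==> \<bar>fst z - fst w\<bar> < d ==> \<bar>snd z - snd w\<bar> < d ==> norm (\<phi> z - \<phi> w) < e'"
  using uniformly_continuous_strip[OF c x e'] by blast
 have "\<forall>\<^sub>F n in sequentially. rr n < d / 3" using rr_tendsto d(1) by (intro order_tendstoD) auto
 then obtain N where N: "\<And>n. n \<ge> N ==> rr n < d / 3" by (auto simp: eventually_sequentially)
 show "\<exists>no. \<forall>n\<ge>no. norm (l2 (SL L) (%z. TT n \<phi> z - \<phi> z) - 0) < e"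
 proof (intro exI allI impI)
  fix n assume n: "n \<ge> N"
  have pt: "norm (TT n \<phi> z - \<phi> z) <= norm (e' *\<^sub>R ?ind z)" if z: "z \<in> space (SL L)" for z
  proof -
   have zs: "z \<in> strip L" using z by simp
   have "TT n \<phi> z - \<phi> z = TT n \<phi> z - (LINT w|SL L. complex_of_real (KK n z w) * \<phi> z)"
    using KK_integral[OF zs] KK_integrable[of n z] by simp
   also have "\<dots> = (LINT w|SL L. complex_of_real (KK n z w) * (\<phi> w - \<phi> z))"
    unfolding TT_eq by (simp add: right_diff_distrib L2_mult_integrable[OF KK_sqi \<phi>s] KK_integrable)
   finally have eq: "TT n \<phi> z - \<phi> z = (LINT w|SL L. complex_of_real (KK n z w) * (\<phi> w - \<phi> z))" .
   show ?thesis
   proof (cases "\<bar>fst z\<bar> <= R + L")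
    case True
    then have "?ind z = 1" by (cases z) (auto simp: indicator_def)
    have "norm (TT n \<phi> z - \<phi> z) <= (LINT w|SL L. e' * KK n z w)"
     unfolding eq
    proof (rule norm_integral_le)
     show "integrable (SL L) (%w. e' * KK n z w)" using KK_integrable by simp
     have "norm (complex_of_real (KK n z w) * (\<phi> w - \<phi> z)) <= e' * KK n z w" if w: "w \<in> space (SL L)" for w
     proof (cases "KK n z w = 0")
      case False
      have "\<bar>fst z - fst w\<bar> < d" "\<bar>snd z - snd w\<bar> < d"
       using KK_near[OF zs False] N[OF n] by linarith+
      then have "norm (\<phi> w - \<phi> z) <= e'" using d(2)[of z w] zs w by (simp add: norm_minus_commute less_imp_le)
      from mult_right_mono[OF this KK_nonneg[of n z w]]
      show ?thesis using KK_nonneg[of n z w] by (simp add: norm_mult mult.commute)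
     qed simp
     then show "AE w in SL L. norm (complex_of_real (KK n z w) * (\<phi> w - \<phi> z)) <= e' * KK n z w" by (rule AE_I2)
    qed
    also have "\<dots> = e'" using KK_integral[OF zs] by simp
    finally show ?thesis using \<open>?ind z = 1\<close> e' by simp
   next
    case False
    have "complex_of_real (KK n z w) * (\<phi> w - \<phi> z) = 0" if w: "w \<in> space (SL L)" for w
    proof (cases "KK n z w = 0")
     case F: False
     have "R < \<bar>fst z\<bar> \<and> R < \<bar>fst w\<bar>" using KK_near(1)[OF zs F] rr_le[of n] rr_pos[of n] False L by linarith
     then show ?thesis using R[of "fst z" "snd z"] R[of "fst w" "snd w"] by simp
    qed simp
    then have "TT n \<phi> z - \<phi> z = (LINT w|SL L. 0)" unfolding eq by (intro Bochner_Integration.integral_cong) auto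
    then show ?thesis by simp
   qed
  qed
  have is1: "?ind \<in> sqi (SL L)"
  proof (rule sqiI)
   have i: "integrable (SL L) ?ind" by (rule integrable_SL_box_indicator[of UNIV]) simp
   then show "?ind \<in> borel_measurable (SL L)" by simp
   have "(norm (?ind z))^2 = ?ind z" for z by (auto simp: indicator_def)
   then show "integrable (SL L) (%z. (norm (?ind z))^2)" using i by (simp only:)
  qed
  have "l2 (SL L) (%z. TT n \<phi> z - \<phi> z) <= l2 (SL L) (%z. e' *\<^sub>R ?ind z)"
  proof (rule sqi_dominated(2)[OF sqi_scale[OF is1]])
   show "(%z. TT n \<phi> z - \<phi> z) \<in> borel_measurable (SL L)" by (intro sqiD sqi_diff TT_L2 \<phi>s)
   show "AE z in SL L. norm (TT n \<phi> z - \<phi> z) <= norm (e' *\<^sub>R ?ind z)" using pt by (rule AE_I2)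
  qed
  also have "\<dots> = e' * A" unfolding l2_scale A_def using e' by simp
  also have "\<dots> < e" using e A0 by (simp add: e'_def field_simps)
  finally show "norm (l2 (SL L) (%z. TT n \<phi> z - \<phi> z) - 0) < e" by simp
 qed
qed

lemma TT_tendsto:
 assumes v: "v \<in> sqi (SL L)"
 shows "(%n. l2 (SL L) (%z. TT n v z - v z)) \<longlonglongrightarrow> 0"
proof (rule LIMSEQ_I)
 fix e :: real assume e: "0 < e"
 obtain \<phi> where \<phi>: "continuous_on UNIV \<phi>" "xsupp \<phi>" "l2 (SL L) (%z. v z - \<phi> z) < e / 4"
  using L2_dense[OF v, of "e/4"] e by auto
 have \<phi>s: "\<phi> \<in> sqi (SL L)" by (rule sqi_SL_continuous[OF \<phi>(1,2)])
 have "\<forall>\<^sub>F n in sequentially. l2 (SL L) (%z. TT n \<phi> z - \<phi> z) < e / 4"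
  using TT_tendsto_continuous[OF \<phi>(1,2)] e by (intro order_tendstoD) auto
 then obtain N where N: "\<And>n. n \<ge> N ==> l2 (SL L) (%z. TT n \<phi> z - \<phi> z) < e / 4" by (auto simp: eventually_sequentially)
 show "\<exists>no. \<forall>n\<ge>no. norm (l2 (SL L) (%z. TT n v z - v z) - 0) < e"
 proof (intro exI allI impI)
  fix n assume n: "n \<ge> N"
  have "l2 (SL L) (%z. TT n v z - v z) <= l2 (SL L) (%z. TT n v z - TT n \<phi> z) + l2 (SL L) (%z. TT n \<phi> z - v z)"
   by (intro l2_triangle_diff TT_L2 v \<phi>s)
  also have "l2 (SL L) (%z. TT n \<phi> z - v z) <= l2 (SL L) (%z. TT n \<phi> z - \<phi> z) + l2 (SL L) (%z. \<phi> z - v z)"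
   by (intro l2_triangle_diff TT_L2 v \<phi>s)
  also have "l2 (SL L) (%z. TT n v z - TT n \<phi> z) <= sqrt 2 * l2 (SL L) (%z. v z - \<phi> z)"
  proof -
   have "TT n (%z. v z - \<phi> z) = (%z. TT n v z - TT n \<phi> z)" by (rule ext, rule TT_diff[OF v \<phi>s])
   then show ?thesis using TT_L2(2)[OF sqi_diff[OF v \<phi>s], of n] by simp
  qed
  also have "sqrt 2 * l2 (SL L) (%z. v z - \<phi> z) <= 2 * l2 (SL L) (%z. v z - \<phi> z)"
   by (intro mult_right_mono real_le_lsqrt) auto
  finally have "l2 (SL L) (%z. TT n v z - v z) <= 2 * l2 (SL L) (%z. v z - \<phi> z) + (l2 (SL L) (%z. TT n \<phi> z - \<phi> z) + l2 (SL L) (%z. \<phi> z - v z))"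
   by simp
  also have "\<dots> < e" using N[OF n] \<phi>(3) l2_minus_commute[of "SL L" \<phi> v] by simp
  finally show "norm (l2 (SL L) (%z. TT n v z - v z) - 0) < e" by simp
 qed
qed

end

section \<open>The Sobolev space of the strip\<close>

context strip_width
begin

lemma weak_partial_iff:
 "has_weak_partial L d u g \<longleftrightarrow> (\<forall>\<phi>\<in>Cc_infinity (interior (strip L)).
  (LINT z|SL L. u z * frechet_derivative \<phi> (at z) d) = - (LINT z|SL L. g z * \<phi> z))"
 by (simp add: has_weak_partial_def set_integral_strip)

lemma C_k_frechet: "\<forall>k. C_k k f ==> C_k k (%z. frechet_derivative f (at z) d)"
 using C_k_SucD(2) by blast

lemma Cc_infinity_C1c:
 assumes "\<phi> \<in> Cc_infinity U"
 shows "C1c \<phi> (%z. frechet_derivative \<phi> (at z) (1, 0)) (%z. frechet_derivative \<phi> (at z) (0, 1))"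
proof -
 obtain K where K: "compact K" "\<And>z. z \<notin> K ==> \<phi> z = 0" and C: "\<forall>k. C_k k \<phi>"
  using assms by (auto simp: Cc_infinity_def)
 have D: "(\<phi> has_derivative frechet_derivative \<phi> (at z)) (at z)" for z
  using C_k_SucD(1)[of 0 \<phi>] C by blast
 obtain R where R: "\<And>z. z \<in> K ==> norm z <= R" using compact_imp_bounded[OF K(1)] by (auto simp: bounded_iff)
 have out: "(x, y) \<notin> K" if "R < \<bar>x\<bar>" for x y
  using R[of "(x, y)"] that norm_fst_le[of x y] by auto
 have D0: "frechet_derivative \<phi> (at z) d = 0" if "z \<notin> K" for z d
 proof -
  have "open (- K)" using K(1) compact_imp_closed by auto
  have "((%_. 0) has_derivative (%_. 0)) (at z)" by simp
  then have "(\<phi> has_derivative (%_. 0)) (at z)"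
   by (rule has_derivative_transform_within_open[OF _ \<open>open (- K)\<close>]) (use that K(2) in auto)
  then show ?thesis using frechet_derivative_at by metis
 qed
 show ?thesis
  unfolding C1c_def
 proof (intro conjI allI)
  show "continuous_on UNIV \<phi>" using C C_k_continuous by blast
  show "continuous_on UNIV (%z. frechet_derivative \<phi> (at z) (1, 0))" "continuous_on UNIV (%z. frechet_derivative \<phi> (at z) (0, 1))"
   using C_k_frechet[OF C] C_k_continuous by blast+
  show "xsupp \<phi>" unfolding xsupp_def using out K(2) by blast
  show "xsupp (%z. frechet_derivative \<phi> (at z) (1, 0))" "xsupp (%z. frechet_derivative \<phi> (at z) (0, 1))"
   unfolding xsupp_def using out D0 by blast+
  fix x y :: real
  have "((%s. (s, y)) has_derivative (%h. (h, 0))) (at x)" by (auto intro!: derivative_eq_intros)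
  from has_derivative_compose[where g = \<phi> and g' = "frechet_derivative \<phi> (at (x, y))", OF this D]
  have "((%s. \<phi> (s, y)) has_derivative (%h. h *\<^sub>R frechet_derivative \<phi> (at (x, y)) (1, 0))) (at x)"
  proof (rule has_derivative_eq_rhs, intro ext)
   fix h
   show "frechet_derivative \<phi> (at (x, y)) (h, 0) = h *\<^sub>R frechet_derivative \<phi> (at (x, y)) (1, 0)"
    using linear_cmul[OF has_derivative_linear[OF D[of "(x, y)"]], of h "(1, 0)"] by simp
  qed
  then show "((%s. \<phi> (s, y)) has_vector_derivative frechet_derivative \<phi> (at (x, y)) (1, 0)) (at x)"
   by (simp only: has_vector_derivative_def)
  have "((%s. (x, s)) has_derivative (%h. (0, h))) (at y)" by (auto intro!: derivative_eq_intros)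
  from has_derivative_compose[where g = \<phi> and g' = "frechet_derivative \<phi> (at (x, y))", OF this D]
  have "((%s. \<phi> (x, s)) has_derivative (%h. h *\<^sub>R frechet_derivative \<phi> (at (x, y)) (0, 1))) (at y)"
  proof (rule has_derivative_eq_rhs, intro ext)
   fix h
   show "frechet_derivative \<phi> (at (x, y)) (0, h) = h *\<^sub>R frechet_derivative \<phi> (at (x, y)) (0, 1)"
    using linear_cmul[OF has_derivative_linear[OF D[of "(x, y)"]], of h "(0, 1)"] by simp
  qed
  then show "((%s. \<phi> (x, s)) has_vector_derivative frechet_derivative \<phi> (at (x, y)) (0, 1)) (at y)"
   by (simp only: has_vector_derivative_def)
 qed
qed

lemma test_sqi:
 assumes "\<phi> \<in> Cc_infinity U"
 shows "\<phi> \<in> sqi (SL L)" "(%z. frechet_derivative \<phi> (at z) (1, 0)) \<in> sqi (SL L)"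
  "(%z. frechet_derivative \<phi> (at z) (0, 1)) \<in> sqi (SL L)"
 by (intro sqi_SL_continuous C1cD[OF Cc_infinity_C1c[OF assms]])+

lemma tens_frechet:
 assumes "smooth P" "smooth Q"
 shows "frechet_derivative (tens P Q) (at z) (1, 0) = tens (deriv P) Q z"
  "frechet_derivative (tens P Q) (at z) (0, 1) = tens P (deriv Q) z"
 using frechet_derivative_at[OF tens_has_derivative[OF assms, of z], symmetric] by simp_all

text \<open>The test functions by which the weak derivatives pass through the mollification.\<close>

lemma kernel_test:
 fixes \<theta> :: "real => real" and n :: nat and x y :: real
 assumes \<theta>: "smooth \<theta>" and y: "y \<in> {0..L}"
 defines "P \<equiv> (%s. \<theta> s * kk n (x - s))" and "Q \<equiv> (%s. kk n (aa n * y + 2 * rr n - s))"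
 shows "tens P Q \<in> Cc_infinity (interior (strip L))"
  "frechet_derivative (tens P Q) (at w) (1, 0)
   = complex_of_real ((deriv \<theta> (fst w) * kk n (x - fst w) - \<theta> (fst w) * deriv (kk n) (x - fst w)) * kk n (aa n * y + 2 * rr n - snd w))"
  "frechet_derivative (tens P Q) (at w) (0, 1)
   = - complex_of_real (\<theta> (fst w) * kk n (x - fst w) * deriv (kk n) (aa n * y + 2 * rr n - snd w))"
proof -
 let ?\<eta> = "aa n * y + 2 * rr n"
 have ks: "smooth (kk n)" by (intro csmooth_smooth ker_csmooth rr_pos)
 have k1: "smooth (%s. kk n (c - s))" for c using smooth_affine[OF ks, of "-1" c] by simp
 have P: "smooth P" unfolding P_def by (intro smooth_mult \<theta> k1)
 have Q: "smooth Q" unfolding Q_def by (rule k1)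
 have dk: "((%s. kk n (c - s)) has_real_derivative - deriv (kk n) (c - s)) (at s)" for c s
  by (rule DERIV_cong[OF DERIV_chain2[OF smooth_DERIV(1)[OF ks]]]) (auto intro!: derivative_eq_intros)
 have dP: "deriv P s = deriv \<theta> s * kk n (x - s) - \<theta> s * deriv (kk n) (x - s)" for s
  unfolding P_def by (rule DERIV_imp_deriv, rule DERIV_cong[OF DERIV_mult[OF smooth_DERIV(1)[OF \<theta>] dk]]) simp
 have dQ: "deriv Q s = - deriv (kk n) (?\<eta> - s)" for s
  unfolding Q_def by (rule DERIV_imp_deriv[OF dk])
 show "tens P Q \<in> Cc_infinity (interior (strip L))"
  unfolding Cc_infinity_def
 proof (intro CollectI conjI allI)
  show "C_k k (tens P Q)" for k by (rule C_k_tens[OF P Q])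
  let ?K = "{x - rr n..x + rr n} \<times> {?\<eta> - rr n..?\<eta> + rr n}"
  show "\<exists>K. compact K \<and> K \<subseteq> interior (strip L) \<and> (\<forall>z. z \<notin> K \<longrightarrow> tens P Q z = 0)"
  proof (intro exI[of _ ?K] conjI allI impI)
   show "compact ?K" by (intro compact_Times) auto
   show "?K \<subseteq> interior (strip L)"
    using contraction(1,2)[OF y, of n] rr_pos[of n] by (auto simp: interior_strip)
   fix z :: "plane" assume "z \<notin> ?K"
   then have "rr n <= \<bar>x - fst z\<bar> \<or> rr n <= \<bar>?\<eta> - snd z\<bar>" by (cases z) (auto simp: abs_if)
   then show "tens P Q z = 0" using ker_zero[OF rr_pos] by (auto simp: tens_def P_def Q_def)
  qed
 qed
 show "frechet_derivative (tens P Q) (at w) (1, 0)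
   = complex_of_real ((deriv \<theta> (fst w) * kk n (x - fst w) - \<theta> (fst w) * deriv (kk n) (x - fst w)) * kk n (?\<eta> - snd w))"
  unfolding tens_frechet[OF P Q] by (simp add: tens_def dP Q_def)
 show "frechet_derivative (tens P Q) (at w) (0, 1)
   = - complex_of_real (\<theta> (fst w) * kk n (x - fst w) * deriv (kk n) (?\<eta> - snd w))"
  unfolding tens_frechet[OF P Q] by (simp add: tens_def dQ P_def)
qed

section \<open>Uniqueness, integration by parts and closedness of weak derivatives\<close>

text \<open>The kernels of \<open>TT\<close> are test functions at every point of the closed strip.
  Hence every mollification of the difference vanishes on the strip, while the mollifications
  converge to the difference.\<close>

lemma weak_partial_unique:
 assumes g: "g \<in> sqi (SL L)" "has_weak_partial L d u g" and h: "h \<in> sqi (SL L)" "has_weak_partial L d u h"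
 shows "AE z in SL L. g z = h z"
proof -
 let ?f = "%z. g z - h z"
 have f: "?f \<in> sqi (SL L)" by (rule sqi_diff[OF g(1) h(1)])
 have "TT n ?f z = 0" if z: "z \<in> strip L" for n z
 proof -
  have y: "snd z \<in> {0..L}" using z by (auto simp: strip_def)
  let ?\<psi> = "tens (%s. 1 * kk n (fst z - s)) (%s. kk n (aa n * snd z + 2 * rr n - s))"
  have \<psi>: "?\<psi> \<in> Cc_infinity (interior (strip L))"
   by (rule kernel_test(1)[OF smooth_const y])
  have e: "?\<psi> w = complex_of_real (KK n z w)" for w by (simp add: tens_def KK_def)
  have 1: "(LINT w|SL L. u w * frechet_derivative ?\<psi> (at w) d) = - (LINT w|SL L. g w * ?\<psi> w)"
   using g(2) \<psi> unfolding weak_partial_iff by blast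
  have 2: "(LINT w|SL L. u w * frechet_derivative ?\<psi> (at w) d) = - (LINT w|SL L. h w * ?\<psi> w)"
   using h(2) \<psi> unfolding weak_partial_iff by blast
  have "(LINT w|SL L. g w * ?\<psi> w) = (LINT w|SL L. h w * ?\<psi> w)"
   by (rule neg_equal_iff_equal[THEN iffD1, OF trans[OF 1[symmetric] 2]])
  then show ?thesis
   unfolding TT_diff[OF g(1) h(1)] TT_eq e by (simp add: mult.commute)
 qed
 then have "l2 (SL L) (%z. TT n ?f z - ?f z) = l2 (SL L) ?f" for n
  unfolding l2_def by (intro arg_cong[where f = sqrt] Bochner_Integration.integral_cong) (auto simp: norm_minus_commute)
 then have "l2 (SL L) ?f = 0" using TT_tendsto[OF f] by (simp add: LIMSEQ_const_iff)
 then have "AE z in SL L. ?f z = 0" using l2_eq_0_iff[OF f] by simp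
 then show ?thesis by eventually_elim simp
qed

lemma weak_partial_diff:
 assumes "has_weak_partial L d u g" "has_weak_partial L d v h" and s: "u \<in> sqi (SL L)" "v \<in> sqi (SL L)" "g \<in> sqi (SL L)" "h \<in> sqi (SL L)"
  and d: "d = (1, 0) \<or> d = (0, 1)"
 shows "has_weak_partial L d (%z. u z - v z) (%z. g z - h z)"
 unfolding weak_partial_iff
proof
 fix \<phi> assume \<phi>: "\<phi> \<in> Cc_infinity (interior (strip L))"
 have m: "\<phi> \<in> sqi (SL L)" "(%z. frechet_derivative \<phi> (at z) d) \<in> sqi (SL L)"
  using test_sqi[OF \<phi>] d by auto
 show "(LINT z|SL L. (u z - v z) * frechet_derivative \<phi> (at z) d) = - (LINT z|SL L. (g z - h z) * \<phi> z)"
  using assms(1,2) \<phi> unfolding weak_partial_iff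
  by (simp add: left_diff_distrib L2_mult_integrable s m)
qed

lemma integral_derivative_zero:
 fixes h :: "real => complex"
 assumes D: "\<And>x. (h has_vector_derivative h' x) (at x)" and c: "continuous_on UNIV h'"
  and z: "h a = 0" "h b = 0" and ab: "a <= b"
 shows "(LINT x|Ival a b. h' x) = 0"
proof -
 have "(LINT x|lborel. indicator {a..b} x *\<^sub>R h' x) = h b - h a"
  by (rule integral_FTC_atLeastAtMost[OF ab])
   (use D c in \<open>auto intro: has_vector_derivative_at_within continuous_on_subset\<close>)
 then show ?thesis using z by (simp add: integral_Ival)
qed

text \<open>Integration by parts on lines: boundary terms vanish far out by the support of
  \<open>f\<close>, and at \<open>y = 0\<close> and \<open>y = L\<close> because the test function
  has compact support in the open strip.\<close>

lemma C1c_weak_partial: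
 fixes f :: "plane => complex"
 assumes C: "C1c f fx fy"
 shows "has_weak_partial L (1, 0) f fx" "has_weak_partial L (0, 1) f fy"
proof -
 note D = C1cD[OF C]
 have "(LINT z|SL L. f z * frechet_derivative \<phi> (at z) (1, 0)) = - (LINT z|SL L. fx z * \<phi> z) \<and>
   (LINT z|SL L. f z * frechet_derivative \<phi> (at z) (0, 1)) = - (LINT z|SL L. fy z * \<phi> z)"
  if \<phi>: "\<phi> \<in> Cc_infinity (interior (strip L))" for \<phi>
 proof -
  let ?px = "%z. frechet_derivative \<phi> (at z) (1, 0)" and ?py = "%z. frechet_derivative \<phi> (at z) (0, 1)"
  note E = C1cD[OF Cc_infinity_C1c[OF \<phi>]]
  obtain R where R: "\<And>x y. R < \<bar>x\<bar> ==> f (x, y) = 0" using D(4) unfolding xsupp_def by blast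
  obtain R1 where R1: "\<And>x y. R1 < \<bar>x\<bar> ==> fx (x, y) = 0" using D(5) unfolding xsupp_def by blast
  have bd: "\<phi> (x, 0) = 0" "\<phi> (x, L) = 0" for x
  proof -
   obtain K where K: "K \<subseteq> UNIV \<times> {0<..<L}" "\<forall>z. z \<notin> K \<longrightarrow> \<phi> z = 0"
    using \<phi> unfolding Cc_infinity_def interior_strip by blast
   have "(x, 0) \<notin> K" "(x, L) \<notin> K" using K(1) by auto
   then show "\<phi> (x, 0) = 0" "\<phi> (x, L) = 0" using K(2) by blast+
  qed
  have cx: "continuous_on UNIV (%z. f z * ?px z + fx z * \<phi> z)" by (intro continuous_intros D(1,2) E(1,2))
  have cy: "continuous_on UNIV (%z. f z * ?py z + fy z * \<phi> z)" by (intro continuous_intros D(1,3) E(1,3))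
  have xx: "xsupp (%z. f z * ?px z + fx z * \<phi> z)" by (rule xsupp_map2[OF D(4,5)]) simp
  have xy: "xsupp (%z. f z * ?py z + fy z * \<phi> z)" by (rule xsupp_map2[OF D(4,6)]) simp
  have ix: "integrable (SL L) (%z. f z * ?px z + fx z * \<phi> z)" by (rule integrable_SL_continuous[OF cx xx])
  have iy: "integrable (SL L) (%z. f z * ?py z + fy z * \<phi> z)" by (rule integrable_SL_continuous[OF cy xy])
  have dx: "((%s. f (s, y) * \<phi> (s, y)) has_vector_derivative f (x, y) * ?px (x, y) + fx (x, y) * \<phi> (x, y)) (at x)" for x y
   by (rule has_vector_derivative_mult[OF D(7) E(7)])
  have dy: "((%s. f (x, s) * \<phi> (x, s)) has_vector_derivative f (x, y) * ?py (x, y) + fy (x, y) * \<phi> (x, y)) (at y)" for x y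
   by (rule has_vector_derivative_mult[OF D(8) E(8)])
  have "(LINT z|SL L. f z * ?px z + fx z * \<phi> z) = (LINT y|Ival 0 L. (LINT x|lborel. f (x, y) * ?px (x, y) + fx (x, y) * \<phi> (x, y)))"
   by (rule integral_SL_snd(1)[OF ix])
  also have "\<dots> = (LINT y|Ival 0 L. 0)"
  proof (rule Bochner_Integration.integral_cong[OF refl])
   fix y
   define R' where "R' = \<bar>R\<bar> + \<bar>R1\<bar> + 1"
   have "(LINT x|lborel. f (x, y) * ?px (x, y) + fx (x, y) * \<phi> (x, y)) = (LINT x|Ival (-R') R'. f (x, y) * ?px (x, y) + fx (x, y) * \<phi> (x, y))"
    unfolding integral_Ival
   proof (rule Bochner_Integration.integral_cong[OF refl])
    fix x show "f (x, y) * ?px (x, y) + fx (x, y) * \<phi> (x, y) = indicator {- R'..R'} x *\<^sub>R (f (x, y) * ?px (x, y) + fx (x, y) * \<phi> (x, y))"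
     using R[of x y] R1[of x y] by (cases "x \<in> {-R'..R'}") (auto simp: R'_def abs_if split: if_splits)
   qed
   also have "\<dots> = 0"
    by (rule integral_derivative_zero[OF dx continuous_slice_x[OF cx]])
     (auto simp: R'_def intro!: R)
   finally show "(LINT x|lborel. f (x, y) * ?px (x, y) + fx (x, y) * \<phi> (x, y)) = 0" .
  qed
  finally have 1: "(LINT z|SL L. f z * ?px z + fx z * \<phi> z) = 0" by simp
  have "(LINT z|SL L. f z * ?py z + fy z * \<phi> z) = (LINT x|lborel. (LINT y|Ival 0 L. f (x, y) * ?py (x, y) + fy (x, y) * \<phi> (x, y)))"
   by (rule integral_SL_fst(1)[OF iy])
  also have "\<dots> = (LINT x|(lborel :: real measure). 0)"
   using L by (intro Bochner_Integration.integral_cong[OF refl] integral_derivative_zero[OF dy continuous_slice_y[OF cy]])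
    (auto simp: bd)
  finally have 2: "(LINT z|SL L. f z * ?py z + fy z * \<phi> z) = 0" by simp
  have s: "f \<in> sqi (SL L)" "fx \<in> sqi (SL L)" "fy \<in> sqi (SL L)" by (intro sqi_SL_continuous D(1-6))+
  note t = test_sqi[OF \<phi>]
  have "(LINT z|SL L. f z * ?px z) + (LINT z|SL L. fx z * \<phi> z) = 0"
   using 1 by (simp add: L2_mult_integrable s t)
  moreover have "(LINT z|SL L. f z * ?py z) + (LINT z|SL L. fy z * \<phi> z) = 0"
   using 2 by (simp add: L2_mult_integrable s t)
  ultimately show ?thesis by (simp add: eq_neg_iff_add_eq_0)
 qed
 then show "has_weak_partial L (1, 0) f fx" "has_weak_partial L (0, 1) f fy"
  by (simp_all add: weak_partial_iff)
qed

lemma weak_partial_limit: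
 assumes s: "\<And>n. f n \<in> sqi (SL L)" "u \<in> sqi (SL L)" "(%n. l2 (SL L) (%z. f n z - u z)) \<longlonglongrightarrow> 0"
  and s': "\<And>n. f' n \<in> sqi (SL L)" "g \<in> sqi (SL L)" "(%n. l2 (SL L) (%z. f' n z - g z)) \<longlonglongrightarrow> 0"
  and w: "\<And>n. has_weak_partial L d (f n) (f' n)" and d: "d = (1, 0) \<or> d = (0, 1)"
 shows "has_weak_partial L d u g"
 unfolding weak_partial_iff
proof
 fix \<phi> assume \<phi>: "\<phi> \<in> Cc_infinity (interior (strip L))"
 have m: "\<phi> \<in> sqi (SL L)" "(%z. frechet_derivative \<phi> (at z) d) \<in> sqi (SL L)"
  using test_sqi[OF \<phi>] d by auto
 have 1: "(%n. \<integral>z. f n z * frechet_derivative \<phi> (at z) d \<partial>SL L) \<longlonglongrightarrow> (LINT z|SL L. u z * frechet_derivative \<phi> (at z) d)"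
  by (rule L2_mult_tendsto[OF s m(2)])
 have 2: "(%n. - (LINT z|SL L. f' n z * \<phi> z)) \<longlonglongrightarrow> - (LINT z|SL L. g z * \<phi> z)"
  by (intro tendsto_minus L2_mult_tendsto[OF s' m(1)])
 have "(LINT z|SL L. f n z * frechet_derivative \<phi> (at z) d) = - (LINT z|SL L. f' n z * \<phi> z)" for n
  using w[of n] \<phi> by (simp add: weak_partial_iff)
 with 1 have "(%n. - (LINT z|SL L. f' n z * \<phi> z)) \<longlonglongrightarrow> (LINT z|SL L. u z * frechet_derivative \<phi> (at z) d)" by simp
 from LIMSEQ_unique[OF this 2]
 show "(LINT z|SL L. u z * frechet_derivative \<phi> (at z) d) = - (LINT z|SL L. g z * \<phi> z)" .
qed

section \<open>Cutting off and mollifying Sobolev functions\<close>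

lemma cutoff_sqi:
 fixes v :: "plane => complex"
 assumes v: "v \<in> sqi (SL L)" and c: "csmooth c"
 shows "(%z. complex_of_real (c (fst z)) * v z) \<in> sqi (SL L)" "integrable (SL L) (%z. complex_of_real (c (fst z)) * v z)"
proof -
 obtain M where M: "\<And>x. \<bar>c x\<bar> <= M" using csmooth_bounded[OF c] by blast
 have [measurable]: "c \<in> borel_measurable borel" "v \<in> borel_measurable (SL L)" using c v by (auto dest: sqiD)
 show 1: "(%z. complex_of_real (c (fst z)) * v z) \<in> sqi (SL L)"
 proof (rule sqi_dominated(1)[OF sqi_scale[OF v, of M]])
  show "AE z in SL L. norm (complex_of_real (c (fst z)) * v z) <= norm (M *\<^sub>R v z)"
   using M by (intro AE_I2) (auto simp: norm_mult intro!: mult_right_mono intro: order_trans[OF M abs_ge_self])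
 qed measurable
 have "(%z. complex_of_real (c (fst z))) \<in> sqi (SL L)"
 proof (rule sqi_SL_continuous)
  show "continuous_on UNIV (%z::plane. complex_of_real (c (fst z)))"
   by (intro continuous_intros continuous_on_compose2[OF smooth_continuous[OF csmooth_smooth[OF c]]]) auto
  show "xsupp (%z::plane. complex_of_real (c (fst z)))"
   using c by (auto simp: xsupp_def csmooth_def)
 qed
 then show "integrable (SL L) (%z. complex_of_real (c (fst z)) * v z)" by (rule L2_mult_integrable[OF _ v])
qed

text \<open>The cutoff is put into the test function, whose x-derivative then has two terms: one
  produces \<open>deriv c\<close>, the other changes sign because the kernel is a function of a
  difference.\<close>

lemma moll_partial:
 assumes u: "u \<in> sqi (SL L)" "g1 \<in> sqi (SL L)" "g2 \<in> sqi (SL L)"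
  and w: "has_weak_partial L (1, 0) u g1" "has_weak_partial L (0, 1) u g2"
  and c: "csmooth c" and z: "z \<in> strip L"
 shows "moll L (deriv (kk n)) (kk n) (aa n) (2 * rr n) (%w. complex_of_real (c (fst w)) * u w) z
   = TT n (%w. complex_of_real (deriv c (fst w)) * u w + complex_of_real (c (fst w)) * g1 w) z"
  "moll L (kk n) (deriv (kk n)) (aa n) (2 * rr n) (%w. complex_of_real (c (fst w)) * u w) z
   = TT n (%w. complex_of_real (c (fst w)) * g2 w) z"
proof -
 have y: "snd z \<in> {0..L}" using z by (auto simp: strip_def)
 let ?\<eta> = "aa n * snd z + 2 * rr n"
 let ?\<psi> = "tens (%s. c s * kk n (fst z - s)) (%s. kk n (?\<eta> - s))"
 note kt = kernel_test[OF csmooth_smooth[OF c] y, where x = "fst z" and n = n]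
 note kc = ker_csmooth[OF rr_pos, of n]
 note ic = cutoff_sqi(2)[OF u(1) c] and ic' = cutoff_sqi(2)[OF u(1) csmooth_deriv[OF c]]
  and ig1 = cutoff_sqi(2)[OF u(2) c] and ig2 = cutoff_sqi(2)[OF u(3) c]
 have I1: "integrable (SL L) (%w. complex_of_real (kk n (fst z - fst w) * kk n (?\<eta> - snd w)) * (complex_of_real (deriv c (fst w)) * u w))"
  by (rule moll_integrable[OF kc kc ic'])
 have I2: "integrable (SL L) (%w. complex_of_real (deriv (kk n) (fst z - fst w) * kk n (?\<eta> - snd w)) * (complex_of_real (c (fst w)) * u w))"
  by (rule moll_integrable[OF csmooth_deriv[OF kc] kc ic])
 have I3: "integrable (SL L) (%w. complex_of_real (kk n (fst z - fst w) * kk n (?\<eta> - snd w)) * (complex_of_real (c (fst w)) * g1 w))"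
  by (rule moll_integrable[OF kc kc ig1])
 have e1: "(LINT w|SL L. u w * frechet_derivative ?\<psi> (at w) (1, 0)) = - (LINT w|SL L. g1 w * ?\<psi> w)"
  using w(1) kt(1) unfolding weak_partial_iff by blast
 have e2: "(LINT w|SL L. u w * frechet_derivative ?\<psi> (at w) (1, 0))
  = (LINT w|SL L. complex_of_real (kk n (fst z - fst w) * kk n (?\<eta> - snd w)) * (complex_of_real (deriv c (fst w)) * u w)
     - complex_of_real (deriv (kk n) (fst z - fst w) * kk n (?\<eta> - snd w)) * (complex_of_real (c (fst w)) * u w))"
  unfolding kt(2) by (intro Bochner_Integration.integral_cong[OF refl]) (simp add: algebra_simps)
 have e3: "(LINT w|SL L. complex_of_real (kk n (fst z - fst w) * kk n (?\<eta> - snd w)) * (complex_of_real (deriv c (fst w)) * u w)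
     - complex_of_real (deriv (kk n) (fst z - fst w) * kk n (?\<eta> - snd w)) * (complex_of_real (c (fst w)) * u w)) = (LINT w|SL L. complex_of_real (kk n (fst z - fst w) * kk n (?\<eta> - snd w)) * (complex_of_real (deriv c (fst w)) * u w))
  - (LINT w|SL L. complex_of_real (deriv (kk n) (fst z - fst w) * kk n (?\<eta> - snd w)) * (complex_of_real (c (fst w)) * u w))"
  by (rule Bochner_Integration.integral_diff[OF I1 I2])
 have e4: "(LINT w|SL L. g1 w * ?\<psi> w) = (LINT w|SL L. complex_of_real (kk n (fst z - fst w) * kk n (?\<eta> - snd w)) * (complex_of_real (c (fst w)) * g1 w))"
  by (intro Bochner_Integration.integral_cong[OF refl]) (simp add: tens_def algebra_simps)
 have e5: "TT n (%w. complex_of_real (deriv c (fst w)) * u w + complex_of_real (c (fst w)) * g1 w) z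
  = (LINT w|SL L. complex_of_real (kk n (fst z - fst w) * kk n (?\<eta> - snd w)) * (complex_of_real (deriv c (fst w)) * u w))
  + (LINT w|SL L. complex_of_real (kk n (fst z - fst w) * kk n (?\<eta> - snd w)) * (complex_of_real (c (fst w)) * g1 w))"
  unfolding TT_def moll_def distrib_left by (rule Bochner_Integration.integral_add[OF I1 I3])
 have alg: "a - b = - c ==> b = a + c" for a b c :: complex by (simp add: algebra_simps)
 show "moll L (deriv (kk n)) (kk n) (aa n) (2 * rr n) (%w. complex_of_real (c (fst w)) * u w) z
   = TT n (%w. complex_of_real (deriv c (fst w)) * u w + complex_of_real (c (fst w)) * g1 w) z"
  unfolding moll_def e5 by (rule alg) (use e1 in \<open>simp only: e2 e3 e4\<close>)
 have "(LINT w|SL L. u w * frechet_derivative ?\<psi> (at w) (0, 1)) = - (LINT w|SL L. g2 w * ?\<psi> w)"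
  using w(2) kt(1) unfolding weak_partial_iff by blast
 moreover have "(LINT w|SL L. u w * frechet_derivative ?\<psi> (at w) (0, 1))
  = (LINT w|SL L. - (complex_of_real (kk n (fst z - fst w) * deriv (kk n) (?\<eta> - snd w)) * (complex_of_real (c (fst w)) * u w)))"
  unfolding kt(3) by (intro Bochner_Integration.integral_cong[OF refl]) (simp add: algebra_simps)
 moreover have "(LINT w|SL L. g2 w * ?\<psi> w) = (LINT w|SL L. complex_of_real (kk n (fst z - fst w) * kk n (?\<eta> - snd w)) * (complex_of_real (c (fst w)) * g2 w))"
  by (intro Bochner_Integration.integral_cong[OF refl]) (simp add: tens_def algebra_simps)
 ultimately show "moll L (kk n) (deriv (kk n)) (aa n) (2 * rr n) (%w. complex_of_real (c (fst w)) * u w) z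
   = TT n (%w. complex_of_real (c (fst w)) * g2 w) z"
  unfolding TT_def moll_def by simp
qed

lemma moll_Cc:
 assumes u: "u \<in> sqi (SL L)" and c: "csmooth c"
 shows "TT n (%w. complex_of_real (c (fst w)) * u w) \<in> Cc_infinity UNIV"
  "frechet_derivative (TT n (%w. complex_of_real (c (fst w)) * u w)) (at z) (1, 0)
   = moll L (deriv (kk n)) (kk n) (aa n) (2 * rr n) (%w. complex_of_real (c (fst w)) * u w) z"
  "frechet_derivative (TT n (%w. complex_of_real (c (fst w)) * u w)) (at z) (0, 1)
   = complex_of_real (aa n) * moll L (kk n) (deriv (kk n)) (aa n) (2 * rr n) (%w. complex_of_real (c (fst w)) * u w) z"
proof -
 let ?v = "%w. complex_of_real (c (fst w)) * u w"
 note kc = ker_csmooth[OF rr_pos, of n]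
 note i = cutoff_sqi(2)[OF u c]
 obtain R where R: "\<And>x. R < \<bar>x\<bar> ==> c x = 0" using c by (auto simp: csmooth_def)
 show "TT n ?v \<in> Cc_infinity UNIV"
  unfolding Cc_infinity_def
 proof (intro CollectI conjI allI)
  show "C_k k (TT n ?v)" for k unfolding TT_def by (rule C_k_moll[OF i kc kc])
  \<comment> \<open>Above height \<open>4 * L\<close> the contracted height exceeds
    \<open>2 * L\<close> in modulus, because \<open>aa n\<close> is at least 1/2, and the kernel no
    longer reaches the strip.\<close>
  let ?R = "\<bar>R\<bar> + L" and ?S = "4 * L"
  show "\<exists>K. compact K \<and> K \<subseteq> UNIV \<and> (\<forall>z. z \<notin> K \<longrightarrow> TT n ?v z = 0)"
  proof (intro exI[of _ "{-?R..?R} \<times> {-?S..?S}"] conjI allI impI)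
   show "compact ({-?R..?R} \<times> {-?S..?S})" by (intro compact_Times) auto
   fix z :: "plane" assume z: "z \<notin> {-?R..?R} \<times> {-?S..?S}"
   have "complex_of_real (KK n z w) * ?v w = 0" if w: "w \<in> space (SL L)" for w
   proof (cases "?R < \<bar>fst z\<bar>")
    case True
    then have "R < \<bar>fst w\<bar> \<or> rr n <= \<bar>fst z - fst w\<bar>" using rr_le[of n] rr_pos[of n] L by linarith
    then show ?thesis using R[of "fst w"] ker_zero[OF rr_pos, of n "fst z - fst w"] by (auto simp: KK_def)
   next
    case False
    then have S: "?S < \<bar>snd z\<bar>" using z by (cases z) (auto simp: abs_le_iff not_le abs_if split: if_splits)
    have w2: "0 <= snd w" "snd w <= L" using w by (auto simp: strip_def)
    have "1 / 2 * \<bar>snd z\<bar> <= aa n * \<bar>snd z\<bar>" using aa_bounds[of n] by (intro mult_right_mono) auto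
    then have "2 * L < \<bar>aa n * snd z\<bar>" using S aa_pos[of n] by (simp add: abs_mult)
    then have "rr n <= \<bar>aa n * snd z + 2 * rr n - snd w\<bar>" using w2 rr_le[of n] rr_pos[of n] by linarith
    then show ?thesis using ker_zero[OF rr_pos, of n "aa n * snd z + 2 * rr n - snd w"] by (simp add: KK_def)
   qed
   then have "TT n ?v z = (LINT w|SL L. 0)" unfolding TT_eq by (intro Bochner_Integration.integral_cong) auto
   then show "TT n ?v z = 0" by simp
  qed simp
 qed
 have fd: "frechet_derivative (TT n ?v) (at z) = (%d. complex_of_real (fst d) * moll L (deriv (kk n)) (kk n) (aa n) (2 * rr n) ?v z
   + complex_of_real (aa n * snd d) * moll L (kk n) (deriv (kk n)) (aa n) (2 * rr n) ?v z)"
  unfolding TT_def by (rule frechet_derivative_at[OF moll_has_derivative[OF kc kc i], symmetric])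
 show "frechet_derivative (TT n ?v) (at z) (1, 0) = moll L (deriv (kk n)) (kk n) (aa n) (2 * rr n) ?v z"
  "frechet_derivative (TT n ?v) (at z) (0, 1) = complex_of_real (aa n) * moll L (kk n) (deriv (kk n)) (aa n) (2 * rr n) ?v z"
  unfolding fd by simp_all
qed

end

lemma C1c_lin:
 fixes f g :: "plane => 'b::real_normed_vector"
 assumes f: "C1c f fx fy" and g: "C1c g gx gy"
 shows "C1c (%z. a *\<^sub>R f z + b *\<^sub>R g z) (%z. a *\<^sub>R fx z + b *\<^sub>R gx z) (%z. a *\<^sub>R fy z + b *\<^sub>R gy z)"
 unfolding C1c_def
proof (intro conjI allI)
 note F = C1cD[OF f] and G = C1cD[OF g]
 show "continuous_on UNIV (%z. a *\<^sub>R f z + b *\<^sub>R g z)" by (intro continuous_intros F(1) G(1))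
 show "continuous_on UNIV (%z. a *\<^sub>R fx z + b *\<^sub>R gx z)" by (intro continuous_intros F(2) G(2))
 show "continuous_on UNIV (%z. a *\<^sub>R fy z + b *\<^sub>R gy z)" by (intro continuous_intros F(3) G(3))
 show "xsupp (%z. a *\<^sub>R f z + b *\<^sub>R g z)" by (rule xsupp_map2[OF F(4) G(4)]) simp
 show "xsupp (%z. a *\<^sub>R fx z + b *\<^sub>R gx z)" by (rule xsupp_map2[OF F(5) G(5)]) simp
 show "xsupp (%z. a *\<^sub>R fy z + b *\<^sub>R gy z)" by (rule xsupp_map2[OF F(6) G(6)]) simp
 fix x y
 show "((%s. a *\<^sub>R f (s, y) + b *\<^sub>R g (s, y)) has_vector_derivative a *\<^sub>R fx (x, y) + b *\<^sub>R gx (x, y)) (at x)"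
  by (intro has_vector_derivative_add bounded_linear.has_vector_derivative[OF bounded_linear_scaleR_right] F(7) G(7))
 show "((%s. a *\<^sub>R f (x, s) + b *\<^sub>R g (x, s)) has_vector_derivative a *\<^sub>R fy (x, y) + b *\<^sub>R gy (x, y)) (at y)"
  by (intro has_vector_derivative_add bounded_linear.has_vector_derivative[OF bounded_linear_scaleR_right] F(8) G(8))
qed

lemma C1c_diff:
 assumes "C1c f fx fy" "C1c g gx gy"
 shows "C1c (%z. f z - g z) (%z. fx z - gx z) (%z. fy z - gy z)"
 using C1c_lin[OF assms, of 1 "-1"] by simp

lemma C1c_scale:
 assumes "C1c f fx fy"
 shows "C1c (%z. a *\<^sub>R f z) (%z. a *\<^sub>R fx z) (%z. a *\<^sub>R fy z)"
 using C1c_lin[OF assms assms, of a 0] by simp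

lemma C1c_of_real:
 fixes f :: "plane => real"
 assumes f: "C1c f fx fy"
 shows "C1c (%z. complex_of_real (f z)) (%z. complex_of_real (fx z)) (%z. complex_of_real (fy z))"
 unfolding C1c_def
proof (intro conjI allI)
 note F = C1cD[OF f]
 show "continuous_on UNIV (%z. complex_of_real (f z))" by (intro continuous_intros F(1))
 show "continuous_on UNIV (%z. complex_of_real (fx z))" by (intro continuous_intros F(2))
 show "continuous_on UNIV (%z. complex_of_real (fy z))" by (intro continuous_intros F(3))
 show "xsupp (%z. complex_of_real (f z))" by (rule xsupp_map[OF F(4)]) simp
 show "xsupp (%z. complex_of_real (fx z))" by (rule xsupp_map[OF F(5)]) simp
 show "xsupp (%z. complex_of_real (fy z))" by (rule xsupp_map[OF F(6)]) simp
 fix x y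
 show "((%s. complex_of_real (f (s, y))) has_vector_derivative complex_of_real (fx (x, y))) (at x)"
  by (rule bounded_linear.has_vector_derivative[OF bounded_linear_of_real F(7)])
 show "((%s. complex_of_real (f (x, s))) has_vector_derivative complex_of_real (fy (x, y))) (at y)"
  by (rule bounded_linear.has_vector_derivative[OF bounded_linear_of_real F(8)])
qed

context strip_width
begin

lemma C1c_sqi:
 fixes f :: "plane => 'b::euclidean_space"
 assumes "C1c f fx fy"
 shows "f \<in> sqi (SL L)" "fx \<in> sqi (SL L)" "fy \<in> sqi (SL L)"
 by (intro sqi_SL_continuous C1cD[OF assms])+

lemma C1c_slice_sqi:
 fixes f :: "plane => 'b::euclidean_space"
 assumes "C1c f fx fy"
 shows "(%y. f (x, y)) \<in> sqi (Ival 0 L)"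
 by (rule sqi_Ival_continuous[OF continuous_slice_y[OF C1cD(1)[OF assms]]])

lemma trace_le:
 fixes f :: "plane => 'b::euclidean_space"
 assumes "C1c f fx fy"
 shows "(l2 (Ival 0 L) (%y. f (x, y)))^2 <= 2 * (l2 (SL L) f * l2 (SL L) fx)"
 unfolding l2_sq[of "Ival 0 L"] by (rule slice_bound[OF assms])

lemma cutoff_tendsto:
 fixes f :: "plane => complex"
 assumes f: "f \<in> sqi (SL L)" and c: "\<And>m. csmooth (c m)" and b: "\<And>m x. \<bar>c m x\<bar> <= C"
  and lim: "\<And>x. \<forall>\<^sub>F m in sequentially. c m x = c'" and C': "\<bar>c'\<bar> <= C"
 shows "(%m. l2 (SL L) (%z. complex_of_real (c m (fst z)) * f z - complex_of_real c' * f z)) \<longlonglongrightarrow> 0"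
proof -
 have [measurable]: "f \<in> borel_measurable (SL L)" "c m \<in> borel_measurable borel" for m using f c by (auto dest: sqiD)
 have "(%m. \<integral>z. (norm (complex_of_real (c m (fst z)) * f z - complex_of_real c' * f z))^2 \<partial>SL L) \<longlonglongrightarrow> (LINT z|SL L. 0)"
 proof (rule integral_dominated_convergence[where w = "%z. (2 * C)^2 * (norm (f z))^2"])
  show "integrable (SL L) (%z. (2 * C)^2 * (norm (f z))^2)" using sqi_integrable[OF f] by simp
  show "AE z in SL L. (%m. (norm (complex_of_real (c m (fst z)) * f z - complex_of_real c' * f z))^2) \<longlonglongrightarrow> 0"
  proof (rule AE_I2)
   fix z
   have "\<forall>\<^sub>F m in sequentially. 0 = (norm (complex_of_real (c m (fst z)) * f z - complex_of_real c' * f z))^2"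
    using lim[of "fst z"] by eventually_elim simp
   then show "(%m. (norm (complex_of_real (c m (fst z)) * f z - complex_of_real c' * f z))^2) \<longlonglongrightarrow> 0"
    by (rule Lim_transform_eventually[OF tendsto_const])
  qed
  show "AE z in SL L. norm ((norm (complex_of_real (c m (fst z)) * f z - complex_of_real c' * f z))^2) <= (2 * C)^2 * (norm (f z))^2" for m
  proof (rule AE_I2)
   fix z
   have "norm (complex_of_real (c m (fst z)) * f z - complex_of_real c' * f z) = \<bar>c m (fst z) - c'\<bar> * norm (f z)"
    by (simp flip: left_diff_distrib of_real_diff add: norm_mult)
   also have "\<dots> <= (2 * C) * norm (f z)" using b[of m "fst z"] C' by (intro mult_right_mono) auto
   finally have "(norm (complex_of_real (c m (fst z)) * f z - complex_of_real c' * f z))^2 <= ((2 * C) * norm (f z))^2"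
    by (intro power_mono) auto
   then show "norm ((norm (complex_of_real (c m (fst z)) * f z - complex_of_real c' * f z))^2) <= (2 * C)^2 * (norm (f z))^2"
    by (simp add: power_mult_distrib)
  qed
 qed auto
 then have "(%m. sqrt (LINT z|SL L. (norm (complex_of_real (c m (fst z)) * f z - complex_of_real c' * f z))^2)) \<longlonglongrightarrow> sqrt (LINT z|SL L. 0)"
  by (rule tendsto_real_sqrt)
 then show ?thesis by (simp add: l2_def)
qed

text \<open>Cutting off before mollifying gives compact support, and the results are smooth on the
  whole plane, as the definition of the trace requires. The mollification index is chosen separately
  for each cutoff radius.\<close>

lemma H1_density:
 assumes u: "u \<in> sqi (SL L)" "g1 \<in> sqi (SL L)" "g2 \<in> sqi (SL L)"
  and w: "has_weak_partial L (1, 0) u g1" "has_weak_partial L (0, 1) u g2"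
 obtains \<psi> :: "nat => plane => complex" where "\<And>n. \<psi> n \<in> Cc_infinity UNIV"
  "(%n. l2 (SL L) (%z. \<psi> n z - u z)) \<longlonglongrightarrow> 0"
  "(%n. l2 (SL L) (%z. frechet_derivative (\<psi> n) (at z) (1, 0) - g1 z)) \<longlonglongrightarrow> 0"
  "(%n. l2 (SL L) (%z. frechet_derivative (\<psi> n) (at z) (0, 1) - g2 z)) \<longlonglongrightarrow> 0"
proof -
 obtain C where C: "0 <= C" "\<And>R x. \<bar>deriv (cutoff R) x\<bar> <= C" "\<And>R x. \<bar>x\<bar> < R ==> deriv (cutoff R) x = 0"
  using deriv_cutoff_bound by metis
 define c where "c m = cutoff (real m)" for m
 have cs: "csmooth (c m)" for m by (simp add: c_def cutoff_csmooth)
 have cs': "csmooth (deriv (c m))" for m by (rule csmooth_deriv[OF cs])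
 have lim1: "\<forall>\<^sub>F m in sequentially. c m x = 1" for x
 proof -
  obtain m0 :: nat where m0: "\<bar>x\<bar> <= real m0" using real_arch_simple by blast
  show ?thesis
   using eventually_ge_at_top[of m0] by eventually_elim (use m0 in \<open>auto simp: c_def intro!: cutoff_one\<close>)
 qed
 have lim2: "\<forall>\<^sub>F m in sequentially. deriv (c m) x = 0" for x
 proof -
  obtain m0 :: nat where m0: "\<bar>x\<bar> < real m0" using reals_Archimedean2 by blast
  show ?thesis
   using eventually_ge_at_top[of m0] by eventually_elim (use m0 in \<open>auto simp: c_def intro!: C(3)\<close>)
 qed
 have b1: "\<bar>c m x\<bar> <= 1" for m x using cutoff_bounds by (simp add: c_def)
 have b2: "\<bar>deriv (c m) x\<bar> <= C" for m x using C(2) by (simp add: c_def)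
 define v where "v m z = complex_of_real (c m (fst z)) * u z" for m z
 define w0 where "w0 m z = complex_of_real (deriv (c m) (fst z)) * u z" for m z
 define w1' where "w1' m z = complex_of_real (c m (fst z)) * g1 z" for m z
 define w1 where "w1 m z = w0 m z + w1' m z" for m z
 define w2 where "w2 m z = complex_of_real (c m (fst z)) * g2 z" for m z
 have s: "v m \<in> sqi (SL L)" "w0 m \<in> sqi (SL L)" "w1' m \<in> sqi (SL L)" "w2 m \<in> sqi (SL L)" for m
  unfolding v_def w0_def w1'_def w2_def by (intro cutoff_sqi u cs cs')+
 have s1: "w1 m \<in> sqi (SL L)" for m unfolding w1_def by (intro sqi_add s)
 have lv: "(%m. l2 (SL L) (%z. v m z - u z)) \<longlonglongrightarrow> 0"
  using cutoff_tendsto[OF u(1) cs b1 lim1] by (simp add: v_def)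
 have lw2: "(%m. l2 (SL L) (%z. w2 m z - g2 z)) \<longlonglongrightarrow> 0"
  using cutoff_tendsto[OF u(3) cs b1 lim1] by (simp add: w2_def)
 have lw1': "(%m. l2 (SL L) (%z. w1' m z - g1 z)) \<longlonglongrightarrow> 0"
  using cutoff_tendsto[OF u(2) cs b1 lim1] by (simp add: w1'_def)
 have lw0: "(%m. l2 (SL L) (w0 m)) \<longlonglongrightarrow> 0"
  using cutoff_tendsto[OF u(1) cs' b2 lim2] C(1) by (simp add: w0_def[abs_def])
 have lw1: "(%m. l2 (SL L) (%z. w1 m z - g1 z)) \<longlonglongrightarrow> 0"
 proof (rule Lim_null_comparison)
  have "l2 (SL L) (%z. w1 m z - g1 z) <= l2 (SL L) (w0 m) + l2 (SL L) (%z. w1' m z - g1 z)" for m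
   using l2_triangle[OF s(2)[of m] sqi_diff[OF s(3)[of m] u(2)]] by (simp add: w1_def add_diff_eq)
  then show "\<forall>\<^sub>F m in sequentially. norm (l2 (SL L) (%z. w1 m z - g1 z)) <= l2 (SL L) (w0 m) + l2 (SL L) (%z. w1' m z - g1 z)"
   by (intro always_eventually) simp
  show "(%m. l2 (SL L) (w0 m) + l2 (SL L) (%z. w1' m z - g1 z)) \<longlonglongrightarrow> 0"
   using tendsto_add[OF lw0 lw1'] by simp
 qed
 \<comment> \<open>By the chain rule the contraction puts a factor \<open>aa n\<close> on the
   y-derivative; it tends to 1.\<close>
 have la: "(%n. l2 (SL L) (%z. complex_of_real (aa n) * TT n f z - f z)) \<longlonglongrightarrow> 0" if f: "f \<in> sqi (SL L)" for f
 proof (rule Lim_null_comparison)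
  have "l2 (SL L) (%z. complex_of_real (aa n) * TT n f z - f z) <= l2 (SL L) (%z. TT n f z - f z) + \<bar>1 - aa n\<bar> * l2 (SL L) f" for n
  proof -
   have e: "(%z. complex_of_real (aa n) * TT n f z - f z) = (%z. aa n *\<^sub>R (TT n f z - f z) + (aa n - 1) *\<^sub>R f z)"
    by (auto simp: fun_eq_iff scaleR_conv_of_real algebra_simps)
   have "l2 (SL L) (%z. complex_of_real (aa n) * TT n f z - f z) <= l2 (SL L) (%z. aa n *\<^sub>R (TT n f z - f z)) + l2 (SL L) (%z. (aa n - 1) *\<^sub>R f z)"
    unfolding e by (intro l2_triangle sqi_scale sqi_diff TT_L2 f)
   also have "\<dots> = aa n * l2 (SL L) (%z. TT n f z - f z) + \<bar>1 - aa n\<bar> * l2 (SL L) f"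
    unfolding l2_scale using aa_pos[of n] by (simp add: abs_minus_commute)
   also have "aa n * l2 (SL L) (%z. TT n f z - f z) <= 1 * l2 (SL L) (%z. TT n f z - f z)"
    using aa_bounds[of n] by (intro mult_right_mono) auto
   finally show ?thesis by simp
  qed
  then show "\<forall>\<^sub>F n in sequentially. norm (l2 (SL L) (%z. complex_of_real (aa n) * TT n f z - f z)) <= l2 (SL L) (%z. TT n f z - f z) + \<bar>1 - aa n\<bar> * l2 (SL L) f"
   by (intro always_eventually) simp
  have "(%n. \<bar>1 - aa n\<bar>) \<longlonglongrightarrow> \<bar>4 * 0 / L\<bar>"
  proof -
   have "(%n. \<bar>4 * rr n / L\<bar>) \<longlonglongrightarrow> \<bar>4 * 0 / L\<bar>" using L by (intro tendsto_intros rr_tendsto) simp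
   then show ?thesis by (simp add: aa_def)
  qed
  then have "(%n. l2 (SL L) (%z. TT n f z - f z) + \<bar>1 - aa n\<bar> * l2 (SL L) f) \<longlonglongrightarrow> 0 + \<bar>4 * 0 / L\<bar> * l2 (SL L) f"
   by (intro tendsto_add[OF TT_tendsto[OF f] tendsto_mult[OF _ tendsto_const]])
  then show "(%n. l2 (SL L) (%z. TT n f z - f z) + \<bar>1 - aa n\<bar> * l2 (SL L) f) \<longlonglongrightarrow> 0" by simp
 qed
 define Pr where "Pr m n \<longleftrightarrow> l2 (SL L) (%z. TT n (v m) z - v m z) < 1 / (real m + 1) \<and> l2 (SL L) (%z. TT n (w1 m) z - w1 m z) < 1 / (real m + 1)
   \<and> l2 (SL L) (%z. complex_of_real (aa n) * TT n (w2 m) z - w2 m z) < 1 / (real m + 1)" for m n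
 have "\<exists>n. Pr m n" for m
 proof (rule eventually_happens'[OF sequentially_bot])
  have p: "0 < 1 / (real m + 1)" by simp
  show "\<forall>\<^sub>F n in sequentially. Pr m n"
   unfolding Pr_def
   by (intro eventually_conj order_tendstoD(2)[OF TT_tendsto[OF s(1)] p] order_tendstoD(2)[OF TT_tendsto[OF s1] p] order_tendstoD(2)[OF la[OF s(4)] p])
 qed
 then obtain N where Pr: "\<And>m. Pr m (N m)" by metis
 have N: "\<And>m. l2 (SL L) (%z. TT (N m) (v m) z - v m z) < 1 / (real m + 1)"
  "\<And>m. l2 (SL L) (%z. TT (N m) (w1 m) z - w1 m z) < 1 / (real m + 1)"
  "\<And>m. l2 (SL L) (%z. complex_of_real (aa (N m)) * TT (N m) (w2 m) z - w2 m z) < 1 / (real m + 1)"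
  using Pr unfolding Pr_def by blast+
 define \<psi> where "\<psi> m = TT (N m) (v m)" for m
 have inv0: "(%m. 1 / (real m + 1)) \<longlonglongrightarrow> 0"
  using LIMSEQ_ignore_initial_segment[OF lim_1_over_n, of 1] by (simp add: add.commute)
 have comb: "(%m. l2 (SL L) (%z. f m z - h z)) \<longlonglongrightarrow> 0"
  if "\<And>m. f m \<in> sqi (SL L)" "\<And>m. k m \<in> sqi (SL L)" "h \<in> sqi (SL L)" "\<And>m. l2 (SL L) (%z. f m z - k m z) < 1 / (real m + 1)"
   "(%m. l2 (SL L) (%z. k m z - h z)) \<longlonglongrightarrow> 0" for f k :: "nat => plane => complex" and h
 proof (rule Lim_null_comparison)
  have "l2 (SL L) (%z. f m z - h z) <= 1 / (real m + 1) + l2 (SL L) (%z. k m z - h z)" for m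
   using l2_triangle_diff[OF that(1)[of m] that(2)[of m] that(3)] that(4)[of m] by simp
  then show "\<forall>\<^sub>F m in sequentially. norm (l2 (SL L) (%z. f m z - h z)) <= 1 / (real m + 1) + l2 (SL L) (%z. k m z - h z)"
   by (intro always_eventually) simp
  show "(%m. 1 / (real m + 1) + l2 (SL L) (%z. k m z - h z)) \<longlonglongrightarrow> 0"
   using tendsto_add[OF inv0 that(5)] by simp
 qed
 have \<psi>e: "\<psi> m = TT (N m) (%z. complex_of_real (c m (fst z)) * u z)" for m by (simp add: \<psi>_def v_def[abs_def])
 note mp = moll_partial[OF u w cs] and mc = moll_Cc[OF u(1) cs]
 have cong: "l2 (SL L) f = l2 (SL L) h" if "\<And>z. z \<in> strip L ==> f z = h z" for f h :: "plane => complex"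
  unfolding l2_def using that by (intro arg_cong[where f = sqrt] Bochner_Integration.integral_cong) auto
 show ?thesis
 proof (rule that[of \<psi>])
  show "\<psi> m \<in> Cc_infinity UNIV" for m unfolding \<psi>e by (rule mc(1))
  show "(%m. l2 (SL L) (%z. \<psi> m z - u z)) \<longlonglongrightarrow> 0"
   unfolding \<psi>_def by (rule comb[OF TT_L2(1)[OF s(1)] s(1) u(1) N(1) lv])
  have "(%m. l2 (SL L) (%z. TT (N m) (w1 m) z - g1 z)) \<longlonglongrightarrow> 0"
   by (rule comb[OF TT_L2(1)[OF s1] s1 u(2) N(2) lw1])
  moreover have "l2 (SL L) (%z. frechet_derivative (\<psi> m) (at z) (1, 0) - g1 z) = l2 (SL L) (%z. TT (N m) (w1 m) z - g1 z)" for m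
   by (rule cong) (simp add: \<psi>e mc(2) mp(1) w1_def[abs_def] w0_def w1'_def)
  ultimately show "(%m. l2 (SL L) (%z. frechet_derivative (\<psi> m) (at z) (1, 0) - g1 z)) \<longlonglongrightarrow> 0" by simp
  have "(%m. l2 (SL L) (%z. complex_of_real (aa (N m)) * TT (N m) (w2 m) z - g2 z)) \<longlonglongrightarrow> 0"
  proof (rule comb[OF _ s(4) u(3) N(3) lw2])
   show "(%z. complex_of_real (aa (N m)) * TT (N m) (w2 m) z) \<in> sqi (SL L)" for m
    using sqi_scale[OF TT_L2(1)[OF s(4)], of "aa (N m)"] by (simp add: scaleR_conv_of_real)
  qed
  moreover have "l2 (SL L) (%z. frechet_derivative (\<psi> m) (at z) (0, 1) - g2 z) = l2 (SL L) (%z. complex_of_real (aa (N m)) * TT (N m) (w2 m) z - g2 z)" for m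
   by (rule cong) (simp add: \<psi>e mc(3) mp(2) w2_def[abs_def])
  ultimately show "(%m. l2 (SL L) (%z. frechet_derivative (\<psi> m) (at z) (0, 1) - g2 z)) \<longlonglongrightarrow> 0" by simp
 qed
qed

section \<open>Approximation by C^1 functions and traces\<close>

text \<open>One sequence approximates the function, both derivatives and the trace, so estimates
  relating them survive the limit. Gradient and trace are arguments, not \<open>wdx\<close>,
  \<open>wdy\<close> and \<open>trace0\<close>, so that explicit representatives can be
  used.\<close>

definition approx ::
  "(plane => complex) => (plane => complex) => (plane => complex) => (real => complex) =>
  (nat => plane => complex) => (nat => plane => complex) => (nat => plane => complex) => bool" where
 "approx u g1 g2 t f fx fy \<longleftrightarrow>
  u \<in> sqi (SL L) \<and> g1 \<in> sqi (SL L) \<and> g2 \<in> sqi (SL L) \<and> t \<in> sqi (Ival 0 L) \<and>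
  (\<forall>n. C1c (f n) (fx n) (fy n)) \<and>
  (%n. l2 (SL L) (%z. f n z - u z)) \<longlonglongrightarrow> 0 \<and> (%n. l2 (SL L) (%z. fx n z - g1 z)) \<longlonglongrightarrow> 0 \<and>
  (%n. l2 (SL L) (%z. fy n z - g2 z)) \<longlonglongrightarrow> 0 \<and> (%n. l2 (Ival 0 L) (%y. f n (0, y) - t y)) \<longlonglongrightarrow> 0"

lemma approxD:
 assumes "approx u g1 g2 t f fx fy"
 shows "u \<in> sqi (SL L)" "g1 \<in> sqi (SL L)" "g2 \<in> sqi (SL L)" "t \<in> sqi (Ival 0 L)" "C1c (f n) (fx n) (fy n)"
  "(%n. l2 (SL L) (%z. f n z - u z)) \<longlonglongrightarrow> 0" "(%n. l2 (SL L) (%z. fx n z - g1 z)) \<longlonglongrightarrow> 0"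
  "(%n. l2 (SL L) (%z. fy n z - g2 z)) \<longlonglongrightarrow> 0" "(%n. l2 (Ival 0 L) (%y. f n (0, y) - t y)) \<longlonglongrightarrow> 0"
 using assms by (auto simp: approx_def)

lemma diff_tendsto_zero:
 fixes f k :: "nat => 'c => complex"
 assumes "\<And>n. f n \<in> sqi M" "\<And>n. k n \<in> sqi M" "h \<in> sqi M"
  "(%n. l2 M (%z. f n z - h z)) \<longlonglongrightarrow> 0" "(%n. l2 M (%z. k n z - h z)) \<longlonglongrightarrow> 0"
 shows "(%n. l2 M (%z. f n z - k n z)) \<longlonglongrightarrow> 0"
proof (rule Lim_null_comparison)
 have "l2 M (%z. f n z - k n z) <= l2 M (%z. f n z - h z) + l2 M (%z. k n z - h z)" for n
  using l2_triangle_diff[OF assms(1)[of n] assms(3) assms(2)[of n]] l2_minus_commute[of M h "k n"] by simp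
 then show "\<forall>\<^sub>F n in sequentially. norm (l2 M (%z. f n z - k n z)) <= l2 M (%z. f n z - h z) + l2 M (%z. k n z - h z)"
  by (intro always_eventually) simp
 show "(%n. l2 M (%z. f n z - h z) + l2 M (%z. k n z - h z)) \<longlonglongrightarrow> 0"
  using tendsto_add[OF assms(4,5)] by simp
qed

lemma trace_diff_tendsto:
 fixes f k :: "nat => plane => complex"
 assumes f: "\<And>n. C1c (f n) (fx n) (fy n)" and k: "\<And>n. C1c (k n) (kx n) (ky n)"
  and 0: "(%n. l2 (SL L) (%z. f n z - k n z)) \<longlonglongrightarrow> 0" "(%n. l2 (SL L) (%z. fx n z - kx n z)) \<longlonglongrightarrow> 0"
 shows "(%n. l2 (Ival 0 L) (%y. f n (0, y) - k n (0, y))) \<longlonglongrightarrow> 0"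
proof -
 have "(%n. (l2 (Ival 0 L) (%y. f n (0, y) - k n (0, y)))^2) \<longlonglongrightarrow> 0"
 proof (rule Lim_null_comparison)
  show "\<forall>\<^sub>F n in sequentially. norm ((l2 (Ival 0 L) (%y. f n (0, y) - k n (0, y)))^2)
   <= 2 * (l2 (SL L) (%z. f n z - k n z) * l2 (SL L) (%z. fx n z - kx n z))"
   using trace_le[OF C1c_diff[OF f k]] by (intro always_eventually) simp
  show "(%n. 2 * (l2 (SL L) (%z. f n z - k n z) * l2 (SL L) (%z. fx n z - kx n z))) \<longlonglongrightarrow> 0"
   using tendsto_mult[OF tendsto_const tendsto_mult[OF 0], of 2] by simp
 qed
 from tendsto_real_sqrt[OF this] show ?thesis by simp
qed

text \<open>By the trace inequality, convergence of the functions and of their x-derivatives makes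
  the restrictions Cauchy.\<close>

lemma trace_exists:
 fixes f :: "nat => plane => complex"
 assumes u: "u \<in> sqi (SL L)" "g1 \<in> sqi (SL L)" and f: "\<And>n. C1c (f n) (fx n) (fy n)"
  and 0: "(%n. l2 (SL L) (%z. f n z - u z)) \<longlonglongrightarrow> 0" "(%n. l2 (SL L) (%z. fx n z - g1 z)) \<longlonglongrightarrow> 0"
 obtains t where "t \<in> sqi (Ival 0 L)" "(%n. l2 (Ival 0 L) (%y. f n (0, y) - t y)) \<longlonglongrightarrow> 0"
proof (rule L2_complete[of "%n y. f n (0, y)" "Ival 0 L"])
 show "(%y. f n (0, y)) \<in> sqi (Ival 0 L)" for n by (rule C1c_slice_sqi[OF f])
 fix e :: real assume e: "0 < e"
 \<comment> \<open>With both differences at most \<open>2 * d\<close> the trace inequality gives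
   \<open>8 * d^2 = e^2 / 2\<close>.\<close>
 define d where "d = e / 4"
 have d: "0 < d" using e by (simp add: d_def)
 have "\<forall>\<^sub>F n in sequentially. l2 (SL L) (%z. f n z - u z) < d \<and> l2 (SL L) (%z. fx n z - g1 z) < d"
  by (intro eventually_conj order_tendstoD(2)[OF 0(1) d] order_tendstoD(2)[OF 0(2) d])
 then obtain N where N: "\<And>n. n \<ge> N ==> l2 (SL L) (%z. f n z - u z) < d" "\<And>n. n \<ge> N ==> l2 (SL L) (%z. fx n z - g1 z) < d"
  by (auto simp: eventually_sequentially)
 show "\<exists>N. \<forall>n\<ge>N. \<forall>k\<ge>N. l2 (Ival 0 L) (%y. f n (0, y) - f k (0, y)) < e"
 proof (intro exI allI impI)
  fix n k assume nk: "N <= n" "N <= k"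
  have a: "l2 (SL L) (%z. f n z - f k z) <= 2 * d"
   using l2_triangle_diff[OF C1c_sqi(1)[OF f] u(1) C1c_sqi(1)[OF f], of n k] N(1)[OF nk(1)] N(1)[OF nk(2)]
    l2_minus_commute[of "SL L" u "f k"] by simp
  have b: "l2 (SL L) (%z. fx n z - fx k z) <= 2 * d"
   using l2_triangle_diff[OF C1c_sqi(2)[OF f] u(2) C1c_sqi(2)[OF f], of n k] N(2)[OF nk(1)] N(2)[OF nk(2)]
    l2_minus_commute[of "SL L" g1 "fx k"] by simp
  have "(l2 (Ival 0 L) (%y. f n (0, y) - f k (0, y)))^2 <= 2 * (l2 (SL L) (%z. f n z - f k z) * l2 (SL L) (%z. fx n z - fx k z))"
   by (rule trace_le[OF C1c_diff[OF f f]])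
  also have "\<dots> <= 2 * ((2 * d) * (2 * d))" using a b d by (intro mult_left_mono mult_mono) auto
  also have "\<dots> < e^2" using e by (simp add: d_def power2_eq_square)
  finally show "l2 (Ival 0 L) (%y. f n (0, y) - f k (0, y)) < e" by (rule power2_less_imp_less) (use e in simp)
 qed
qed (use that in blast)

lemma approx_weak_partial:
 assumes "approx u g1 g2 t f fx fy"
 shows "has_weak_partial L (1, 0) u g1" "has_weak_partial L (0, 1) u g2"
proof -
 note A = approxD[OF assms]
 show "has_weak_partial L (1, 0) u g1"
  by (rule weak_partial_limit[OF C1c_sqi(1)[OF A(5)] A(1,6) C1c_sqi(2)[OF A(5)] A(2,7) C1c_weak_partial(1)[OF A(5)]]) simp
 show "has_weak_partial L (0, 1) u g2"
  by (rule weak_partial_limit[OF C1c_sqi(1)[OF A(5)] A(1,6) C1c_sqi(3)[OF A(5)] A(3,8) C1c_weak_partial(2)[OF A(5)]]) simp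
qed

lemma wd_AE:
 assumes "g \<in> sqi (SL L)"
 shows "has_weak_partial L (1, 0) u g ==> wdx L u \<in> sqi (SL L) \<and> has_weak_partial L (1, 0) u (wdx L u) \<and> (AE z in SL L. wdx L u z = g z)"
  "has_weak_partial L (0, 1) u g ==> wdy L u \<in> sqi (SL L) \<and> has_weak_partial L (0, 1) u (wdy L u) \<and> (AE z in SL L. wdy L u z = g z)"
proof -
 assume w: "has_weak_partial L (1, 0) u g"
 then have "\<exists>g. g \<in> L2 (strip L) \<and> has_weak_partial L (1, 0) u g" using assms by (auto simp: L2_strip)
 from someI_ex[OF this, folded wdx_def] have *: "wdx L u \<in> sqi (SL L)" "has_weak_partial L (1, 0) u (wdx L u)"
  by (auto simp: L2_strip)
 with weak_partial_unique[OF * assms w]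
 show "wdx L u \<in> sqi (SL L) \<and> has_weak_partial L (1, 0) u (wdx L u) \<and> (AE z in SL L. wdx L u z = g z)" by simp
next
 assume w: "has_weak_partial L (0, 1) u g"
 then have "\<exists>g. g \<in> L2 (strip L) \<and> has_weak_partial L (0, 1) u g" using assms by (auto simp: L2_strip)
 from someI_ex[OF this, folded wdy_def] have *: "wdy L u \<in> sqi (SL L)" "has_weak_partial L (0, 1) u (wdy L u)"
  by (auto simp: L2_strip)
 with weak_partial_unique[OF * assms w]
 show "wdy L u \<in> sqi (SL L) \<and> has_weak_partial L (0, 1) u (wdy L u) \<and> (AE z in SL L. wdy L u z = g z)" by simp
qed

lemma mass_l2: "mass L u = (l2 (SL L) u)^2"
 by (simp add: mass_def set_integral_strip l2_sq)

lemma grad_norm_sq_eq: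
 assumes g: "g1 \<in> sqi (SL L)" "g2 \<in> sqi (SL L)"
  and w: "has_weak_partial L (1, 0) u g1" "has_weak_partial L (0, 1) u g2"
 shows "grad_norm_sq L u = (l2 (SL L) g1)^2 + (l2 (SL L) g2)^2"
proof -
 note X = wd_AE(1)[OF g(1) w(1)] and Y = wd_AE(2)[OF g(2) w(2)]
 have "grad_norm_sq L u = (LINT z|SL L. (norm (wdx L u z))^2) + (LINT z|SL L. (norm (wdy L u z))^2)"
  unfolding grad_norm_sq_def set_integral_strip
  by (rule Bochner_Integration.integral_add) (use X Y in \<open>auto intro: sqi_integrable\<close>)
 also have "\<dots> = (l2 (SL L) (wdx L u))^2 + (l2 (SL L) (wdy L u))^2" by (simp add: l2_sq)
 also have "l2 (SL L) (wdx L u) = l2 (SL L) g1" using X g by (intro l2_cong_AE) (auto dest: sqiD)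
 also have "l2 (SL L) (wdy L u) = l2 (SL L) g2" using Y g by (intro l2_cong_AE) (auto dest: sqiD)
 finally show ?thesis .
qed

lemma H1_norm_eq:
 assumes "g1 \<in> sqi (SL L)" "g2 \<in> sqi (SL L)"
  and "has_weak_partial L (1, 0) u g1" "has_weak_partial L (0, 1) u g2"
 shows "H1_norm L u = sqrt ((l2 (SL L) u)^2 + ((l2 (SL L) g1)^2 + (l2 (SL L) g2)^2))"
 by (simp add: H1_norm_def mass_l2 grad_norm_sq_eq[OF assms])

lemma H1_norm_diff:
 assumes A: "approx u g1 g2 t f fx fy" and \<psi>: "\<psi> \<in> Cc_infinity UNIV"
 shows "H1_norm L (%z. \<psi> z - u z) = sqrt ((l2 (SL L) (%z. \<psi> z - u z))^2 +
  ((l2 (SL L) (%z. frechet_derivative \<psi> (at z) (1, 0) - g1 z))^2 + (l2 (SL L) (%z. frechet_derivative \<psi> (at z) (0, 1) - g2 z))^2))"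
proof -
 note D = approxD[OF A] and W = approx_weak_partial[OF A] and C = Cc_infinity_C1c[OF \<psi>]
 show ?thesis
  by (rule H1_norm_eq[OF sqi_diff[OF C1c_sqi(2)[OF C] D(2)] sqi_diff[OF C1c_sqi(3)[OF C] D(3)]
     weak_partial_diff[OF C1c_weak_partial(1)[OF C] W(1) C1c_sqi(1)[OF C] D(1) C1c_sqi(2)[OF C] D(2)]
     weak_partial_diff[OF C1c_weak_partial(2)[OF C] W(2) C1c_sqi(1)[OF C] D(1) C1c_sqi(3)[OF C] D(3)]]) simp_all
qed

text \<open>Makes the choice in \<open>trace0\<close> harmless. Sequences with the same limit in
  \<open>H^1\<close> have restrictions that come together, so the trace is unique almost everywhere;
  density supplies the test functions that the definition asks for.\<close>

lemma has_trace_iff: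
 assumes A: "approx u g1 g2 t f fx fy"
 shows "has_trace L u s \<longleftrightarrow> s \<in> sqi (Ival 0 L) \<and> (AE y in Ival 0 L. s y = t y)"
proof
 note D = approxD[OF A] and W = approx_weak_partial[OF A]
 assume "has_trace L u s"
 then obtain \<psi> :: "nat => plane => complex" where s: "s \<in> sqi (Ival 0 L)" and \<psi>: "\<And>n. \<psi> n \<in> Cc_infinity UNIV"
  and H: "(%n. H1_norm L (%z. \<psi> n z - u z)) \<longlonglongrightarrow> 0"
  and T: "(%n. LINT y:{0..L}|lborel. (cmod (\<psi> n (0, y) - s y))^2) \<longlonglongrightarrow> 0"
  by (auto simp: has_trace_def L2_Ival)
 note C = Cc_infinity_C1c[OF \<psi>]
 have a: "(%n. l2 (SL L) (%z. \<psi> n z - u z)) \<longlonglongrightarrow> 0"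
  by (rule Lim_null_comparison[OF always_eventually H]) (auto simp: H1_norm_diff[OF A \<psi>] intro!: real_le_rsqrt)
 have b: "(%n. l2 (SL L) (%z. frechet_derivative (\<psi> n) (at z) (1, 0) - g1 z)) \<longlonglongrightarrow> 0"
  by (rule Lim_null_comparison[OF always_eventually H]) (auto simp: H1_norm_diff[OF A \<psi>] intro!: real_le_rsqrt)
 have c: "(%n. l2 (Ival 0 L) (%y. \<psi> n (0, y) - f n (0, y))) \<longlonglongrightarrow> 0"
  by (rule trace_diff_tendsto[OF C D(5) diff_tendsto_zero[OF C1c_sqi(1)[OF C] C1c_sqi(1)[OF D(5)] D(1) a D(6)]
     diff_tendsto_zero[OF C1c_sqi(2)[OF C] C1c_sqi(2)[OF D(5)] D(2) b D(7)]])
 have d: "(%n. l2 (Ival 0 L) (%y. \<psi> n (0, y) - s y)) \<longlonglongrightarrow> 0"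
  using tendsto_real_sqrt[OF T] by (simp add: l2_def set_integral_Ival)
 have "(%n. l2 (Ival 0 L) (%y. \<psi> n (0, y) - s y) + l2 (Ival 0 L) (%y. \<psi> n (0, y) - f n (0, y)) + l2 (Ival 0 L) (%y. f n (0, y) - t y)) \<longlonglongrightarrow> 0 + 0 + 0"
  by (intro tendsto_add d c D(9))
 moreover have "l2 (Ival 0 L) (%y. s y - t y) <= l2 (Ival 0 L) (%y. \<psi> n (0, y) - s y) + l2 (Ival 0 L) (%y. \<psi> n (0, y) - f n (0, y)) + l2 (Ival 0 L) (%y. f n (0, y) - t y)" for n
  using l2_triangle_diff[OF s C1c_slice_sqi[OF C, of n 0] D(4)] l2_triangle_diff[OF C1c_slice_sqi[OF C, of n 0] C1c_slice_sqi[OF D(5), of n 0] D(4)]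
   l2_minus_commute[of "Ival 0 L" s "%y. \<psi> n (0, y)"] by simp
 ultimately have "l2 (Ival 0 L) (%y. s y - t y) <= 0" by (intro LIMSEQ_le_const) auto
 then have "l2 (Ival 0 L) (%y. s y - t y) = 0" using l2_nonneg[of "Ival 0 L" "%y. s y - t y"] by linarith
 then have "AE y in Ival 0 L. s y - t y = 0" using l2_eq_0_iff[OF sqi_diff[OF s D(4)]] by simp
 then show "s \<in> sqi (Ival 0 L) \<and> (AE y in Ival 0 L. s y = t y)" using s by auto
next
 note D = approxD[OF A] and W = approx_weak_partial[OF A]
 assume s: "s \<in> sqi (Ival 0 L) \<and> (AE y in Ival 0 L. s y = t y)"
 obtain \<psi> :: "nat => plane => complex" where \<psi>: "\<And>n. \<psi> n \<in> Cc_infinity UNIV"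
  "(%n. l2 (SL L) (%z. \<psi> n z - u z)) \<longlonglongrightarrow> 0"
  "(%n. l2 (SL L) (%z. frechet_derivative (\<psi> n) (at z) (1, 0) - g1 z)) \<longlonglongrightarrow> 0"
  "(%n. l2 (SL L) (%z. frechet_derivative (\<psi> n) (at z) (0, 1) - g2 z)) \<longlonglongrightarrow> 0"
  using H1_density[OF D(1-3) W] by blast
 note C = Cc_infinity_C1c[OF \<psi>(1)]
 have "(%n. sqrt ((l2 (SL L) (%z. \<psi> n z - u z))^2 +
  ((l2 (SL L) (%z. frechet_derivative (\<psi> n) (at z) (1, 0) - g1 z))^2 + (l2 (SL L) (%z. frechet_derivative (\<psi> n) (at z) (0, 1) - g2 z))^2))) \<longlonglongrightarrow> sqrt (0^2 + (0^2 + 0^2))"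
  by (intro tendsto_intros \<psi>)
 then have H: "(%n. H1_norm L (%z. \<psi> n z - u z)) \<longlonglongrightarrow> 0" by (simp add: H1_norm_diff[OF A \<psi>(1)])
 have c: "(%n. l2 (Ival 0 L) (%y. \<psi> n (0, y) - f n (0, y))) \<longlonglongrightarrow> 0"
  by (rule trace_diff_tendsto[OF C D(5) diff_tendsto_zero[OF C1c_sqi(1)[OF C] C1c_sqi(1)[OF D(5)] D(1) \<psi>(2) D(6)]
     diff_tendsto_zero[OF C1c_sqi(2)[OF C] C1c_sqi(2)[OF D(5)] D(2) \<psi>(3) D(7)]])
 have "(%n. (l2 (Ival 0 L) (%y. \<psi> n (0, y) - s y))^2) \<longlonglongrightarrow> 0"
 proof (rule Lim_null_comparison)
  have st: "l2 (Ival 0 L) (%y. f n (0, y) - s y) = l2 (Ival 0 L) (%y. f n (0, y) - t y)" for n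
   by (rule l2_cong_AE) (use s D(4) C1c_slice_sqi[OF D(5), of n 0] in \<open>auto dest!: sqiD\<close>)
  have "l2 (Ival 0 L) (%y. \<psi> n (0, y) - s y) <= l2 (Ival 0 L) (%y. \<psi> n (0, y) - f n (0, y)) + l2 (Ival 0 L) (%y. f n (0, y) - t y)" for n
   using l2_triangle_diff[OF C1c_slice_sqi[OF C, of n 0] C1c_slice_sqi[OF D(5), of n 0] conjunct1[OF s]] st by simp
  then show "\<forall>\<^sub>F n in sequentially. norm ((l2 (Ival 0 L) (%y. \<psi> n (0, y) - s y))^2)
    <= (l2 (Ival 0 L) (%y. \<psi> n (0, y) - f n (0, y)) + l2 (Ival 0 L) (%y. f n (0, y) - t y))^2"
   by (intro always_eventually) (auto intro: power_mono)
  show "(%n. (l2 (Ival 0 L) (%y. \<psi> n (0, y) - f n (0, y)) + l2 (Ival 0 L) (%y. f n (0, y) - t y))^2) \<longlonglongrightarrow> 0"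
   using tendsto_power[OF tendsto_add[OF c D(9)], of 2] by simp
 qed
 then have "(%n. LINT y:{0..L}|lborel. (cmod (\<psi> n (0, y) - s y))^2) \<longlonglongrightarrow> 0"
  by (simp add: l2_sq set_integral_Ival)
 then show "has_trace L u s"
  unfolding has_trace_def L2_Ival using s \<psi>(1) H by blast
qed

lemma trace0_AE:
 assumes A: "approx u g1 g2 t f fx fy"
 shows "trace0 L u \<in> sqi (Ival 0 L)" "AE y in Ival 0 L. trace0 L u y = t y"
proof -
 have "\<exists>s. has_trace L u s" using has_trace_iff[OF A] approxD(4)[OF A] by (intro exI[of _ t]) simp
 then have "has_trace L u (trace0 L u)" unfolding trace0_def by (rule someI_ex)
 then show "trace0 L u \<in> sqi (Ival 0 L)" "AE y in Ival 0 L. trace0 L u y = t y" using has_trace_iff[OF A] by auto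
qed

lemma approx_H1:
 assumes A: "approx u g1 g2 t f fx fy"
 shows "u \<in> H1 L" "grad_norm_sq L u = (l2 (SL L) g1)^2 + (l2 (SL L) g2)^2"
  "(LINT y:{0..L}|lborel. (cmod (trace0 L u y))^2) = (l2 (Ival 0 L) t)^2"
proof -
 note D = approxD[OF A] and W = approx_weak_partial[OF A]
 show "u \<in> H1 L" unfolding H1_def L2_strip using D W by blast
 show "grad_norm_sq L u = (l2 (SL L) g1)^2 + (l2 (SL L) g2)^2" by (rule grad_norm_sq_eq[OF D(2,3) W])
 have "l2 (Ival 0 L) (trace0 L u) = l2 (Ival 0 L) t"
  by (rule l2_cong_AE) (use trace0_AE[OF A] D(4) in \<open>auto dest: sqiD\<close>)
 then show "(LINT y:{0..L}|lborel. (cmod (trace0 L u y))^2) = (l2 (Ival 0 L) t)^2"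
  by (simp add: set_integral_Ival l2_sq[symmetric])
qed

lemma approx_energy:
 assumes A: "approx u g1 g2 t f fx fy"
 shows "energy L \<gamma> p u = 1 / 2 * ((l2 (SL L) g1)^2 + (l2 (SL L) g2)^2) + \<gamma> / 2 * (l2 (Ival 0 L) t)^2
  - 1 / (p + 1) * (LINT z|SL L. cmod (u z) powr (p + 1))"
 unfolding energy_def approx_H1(2,3)[OF A] set_integral_strip ..

text \<open>The entry from the space of the statement into \<open>approx\<close>. The gradient slots
  hold the chosen representatives, which are those occurring in the weak form.\<close>

lemma H1_approx:
 assumes "u \<in> H1 L"
 obtains t f fx fy where "approx u (wdx L u) (wdy L u) t f fx fy"
proof -
 obtain g1 g2 where g: "u \<in> sqi (SL L)" "g1 \<in> sqi (SL L)" "g2 \<in> sqi (SL L)"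
  "has_weak_partial L (1, 0) u g1" "has_weak_partial L (0, 1) u g2"
  using assms by (auto simp: H1_def L2_strip)
 note X = wd_AE(1)[OF g(2,4)] and Y = wd_AE(2)[OF g(3,5)]
 have X1: "wdx L u \<in> sqi (SL L)" "has_weak_partial L (1, 0) u (wdx L u)" using X by auto
 have Y1: "wdy L u \<in> sqi (SL L)" "has_weak_partial L (0, 1) u (wdy L u)" using Y by auto
 obtain \<psi> :: "nat => plane => complex" where \<psi>: "\<And>n. \<psi> n \<in> Cc_infinity UNIV"
  "(%n. l2 (SL L) (%z. \<psi> n z - u z)) \<longlonglongrightarrow> 0"
  "(%n. l2 (SL L) (%z. frechet_derivative (\<psi> n) (at z) (1, 0) - wdx L u z)) \<longlonglongrightarrow> 0"
  "(%n. l2 (SL L) (%z. frechet_derivative (\<psi> n) (at z) (0, 1) - wdy L u z)) \<longlonglongrightarrow> 0"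
  using H1_density[OF g(1) X1(1) Y1(1) X1(2) Y1(2)] by blast
 note C = Cc_infinity_C1c[OF \<psi>(1)]
 obtain t where t: "t \<in> sqi (Ival 0 L)" "(%n. l2 (Ival 0 L) (%y. \<psi> n (0, y) - t y)) \<longlonglongrightarrow> 0"
  using trace_exists[OF g(1) X1(1) C \<psi>(2,3)] by blast
 have "approx u (wdx L u) (wdy L u) t \<psi> (%n z. frechet_derivative (\<psi> n) (at z) (1, 0)) (%n z. frechet_derivative (\<psi> n) (at z) (0, 1))"
  unfolding approx_def using g X1 Y1 \<psi> C t by blast
 then show ?thesis by (rule that)
qed

lemma approx_lin:
 assumes A: "approx u g1 g2 t f fx fy" and B: "approx v h1 h2 s k kx ky"
 shows "approx (%z. u z + c *\<^sub>R v z) (%z. g1 z + c *\<^sub>R h1 z) (%z. g2 z + c *\<^sub>R h2 z) (%y. t y + c *\<^sub>R s y)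
  (%n z. f n z + c *\<^sub>R k n z) (%n z. fx n z + c *\<^sub>R kx n z) (%n z. fy n z + c *\<^sub>R ky n z)"
proof -
 note D = approxD[OF A] and E = approxD[OF B]
 have lim: "(%n. l2 M (%z. (a n z + c *\<^sub>R b n z) - (a' z + c *\<^sub>R b' z))) \<longlonglongrightarrow> 0"
  if "\<And>n. a n \<in> sqi M" "a' \<in> sqi M" "\<And>n. b n \<in> sqi M" "b' \<in> sqi M"
   "(%n. l2 M (%z. a n z - a' z)) \<longlonglongrightarrow> 0" "(%n. l2 M (%z. b n z - b' z)) \<longlonglongrightarrow> 0"
  for M :: "'x measure" and a b :: "nat => 'x => complex" and a' b'
 proof (rule Lim_null_comparison)
  have "l2 M (%z. (a n z + c *\<^sub>R b n z) - (a' z + c *\<^sub>R b' z)) <= l2 M (%z. a n z - a' z) + \<bar>c\<bar> * l2 M (%z. b n z - b' z)" for n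
   using l2_triangle[OF sqi_diff[OF that(1)[of n] that(2)] sqi_scale[OF sqi_diff[OF that(3)[of n] that(4)], of c]]
   unfolding l2_scale by (simp add: scaleR_diff_right add_diff_add)
  then show "\<forall>\<^sub>F n in sequentially. norm (l2 M (%z. (a n z + c *\<^sub>R b n z) - (a' z + c *\<^sub>R b' z))) <= l2 M (%z. a n z - a' z) + \<bar>c\<bar> * l2 M (%z. b n z - b' z)"
   by (intro always_eventually) simp
  show "(%n. l2 M (%z. a n z - a' z) + \<bar>c\<bar> * l2 M (%z. b n z - b' z)) \<longlonglongrightarrow> 0"
   using tendsto_add[OF that(5) tendsto_mult_right_zero[OF that(6)]] by simp
 qed
 show ?thesis
  unfolding approx_def
 proof (intro conjI allI)
  show "C1c (%z. f n z + c *\<^sub>R k n z) (%z. fx n z + c *\<^sub>R kx n z) (%z. fy n z + c *\<^sub>R ky n z)" for n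
   using C1c_lin[OF D(5)[of n] E(5)[of n], of 1 c] by simp
 qed (intro sqi_add sqi_scale D(1-4) E(1-4) lim C1c_sqi[OF D(5)] C1c_sqi[OF E(5)] C1c_slice_sqi[OF D(5)] C1c_slice_sqi[OF E(5)] D(6-9) E(6-9))+
qed

lemma approx_const:
 assumes "C1c f fx fy"
 shows "approx f fx fy (%y. f (0, y)) (%_. f) (%_. fx) (%_. fy)"
 unfolding approx_def using assms C1c_sqi[OF assms] C1c_slice_sqi[OF assms] by (simp add: l2_def)

text \<open>Lets the minimizer be changed on a null set at the very end, when positivity at every
  point is required.\<close>

lemma approx_cong_AE:
 assumes A: "approx u g1 g2 t f fx fy" and u': "u' \<in> borel_measurable (SL L)" "AE z in SL L. u z = u' z"
 shows "approx u' g1 g2 t f fx fy"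
proof -
 note D = approxD[OF A]
 have 1: "u' \<in> sqi (SL L)" by (rule sqi_dominated(1)[OF D(1) u'(1)]) (use u'(2) in auto)
 have "l2 (SL L) (%z. f n z - u' z) = l2 (SL L) (%z. f n z - u z)" for n
  by (rule l2_cong_AE) (use u' D(1) C1c_sqi(1)[OF D(5), of n] in \<open>auto dest!: sqiD\<close>)
 then show ?thesis using A 1 unfolding approx_def by simp
qed

end

section \<open>The energy on smooth functions\<close>

text \<open>A substitute for the modulus, which is not differentiable at zeros. Subtracting
  \<open>e\<close> preserves the support, and by Cauchy-Schwarz the gradient does not grow.\<close>

lemma smooth_abs:
 fixes f :: "plane => 'b::euclidean_space"
 assumes f: "C1c f fx fy" and e: "0 < e"
 defines "r \<equiv> (%z. sqrt ((norm (f z))^2 + e^2) - e)"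
  and "d \<equiv> (%g z. inner (f z) (g z) / sqrt ((norm (f z))^2 + e^2))"
 shows "C1c r (d fx) (d fy)" "0 <= r z" "r z <= norm (f z)" "norm (f z) - r z <= e" "\<bar>d g z\<bar> <= norm (g z)"
proof -
 note F = C1cD[OF f]
 have pos: "0 < (norm (f z))^2 + e^2" for z using e by (simp add: add_nonneg_pos)
 have s: "norm (f z) <= sqrt ((norm (f z))^2 + e^2)" "e <= sqrt ((norm (f z))^2 + e^2)" for z
  using e by (auto intro!: real_le_rsqrt)
 have s2: "sqrt ((norm (f z))^2 + e^2) <= norm (f z) + e" for z
  using e by (intro real_le_lsqrt) (auto simp: power2_sum)
 show "0 <= r z" "r z <= norm (f z)" "norm (f z) - r z <= e"
  using s[of z] s2[of z] by (auto simp: r_def)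
 show "\<bar>d g z\<bar> <= norm (g z)"
 proof -
  have "\<bar>inner (f z) (g z)\<bar> <= norm (f z) * norm (g z)" by (rule Cauchy_Schwarz_ineq2)
  also have "\<dots> <= sqrt ((norm (f z))^2 + e^2) * norm (g z)" using s(1)[of z] by (intro mult_right_mono) auto
  finally show ?thesis using pos[of z] by (simp add: d_def divide_le_eq mult.commute)
 qed
 have der: "((%s. sqrt ((norm (g s))^2 + e^2) - e) has_vector_derivative inner (g x) g' / sqrt ((norm (g x))^2 + e^2)) (at x)"
  if g: "(g has_vector_derivative g') (at x)" for g :: "real => 'b" and g' x
 proof -
  have 1: "((%s. (norm (g s))^2 + e^2) has_real_derivative 2 * inner (g x) g') (at x)"
  proof -
   have "((%s. inner (g s) (g s)) has_real_derivative 2 * inner (g x) g') (at x)"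
    unfolding DERIV_iff_vec by (rule inner_self_derivative[OF g])
   from DERIV_add[OF this DERIV_const[of "e^2"]] show ?thesis
    unfolding power2_norm_eq_inner add_0_right .
  qed
  have p: "0 < (norm (g x))^2 + e^2" using e by (simp add: add_nonneg_pos)
  have "((%s. sqrt ((norm (g s))^2 + e^2)) has_real_derivative (inverse (sqrt ((norm (g x))^2 + e^2)) / 2) * (2 * inner (g x) g')) (at x)"
   by (rule DERIV_chain2[OF DERIV_real_sqrt[OF p] 1])
  then have "((%s. sqrt ((norm (g s))^2 + e^2) - e) has_real_derivative (inverse (sqrt ((norm (g x))^2 + e^2)) / 2) * (2 * inner (g x) g') - 0) (at x)"
   by (rule DERIV_diff) simp
  then have "((%s. sqrt ((norm (g s))^2 + e^2) - e) has_real_derivative inner (g x) g' / sqrt ((norm (g x))^2 + e^2)) (at x)"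
   by (rule DERIV_cong) (simp add: field_simps)
  then show ?thesis
   unfolding DERIV_iff_vec .
 qed
 show "C1c r (d fx) (d fy)"
  unfolding C1c_def
 proof (intro conjI allI)
  show "continuous_on UNIV r" unfolding r_def by (intro continuous_intros F(1))
  have nz: "sqrt ((norm (f z))^2 + e^2) \<noteq> 0" for z using e by simp
  show "continuous_on UNIV (d fx)" unfolding d_def by (intro continuous_intros F(1,2) ballI nz)
  show "continuous_on UNIV (d fy)" unfolding d_def by (intro continuous_intros F(1,3) ballI nz)
  show "xsupp r" by (rule xsupp_map[OF F(4)]) (use e in \<open>simp add: r_def\<close>)
  show "xsupp (d fx)" "xsupp (d fy)" by (rule xsupp_map[OF F(4)], simp add: d_def)+
  fix x y
  show "((%s. r (s, y)) has_vector_derivative d fx (x, y)) (at x)" unfolding r_def d_def by (rule der[OF F(7)])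
  show "((%s. r (x, s)) has_vector_derivative d fy (x, y)) (at y)" unfolding r_def d_def by (rule der[OF F(8)])
 qed
qed

section \<open>The functionals and coercivity\<close>

locale nls = strip_width +
 fixes \<gamma> p m :: real
 assumes \<gamma>: "\<gamma> < 0" and p: "1 < p" "p < 3" and m: "0 < m"
begin

abbreviation "q \<equiv> p + 1"

definition NN :: "(plane => 'b::euclidean_space) => real" where
 "NN f = (LINT z|SL L. norm (f z) powr q)"

definition MM :: "(plane => 'b::euclidean_space) => real" where
 "MM f = (l2 (SL L) f)^2"

definition tr :: "(plane => 'b::euclidean_space) => real" where
 "tr f = (l2 (Ival 0 L) (%y. f (0, y)))^2"

text \<open>Derivatives are passed explicitly, since trial functions carry theirs along in
  \<open>C1c\<close>.\<close>

definition GG :: "(plane => 'b::euclidean_space) => (plane => 'b) => real" where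
 "GG fx fy = (l2 (SL L) fx)^2 + (l2 (SL L) fy)^2"

definition QQ :: "(plane => 'b::euclidean_space) => (plane => 'b) => (plane => 'b) => real" where
 "QQ f fx fy = 1 / 2 * GG fx fy + \<gamma> / 2 * tr f"

definition FF :: "(plane => 'b::euclidean_space) => (plane => 'b) => (plane => 'b) => real" where
 "FF f fx fy = QQ f fx fy - NN f / q"

lemma q: "2 < q" "q < 4"
 using p by auto

lemma MM_nonneg: "0 <= MM f" and GG_nonneg: "0 <= GG fx fy" and tr_nonneg: "0 <= tr f"
 by (simp_all add: MM_def GG_def tr_def)

lemma NN_nonneg: "0 <= NN f"
 by (simp add: NN_def)

lemma NN_integrable:
 fixes f :: "plane => 'b::euclidean_space"
 assumes "continuous_on UNIV f" "xsupp f"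
 shows "integrable (SL L) (%z. norm (f z) powr q)"
proof (rule integrable_SL_continuous)
 show "continuous_on UNIV (%z. norm (f z) powr q)"
  by (rule continuous_on_powr') (use q in \<open>auto intro!: continuous_intros assms\<close>)
 show "xsupp (%z. norm (f z) powr q)" by (rule xsupp_map[OF assms(2)]) simp
qed

lemma L4_integrable:
 fixes f :: "plane => 'b::euclidean_space"
 assumes "continuous_on UNIV f" "xsupp f"
 shows "integrable (SL L) (%z. norm (f z) ^ 4)"
 by (rule integrable_SL_continuous) (auto intro!: continuous_intros assms(1) intro: xsupp_map[OF assms(2)])

lemma NN_le_L4:
 fixes f :: "plane => 'b::euclidean_space"
 assumes f: "C1c f fx fy" and K: "0 < K"
 shows "NN f <= K powr (q - 2) * MM f + K powr (q - 4) * (LINT z|SL L. norm (f z) ^ 4)"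
proof -
 note F = C1cD[OF f]
 note i = sqi_integrable[OF C1c_sqi(1)[OF f]] and i4 = L4_integrable[OF F(1,4)]
 have "NN f <= (LINT z|SL L. K powr (q - 2) * (norm (f z))^2 + K powr (q - 4) * norm (f z) ^ 4)"
  unfolding NN_def
 proof (rule integral_mono)
  show "norm (f z) powr q <= K powr (q - 2) * (norm (f z))^2 + K powr (q - 4) * norm (f z) ^ 4" for z
   by (rule powr_interpolation) (use K q in auto)
 qed (use NN_integrable[OF F(1,4)] i i4 in auto)
 also have "\<dots> = K powr (q - 2) * MM f + K powr (q - 4) * (LINT z|SL L. norm (f z) ^ 4)"
  using i i4 by (simp add: MM_def l2_sq)
 finally show ?thesis .
qed

lemma L4_le:
 fixes f :: "plane => 'b::euclidean_space"
 assumes f: "C1c f fx fy"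
 shows "(LINT z|SL L. norm (f z) ^ 4) <= (1 / L + 2) * (MM f * (MM f + GG fx fy))"
proof -
 define a b c where "a = l2 (SL L) f" and "b = l2 (SL L) fx" and "c = l2 (SL L) fy"
 have nn: "0 <= a" "0 <= b" "0 <= c" by (auto simp: a_def b_def c_def)
 have "(LINT z|SL L. norm (f z) ^ 4) <= (2 * (a * b)) * (1 / L * a^2 + 2 * (a * c))"
  unfolding a_def b_def c_def by (rule L4_bound[OF f L slice_bound[OF f]])
 also have "\<dots> = 1 / L * (a^2 * (2 * a * b)) + 2 * (a^2 * (2 * b * c))" by (simp add: algebra_simps power2_eq_square)
 also have "\<dots> <= 1 / L * (a^2 * (a^2 + (b^2 + c^2))) + 2 * (a^2 * (a^2 + (b^2 + c^2)))"
 proof (intro add_mono mult_left_mono)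
  show "2 * a * b <= a^2 + (b^2 + c^2)" using sum_squares_bound[of a b] zero_le_power2[of c] by linarith
  show "2 * b * c <= a^2 + (b^2 + c^2)" using sum_squares_bound[of b c] zero_le_power2[of a] by linarith
 qed (use L in auto)
 also have "\<dots> = (1 / L + 2) * (MM f * (MM f + GG fx fy))"
  by (simp add: a_def b_def c_def MM_def GG_def algebra_simps)
 finally show ?thesis .
qed

text \<open>The product in the trace inequality is split with weights that spend only a quarter of
  the gradient.\<close>

lemma tr_le:
 fixes f :: "plane => 'b::euclidean_space"
 assumes f: "C1c f fx fy"
 shows "\<bar>\<gamma>\<bar> * tr f <= 1 / 4 * GG fx fy + 4 * \<gamma>^2 * MM f"
proof -
 define a b where "a = l2 (SL L) f" and "b = l2 (SL L) fx"
 have "\<bar>\<gamma>\<bar> * tr f <= \<bar>\<gamma>\<bar> * (2 * (a * b))"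
  unfolding tr_def a_def b_def by (intro mult_left_mono trace_le[OF f]) auto
 also have "\<dots> = 2 * (2 * \<bar>\<gamma>\<bar> * a) * (b / 2)" by simp
 also have "\<dots> <= (2 * \<bar>\<gamma>\<bar> * a)^2 + (b / 2)^2" by (rule sum_squares_bound)
 also have "\<dots> = 4 * \<gamma>^2 * a^2 + 1 / 4 * b^2" by (simp add: power_mult_distrib power_divide)
 also have "\<dots> <= 1 / 4 * GG fx fy + 4 * \<gamma>^2 * MM f" by (simp add: a_def b_def GG_def MM_def)
 finally show ?thesis .
qed

text \<open>Here \<open>q < 4\<close> is decisive: a large \<open>K\<close> lets the nonlinear term
  cost an eighth of the gradient, the trace costs another eighth, and at least the claimed eighth is
  left.\<close>

lemma coercive:
 obtains C where "\<And>(f :: plane => real) fx fy. C1c f fx fy ==> MM f <= m ==> 1 / 8 * GG fx fy - C <= FF f fx fy"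
proof -
 define C4 where "C4 = 1 / L + 2"
 have C4: "0 < C4" using L by (simp add: C4_def add_pos_pos)
 \<comment> \<open>Chosen so that \<open>K powr (q - 4)\<close> equals
   \<open>1 / (8 * C4 * m)\<close>.\<close>
 define K where "K = (8 * C4 * m) powr (1 / (4 - q))"
 have B: "0 < 8 * C4 * m" by (intro mult_pos_pos C4 m) simp
 have K: "0 < K" using C4 m by (simp add: K_def)
 have "K powr (q - 4) = (8 * C4 * m) powr (- 1)"
 proof -
  have "1 / (4 - q) * (q - 4) = - 1" using q by (simp add: field_simps)
  then show ?thesis by (simp only: K_def powr_powr)
 qed
 then have Kq: "K powr (q - 4) = 1 / (8 * C4 * m)" using B C4 m by (simp add: powr_minus_divide)
 define C where "C = 2 * \<gamma>^2 * m + K powr (q - 2) * m + m"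
 show ?thesis
 proof (rule that[of C])
  fix f :: "plane => real" and fx fy
  assume f: "C1c f fx fy" and M: "MM f <= m"
  let ?G = "GG fx fy"
  have "NN f <= K powr (q - 2) * MM f + K powr (q - 4) * (LINT z|SL L. norm (f z) ^ 4)"
   by (rule NN_le_L4[OF f K])
  also have "\<dots> <= K powr (q - 2) * m + K powr (q - 4) * (C4 * (m * (m + ?G)))"
  proof (intro add_mono mult_left_mono M)
   have "(LINT z|SL L. norm (f z) ^ 4) <= C4 * (MM f * (MM f + ?G))" unfolding C4_def by (rule L4_le[OF f])
   also have "\<dots> <= C4 * (m * (m + ?G))"
    using C4 M MM_nonneg[of f] GG_nonneg[of fx fy] m by (intro mult_left_mono mult_mono) auto
   finally show "(LINT z|SL L. norm (f z) ^ 4) <= C4 * (m * (m + ?G))" .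
  qed auto
  also have "K powr (q - 4) * (C4 * (m * (m + ?G))) = (m + ?G) / 8" unfolding Kq using C4 m by simp
  finally have N: "NN f <= K powr (q - 2) * m + (m + ?G) / 8" .
  have "NN f / q <= NN f / 1" using q NN_nonneg[of f] by (intro divide_left_mono) auto
  then have N': "NN f / q <= K powr (q - 2) * m + (m + ?G) / 8" using N by simp
  have t1: "\<bar>\<gamma>\<bar> * tr f <= 1 / 4 * ?G + 4 * \<gamma>^2 * MM f" by (rule tr_le[OF f])
  have t2: "4 * \<gamma>^2 * MM f <= 4 * \<gamma>^2 * m" using M by (intro mult_left_mono) auto
  have t3: "\<gamma> / 2 * tr f = - (\<bar>\<gamma>\<bar> * tr f) / 2" using \<gamma> by simp
  have "- (1 / 4 * ?G + 4 * \<gamma>^2 * m) / 2 <= \<gamma> / 2 * tr f" unfolding t3 using t1 t2 by simp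
  moreover have "1 / 8 * G - (2 * b + a + c) <= 1 / 2 * G + T - N"
   if "- (1 / 4 * G + 4 * b) / 2 <= T" "N <= a + (c + G) / 8" "0 <= G" "0 <= c" for G T N a b c :: real
   using that by argo
  ultimately have "1 / 8 * ?G - (2 * (\<gamma>^2 * m) + K powr (q - 2) * m + m) <= 1 / 2 * ?G + \<gamma> / 2 * tr f - NN f / q"
   using N' GG_nonneg[of fx fy] m by (simp only: mult.assoc less_imp_le)
  then show "1 / 8 * ?G - C <= FF f fx fy" by (simp only: FF_def QQ_def C_def mult.assoc)
 qed
qed

section \<open>The infimum over smooth functions and its scaling\<close>

definition adm :: "(plane => real) => (plane => real) => (plane => real) => bool" where
 "adm f fx fy \<longleftrightarrow> C1c f fx fy \<and> (\<forall>z. 0 <= f z)"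

text \<open>A real infimum over nonnegative C^1 functions; its agreement with
  \<open>min_energy\<close> follows only once a minimizer exists.\<close>

definition Einf :: real where
 "Einf = Inf {FF f fx fy |f fx fy. adm f fx fy \<and> MM f = m}"

lemma Einf_le: "adm f fx fy ==> MM f = m ==> Einf <= FF f fx fy"
proof -
 assume a: "adm f fx fy" "MM f = m"
 obtain C where C: "\<And>(f :: plane => real) fx fy. C1c f fx fy ==> MM f <= m ==> 1 / 8 * GG fx fy - C <= FF f fx fy"
  using coercive by blast
 show ?thesis
  unfolding Einf_def
 proof (rule cInf_lower)
  show "FF f fx fy \<in> {FF f fx fy |f fx fy. adm f fx fy \<and> MM f = m}" using a by blast
  show "bdd_below {FF f fx fy |f fx fy. adm f fx fy \<and> MM f = m}"
  proof (rule bdd_belowI[of _ "- C"])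
   fix x assume "x \<in> {FF f fx fy |f fx fy. adm f fx fy \<and> MM f = m}"
   then obtain f fx fy where x: "x = FF f fx fy" "adm f fx fy" "MM f = m" by blast
   then have "1 / 8 * GG fx fy - C <= x" using C[of f fx fy] by (simp add: adm_def)
   then show "- C <= x" using GG_nonneg[of fx fy] by linarith
  qed
 qed
qed

lemma MM_scale: "MM (%z. a *\<^sub>R f z) = a^2 * MM f"
 by (simp add: MM_def l2_scale power_mult_distrib)

lemma QQ_scale: "QQ (%z. a *\<^sub>R f z) (%z. a *\<^sub>R fx z) (%z. a *\<^sub>R fy z) = a^2 * QQ f fx fy"
 by (simp add: QQ_def GG_def tr_def l2_scale power_mult_distrib algebra_simps)

lemma NN_scale: "0 <= a ==> NN (%z. a *\<^sub>R f z) = a powr q * NN f"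
 by (simp add: NN_def powr_mult)

text \<open>Multiplication by \<open>sqrt (m / MM f)\<close> reaches mass \<open>m\<close>. The
  quadratic part scales with \<open>m / MM f\<close>, the nonlinear one with the power
  \<open>q / 2 > 1\<close> of it; this gap drives the compactness argument.\<close>

lemma scaling:
 assumes f: "adm f fx fy" and M: "0 < MM f"
 shows "Einf <= m / MM f * QQ f fx fy - (m / MM f) powr (q / 2) * NN f / q"
proof -
 define a where "a = sqrt (m / MM f)"
 have a: "0 < a" using m M by (simp add: a_def)
 have a2: "a^2 = m / MM f" using m M by (simp add: a_def)
 have aq: "a powr q = (m / MM f) powr (q / 2)"
  using m M by (simp add: a_def powr_half_sqrt[symmetric] powr_powr)
 have "adm (%z. a *\<^sub>R f z) (%z. a *\<^sub>R fx z) (%z. a *\<^sub>R fy z)"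
  using f a C1c_scale[of f fx fy a] by (auto simp: adm_def)
 moreover have "MM (%z. a *\<^sub>R f z) = m" using M by (simp only: MM_scale a2) simp
 ultimately have "Einf <= FF (%z. a *\<^sub>R f z) (%z. a *\<^sub>R fx z) (%z. a *\<^sub>R fy z)" by (rule Einf_le)
 also have "\<dots> = m / MM f * QQ f fx fy - (m / MM f) powr (q / 2) * NN f / q"
  unfolding FF_def QQ_scale NN_scale[OF less_imp_le[OF a]] a2 aq by simp
 finally show ?thesis .
qed

lemma NN_Fatou:
 fixes f :: "nat => plane => 'b::euclidean_space"
 assumes f: "\<And>n. f n \<in> sqi (SL L)" "u \<in> sqi (SL L)" "(%n. l2 (SL L) (%z. f n z - u z)) \<longlonglongrightarrow> 0"
  and i: "\<And>n. integrable (SL L) (%z. norm (f n z) powr q)"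
  and C: "\<forall>\<^sub>F n in sequentially. NN (f n) <= C"
 shows "integrable (SL L) (%z. norm (u z) powr q)" "NN u <= C"
proof -
 obtain r :: "nat => nat" where r: "strict_mono r" "AE z in SL L. (%k. f (r k) z) \<longlonglongrightarrow> u z"
  using L2_tendsto_AE_subseq[OF f] by blast
 have [measurable]: "u \<in> borel_measurable (SL L)" using f(2) by (rule sqiD)
 have lim: "AE z in SL L. (%k. norm (f (r k) z) powr q) \<longlonglongrightarrow> norm (u z) powr q"
  using r(2)
 proof eventually_elim
  fix z assume "(%k. f (r k) z) \<longlonglongrightarrow> u z"
  then have "(%k. norm (f (r k) z)) \<longlonglongrightarrow> norm (u z)" by (rule tendsto_norm)
  then show "(%k. norm (f (r k) z) powr q) \<longlonglongrightarrow> norm (u z) powr q"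
   using q by (intro tendsto_powr' tendsto_const) auto
 qed
 have C': "\<forall>\<^sub>F k in sequentially. (LINT z|SL L. norm (f (r k) z) powr q) <= C"
  using eventually_subseq[OF r(1) C] by (simp add: NN_def)
 show "integrable (SL L) (%z. norm (u z) powr q)" "NN u <= C"
  unfolding NN_def using integral_Fatou[OF i _ _ lim C'] by auto
qed

lemma smooth_abs_close:
 fixes f :: "plane => complex"
 assumes f: "C1c f fx fy" and d: "0 < d"
 obtains r rx ry where "adm r rx ry" "l2 (SL L) (%z. r z - norm (f z)) <= d"
  "l2 (Ival 0 L) (%y. r (0, y) - norm (f (0, y))) <= d" "GG rx ry <= GG fx fy"
proof -
 note F = C1cD[OF f]
 obtain R where R: "\<And>x y. R < \<bar>x\<bar> ==> f (x, y) = 0" using F(4) unfolding xsupp_def by blast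
 let ?ind = "%z::plane. indicator ({-R..R} \<times> UNIV) z * (1::real)"
 define A where "A = l2 (SL L) ?ind"
 define B where "B = l2 (Ival 0 L) (%y. 1::real)"
 have AB: "0 <= A" "0 <= B" by (auto simp: A_def B_def)
 \<comment> \<open>\<open>A\<close> and \<open>B\<close> measure the support band and the
   cross-section, so the uniform error \<open>e\<close> costs at most \<open>d\<close> in both
   norms.\<close>
 define e where "e = d / (A + B + 1)"
 have e: "0 < e" using d AB by (simp add: e_def)
 have eA: "e * A <= d" "e * B <= d" using d AB by (simp_all add: e_def field_simps)
 define r where "r = (%z. sqrt ((norm (f z))^2 + e^2) - e)"
 define D where "D = (%g z. inner (f z) (g z) / sqrt ((norm (f z))^2 + e^2))"
 have sa: "C1c r (D fx) (D fy)" "\<And>z. 0 <= r z" "\<And>z. r z <= norm (f z)" "\<And>z. norm (f z) - r z <= e" "\<And>g z. \<bar>D g z\<bar> <= norm (g z)"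
  unfolding r_def D_def by (rule smooth_abs[OF f e])+
 have ii: "?ind \<in> sqi (SL L)"
 proof (rule sqiI)
  have i: "integrable (SL L) ?ind" by (rule integrable_SL_box_indicator[of UNIV]) simp
  then show "?ind \<in> borel_measurable (SL L)" by simp
  have "(norm (?ind z))^2 = ?ind z" for z by (auto simp: indicator_def)
  then show "integrable (SL L) (%z. (norm (?ind z))^2)" using i by (simp only:)
 qed
 have dom: "l2 M g <= l2 M h" if "h \<in> sqi M" "g \<in> sqi M" "\<And>x. x \<in> space M ==> norm (g x) <= norm (h x)"
  for M :: "'x measure" and g h :: "'x => 'y::euclidean_space"
  by (rule sqi_dominated(2)[OF that(1) sqiD[OF that(2)]]) (use that(3) in auto)
 have dom': "l2 M g <= l2 M h" if "h \<in> sqi M" "g \<in> sqi M" "\<And>x. x \<in> space M ==> norm (g x) <= norm (h x)"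
  for M :: "'x measure" and g :: "'x => real" and h :: "'x => complex"
  using dom[OF sqi_norm[OF that(1)] that(2)] that(3) by (simp add: l2_norm)
 have pt: "\<bar>r z - norm (f z)\<bar> <= e" for z using sa(3,4)[of z] by simp
 show ?thesis
 proof (rule that[of r "D fx" "D fy"])
  show "adm r (D fx) (D fy)" using sa(1,2) by (simp add: adm_def)
  have "l2 (SL L) (%z. r z - norm (f z)) <= l2 (SL L) (%z. e *\<^sub>R ?ind z)"
  proof (rule dom[OF sqi_scale[OF ii]])
   show "(%z. r z - norm (f z)) \<in> sqi (SL L)" by (intro sqi_diff sqi_norm C1c_sqi(1)[OF sa(1)] C1c_sqi(1)[OF f])
   fix z :: "plane"
   show "norm (r z - norm (f z)) <= norm (e *\<^sub>R ?ind z)"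
   proof (cases "f z = 0")
    case True then show ?thesis using e by (simp add: r_def)
   next
    case False
    then have "\<bar>fst z\<bar> <= R" using R[of "fst z" "snd z"] by (metis not_le prod.collapse)
    then have "?ind z = 1" by (cases z) (auto simp: indicator_def)
    then show ?thesis using pt[of z] e by simp
   qed
  qed
  also have "\<dots> = e * A" unfolding l2_scale A_def using e by simp
  finally show "l2 (SL L) (%z. r z - norm (f z)) <= d" using eA by simp
  have "l2 (Ival 0 L) (%y. r (0, y) - norm (f (0, y))) <= l2 (Ival 0 L) (%y. e *\<^sub>R (1::real))"
  proof (rule dom[OF sqi_scale[OF sqi_Ival_continuous]])
   show "(%y. r (0, y) - norm (f (0, y))) \<in> sqi (Ival 0 L)"
    by (intro sqi_diff sqi_norm C1c_slice_sqi[OF sa(1)] C1c_slice_sqi[OF f])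
   show "norm (r (0, y) - norm (f (0, y))) <= norm (e *\<^sub>R (1::real))" for y using pt[of "(0, y)"] e by simp
  qed simp
  also have "\<dots> = e * B" unfolding l2_scale B_def using e by simp
  finally show "l2 (Ival 0 L) (%y. r (0, y) - norm (f (0, y))) <= d" using eA by simp
  have "l2 (SL L) (D fx) <= l2 (SL L) fx" "l2 (SL L) (D fy) <= l2 (SL L) fy"
   using sa(5) by (auto intro!: dom' C1c_sqi[OF f] C1c_sqi[OF sa(1)])
  then show "GG (D fx) (D fy) <= GG fx fy" unfolding GG_def by (intro add_mono power_mono) auto
 qed
qed

text \<open>This extends the lower bound by \<open>Einf\<close> from smooth nonnegative functions to the Sobolev space.\<close>

lemma key_inequality:
 assumes A: "approx u g1 g2 t f fx fy" and M: "0 < MM u"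
 shows "integrable (SL L) (%z. norm (u z) powr q)"
  "(m / MM u) powr (q / 2) * NN u / q <= m / MM u * (1 / 2 * GG g1 g2 + \<gamma> / 2 * (l2 (Ival 0 L) t)^2) - Einf"
proof -
 note D = approxD[OF A]
 define Pr where "Pr n r rx ry \<longleftrightarrow> adm r rx ry \<and> l2 (SL L) (%z. r z - norm (f n z)) <= 1 / (real n + 1) \<and>
  l2 (Ival 0 L) (%y. r (0, y) - norm (f n (0, y))) <= 1 / (real n + 1) \<and> GG rx ry <= GG (fx n) (fy n)" for n r rx ry
 have "\<exists>r rx ry. Pr n r rx ry" for n
 proof -
  have e: "0 < 1 / (real n + 1)" by simp
  from smooth_abs_close[OF D(5)[of n] e] show ?thesis unfolding Pr_def by blast
 qed
 then obtain r rx ry where "\<And>n. Pr n (r n) (rx n) (ry n)" by metis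
 then have r: "\<And>n. adm (r n) (rx n) (ry n)" "\<And>n. l2 (SL L) (%z. r n z - norm (f n z)) <= 1 / (real n + 1)"
  "\<And>n. l2 (Ival 0 L) (%y. r n (0, y) - norm (f n (0, y))) <= 1 / (real n + 1)" "\<And>n. GG (rx n) (ry n) <= GG (fx n) (fy n)"
  unfolding Pr_def by blast+
 have C: "C1c (r n) (rx n) (ry n)" for n using r(1) by (simp add: adm_def)
 have inv0: "(%m. 1 / (real m + 1)) \<longlonglongrightarrow> 0"
  using LIMSEQ_ignore_initial_segment[OF lim_1_over_n, of 1] by (simp add: add.commute)
 have lim: "(%n. l2 M (%z. a n z - norm (b z))) \<longlonglongrightarrow> 0"
  if "\<And>n. a n \<in> sqi M" "\<And>n. c n \<in> sqi M" "b \<in> sqi M" "\<And>n. l2 M (%z. a n z - norm (c n z)) <= 1 / (real n + 1)"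
   "(%n. l2 M (%z. c n z - b z)) \<longlonglongrightarrow> 0"
  for M :: "'x measure" and a :: "nat => 'x => real" and c :: "nat => 'x => complex" and b
 proof (rule Lim_null_comparison)
  have "l2 M (%z. a n z - norm (b z)) <= 1 / (real n + 1) + l2 M (%z. c n z - b z)" for n
  proof -
   have "l2 M (%z. a n z - norm (b z)) <= l2 M (%z. a n z - norm (c n z)) + l2 M (%z. norm (c n z) - norm (b z))"
    by (intro l2_triangle_diff sqi_norm that)
   also have "l2 M (%z. norm (c n z) - norm (b z)) <= l2 M (%z. norm (c n z - b z))"
    by (rule sqi_dominated(2)[OF sqi_norm[OF sqi_diff[OF that(2,3)]]])
     (auto intro!: sqiD sqi_diff sqi_norm that norm_triangle_ineq3)
   finally show ?thesis using that(4)[of n] by (simp add: l2_norm)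
  qed
  then show "\<forall>\<^sub>F n in sequentially. norm (l2 M (%z. a n z - norm (b z))) <= 1 / (real n + 1) + l2 M (%z. c n z - b z)"
   by (intro always_eventually) simp
  show "(%n. 1 / (real n + 1) + l2 M (%z. c n z - b z)) \<longlonglongrightarrow> 0" using tendsto_add[OF inv0 that(5)] by simp
 qed
 have l1: "(%n. l2 (SL L) (%z. r n z - norm (u z))) \<longlonglongrightarrow> 0"
  by (rule lim[OF C1c_sqi(1)[OF C] C1c_sqi(1)[OF D(5)] D(1) r(2) D(6)])
 have l2': "(%n. l2 (Ival 0 L) (%y. r n (0, y) - norm (t y))) \<longlonglongrightarrow> 0"
  by (rule lim[OF C1c_slice_sqi[OF C] C1c_slice_sqi[OF D(5)] D(4) r(3) D(9)])
 have "(%n. l2 (SL L) (r n)) \<longlonglongrightarrow> l2 (SL L) (%z. norm (u z))"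
  by (rule l2_tendsto[OF C1c_sqi(1)[OF C] sqi_norm[OF D(1)] l1])
 then have Ml: "(%n. MM (r n)) \<longlonglongrightarrow> MM u" unfolding MM_def l2_norm by (rule tendsto_power)
 have "(%n. l2 (Ival 0 L) (%y. r n (0, y))) \<longlonglongrightarrow> l2 (Ival 0 L) (%y. norm (t y))"
  by (rule l2_tendsto[OF C1c_slice_sqi[OF C] sqi_norm[OF D(4)] l2'])
 then have Tl: "(%n. tr (r n)) \<longlonglongrightarrow> (l2 (Ival 0 L) t)^2" unfolding tr_def l2_norm by (rule tendsto_power)
 have Gl: "(%n. GG (fx n) (fy n)) \<longlonglongrightarrow> GG g1 g2"
  unfolding GG_def by (intro tendsto_add tendsto_power l2_tendsto[OF C1c_sqi(2)[OF D(5)] D(2,7)] l2_tendsto[OF C1c_sqi(3)[OF D(5)] D(3,8)])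
 \<comment> \<open>The gradient of \<open>f n\<close> stands in for that of \<open>r n\<close>: it
   dominates it and is the one known to converge.\<close>
 define Qn where "Qn n = 1 / 2 * GG (fx n) (fy n) + \<gamma> / 2 * tr (r n)" for n
 define Qu where "Qu = 1 / 2 * GG g1 g2 + \<gamma> / 2 * (l2 (Ival 0 L) t)^2"
 have Ql: "Qn \<longlonglongrightarrow> Qu" unfolding Qn_def Qu_def by (intro tendsto_intros Gl Tl)
 \<comment> \<open>The right-hand side of the scaling inequality after solving for the nonlinear
   term. It converges, so Fatou gives both integrability and the bound for \<open>u\<close>.\<close>
 define Bn where "Bn n = q * (m / MM (r n)) powr (- (q / 2)) * (m / MM (r n) * Qn n - Einf)" for n
 define Bu where "Bu = q * (m / MM u) powr (- (q / 2)) * (m / MM u * Qu - Einf)"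
 have Bl: "Bn \<longlonglongrightarrow> Bu" unfolding Bn_def Bu_def using M m by (intro tendsto_intros Ml Ql) auto
 have le: "NN (r n) <= Bn n" if Mn: "0 < MM (r n)" for n
 proof -
  have pp: "0 < (m / MM (r n)) powr (q / 2)" using m Mn by simp
  have "Einf <= m / MM (r n) * QQ (r n) (rx n) (ry n) - (m / MM (r n)) powr (q / 2) * NN (r n) / q"
   by (rule scaling[OF r(1) Mn])
  also have "m / MM (r n) * QQ (r n) (rx n) (ry n) <= m / MM (r n) * Qn n"
   using m Mn r(4)[of n] by (intro mult_left_mono) (auto simp: QQ_def Qn_def)
  finally have "(m / MM (r n)) powr (q / 2) * NN (r n) / q <= m / MM (r n) * Qn n - Einf" by simp
  then have "(m / MM (r n)) powr (q / 2) * NN (r n) <= q * (m / MM (r n) * Qn n - Einf)"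
   using q by (simp add: pos_divide_le_eq mult.commute)
  then have "NN (r n) <= q * (m / MM (r n) * Qn n - Einf) / (m / MM (r n)) powr (q / 2)"
   using pp by (simp add: pos_le_divide_eq mult.commute)
  also have "\<dots> = Bn n" unfolding Bn_def powr_minus divide_inverse by (simp only: ac_simps)
  finally show ?thesis .
 qed
 have ev: "\<forall>\<^sub>F n in sequentially. NN (r n) <= Bu + e" if "0 < e" for e
 proof -
  have "\<forall>\<^sub>F n in sequentially. 0 < MM (r n)" using Ml M by (rule order_tendstoD)
  moreover have "\<forall>\<^sub>F n in sequentially. Bn n < Bu + e" using Bl by (rule order_tendstoD) (use that in simp)
  ultimately show ?thesis by eventually_elim (meson le less_imp_le order_trans)
 qed
 have us: "(%z. norm (u z)) \<in> sqi (SL L)" by (rule sqi_norm[OF D(1)])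
 have ir: "integrable (SL L) (%z. norm (r n z) powr q)" for n by (rule NN_integrable[OF C1cD(1,4)[OF C]])
 note Fa = NN_Fatou[OF C1c_sqi(1)[OF C] us l1 ir]
 show "integrable (SL L) (%z. norm (u z) powr q)" using Fa(1)[OF ev[of 1]] by simp
 have "NN u <= Bu + e" if "0 < e" for e using Fa(2)[OF ev[OF that]] by (simp add: NN_def)
 then have "NN u <= Bu" by (rule field_le_epsilon)
 have pp: "0 < (m / MM u) powr (q / 2)" using m M by simp
 have "(m / MM u) powr (q / 2) * NN u <= (m / MM u) powr (q / 2) * Bu"
  using \<open>NN u <= Bu\<close> pp by (intro mult_left_mono) auto
 also have "\<dots> = q * (m / MM u * Qu - Einf)" using pp by (simp add: Bu_def powr_minus)
 finally have "(m / MM u) powr (q / 2) * NN u / q <= m / MM u * Qu - Einf"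
  using q by (simp add: pos_divide_le_eq mult.commute)
 then show "(m / MM u) powr (q / 2) * NN u / q <= m / MM u * (1 / 2 * GG g1 g2 + \<gamma> / 2 * (l2 (Ival 0 L) t)^2) - Einf"
  by (simp add: Qu_def)
qed

end

section \<open>The infimum is negative\<close>

context nls
begin

lemma fun_of_x_integral:
 fixes g :: "real => real"
 assumes c: "continuous_on UNIV g" and z: "\<And>x. B < \<bar>x\<bar> ==> g x = 0"
 shows "(LINT z|SL L. g (fst z)) = L * (LINT x|Ival (-B) B. g x)"
proof -
 have i: "integrable (SL L) (%z. g (fst z))"
 proof (rule integrable_SL_continuous)
  show "continuous_on UNIV (%z::plane. g (fst z))"
   by (rule continuous_on_compose2[OF c]) (auto intro!: continuous_intros)
  show "xsupp (%z::plane. g (fst z))" unfolding xsupp_def using z by auto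
 qed
 have "(LINT z|SL L. g (fst z)) = (LINT x|lborel. L * g x)"
  using integral_SL_fst(1)[OF i] L by (simp add: measure_Ival)
 also have "\<dots> = L * (LINT x|Ival (-B) B. g x)"
 proof -
  have e: "indicator {-B..B} x *\<^sub>R g x = g x" for x
  proof (cases "x \<in> {-B..B}")
   case False
   then have "B < \<bar>x\<bar>" by auto
   then show ?thesis using z by simp
  qed simp
  show ?thesis unfolding integral_Ival e by simp
 qed
 finally show ?thesis .
qed

text \<open>The trial function is \<open>cutoff R x * exp (- k * sqrt (x^2 + d^2))\<close> with \<open>k = - \<gamma> / 2\<close>: a cut off and smoothed
 version of \<open>exp (- k * \<bar>x\<bar>)\<close>, the ground state of \<open>- u'' + \<gamma> \<delta>\<^sub>0 u\<close> on the line.\<close>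

lemma trial_function:
 assumes e: "0 < e"
 obtains f fx fy where "adm f fx fy" "0 < MM f" "QQ f fx fy <= (- (\<gamma>^2 / 8) + e) * MM f"
proof -
 define k where "k = - \<gamma> / 2"
 have k: "0 < k" using \<gamma> by (simp add: k_def)
 obtain C where C: "0 <= C" "\<And>R x. \<bar>deriv (cutoff R) x\<bar> <= C" "\<And>R x. \<bar>x\<bar> < R ==> deriv (cutoff R) x = 0"
  "\<And>R x. R + 1 < \<bar>x\<bar> ==> deriv (cutoff R) x = 0"
  using deriv_cutoff_bound by metis
 \<comment> \<open>A lower bound for the mass: on \<open>[0, 1]\<close> the smoothed modulus is at
   most 2, so \<open>h^2\<close> is at least \<open>exp (- 4 * k)\<close>.\<close>
 define c0 where "c0 = exp (- 4 * k)"
 have c0: "0 < c0" by (simp add: c0_def)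
 define e' where "e' = e / 2 * c0"
 have e': "0 < e'" using e c0 by (simp add: e'_def)
 define c where "c = k^2 + 1"
 have c: "0 < c" "k^2 <= c" by (auto simp: c_def add_nonneg_pos)
 \<comment> \<open>Smoothing will cost at most \<open>4 * d * k^2\<close>; this choice keeps the
   cost below \<open>2 * e'\<close>.\<close>
 define d where "d = min 1 (e' / (2 * c))"
 have d: "0 < d" "d <= 1" using e' c by (auto simp: d_def)
 have kd: "k^2 * (2 * d) <= e'"
 proof -
  have "k^2 * (2 * d) <= c * (2 * d)" using d c by (intro mult_right_mono) auto
  also have "\<dots> <= c * (2 * (e' / (2 * c)))"
   using c by (intro mult_left_mono) (auto simp: d_def)
  also have "\<dots> = e'" using c by simp
  finally show ?thesis .
 qed
 \<comment> \<open>The exponential decay beats the derivative of the cutoff, which is bounded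
   uniformly in \<open>R\<close>.\<close>
 have "\<exists>R\<ge>1. C^2 * exp (- 2 * k * R) <= e' / 4"
 proof -
  have "((%R. C^2 * exp (- (2 * k * R))) \<longlongrightarrow> C^2 * 0) at_top"
   using k by (intro tendsto_intros filterlim_compose[OF exp_at_bot] filterlim_compose[OF filterlim_uminus_at_bot_at_top]
     filterlim_tendsto_pos_mult_at_top[OF tendsto_const] filterlim_ident) auto
  then have "\<forall>\<^sub>F R in at_top. C^2 * exp (- (2 * k * R)) < e' / 4" using e' by (intro order_tendstoD) auto
  then have "\<forall>\<^sub>F R in at_top. C^2 * exp (- (2 * k * R)) < e' / 4 \<and> 1 <= R"
   using eventually_ge_at_top[of "1::real"] by (rule eventually_conj)
  then obtain R where "C^2 * exp (- (2 * k * R)) < e' / 4 \<and> 1 <= R"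
   unfolding eventually_at_top_linorder by blast
  then show ?thesis by (intro exI[of _ R]) simp
 qed
 then obtain R where R: "1 <= R" "C^2 * exp (- 2 * k * R) <= e' / 4" by blast
 define B where "B = R + 1"
 have B: "2 <= B" using R by (simp add: B_def)
 define \<sigma> where "\<sigma> x = sqrt (x^2 + d^2)" for x
 define s where "s x = x / \<sigma> x" for x
 define s' where "s' x = d^2 / (\<sigma> x) ^ 3" for x
 define h where "h x = cutoff R x * exp (- k * \<sigma> x)" for x
 define \<rho> where "\<rho> x = deriv (cutoff R) x * exp (- k * \<sigma> x)" for x
 define h' where "h' x = \<rho> x - k * s x * h x" for x
 have pos: "0 < x^2 + d^2" for x using d by (simp add: add_nonneg_pos)
 have \<sigma>: "0 < \<sigma> x" "(\<sigma> x)^2 = x^2 + d^2" "\<bar>x\<bar> <= \<sigma> x" "d <= \<sigma> x" for x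
  using pos[of x] d by (auto simp: \<sigma>_def intro!: real_le_rsqrt)
 have D\<sigma>: "(\<sigma> has_real_derivative s x) (at x)" for x
 proof -
  have 1: "((%x. x^2 + d^2) has_real_derivative 2 * x) (at x)" by (auto intro!: derivative_eq_intros)
  show ?thesis
   unfolding \<sigma>_def[abs_def] s_def
   by (rule DERIV_cong[OF DERIV_chain2[OF DERIV_real_sqrt[OF pos] 1]]) (simp add: field_simps)
 qed
 have Ds: "(s has_real_derivative s' x) (at x)" for x
 proof -
  have n: "\<sigma> x \<noteq> 0" using \<sigma>(1)[of x] by simp
  have "(1 * \<sigma> x - x * s x) / (\<sigma> x * \<sigma> x) = ((\<sigma> x)^2 - x^2) / (\<sigma> x) ^ 3"
   using n by (simp add: s_def field_simps power2_eq_square power3_eq_cube)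
  also have "\<dots> = s' x" unfolding \<sigma>(2) s'_def by simp
  finally have "(1 * \<sigma> x - x * s x) / (\<sigma> x * \<sigma> x) = s' x" .
  then show ?thesis
   unfolding s_def[abs_def] by (intro DERIV_cong[OF DERIV_divide[OF DERIV_ident D\<sigma> n]]) (simp add: s_def)
 qed
 have Dh: "(h has_real_derivative h' x) (at x)" for x
 proof -
  have 1: "((%x. exp (- k * \<sigma> x)) has_real_derivative exp (- k * \<sigma> x) * (- k * s x)) (at x)"
   by (rule DERIV_chain2[OF DERIV_exp DERIV_cmult[OF D\<sigma>]])
  show ?thesis
   unfolding h_def[abs_def] h'_def \<rho>_def
   by (rule DERIV_cong[OF DERIV_mult[OF smooth_DERIV(1)[OF cutoff_smooth] 1]]) (simp add: h_def)
 qed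
 have cont: "continuous_on UNIV g" if "\<And>x. (g has_real_derivative g' x) (at x)" for g g' :: "real => real"
  by (rule continuous_at_imp_continuous_on) (auto intro: DERIV_isCont[OF that])
 have c\<sigma>: "continuous_on UNIV \<sigma>" by (rule cont[OF D\<sigma>])
 have cs: "continuous_on UNIV s" by (rule cont[OF Ds])
 have ch: "continuous_on UNIV h" by (rule cont[OF Dh])
 have c\<rho>: "continuous_on UNIV \<rho>" unfolding \<rho>_def by (intro continuous_intros c\<sigma> smooth_continuous[OF smooth_DERIV(2)[OF cutoff_smooth]])
 have ch': "continuous_on UNIV h'" unfolding h'_def by (intro continuous_intros c\<rho> cs ch)
 have cs': "continuous_on UNIV s'" unfolding s'_def using \<sigma>(1) by (intro continuous_intros c\<sigma>) (metis less_irrefl power_not_zero)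
 have h0: "0 <= h x" for x unfolding h_def using cutoff_bounds by simp
 have hz: "h x = 0" if "B <= \<bar>x\<bar>" for x using cutoff_zero[of R x] that by (simp add: h_def B_def)
 have hz': "h' x = 0" if "B < \<bar>x\<bar>" for x using C(4)[of R x] hz[of x] that by (simp add: h'_def \<rho>_def B_def)
 have hmax: "(h x)^2 <= (h 0)^2" for x
 proof (rule power_mono[OF _ h0])
  have "h x <= 1 * exp (- k * \<sigma> x)" unfolding h_def using cutoff_bounds by (intro mult_right_mono) auto
  also have "\<dots> <= exp (- k * \<sigma> 0)" using \<sigma>(4)[of x] d k by (simp add: \<sigma>_def)
  also have "\<dots> = h 0" using R by (simp add: h_def cutoff_one)
  finally show "h x <= h 0" .
 qed
 let ?J = "Ival (-B) B"
 have iJ: "integrable ?J g" if "continuous_on UNIV g" for g :: "real => real" by (rule integrable_Ival_continuous[OF that])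
 have FTC: "(LINT x|?J. g' x) = g B - g (-B)" if "\<And>x. (g has_real_derivative g' x) (at x)" "continuous_on UNIV g'" for g g'
 proof -
  have "(LINT x|lborel. indicator {-B..B} x *\<^sub>R g' x) = g B - g (-B)"
   by (rule integral_FTC_atLeastAtMost)
    (use that B in \<open>auto simp: DERIV_iff_vec intro: has_vector_derivative_at_within continuous_on_subset\<close>)
  then show ?thesis by (simp add: integral_Ival)
 qed
 \<comment> \<open>The derivative of \<open>s * h^2\<close> integrates to zero; this trades the
   mixed term of the completed square for \<open>s' * h^2\<close>.\<close>
 have I1: "(LINT x|?J. s' x * (h x)^2 + 2 * (s x * h x * h' x)) = 0"
 proof -
  have "((%x. s x * (h x * h x)) has_real_derivative s' x * (h x)^2 + 2 * (s x * h x * h' x)) (at x)" for x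
   by (rule DERIV_cong[OF DERIV_mult[OF Ds DERIV_mult[OF Dh Dh]]]) (simp add: power2_eq_square algebra_simps)
  from FTC[OF this] show ?thesis using hz[of B] hz[of "-B"] B
   by (simp add: continuous_intros cs' ch cs ch')
 qed
 \<comment> \<open>\<open>s'\<close> plays the role of twice the delta at 0: its integral is at most
   2, and \<open>h^2\<close> is largest at 0. After the factor \<open>k / 2\<close> this bound is
   cancelled exactly by the trace term.\<close>
 have I2: "(LINT x|?J. s' x * (h x)^2) <= 2 * (h 0)^2"
 proof -
  have s'0: "0 <= s' x" for x using \<sigma>(1)[of x] by (simp add: s'_def)
  have "(LINT x|?J. s' x * (h x)^2) <= (LINT x|?J. s' x * (h 0)^2)"
   by (intro integral_mono iJ continuous_intros cs' ch mult_left_mono hmax s'0)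
  also have "\<dots> = (s B - s (-B)) * (h 0)^2" using FTC[OF Ds cs'] by simp
  also have "\<dots> <= 2 * (h 0)^2"
  proof (rule mult_right_mono)
   have "\<bar>s x\<bar> <= 1" for x using \<sigma>(1,3)[of x] by (simp add: s_def)
   then show "s B - s (- B) <= 2" using abs_le_D1[of "s B" 1] abs_le_D2[of "s (-B)" 1] by fastforce
  qed simp
  finally show ?thesis .
 qed
 \<comment> \<open>\<open>1 - s^2\<close> is a Lorentz profile of width \<open>d\<close>, so its
   integral is of order \<open>d\<close>.\<close>
 have I3: "(LINT x|?J. (1 - (s x)^2) * (h x)^2) <= 4 * d"
 proof -
  have s1: "1 - (s x)^2 = 1 / (1 + (x / d)^2)" for x
  proof -
   have "1 - (s x)^2 = d^2 / (x^2 + d^2)"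
    unfolding s_def power_divide \<sigma>(2) using less_imp_neq[OF pos[of x]] by (simp add: field_simps)
   also have "\<dots> = 1 / (1 + (x / d)^2)" using d less_imp_neq[OF pos[of x]] by (simp add: field_simps power_divide)
   finally show ?thesis .
  qed
  have h1: "(h x)^2 <= 1" for x
  proof -
   have "h x <= 1 * 1" unfolding h_def using cutoff_bounds k \<sigma>(1)[of x] by (intro mult_mono) auto
   then show ?thesis using h0[of x] by (simp add: power_le_one)
  qed
  have "(LINT x|?J. (1 - (s x)^2) * (h x)^2) <= (LINT x|?J. 1 / (1 + (x / d)^2))"
  proof (rule integral_mono)
   show "integrable ?J (%x. (1 - (s x)^2) * (h x)^2)" by (intro iJ continuous_intros cs ch)
   have nz: "1 + (x / d)^2 \<noteq> 0" for x by (metis add_pos_nonneg less_irrefl zero_le_power2 zero_less_one)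
   show "integrable ?J (%x. 1 / (1 + (x / d)^2))"
    using nz d by (intro iJ continuous_intros) auto
   fix x
   have "0 <= 1 / (1 + (x / d)^2)" by (simp add: add_nonneg_nonneg)
   then show "(1 - (s x)^2) * (h x)^2 <= 1 / (1 + (x / d)^2)"
    unfolding s1 using h1[of x] by (metis mult_left_le)
  qed
  also have "\<dots> = d * arctan (B / d) - d * arctan (- B / d)"
  proof (rule FTC)
   fix x
   have 1: "((%x. x / d) has_real_derivative 1 / d) (at x)" using DERIV_cdivide[OF DERIV_ident] .
   show "((%x. d * arctan (x / d)) has_real_derivative 1 / (1 + (x / d)^2)) (at x)"
    by (rule DERIV_cong[OF DERIV_cmult[OF DERIV_chain2[OF DERIV_arctan 1]]]) (use d in \<open>simp add: divide_inverse\<close>)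
  next
   have nz: "1 + (x / d)^2 \<noteq> 0" for x by (metis add_pos_nonneg less_irrefl zero_le_power2 zero_less_one)
   show "continuous_on UNIV (%x. 1 / (1 + (x / d)^2))" using nz d by (intro continuous_intros) auto
  qed
  also have "\<dots> <= d * 4"
  proof -
   have "arctan (B / d) - arctan (- B / d) <= 4" using arctan_bounded[of "B / d"] pi_less_4 by (simp add: arctan_minus)
   then have "d * (arctan (B / d) - arctan (- B / d)) <= d * 4" using d by (intro mult_left_mono) auto
   then show ?thesis by (simp add: right_diff_distrib)
  qed
  finally show ?thesis by simp
 qed
 have I4: "(LINT x|?J. (\<rho> x)^2) <= e' / 2"
 proof -
  have "(LINT x|?J. (\<rho> x)^2) <= (LINT x|?J. (e' / 4) * (indicator {R..R+1} x + indicator {-R-1..-R} x))"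
  proof (rule integral_mono)
   show "integrable ?J (%x. (\<rho> x)^2)" by (intro iJ continuous_intros c\<rho>)
   interpret finite_measure ?J by (rule finite_measure_Ival)
   have ind: "(%x. indicator A x :: real) \<in> borel_measurable ?J" if "A \<in> sets borel" for A :: "real set"
    using that unfolding Ival_def by (intro measurable_restrict_space1) simp
   show "integrable ?J (%x. (e' / 4) * (indicator {R..R+1} x + indicator {-R-1..-R} x))"
    by (intro integrable_mult_right Bochner_Integration.integrable_add integrable_const_bound[of _ 1] ind) (auto simp: indicator_def)
   fix x assume x: "x \<in> space ?J"
   show "(\<rho> x)^2 <= (e' / 4) * (indicator {R..R+1} x + indicator {-R-1..-R} x)"
   proof (cases "\<bar>x\<bar> < R")
    case True
    then show ?thesis using C(3)[of x R] e' by (simp add: \<rho>_def)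
   next
    case False
    have "\<bar>\<rho> x\<bar> <= C * exp (- k * R)"
     unfolding \<rho>_def abs_mult using C(2)[of R x] \<sigma>(3)[of x] False k C(1) by (intro mult_mono) auto
    then have "\<bar>\<rho> x\<bar>^2 <= (C * exp (- k * R))^2" by (intro power_mono) auto
    also have "\<dots> = C^2 * exp (- 2 * k * R)" by (simp add: power_mult_distrib exp_double[symmetric] mult.assoc)
    also have "\<dots> <= e' / 4" by (rule R(2))
    also have "e' / 4 <= (e' / 4) * (indicator {R..R+1} x + indicator {-R-1..-R} x)"
     using False x e' by (auto simp: indicator_def B_def abs_if split: if_splits)
    finally show ?thesis by simp
   qed
  qed
  also have "\<dots> = (e' / 4) * 2"
  proof -
   have "(LINT x|?J. indicator A x) = (measure lborel A :: real)" if "A \<in> sets borel" "A \<subseteq> {-B..B}" for A :: "real set"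
   proof -
    have e1: "indicator {-B..B} x *\<^sub>R indicator A x = (indicator A x :: real)" for x using that by (auto simp: indicator_def)
    show ?thesis unfolding integral_Ival e1 by simp
   qed
   note mA = this
   interpret finite_measure ?J by (rule finite_measure_Ival)
   have ind: "(%x. indicator A x :: real) \<in> borel_measurable ?J" if "A \<in> sets borel" for A :: "real set"
    using that unfolding Ival_def by (intro measurable_restrict_space1) simp
   have int: "integrable ?J (%x. indicator A x :: real)" if "A \<in> sets borel" for A :: "real set"
    by (rule integrable_const_bound[of _ 1]) (use ind[OF that] in \<open>auto simp: indicator_def\<close>)
   have "(LINT x|?J. indicator {R..R+1} x + indicator {-R-1..-R} x) = (LINT x|?J. indicator {R..R+1} x) + ((LINT x|?J. indicator {-R-1..-R} x) :: real)"
    by (intro Bochner_Integration.integral_add int) auto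
   also have "\<dots> = 2" using R by (subst (1 2) mA) (auto simp: B_def)
   finally show ?thesis by simp
  qed
  finally show ?thesis by simp
 qed
 have I5: "c0 <= (LINT x|?J. (h x)^2)"
 proof -
  have le: "(LINT x|?J. c0 * indicator {0..1} x) <= (LINT x|?J. (h x)^2)"
  proof (rule integral_mono_AE')
   show "integrable ?J (%x. (h x)^2)" by (intro iJ continuous_intros ch)
   have "c0 * indicator {0..1} x <= (h x)^2" for x
   proof (cases "x \<in> {0..1}")
    case True
    have "\<sigma> x <= 2" unfolding \<sigma>_def using True d by (intro real_le_lsqrt) (auto intro: order_trans[OF add_mono[OF power_le_one power_le_one]])
    then have "exp (- k * 2) <= exp (- k * \<sigma> x)" using k by simp
    also have "\<dots> = h x" using True R by (simp add: h_def cutoff_one)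
    finally have "(exp (- k * 2))^2 <= (h x)^2" by (intro power_mono) auto
    moreover have "(exp (- k * 2))^2 = c0" by (simp add: c0_def exp_double[symmetric])
    ultimately show ?thesis using True by simp
   qed simp
   then show "AE x in ?J. c0 * indicator {0..1} x <= (h x)^2" by simp
  qed simp
  have "(LINT x|?J. c0 * indicator {0..1} x) = c0"
  proof -
   have e1: "indicator {-B..B} x *\<^sub>R (c0 * indicator {0..1} x) = (c0 * indicator {0..1} x :: real)" for x using B by (auto simp: indicator_def)
   show ?thesis unfolding integral_Ival e1 by simp
  qed
  with le show ?thesis by (simp only:)
 qed
 define H where "H = (LINT x|?J. (h x)^2)"
 have I6: "(LINT x|?J. (h' x)^2) <= (LINT x|?J. (\<rho> x)^2) + k * (2 * (h 0)^2) - k^2 * H + k^2 * (4 * d)"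
 proof -
  \<comment> \<open>Completes the square with \<open>\<rho> = h' + k * s * h\<close>, which vanishes
    except where the cutoff varies.\<close>
  have pt: "(h' x)^2 = (\<rho> x)^2 + k * (s' x * (h x)^2) - k * (s' x * (h x)^2 + 2 * (s x * h x * h' x)) - k^2 * (h x)^2 + k^2 * ((1 - (s x)^2) * (h x)^2)" for x
  proof -
   have "(\<rho> x)^2 = (h' x + k * s x * h x)^2" by (simp add: h'_def)
   then show ?thesis by (simp add: power2_eq_square algebra_simps)
  qed
  have "(LINT x|?J. (h' x)^2) = (LINT x|?J. (\<rho> x)^2) + k * (LINT x|?J. s' x * (h x)^2)
   - k * (LINT x|?J. s' x * (h x)^2 + 2 * (s x * h x * h' x)) - k^2 * (LINT x|?J. (h x)^2) + k^2 * (LINT x|?J. (1 - (s x)^2) * (h x)^2)"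
  proof -
   have i: "integrable ?J (%x. (\<rho> x)^2)" "integrable ?J (%x. s' x * (h x)^2)" "integrable ?J (%x. s' x * (h x)^2 + 2 * (s x * h x * h' x))"
    "integrable ?J (%x. (h x)^2)" "integrable ?J (%x. (1 - (s x)^2) * (h x)^2)"
    by (intro iJ continuous_intros c\<rho> cs cs' ch ch')+
   have gen: "(LINT x|?J. F1 x + k * F2 x - k * F3 x - k^2 * F4 x + k^2 * F5 x) = (LINT x|?J. F1 x) + k * (LINT x|?J. F2 x) - k * (LINT x|?J. F3 x)
    - k^2 * (LINT x|?J. F4 x) + k^2 * (LINT x|?J. F5 x)"
    if "integrable ?J F1" "integrable ?J F2" "integrable ?J F3" "integrable ?J F4" "integrable ?J F5" for F1 F2 F3 F4 F5 :: "real => real"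
    using that by simp
   show ?thesis unfolding pt by (rule gen[OF i])
  qed
  moreover have "k * (LINT x|?J. s' x * (h x)^2) <= k * (2 * (h 0)^2)" using I2 k by (intro mult_left_mono) auto
  moreover have "k^2 * (LINT x|?J. (1 - (s x)^2) * (h x)^2) <= k^2 * (4 * d)" using I3 by (intro mult_left_mono) auto
  ultimately show ?thesis unfolding I1 H_def by simp
 qed
 have I7: "1 / 2 * (LINT x|?J. (h' x)^2) - k * (h 0)^2 <= (- (k^2 / 2) + e) * H"
 proof -
  have "1 / 2 * (LINT x|?J. (h' x)^2) - k * (h 0)^2 <= 1 / 2 * (e' / 2 - k^2 * H + 2 * e')"
   using I6 I4 kd by argo
  also have "\<dots> <= - (k^2 / 2) * H + 2 * e'" using e' by (simp add: field_simps)
  also have "2 * e' <= e * H" using I5 e by (simp add: e'_def H_def)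
  finally show ?thesis by (simp add: algebra_simps)
 qed
 define f where "f = (%z::plane. h (fst z))"
 define fx where "fx = (%z::plane. h' (fst z))"
 have C1: "C1c f fx (%_. 0)"
  unfolding C1c_def
 proof (intro conjI allI)
  show "continuous_on UNIV f" "continuous_on UNIV fx" unfolding f_def fx_def
   by (rule continuous_on_compose2[OF ch] continuous_on_compose2[OF ch'], auto intro!: continuous_intros)+
  show "xsupp f" "xsupp fx" unfolding f_def fx_def xsupp_def using hz hz' by (auto intro!: exI[of _ B])
  show "((%s. f (s, y)) has_vector_derivative fx (x, y)) (at x)" for x y
   using Dh by (simp add: f_def fx_def DERIV_iff_vec)
 qed (auto simp: f_def xsupp_def)
 have MM: "MM f = L * H" "GG fx (%_. 0) = L * (LINT x|?J. (h' x)^2)"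
 proof -
  show "MM f = L * H"
   unfolding MM_def l2_sq f_def H_def using hz by (simp add: fun_of_x_integral[where g = "%x. (h x)^2" and B = B] continuous_intros ch)
  show "GG fx (%_. 0) = L * (LINT x|?J. (h' x)^2)"
   unfolding GG_def l2_sq fx_def using hz' by (simp add: fun_of_x_integral[where g = "%x. (h' x)^2" and B = B] continuous_intros ch')
 qed
 have tr: "tr f = L * (h 0)^2" unfolding tr_def l2_sq f_def using L by (simp add: measure_Ival)
 have g8: "\<gamma> = - 2 * k" and g2: "\<gamma>^2 / 8 = k^2 / 2" by (simp_all add: k_def power_divide)
 show ?thesis
 proof (rule that[of f fx "%_. 0"])
  show "adm f fx (%_. 0)" using C1 h0 by (simp add: adm_def f_def)
  show "0 < MM f" using I5 c0 L by (simp add: MM H_def)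
  have "QQ f fx (%_. 0) = L * (1 / 2 * (LINT x|?J. (h' x)^2) - k * (h 0)^2)"
   unfolding QQ_def MM tr by (simp add: g8 algebra_simps)
  also have "\<dots> <= L * ((- (k^2 / 2) + e) * H)" using I7 L by (intro mult_left_mono) auto
  finally show "QQ f fx (%_. 0) <= (- (\<gamma>^2 / 8) + e) * MM f" by (simp add: MM g2 algebra_simps)
 qed
qed

lemma Einf_upper: "Einf <= - (\<gamma>^2 / 8) * m"
proof (rule field_le_epsilon)
 fix e :: real assume e: "0 < e"
 have "0 < e / m" using e m by simp
 then obtain f fx fy where f: "adm f fx fy" "0 < MM f" "QQ f fx fy <= (- (\<gamma>^2 / 8) + e / m) * MM f"
  using trial_function by blast
 have "Einf <= m / MM f * QQ f fx fy - (m / MM f) powr (q / 2) * NN f / q" by (rule scaling[OF f(1,2)])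
 also have "\<dots> <= m / MM f * QQ f fx fy" using q NN_nonneg[of f] by simp
 also have "\<dots> <= m / MM f * ((- (\<gamma>^2 / 8) + e / m) * MM f)" using f m by (intro mult_left_mono) auto
 also have "\<dots> = - (\<gamma>^2 / 8) * m + e" using f(2) m by (simp add: field_simps)
 finally show "Einf <= - (\<gamma>^2 / 8) * m + e" .
qed

lemma Einf_neg: "Einf < 0"
proof -
 have "0 < \<gamma>^2 / 8 * m" using \<gamma> m by simp
 then show ?thesis using Einf_upper by simp
qed

end

section \<open>Minimizing sequences do not vanish and are tight\<close>

lemma C1c_mult_x:
 fixes f :: "plane => real" and a :: "real => real"
 assumes f: "C1c f fx fy" and a: "\<And>x. (a has_real_derivative a' x) (at x)" and a': "continuous_on UNIV a'"
 shows "C1c (%z. a (fst z) * f z) (%z. a (fst z) * fx z + a' (fst z) * f z) (%z. a (fst z) * fy z)"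
 unfolding C1c_def
proof (intro conjI allI)
 note F = C1cD[OF f]
 have ca: "continuous_on UNIV a" by (rule continuous_at_imp_continuous_on) (auto intro: DERIV_isCont[OF a])
 have c: "continuous_on UNIV (%z::plane. a (fst z))" "continuous_on UNIV (%z::plane. a' (fst z))"
  by (rule continuous_on_compose2[OF ca] continuous_on_compose2[OF a'], auto intro!: continuous_intros)+
 show "continuous_on UNIV (%z. a (fst z) * f z)" by (intro continuous_intros c F(1))
 show "continuous_on UNIV (%z. a (fst z) * fx z + a' (fst z) * f z)" by (intro continuous_intros c F(1,2))
 show "continuous_on UNIV (%z. a (fst z) * fy z)" by (intro continuous_intros c F(3))
 show "xsupp (%z. a (fst z) * f z)" by (rule xsupp_map[OF F(4)]) simp
 show "xsupp (%z. a (fst z) * fx z + a' (fst z) * f z)" by (rule xsupp_map2[OF F(4,5)]) simp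
 show "xsupp (%z. a (fst z) * fy z)" by (rule xsupp_map[OF F(6)]) simp
 fix x y
 have 1: "((%s. f (s, y)) has_real_derivative fx (x, y)) (at x)"
  using F(7) by (simp add: DERIV_iff_vec)
 have 2: "((%s. f (x, s)) has_real_derivative fy (x, y)) (at y)"
  using F(8) by (simp add: DERIV_iff_vec)
 show "((%s. a (fst (s, y)) * f (s, y)) has_vector_derivative a (fst (x, y)) * fx (x, y) + a' (fst (x, y)) * f (x, y)) (at x)"
  unfolding DERIV_iff_vec[symmetric]
  by (rule DERIV_cong[OF DERIV_mult[OF _ 1]]) (auto intro: a)
 show "((%t. a (fst (x, t)) * f (x, t)) has_vector_derivative a (fst (x, y)) * fy (x, y)) (at y)"
  unfolding DERIV_iff_vec[symmetric]
  using DERIV_cmult[OF 2] by simp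
qed

lemma C1c_shift:
 fixes f :: "plane => real"
 assumes f: "C1c f fx fy"
 shows "C1c (%z. f (fst z + c, snd z)) (%z. fx (fst z + c, snd z)) (%z. fy (fst z + c, snd z))"
 unfolding C1c_def
proof (intro conjI allI)
 note F = C1cD[OF f]
 have cs: "continuous_on UNIV (%z. g (fst z + c, snd z))" if "continuous_on UNIV g" for g :: "plane => real"
  by (rule continuous_on_compose2[OF that]) (auto intro!: continuous_intros)
 have xs: "xsupp (%z. g (fst z + c, snd z))" if g: "xsupp g" for g :: "plane => real"
 proof -
  obtain R where R: "\<And>x y. R < \<bar>x\<bar> ==> g (x, y) = 0" using g unfolding xsupp_def by blast
  show ?thesis unfolding xsupp_def
  proof (intro exI allI impI)
   fix x y :: real assume "R + \<bar>c\<bar> < \<bar>x\<bar>"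
   then show "g (fst (x, y) + c, snd (x, y)) = 0" by (simp add: R)
  qed
 qed
 show "continuous_on UNIV (%z. f (fst z + c, snd z))" "continuous_on UNIV (%z. fx (fst z + c, snd z))"
  "continuous_on UNIV (%z. fy (fst z + c, snd z))" by (rule cs[OF F(1)] cs[OF F(2)] cs[OF F(3)])+
 show "xsupp (%z. f (fst z + c, snd z))" "xsupp (%z. fx (fst z + c, snd z))"
  "xsupp (%z. fy (fst z + c, snd z))" by (rule xs[OF F(4)] xs[OF F(5)] xs[OF F(6)])+
 fix x y
 have 1: "((%s. f (s, y)) has_real_derivative fx (x + c, y)) (at (x + c))"
  using F(7) by (simp add: DERIV_iff_vec)
 have "((%s. f (s + c, y)) has_real_derivative fx (x + c, y)) (at x)"
  using DERIV_shift[of "%s. f (s, y)" "fx (x + c, y)" x c] 1 by simp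
 then show "((%s. f (fst (s, y) + c, snd (s, y))) has_vector_derivative fx (fst (x, y) + c, snd (x, y))) (at x)"
  by (simp add: DERIV_iff_vec)
 show "((%s. f (fst (x, s) + c, snd (x, s))) has_vector_derivative fy (fst (x, y) + c, snd (x, y))) (at y)"
  using F(8) by simp
qed

lemma integral_SL_shift:
 fixes g :: "plane => real"
 assumes c: "continuous_on UNIV g" and x: "xsupp g"
 shows "(LINT z|SL L. g (fst z + c, snd z)) = (LINT z|SL L. g z)"
proof -
 have i: "integrable (SL L) g" by (rule integrable_SL_continuous[OF c x])
 have i': "integrable (SL L) (%z. g (fst z + c, snd z))"
 proof (rule integrable_SL_continuous)
  show "continuous_on UNIV (%z. g (fst z + c, snd z))"
   by (rule continuous_on_compose2[OF c]) (auto intro!: continuous_intros)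
  obtain R where R: "\<And>x y. R < \<bar>x\<bar> ==> g (x, y) = 0" using x unfolding xsupp_def by blast
  show "xsupp (%z. g (fst z + c, snd z))" unfolding xsupp_def
  proof (intro exI allI impI)
   fix x y :: real assume "R + \<bar>c\<bar> < \<bar>x\<bar>"
   then show "g (fst (x, y) + c, snd (x, y)) = 0" by (simp add: R)
  qed
 qed
 have "(LINT x|lborel. g (x + c, y)) = (LINT x|lborel. g (x, y))" for y
  using lborel_integral_real_affine[of 1 "%x. g (x, y)" c] by (simp add: add.commute)
 then show ?thesis
  using integral_SL_snd(1)[OF i] integral_SL_snd(1)[OF i'] by simp
qed

lemma fst_band_sets:
 "{z::plane. R <= \<bar>fst z\<bar>} \<in> sets borel" "{z::plane. R <= \<bar>fst z\<bar> \<and> \<bar>fst z\<bar> < R'} \<in> sets borel"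
proof -
 have "closed {z::plane. R <= \<bar>fst z\<bar>}" by (intro closed_Collect_le continuous_intros)
 then show 1: "{z::plane. R <= \<bar>fst z\<bar>} \<in> sets borel" by simp
 have "open {z::plane. \<bar>fst z\<bar> < R'}" by (intro open_Collect_less continuous_intros)
 then have "{z::plane. \<bar>fst z\<bar> < R'} \<in> sets borel" by simp
 with 1 show "{z::plane. R <= \<bar>fst z\<bar> \<and> \<bar>fst z\<bar> < R'} \<in> sets borel"
  unfolding Collect_conj_eq by (rule sets.Int)
qed

lemma set_SL_sets: "A \<in> sets borel ==> (%z. indicator A z :: real) \<in> borel_measurable (SL L)"
 unfolding SL_eq by (intro measurable_restrict_space1) simp

lemma ind_integrable:
 fixes g :: "plane => real"
 assumes "integrable (SL L) g" "A \<in> sets borel"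
 shows "integrable (SL L) (%z. indicator A z * g z)"
proof (rule Bochner_Integration.integrable_bound[OF assms(1)])
 show "(%z. indicator A z * g z) \<in> borel_measurable (SL L)"
  using set_SL_sets[OF assms(2)] assms(1) by simp
qed (auto simp: indicator_def)

context nls
begin

section \<open>Peaked minimizing sequences\<close>

definition slice :: "(plane => real) => real => real" where
 "slice f x = (l2 (Ival 0 L) (%y. f (x, y)))^2"

text \<open>The trace at 0 is within a factor 2 of the largest cross-section, so in
  \<open>L4_bound\<close> the constant \<open>S\<close> can be taken to be twice the trace.\<close>

definition peaked :: "(plane => real) => (plane => real) => (plane => real) => bool" where
 "peaked f fx fy \<longleftrightarrow> adm f fx fy \<and> MM f = m \<and> (\<forall>x. slice f x <= 2 * tr f)"

lemma minimizing:
 assumes e: "0 < e"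
 obtains f fx fy where "peaked f fx fy" "FF f fx fy < Einf + e"
proof -
 let ?S = "{FF f fx fy |f fx fy. adm f fx fy \<and> MM f = m}"
 have ne: "?S \<noteq> {}"
 proof -
  obtain f fx fy where f: "adm f fx fy" "0 < MM f" using trial_function[of 1, OF zero_less_one] by blast
  define a where "a = sqrt (m / MM f)"
  have a: "0 < a" "a^2 = m / MM f" using m f by (simp_all add: a_def)
  have "adm (%z. a *\<^sub>R f z) (%z. a *\<^sub>R fx z) (%z. a *\<^sub>R fy z)"
   using f a C1c_scale[of f fx fy a] by (auto simp: adm_def)
  moreover have "MM (%z. a *\<^sub>R f z) = m" using f by (simp only: MM_scale a) simp
  ultimately show ?thesis by blast
 qed
 have "Inf ?S < Einf + e" unfolding Einf_def[symmetric] using e by simp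
 from cInf_lessD[OF ne this]
 obtain f fx fy where f: "adm f fx fy" "MM f = m" "FF f fx fy < Einf + e" by blast
 have C: "C1c f fx fy" and f0: "\<And>z. 0 <= f z" using f(1) by (auto simp: adm_def)
 note F = C1cD[OF C]
 have bd: "slice f x <= 2 * (l2 (SL L) f * l2 (SL L) fx)" for x unfolding slice_def by (rule trace_le[OF C])
 have sl0: "0 <= slice f x" for x by (simp add: slice_def)
 \<comment> \<open>If 0 is not good enough, the supremum exceeds \<open>2 * slice f 0\<close>, and
   any point above half the supremum improves on 0.\<close>
 have "\<exists>x0. slice f 0 <= slice f x0 \<and> (\<forall>x. slice f x <= 2 * slice f x0)"
 proof (cases "\<forall>x. slice f x <= 2 * slice f 0")
  case False
  define S where "S = (SUP x. slice f x)"
  have bdd: "bdd_above (range (slice f))" using bd by (intro bdd_aboveI[of _ "2 * (l2 (SL L) f * l2 (SL L) fx)"]) auto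
  have le: "slice f x <= S" for x unfolding S_def by (rule cSUP_upper[OF _ bdd]) simp
  obtain x1 where x1: "2 * slice f 0 < slice f x1" using False by (auto simp: not_le)
  then have S: "0 < S" "2 * slice f 0 < S" using le[of x1] sl0[of 0] by linarith+
  have "S / 2 < S" using S by simp
  then obtain x0 where x0: "S / 2 < slice f x0" using less_cSUP_iff[OF UNIV_not_empty bdd, of "S / 2"] unfolding S_def[symmetric] by auto
  have "slice f x <= 2 * slice f x0" for x using le[of x] x0 by linarith
  moreover have "slice f 0 <= slice f x0" using S x0 by linarith
  ultimately show ?thesis by blast
 qed auto
 then obtain x0 where x0: "slice f 0 <= slice f x0" "\<And>x. slice f x <= 2 * slice f x0" by blast
 define sh where "sh g = (%z::plane. (g (fst z + x0, snd z) :: real))" for g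
 have C': "C1c (sh f) (sh fx) (sh fy)" unfolding sh_def by (rule C1c_shift[OF C])
 have l2s: "l2 (SL L) (sh g) = l2 (SL L) g" if "continuous_on UNIV g" "xsupp g" for g
 proof -
  have "(LINT z|SL L. (norm (sh g z))^2) = (LINT z|SL L. (norm (g z))^2)"
   unfolding sh_def by (rule integral_SL_shift) (auto intro!: continuous_intros that(1) intro: xsupp_map[OF that(2)])
  then show ?thesis by (simp add: l2_def)
 qed
 have N: "NN (sh f) = NN f"
  unfolding NN_def sh_def
 proof (rule integral_SL_shift)
  show "continuous_on UNIV (%z. norm (f z) powr q)"
   by (rule continuous_on_powr') (use q in \<open>auto intro!: continuous_intros F(1)\<close>)
  show "xsupp (%z. norm (f z) powr q)" by (rule xsupp_map[OF F(4)]) simp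
 qed
 have sls: "slice (sh f) x = slice f (x + x0)" for x by (simp add: slice_def sh_def)
 have tr: "tr (sh f) = slice f x0" "tr f = slice f 0" by (simp_all add: tr_def slice_def sh_def)
 have "peaked (sh f) (sh fx) (sh fy)"
  unfolding peaked_def
 proof (intro conjI allI)
  show "adm (sh f) (sh fx) (sh fy)" using C' f0 by (simp add: adm_def sh_def)
  show "MM (sh f) = m" using f(2) l2s[OF F(1,4)] by (simp add: MM_def)
  show "slice (sh f) x <= 2 * tr (sh f)" for x using x0(2) by (simp add: sls tr)
 qed
 moreover have "FF (sh f) (sh fx) (sh fy) <= FF f fx fy"
 proof -
  have "\<gamma> / 2 * slice f x0 <= \<gamma> / 2 * slice f 0" using x0(1) \<gamma> by (intro mult_left_mono_neg) auto
  then show ?thesis unfolding FF_def QQ_def GG_def N tr l2s[OF F(2,5)] l2s[OF F(3,6)] by simp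
 qed
 ultimately show ?thesis using that f(3) by fastforce
qed

lemma GG_bound:
 obtains G0 where "0 <= G0" "\<And>f fx fy. adm f fx fy ==> MM f <= m ==> FF f fx fy <= 0 ==> GG fx fy <= G0"
proof -
 obtain C where C: "\<And>(f :: plane => real) fx fy. C1c f fx fy ==> MM f <= m ==> 1 / 8 * GG fx fy - C <= FF f fx fy"
  using coercive by blast
 show ?thesis
 proof (rule that[of "8 * \<bar>C\<bar>"])
  fix f fx fy assume "adm f fx fy" "MM f <= m" "FF f fx fy <= 0"
  then have "1 / 8 * GG fx fy <= C" using C[of f fx fy] by (simp add: adm_def)
  then show "GG fx fy <= 8 * \<bar>C\<bar>" by simp
 qed simp
qed

abbreviation box :: "(plane) set" where "box \<equiv> {0..1} \<times> {0..L}"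

text \<open>Energy at most \<open>Einf / 2\<close> forces the nonlinear and trace terms together to
  be at least \<open>b\<close>. For peaked functions the nonlinear term is at most
  \<open>b / 2\<close> plus a multiple of the trace, so the trace is bounded below, and
  \<open>slice_local_bound\<close> turns this into mass in the box.\<close>

lemma nonvanishing:
 obtains c1 c2 where "0 < c1" "0 < c2"
  "\<And>f fx fy. peaked f fx fy ==> FF f fx fy <= Einf / 2 ==> c1 <= (LINT z|SL L. indicator box z * (f z)^2)"
  "\<And>f fx fy. peaked f fx fy ==> FF f fx fy <= Einf / 2 ==> c2 <= (LINT z|SL L. indicator box z * \<bar>f z\<bar> powr q)"
proof -
 obtain G0 where G0: "0 <= G0" "\<And>f fx fy. adm f fx fy ==> MM f <= m ==> FF f fx fy <= 0 ==> GG fx fy <= G0"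
  using GG_bound by blast
 define g where "g = sqrt G0"
 have g: "0 <= g" using G0 by (simp add: g_def)
 define D where "D = 1 / L * m + 2 * (sqrt m * g)"
 have D: "0 <= D" using L m g by (simp add: D_def)
 define b where "b = - Einf / 2"
 have b: "0 < b" using Einf_neg by (simp add: b_def)
 \<comment> \<open>Makes the quadratic part of the interpolation equal to
   \<open>b / 2\<close>.\<close>
 define K where "K = (b / (2 * m)) powr (1 / (q - 2))"
 have K: "0 < K" using b m by (simp add: K_def)
 have Kq: "K powr (q - 2) * m = b / 2"
 proof -
  have e: "1 / (q - 2) * (q - 2) = 1" using q by simp
  have "K powr (q - 2) = b / (2 * m)" unfolding K_def powr_powr e using b m by simp
  then show ?thesis using m by simp
 qed
 define E where "E = 2 * (K powr (q - 4) * D) + \<bar>\<gamma>\<bar> / 2"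
 have E: "0 < E"
 proof -
  have "0 <= 2 * (K powr (q - 4) * D)" "0 < \<bar>\<gamma>\<bar> / 2" using D \<gamma> by auto
  then show ?thesis unfolding E_def by linarith
 qed
 define c0 where "c0 = b / 2 / E"
 have c0: "0 < c0" using b E by (simp add: c0_def)
 \<comment> \<open>If \<open>sqrt ml\<close> were below \<open>s0\<close>, then
   \<open>ml + 2 * (sqrt ml * g)\<close> would be below \<open>c0\<close>. The bound by 1 lets
   \<open>ml\<close> be estimated by \<open>s0\<close>.\<close>
 define s0 where "s0 = min 1 (c0 / (2 * (1 + 2 * g)))"
 have s0: "0 < s0" "s0 <= 1" "s0 * (1 + 2 * g) < c0"
 proof -
  show "0 < s0" "s0 <= 1" using c0 g by (auto simp: s0_def)
  have "s0 * (1 + 2 * g) <= (c0 / (2 * (1 + 2 * g))) * (1 + 2 * g)" using g by (intro mult_right_mono) (auto simp: s0_def)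
  also have "\<dots> = c0 / 2" using g by (simp add: field_simps)
  finally show "s0 * (1 + 2 * g) < c0" using c0 by simp
 qed
 define c1 where "c1 = s0^2"
 have c1: "0 < c1" using s0 by (simp add: c1_def)
 \<comment> \<open>Values below \<open>K1\<close> carry at most \<open>K1^2 * L = c1 / 2\<close> of
   the square integral over the box.\<close>
 define K1 where "K1 = sqrt (c1 / (2 * L))"
 have K1: "0 < K1" "K1^2 = c1 / (2 * L)" using c1 L by (simp_all add: K1_def)
 define c2 where "c2 = c1 / 2 / K1 powr (2 - q)"
 have c2: "0 < c2" using c1 K1 by (simp add: c2_def)
 have key: "c1 <= (LINT z|SL L. indicator box z * (f z)^2)" if f: "peaked f fx fy" "FF f fx fy <= Einf / 2" for f fx fy
 proof -
  have a: "adm f fx fy" "MM f = m" "\<And>x. slice f x <= 2 * tr f" and C: "C1c f fx fy"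
   using f(1) by (auto simp: peaked_def adm_def)
  have G: "GG fx fy <= G0" using G0(2)[OF a(1)] a(2) f(2) Einf_neg by simp
  have lf: "l2 (SL L) f = sqrt m" using a(2) by (simp add: MM_def real_sqrt_unique)
  have "(l2 (SL L) fx)^2 <= G0" "(l2 (SL L) fy)^2 <= G0"
   using G zero_le_power2[of "l2 (SL L) fx"] zero_le_power2[of "l2 (SL L) fy"] unfolding GG_def by linarith+
  then have lfx: "l2 (SL L) fx <= g" and lfy: "l2 (SL L) fy <= g" unfolding g_def by (auto intro: real_le_rsqrt)
  have "(LINT z|SL L. norm (f z) ^ 4) <= (2 * tr f) * (1 / L * (l2 (SL L) f)^2 + 2 * (l2 (SL L) f * l2 (SL L) fy))"
   by (rule L4_bound[OF C L]) (use a(3) in \<open>simp add: slice_def l2_sq\<close>)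
  also have "\<dots> <= (2 * tr f) * D"
   unfolding D_def lf using m L tr_nonneg[of f] lfy by (intro mult_left_mono add_mono) auto
  finally have L4: "(LINT z|SL L. norm (f z) ^ 4) <= 2 * tr f * D" .
  have "NN f <= K powr (q - 2) * MM f + K powr (q - 4) * (LINT z|SL L. norm (f z) ^ 4)" by (rule NN_le_L4[OF C K])
  also have "\<dots> <= b / 2 + K powr (q - 4) * (2 * tr f * D)"
   unfolding a(2) Kq using L4 by (intro add_left_mono mult_left_mono) auto
  finally have N: "NN f <= b / 2 + 2 * (K powr (q - 4) * D) * tr f" by (simp add: algebra_simps)
  have Nq: "NN f / q <= NN f" using q NN_nonneg[of f] by (simp add: divide_le_eq mult_left_mono[of 1 q, simplified])
  have "- b \<ge> QQ f fx fy - NN f / q" using f(2) by (simp add: FF_def b_def)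
  moreover have "QQ f fx fy \<ge> - (\<bar>\<gamma>\<bar> / 2 * tr f)" using GG_nonneg[of fx fy] \<gamma> by (simp add: QQ_def)
  ultimately have "b <= NN f + \<bar>\<gamma>\<bar> / 2 * tr f" using Nq by linarith
  then have "b / 2 <= E * tr f" using N unfolding E_def distrib_right by linarith
  then have trc: "c0 <= tr f" unfolding c0_def using pos_divide_le_eq[OF E, of "b / 2" "tr f"] by (simp only: mult.commute[of E "tr f"])
  define ml where "ml = (LINT z|SL L. indicator ({0..1} \<times> {0..L}) z * (norm (f z))^2)"
  have ml0: "0 <= ml" unfolding ml_def by (rule Bochner_Integration.integral_nonneg) simp
  have "tr f <= ml + 2 * (sqrt ml * l2 (SL L) fx)"
   unfolding tr_def l2_sq[of "Ival 0 L"] by (rule slice_local_bound[OF C L ml_def])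
  also have "\<dots> <= ml + 2 * (sqrt ml * g)" using lfx ml0 by (intro add_left_mono mult_left_mono) auto
  finally have t: "c0 <= ml + 2 * (sqrt ml * g)" using trc by linarith
  have "s0 <= sqrt ml"
  proof (rule ccontr)
   assume n: "\<not> s0 <= sqrt ml"
   have "ml = sqrt ml * sqrt ml" using ml0 by simp
   also have "\<dots> <= s0 * 1"
   proof (rule mult_mono)
    show "sqrt ml <= s0" "sqrt ml <= 1" using n s0 by linarith+
   qed (use s0 ml0 in auto)
   finally have "ml + 2 * (sqrt ml * g) <= s0 + 2 * (s0 * g)" using n g by (intro add_mono mult_left_mono mult_right_mono) auto
   also have "\<dots> = s0 * (1 + 2 * g)" by (simp add: algebra_simps)
   finally show False using t s0(3) by linarith
  qed
  then have "s0^2 <= (sqrt ml)^2" using s0 by (intro power_mono) auto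
  then show ?thesis using ml0 by (simp add: c1_def ml_def)
 qed
 moreover have "c2 <= (LINT z|SL L. indicator box z * \<bar>f z\<bar> powr q)" if f: "peaked f fx fy" "FF f fx fy <= Einf / 2" for f fx fy
 proof -
  have C: "C1c f fx fy" using f(1) by (auto simp: peaked_def adm_def)
  note F = C1cD[OF C]
  have bs: "box \<in> sets borel" by (rule box_sets)
  have i1: "integrable (SL L) (%z. indicator box z * (f z)^2)"
   using sqi_integrable[OF C1c_sqi(1)[OF C]] by (intro ind_integrable bs) simp
  have i2: "integrable (SL L) (%z. indicator box z * \<bar>f z\<bar> powr q)"
   using NN_integrable[OF F(1,4)] by (intro ind_integrable bs) simp
  have i3: "integrable (SL L) (%z. indicator box z :: real)" "(LINT z|SL L. indicator box z) = L"
  proof -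
   have "integrable (SL L) (%z. indicator box z * (indicator ({-1..1} \<times> UNIV) z * (1::real)))"
    by (intro ind_integrable bs integrable_SL_box_indicator[of UNIV]) simp
   moreover have "indicator box z * (indicator ({-1..1} \<times> UNIV) z * (1::real)) = indicator box z" for z :: "plane"
    by (auto simp: indicator_def)
   ultimately show i: "integrable (SL L) (%z. indicator box z :: real)" by (simp only:)
   have "(LINT z|SL L. indicator box z) = (LINT z|(Ival 0 1 \<Otimes>\<^sub>M Ival 0 L). (1::real))" using box_integral_SL[of 0 L L 0 1 "%_. 1 :: real"] by simp
   also have "\<dots> = (LINT x|Ival 0 1. (LINT y|Ival 0 L. 1))" using integral_box_fst(1)[of "%_. 1 :: real" 0 1 0 L] by simp
   also have "\<dots> = L" using L by (simp add: measure_Ival)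
   finally show "(LINT z|SL L. indicator box z) = L" .
  qed
  have "c1 <= (LINT z|SL L. indicator box z * (f z)^2)" by (rule key[OF f])
  also have "\<dots> <= (LINT z|SL L. K1^2 * indicator box z + K1 powr (2 - q) * (indicator box z * \<bar>f z\<bar> powr q))"
  proof (rule integral_mono[OF i1])
   show "integrable (SL L) (%z. K1^2 * indicator box z + K1 powr (2 - q) * (indicator box z * \<bar>f z\<bar> powr q))" using i2 i3 by simp
   show "indicator box z * (f z)^2 <= K1^2 * indicator box z + K1 powr (2 - q) * (indicator box z * \<bar>f z\<bar> powr q)" for z
    using square_le_powr[of "\<bar>f z\<bar>" K1 q] K1 q by (auto simp: indicator_def)
  qed
  also have "\<dots> = K1^2 * L + K1 powr (2 - q) * (LINT z|SL L. indicator box z * \<bar>f z\<bar> powr q)" using i2 i3 by simp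
  also have "K1^2 * L = c1 / 2" using K1 L by simp
  finally have "c1 / 2 <= K1 powr (2 - q) * (LINT z|SL L. indicator box z * \<bar>f z\<bar> powr q)" by simp
  then show ?thesis using K1 unfolding c2_def by (simp add: pos_divide_le_eq mult.commute)
 qed
 ultimately show ?thesis using that[OF c1 c2] by blast
qed

section \<open>Splitting of mass\<close>

text \<open>The scaling inequality read backwards. Below mass \<open>m\<close> the exponent gap
  leaves a positive multiple of the nonlinear term, which is a quantitative strict
  subadditivity.\<close>

lemma FF_ge:
 assumes f: "adm f fx fy" and M: "MM f <= m"
 shows "MM f / m * Einf <= FF f fx fy"
  "0 < MM f ==> MM f / m * Einf + ((m / MM f) powr (q / 2 - 1) - 1) * (NN f / q) <= FF f fx fy"
proof -
 have C: "C1c f fx fy" using f by (simp add: adm_def)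
 show strong: "MM f / m * Einf + ((m / MM f) powr (q / 2 - 1) - 1) * (NN f / q) <= FF f fx fy" if M0: "0 < MM f"
 proof -
  have r: "0 < MM f / m" using M0 m by simp
  have "Einf <= m / MM f * QQ f fx fy - (m / MM f) powr (q / 2) * NN f / q" by (rule scaling[OF f M0])
  then have "MM f / m * Einf <= MM f / m * (m / MM f * QQ f fx fy - (m / MM f) powr (q / 2) * NN f / q)"
   using r by (intro mult_left_mono) auto
  also have "\<dots> = QQ f fx fy - (MM f / m * (m / MM f) powr (q / 2)) * (NN f / q)"
   using M0 m by (simp add: right_diff_distrib)
  also have "MM f / m * (m / MM f) powr (q / 2) = (m / MM f) powr (q / 2 - 1)"
   using powr_diff[of "m / MM f" "q / 2" 1] M0 m by (simp add: powr_one)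
  finally show ?thesis unfolding FF_def left_diff_distrib by simp
 qed
 show "MM f / m * Einf <= FF f fx fy"
 proof (cases "MM f = 0")
  case True
  have "NN f <= 1 powr (q - 2) * MM f + 1 powr (q - 4) * (LINT z|SL L. norm (f z) ^ 4)" by (rule NN_le_L4[OF C]) simp
  also have "(LINT z|SL L. norm (f z) ^ 4) <= (1 / L + 2) * (MM f * (MM f + GG fx fy))" by (rule L4_le[OF C])
  finally have "NN f = 0" using NN_nonneg[of f] by (simp add: True)
  moreover have "tr f = 0"
   using trace_le[OF C, of 0] True by (simp add: tr_def MM_def)
  ultimately show ?thesis using GG_nonneg[of fx fy] by (simp add: FF_def QQ_def True)
 next
  case False
  then have M0: "0 < MM f" using MM_nonneg[of f] by simp
  have "1 <= (m / MM f) powr (q / 2 - 1)"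
   using M M0 q m by (intro ge_one_powr_ge_zero) auto
  then have "0 <= ((m / MM f) powr (q / 2 - 1) - 1) * (NN f / q)"
   using NN_nonneg[of f] q by (intro mult_nonneg_nonneg) auto
  then show ?thesis using strong[OF M0] by linarith
 qed
qed

text \<open>The IMS localization with \<open>cos^2 \<theta> + sin^2 \<theta> = 1\<close>, where \<open>\<theta>\<close> rises from 0 to \<open>pi / 2\<close> for \<open>R <= \<bar>x\<bar> <= 2 * R\<close>.\<close>

lemma localization:
 obtains M where "0 <= M" "\<And>f fx fy R. adm f fx fy ==> 0 < R ==>
  \<exists>f1 f1x f1y f2 f2x f2y. adm f1 f1x f1y \<and> adm f2 f2x f2y \<and> MM f1 + MM f2 = MM f \<and>
   GG f1x f1y + GG f2x f2y <= GG fx fy + (M / R)^2 * MM f \<and> tr f1 = tr f \<and> tr f2 = 0 \<and>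
   (\<forall>z. \<bar>fst z\<bar> <= R \<longrightarrow> f1 z = f z) \<and> (\<forall>z. 2 * R <= \<bar>fst z\<bar> \<longrightarrow> f2 z = f z) \<and>
   NN f <= NN f1 + NN f2 + (LINT z|SL L. indicator {z. R <= \<bar>fst z\<bar> \<and> \<bar>fst z\<bar> < 2 * R} z * \<bar>f z\<bar> powr q)"
proof -
 have "csmooth (deriv smooth_step)"
  unfolding csmooth_def using smooth_DERIV(2)[OF smooth_step(1)]
  by (auto intro!: exI[of _ 1] deriv_smooth_step_zero)
 then obtain M0 where M0: "\<And>x. \<bar>deriv smooth_step x\<bar> <= M0" using csmooth_bounded by blast
 have M00: "0 <= M0" using M0[of 0] by linarith
 show ?thesis
 proof (rule that[of "4 * M0"])
  show "0 <= 4 * M0" using M00 by simp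
  fix f fx fy and R :: real assume f: "adm f fx fy" and R: "0 < R"
  have C: "C1c f fx fy" and f0: "\<And>z. 0 <= f z" using f by (auto simp: adm_def)
  note F = C1cD[OF C]
  \<comment> \<open>Quadratic in \<open>x\<close>, hence smooth across 0; it is 0 at
    \<open>\<bar>x\<bar> = R\<close> and 1 at \<open>\<bar>x\<bar> = 2 * R\<close>.\<close>
  define w where "w x = (x^2 / R^2 - 1) / 3" for x
  define \<theta> where "\<theta> x = pi / 2 * smooth_step (w x)" for x
  define \<theta>' where "\<theta>' x = pi / 2 * (deriv smooth_step (w x) * (2 * x / R^2 / 3))" for x
  have Dw: "(w has_real_derivative 2 * x / R^2 / 3) (at x)" for x
   unfolding w_def[abs_def] using R by (auto intro!: derivative_eq_intros simp: field_simps power2_eq_square power4_eq_xxxx)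
  have D\<theta>: "(\<theta> has_real_derivative \<theta>' x) (at x)" for x
   unfolding \<theta>_def[abs_def] \<theta>'_def by (rule DERIV_cmult[OF DERIV_chain2[OF smooth_DERIV(1)[OF smooth_step(1)] Dw]])
  have cw: "continuous_on UNIV w" unfolding w_def using R by (intro continuous_intros) auto
  have c\<theta>: "continuous_on UNIV \<theta>" by (rule continuous_at_imp_continuous_on) (auto intro: DERIV_isCont[OF D\<theta>])
  have c\<theta>': "continuous_on UNIV \<theta>'"
   unfolding \<theta>'_def using R
   by (intro continuous_intros continuous_on_compose2[OF smooth_continuous[OF smooth_DERIV(2)[OF smooth_step(1)]] cw]) auto
  have range: "0 <= \<theta> x" "\<theta> x <= pi / 2" for x
   using smooth_step_bounds[of "w x"] by (auto simp: \<theta>_def mult_left_le)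
  have w0: "w x <= 0" if "\<bar>x\<bar> <= R" for x
  proof -
   have "\<bar>x\<bar>^2 <= R^2" using that by (intro power_mono) auto
   then show ?thesis using R by (simp add: w_def)
  qed
  have w1: "1 <= w x" if "2 * R <= \<bar>x\<bar>" for x
  proof -
   have "(2 * R)^2 <= \<bar>x\<bar>^2" using that R by (intro power_mono) auto
   then have "4 <= x^2 / R^2" using R by (simp add: pos_le_divide_eq power_mult_distrib)
   then show ?thesis by (simp add: w_def)
  qed
  have th0: "\<theta> x = 0" if "\<bar>x\<bar> <= R" for x using smooth_step(2)[OF w0[OF that]] by (simp add: \<theta>_def)
  have th1: "\<theta> x = pi / 2" if "2 * R <= \<bar>x\<bar>" for x using smooth_step(3)[OF w1[OF that]] by (simp add: \<theta>_def)
  have cs1: "cos (\<theta> x) = 0" "sin (\<theta> x) = 1" if "2 * R <= \<bar>x\<bar>" for x by (simp_all only: th1[OF that] cos_pi_half sin_pi_half)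
  have bound: "(\<theta>' x)^2 <= (4 * M0 / R)^2" for x
  proof -
   have "\<bar>\<theta>' x\<bar> <= 4 * M0 / R"
   proof (cases "2 * R <= \<bar>x\<bar>")
    case True
    then show ?thesis using deriv_smooth_step_zero[of "w x"] w1[OF True] M00 R by (simp add: \<theta>'_def)
   next
    case False
    have "\<bar>2 * x / R^2 / 3\<bar> = 2 * \<bar>x\<bar> / (3 * R^2)" by (simp add: abs_mult)
    also have "\<dots> <= 2 * (2 * R) / (3 * R^2)" using False R by (intro divide_right_mono mult_left_mono) auto
    also have "\<dots> = 4 / (3 * R)" using R by (simp add: power2_eq_square)
    finally have x: "\<bar>2 * x / R^2 / 3\<bar> <= 4 / (3 * R)" .
    have "\<bar>\<theta>' x\<bar> <= 2 * (M0 * (4 / (3 * R)))"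
     unfolding \<theta>'_def abs_mult using pi_less_4 M0[of "w x"] x R M00 pi_gt_zero by (intro mult_mono) auto
    also have "\<dots> = (8 / 3) * (M0 / R)" by simp
    also have "\<dots> <= 4 * (M0 / R)" using M00 R by (intro mult_right_mono) auto
    finally show ?thesis by simp
   qed
   then have "\<bar>\<theta>' x\<bar>^2 <= (4 * M0 / R)^2" by (intro power_mono) auto
   then show ?thesis by simp
  qed
  have Dc: "((%x. cos (\<theta> x)) has_real_derivative - sin (\<theta> x) * \<theta>' x) (at x)" for x
   by (rule DERIV_chain2[OF DERIV_cos D\<theta>])
  have Dsn: "((%x. sin (\<theta> x)) has_real_derivative cos (\<theta> x) * \<theta>' x) (at x)" for x
   by (rule DERIV_chain2[OF DERIV_sin D\<theta>])
  define f1 where "f1 = (%z::plane. cos (\<theta> (fst z)) * f z)"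
  define f1x where "f1x = (%z::plane. cos (\<theta> (fst z)) * fx z + (- sin (\<theta> (fst z)) * \<theta>' (fst z)) * f z)"
  define f1y where "f1y = (%z::plane. cos (\<theta> (fst z)) * fy z)"
  define f2 where "f2 = (%z::plane. sin (\<theta> (fst z)) * f z)"
  define f2x where "f2x = (%z::plane. sin (\<theta> (fst z)) * fx z + (cos (\<theta> (fst z)) * \<theta>' (fst z)) * f z)"
  define f2y where "f2y = (%z::plane. sin (\<theta> (fst z)) * fy z)"
  have C1: "C1c f1 f1x f1y" unfolding f1_def f1x_def f1y_def
   by (rule C1c_mult_x[OF C Dc]) (intro continuous_intros c\<theta> c\<theta>')
  have C2: "C1c f2 f2x f2y" unfolding f2_def f2x_def f2y_def
   by (rule C1c_mult_x[OF C Dsn]) (intro continuous_intros c\<theta> c\<theta>')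
  have cs0: "0 <= cos (\<theta> x)" "0 <= sin (\<theta> x)" for x
   using range[of x] pi_gt_zero by (auto intro!: cos_ge_zero sin_ge_zero)
  note i = sqi_integrable[OF C1c_sqi(1)[OF C]] sqi_integrable[OF C1c_sqi(2)[OF C]] sqi_integrable[OF C1c_sqi(3)[OF C]]
  note i1 = sqi_integrable[OF C1c_sqi(1)[OF C1]] sqi_integrable[OF C1c_sqi(2)[OF C1]] sqi_integrable[OF C1c_sqi(3)[OF C1]]
  note i2 = sqi_integrable[OF C1c_sqi(1)[OF C2]] sqi_integrable[OF C1c_sqi(2)[OF C2]] sqi_integrable[OF C1c_sqi(3)[OF C2]]
  have cs2: "(cos t * a)^2 + (sin t * a)^2 = a^2" for t a :: real
  proof -
   have "(cos t * a)^2 + (sin t * a)^2 = ((cos t)^2 + (sin t)^2) * a^2" by (simp only: power_mult_distrib distrib_right)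
   then show ?thesis by simp
  qed
  \<comment> \<open>The mixed terms cancel, because a curve on the unit circle is orthogonal to its
    derivative; only the square of \<open>\<theta>'\<close> times \<open>f\<close> is added.\<close>
  have cs3: "(cos t * a + (- sin t * c) * b)^2 + (sin t * a + (cos t * c) * b)^2 = a^2 + c^2 * b^2" for t a b c :: real
  proof -
   have "(k * a + (- s * c) * b)^2 + (s * a + (k * c) * b)^2 = (k^2 + s^2) * (a^2 + c^2 * b^2)" for k s
    by (simp add: power2_eq_square algebra_simps)
   from this[of "cos t" "sin t"] show ?thesis by simp
  qed
  have e1: "MM f1 + MM f2 = MM f"
  proof -
   have "MM f1 + MM f2 = (LINT z|SL L. (norm (f1 z))^2 + (norm (f2 z))^2)" using i1 i2 by (simp add: MM_def l2_sq)
   also have "\<dots> = MM f" unfolding MM_def l2_sq by (intro Bochner_Integration.integral_cong) (simp_all add: f1_def f2_def cs2)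
   finally show ?thesis .
  qed
  have e2: "GG f1x f1y + GG f2x f2y <= GG fx fy + (4 * M0 / R)^2 * MM f"
  proof -
   have "GG f1x f1y + GG f2x f2y = (LINT z|SL L. ((norm (f1x z))^2 + (norm (f2x z))^2) + ((norm (f1y z))^2 + (norm (f2y z))^2))"
    using i1 i2 by (simp add: GG_def l2_sq)
   also have "\<dots> <= (LINT z|SL L. ((norm (fx z))^2 + (4 * M0 / R)^2 * (norm (f z))^2) + (norm (fy z))^2)"
   proof (rule integral_mono)
    fix z
    have "(norm (f1x z))^2 + (norm (f2x z))^2 = (fx z)^2 + (\<theta>' (fst z))^2 * (f z)^2"
     using cs3[of "\<theta> (fst z)" "fx z" "\<theta>' (fst z)" "f z"] by (simp add: f1x_def f2x_def)
    moreover have "(\<theta>' (fst z))^2 * (f z)^2 <= (4 * M0 / R)^2 * (f z)^2" using bound by (intro mult_right_mono) auto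
    moreover have "(norm (f1y z))^2 + (norm (f2y z))^2 = (fy z)^2" by (simp add: f1y_def f2y_def cs2)
    ultimately show "((norm (f1x z))^2 + (norm (f2x z))^2) + ((norm (f1y z))^2 + (norm (f2y z))^2)
     <= ((norm (fx z))^2 + (4 * M0 / R)^2 * (norm (f z))^2) + (norm (fy z))^2" by simp
   qed (use i i1 i2 in auto)
   also have "\<dots> = GG fx fy + (4 * M0 / R)^2 * MM f" using i by (simp add: GG_def MM_def l2_sq)
   finally show ?thesis .
  qed
  \<comment> \<open>Outside the shell \<open>f\<close> coincides with one of the pieces; inside it
    the whole power of \<open>f\<close> is charged to the shell integral.\<close>
  have e3: "NN f <= NN f1 + NN f2 + (LINT z|SL L. indicator {z. R <= \<bar>fst z\<bar> \<and> \<bar>fst z\<bar> < 2 * R} z * \<bar>f z\<bar> powr q)"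
  proof -
   let ?A = "{z::plane. R <= \<bar>fst z\<bar> \<and> \<bar>fst z\<bar> < 2 * R}"
   have A: "?A \<in> sets borel" by (rule fst_band_sets)
   note j = NN_integrable[OF F(1,4)] NN_integrable[OF C1cD(1,4)[OF C1]] NN_integrable[OF C1cD(1,4)[OF C2]]
   have jA: "integrable (SL L) (%z. indicator ?A z * \<bar>f z\<bar> powr q)" using j(1) by (intro ind_integrable A) simp
   have "NN f <= (LINT z|SL L. (norm (f1 z) powr q + norm (f2 z) powr q) + indicator ?A z * \<bar>f z\<bar> powr q)"
    unfolding NN_def
   proof (rule integral_mono)
    fix z :: "plane"
    consider "\<bar>fst z\<bar> <= R" | "2 * R <= \<bar>fst z\<bar>" | "z \<in> ?A" by fastforce
    then show "norm (f z) powr q <= (norm (f1 z) powr q + norm (f2 z) powr q) + indicator ?A z * \<bar>f z\<bar> powr q"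
    proof cases
     case 1 then show ?thesis using th0[OF 1] by (simp add: f1_def f2_def)
    next
     case 2 then show ?thesis using cs1[OF 2] by (simp add: f1_def f2_def)
    next
     case 3 then show ?thesis by simp
    qed
   qed (use j jA in auto)
   also have "\<dots> = NN f1 + NN f2 + (LINT z|SL L. indicator ?A z * \<bar>f z\<bar> powr q)" using j jA by (simp add: NN_def)
   finally show ?thesis .
  qed
  have e4: "tr f1 = tr f" "tr f2 = 0" using th0[of 0] R by (simp_all add: tr_def f1_def f2_def l2_def)
  have "adm f1 f1x f1y" "adm f2 f2x f2y" using C1 C2 cs0 f0 by (auto simp: adm_def f1_def f2_def)
  moreover have "\<forall>z. \<bar>fst z\<bar> <= R \<longrightarrow> f1 z = f z" using th0 by (simp add: f1_def)
  moreover have "\<forall>z. 2 * R <= \<bar>fst z\<bar> \<longrightarrow> f2 z = f z" using cs1 by (simp add: f2_def)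
  ultimately show "\<exists>f1 f1x f1y f2 f2x f2y. adm f1 f1x f1y \<and> adm f2 f2x f2y \<and> MM f1 + MM f2 = MM f \<and>
   GG f1x f1y + GG f2x f2y <= GG fx fy + (4 * M0 / R)^2 * MM f \<and> tr f1 = tr f \<and> tr f2 = 0 \<and>
   (\<forall>z. \<bar>fst z\<bar> <= R \<longrightarrow> f1 z = f z) \<and> (\<forall>z. 2 * R <= \<bar>fst z\<bar> \<longrightarrow> f2 z = f z) \<and>
   NN f <= NN f1 + NN f2 + (LINT z|SL L. indicator {z. R <= \<bar>fst z\<bar> \<and> \<bar>fst z\<bar> < 2 * R} z * \<bar>f z\<bar> powr q)"
   using e1 e2 e3 e4 by blast
 qed
qed

text \<open>Among \<open>J\<close> disjoint dyadic shells one carries at most the mass \<open>m / J\<close>.\<close>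

lemma shell_pigeonhole:
 fixes f :: "plane => real"
 assumes f: "f \<in> sqi (SL L)" and J: "0 < J"
 obtains j where "J <= j" "j < 2 * J"
  "(LINT z|SL L. indicator {z. 2 ^ j <= \<bar>fst z\<bar> \<and> \<bar>fst z\<bar> < 2 * 2 ^ j} z * (f z)^2) <= MM f / real J"
proof -
 let ?A = "%j. {z::plane. 2 ^ j <= \<bar>fst z\<bar> \<and> \<bar>fst z\<bar> < 2 * 2 ^ j}"
 let ?I = "%j. \<integral>z. indicator (?A j) z * (f z)^2 \<partial>SL L"
 have A: "?A j \<in> sets borel" for j by (rule fst_band_sets)
 have i: "integrable (SL L) (%z. (f z)^2)" using sqi_integrable[OF f] by simp
 have iA: "integrable (SL L) (%z. indicator (?A j) z * (f z)^2)" for j by (rule ind_integrable[OF i A])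
 have dis: "disjoint_family_on ?A {J..<2 * J}"
 proof -
  have d: "?A j \<inter> ?A k = {}" if "j < k" for j k
  proof -
   have "(2::real) ^ Suc j <= 2 ^ k" using that by (intro power_increasing) auto
   then show ?thesis by auto
  qed
  show ?thesis unfolding disjoint_family_on_def
  proof (intro ballI impI)
   fix j k :: nat assume "j \<noteq> k"
   then consider "j < k" | "k < j" by linarith
   then show "?A j \<inter> ?A k = {}"
   proof cases
    case 1 show ?thesis by (rule d[OF 1])
   next
    case 2 show ?thesis using d[OF 2] by blast
   qed
  qed
 qed
 have "(\<Sum>j\<in>{J..<2 * J}. ?I j) = (LINT z|SL L. (\<Sum>j\<in>{J..<2 * J}. indicator (?A j) z * (f z)^2))"
  by (rule Bochner_Integration.integral_sum[symmetric]) (rule iA)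
 also have "\<dots> <= (LINT z|SL L. (f z)^2)"
 proof (rule integral_mono[OF _ i])
  show "integrable (SL L) (%z. \<Sum>j\<in>{J..<2 * J}. indicator (?A j) z * (f z)^2)" by (rule Bochner_Integration.integrable_sum) (rule iA)
  fix z
  have "(\<Sum>j\<in>{J..<2 * J}. indicator (?A j) z) = (indicator (\<Union>j\<in>{J..<2 * J}. ?A j) z :: real)"
   by (rule indicator_UN_disjoint[symmetric, OF _ dis]) simp
  also have "\<dots> <= 1" by (simp add: indicator_def)
  finally have "(\<Sum>j\<in>{J..<2 * J}. indicator (?A j) z) * (f z)^2 <= 1 * (f z)^2" by (rule mult_right_mono) simp
  then show "(\<Sum>j\<in>{J..<2 * J}. indicator (?A j) z * (f z)^2) <= (f z)^2" by (simp add: sum_distrib_right)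
 qed
 also have "\<dots> = MM f" by (simp add: MM_def l2_sq)
 finally have S: "(\<Sum>j\<in>{J..<2 * J}. ?I j) <= MM f" .
 have "\<exists>j\<in>{J..<2 * J}. ?I j <= MM f / real J"
 proof (rule ccontr)
  assume "\<not> ?thesis"
  then have n: "MM f / real J < ?I j" if "j \<in> {J..<2 * J}" for j using that by (meson not_le)
  have "(\<Sum>j\<in>{J..<2 * J}. MM f / real J) < (\<Sum>j\<in>{J..<2 * J}. ?I j)" using J by (intro sum_strict_mono n) auto
  moreover have "(\<Sum>j\<in>{J..<2 * J}. MM f / real J) = MM f" using J by simp
  ultimately show False using S by linarith
 qed
 then obtain j where "j \<in> {J..<2 * J}" "?I j <= MM f / real J" by blast
 then show ?thesis using that[of j] by simp
qed

text \<open>The inner piece inherits the lower bound \<open>c2\<close> for its nonlinear term, so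
  the extra term of \<open>FF_ge\<close> is bounded below uniformly as soon as its mass drops below
  \<open>m - t'\<close>; the outer piece only needs the weak bound.\<close>

lemma tightness:
 assumes t: "0 < t"
 obtains R d where "0 < R" "0 < d"
  "\<And>f fx fy. peaked f fx fy ==> FF f fx fy <= Einf / 2 ==> FF f fx fy <= Einf + d ==>
   (LINT z|SL L. indicator {z. R <= \<bar>fst z\<bar>} z * (f z)^2) <= t"
proof -
 obtain G0 where G0: "0 <= G0" "\<And>f fx fy. adm f fx fy ==> MM f <= m ==> FF f fx fy <= 0 ==> GG fx fy <= G0"
  using GG_bound by blast
 obtain c1 c2 where c: "0 < c1" "0 < c2"
  "\<And>f fx fy. peaked f fx fy ==> FF f fx fy <= Einf / 2 ==> c1 <= (LINT z|SL L. indicator box z * (f z)^2)"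
  "\<And>f fx fy. peaked f fx fy ==> FF f fx fy <= Einf / 2 ==> c2 <= (LINT z|SL L. indicator box z * \<bar>f z\<bar> powr q)"
  using nonvanishing by blast
 obtain M where M: "0 <= M" "\<And>f fx fy R. adm f fx fy ==> 0 < R ==>
  \<exists>f1 f1x f1y f2 f2x f2y. adm f1 f1x f1y \<and> adm f2 f2x f2y \<and> MM f1 + MM f2 = MM f \<and>
   GG f1x f1y + GG f2x f2y <= GG fx fy + (M / R)^2 * MM f \<and> tr f1 = tr f \<and> tr f2 = 0 \<and>
   (\<forall>z. \<bar>fst z\<bar> <= R \<longrightarrow> f1 z = f z) \<and> (\<forall>z. 2 * R <= \<bar>fst z\<bar> \<longrightarrow> f2 z = f z) \<and>
   NN f <= NN f1 + NN f2 + (LINT z|SL L. indicator {z. R <= \<bar>fst z\<bar> \<and> \<bar>fst z\<bar> < 2 * R} z * \<bar>f z\<bar> powr q)"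
  using localization by blast
 \<comment> \<open>Keeps \<open>m - t'\<close> positive.\<close>
 define t' where "t' = min t (m / 2)"
 have t': "0 < t'" "t' <= t" "t' < m" using t m by (auto simp: t'_def)
 define b where "b = (m / (m - t')) powr (q / 2 - 1) - 1"
 have b: "0 < b"
 proof -
  have "1 < m / (m - t')" using t' by (simp add: less_divide_eq)
  then have "1 powr (q / 2 - 1) < (m / (m - t')) powr (q / 2 - 1)" using q by (intro powr_less_mono2) auto
  then show ?thesis by (simp add: b_def)
 qed
 \<comment> \<open>The errors add up to \<open>3 * e\<close>: two from the localization, one from
   the distance to the infimum. A loss of more than \<open>t'\<close> would require
   \<open>4 * e\<close>.\<close>
 define e where "e = b * (c2 / q) / 4"
 have e: "0 < e" using b c q by (simp add: e_def)
 define C4 where "C4 = (1 / L + 2) * (m * (m + G0))"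
 have C4: "0 < C4" using L m G0 by (auto simp: C4_def intro!: mult_pos_pos add_pos_pos add_pos_nonneg)
 define K where "K = (2 * C4 / e) powr (1 / (4 - q))"
 have K: "0 < K" using C4 e by (simp add: K_def)
 have Kq: "K powr (q - 4) * C4 = e / 2"
 proof -
  have 1: "1 / (4 - q) * (q - 4) = - 1" using q by (simp add: field_simps)
  have "K powr (q - 4) = 1 / (2 * C4 / e)" unfolding K_def powr_powr 1 using C4 e by (simp add: powr_minus_divide)
  then show ?thesis using C4 e by simp
 qed
 \<comment> \<open>After \<open>K\<close> has made the quartic part at most \<open>e / 2\<close>,
   \<open>J\<close> makes the square part on a shell of mass \<open>m / J\<close> at most
   \<open>e / 2\<close> and the gradient error of the localization at most \<open>e\<close>.\<close>
 obtain J :: nat where J0: "max (2 * (K powr (q - 2) * m) / e) (M^2 * m / e) + 1 <= real J" using real_arch_simple by blast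
 have J: "0 < J" "K powr (q - 2) * (m / real J) <= e / 2" "1 / 2 * ((M / 2 ^ j)^2 * m) <= e" if "J <= j" for j
 proof -
  have n0: "0 <= 2 * (K powr (q - 2) * m) / e" using m e by simp
  have a: "2 * (K powr (q - 2) * m) / e <= real J" "M^2 * m / e <= real J" "1 <= real J" using J0 n0 by linarith+
  show J: "0 < J" using a(3) by simp
  have "2 * (K powr (q - 2) * m) <= real J * e" using a(1) e by (simp add: pos_divide_le_eq)
  then show "K powr (q - 2) * (m / real J) <= e / 2" using J by (simp add: pos_divide_le_eq field_simps)
  have "real J <= 2 ^ J" using less_exp[of J] by (metis less_imp_le of_nat_le_iff of_nat_numeral of_nat_power)
  also have "\<dots> <= (2::real) ^ j" using that by (intro power_increasing) auto
  also have "\<dots> <= (2 ^ j) * (2 ^ j)" by (rule mult_left_le_imp_le[of 1]) (auto simp: mult_le_cancel_left1)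
  finally have "real J <= (2 ^ j)^2" by (simp add: power2_eq_square)
  then have "M^2 * m / e <= (2 ^ j)^2" using a(2) by linarith
  then have "M^2 * m <= (2 ^ j)^2 * e" using e by (simp add: pos_divide_le_eq)
  then have "M^2 * m / (2 ^ j)^2 <= e" by (simp add: pos_divide_le_eq mult.commute)
  moreover have "0 <= M^2 * m / (2 ^ j)^2" using m by simp
  ultimately show "1 / 2 * ((M / 2 ^ j)^2 * m) <= e" by (simp add: power_divide)
 qed
 show ?thesis
 \<comment> \<open>The shell depends on \<open>f\<close>, but its index stays below
   \<open>2 * J\<close>; this radius encloses all possible shells.\<close>
 proof (rule that[of "2 * 2 ^ (2 * J)" e])
  show "0 < e" by (rule e)
  fix f fx fy assume P: "peaked f fx fy" and F2: "FF f fx fy <= Einf / 2" and Fd: "FF f fx fy <= Einf + e"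
  have a: "adm f fx fy" "MM f = m" and C: "C1c f fx fy" using P by (auto simp: peaked_def adm_def)
  have G: "GG fx fy <= G0" using G0(2)[OF a(1)] a(2) F2 Einf_neg by simp
  note FD = C1cD[OF C]
  obtain j where j: "J <= j" "j < 2 * J"
   "(LINT z|SL L. indicator {z. 2 ^ j <= \<bar>fst z\<bar> \<and> \<bar>fst z\<bar> < 2 * 2 ^ j} z * (f z)^2) <= MM f / real J"
   using shell_pigeonhole[OF C1c_sqi(1)[OF C] J(1)[OF order_refl]] by blast
  define R where "R = (2::real) ^ j"
  have R: "0 < R" "1 <= R" by (auto simp: R_def)
  let ?A = "{z::plane. R <= \<bar>fst z\<bar> \<and> \<bar>fst z\<bar> < 2 * R}"
  have A: "?A \<in> sets borel" by (rule fst_band_sets)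
  obtain f1 f1x f1y f2 f2x f2y where l: "adm f1 f1x f1y" "adm f2 f2x f2y" "MM f1 + MM f2 = MM f"
   "GG f1x f1y + GG f2x f2y <= GG fx fy + (M / R)^2 * MM f" "tr f1 = tr f" "tr f2 = 0"
   "\<And>z. \<bar>fst z\<bar> <= R ==> f1 z = f z" "\<And>z. 2 * R <= \<bar>fst z\<bar> ==> f2 z = f z"
   "NN f <= NN f1 + NN f2 + (LINT z|SL L. indicator ?A z * \<bar>f z\<bar> powr q)"
   using M(2)[OF a(1) R(1)] by blast
  have C1: "C1c f1 f1x f1y" and C2: "C1c f2 f2x f2y" using l(1,2) by (auto simp: adm_def)
  note i2 = sqi_integrable[OF C1c_sqi(1)[OF C]] and i4 = L4_integrable[OF FD(1,4)] and iq = NN_integrable[OF FD(1,4)]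
  have iA2: "integrable (SL L) (%z. indicator ?A z * (f z)^2)" using i2 by (intro ind_integrable A) simp
  have iAq: "integrable (SL L) (%z. indicator ?A z * \<bar>f z\<bar> powr q)" using iq by (intro ind_integrable A) simp
  have NA: "(LINT z|SL L. indicator ?A z * \<bar>f z\<bar> powr q) <= e"
  proof -
   have "(LINT z|SL L. indicator ?A z * \<bar>f z\<bar> powr q)
    <= (LINT z|SL L. K powr (q - 2) * (indicator ?A z * (f z)^2) + K powr (q - 4) * norm (f z) ^ 4)"
   proof (rule integral_mono[OF iAq])
    show "integrable (SL L) (%z. K powr (q - 2) * (indicator ?A z * (f z)^2) + K powr (q - 4) * norm (f z) ^ 4)"
     using iA2 i4 by simp
    show "indicator ?A z * \<bar>f z\<bar> powr q <= K powr (q - 2) * (indicator ?A z * (f z)^2) + K powr (q - 4) * norm (f z) ^ 4" for z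
     using powr_interpolation[of "\<bar>f z\<bar>" K q] K q by (auto simp: indicator_def)
   qed
   also have "\<dots> = K powr (q - 2) * (LINT z|SL L. indicator ?A z * (f z)^2) + K powr (q - 4) * (LINT z|SL L. norm (f z) ^ 4)"
    using iA2 i4 by simp
   also have "\<dots> <= K powr (q - 2) * (m / real J) + K powr (q - 4) * C4"
   proof (intro add_mono mult_left_mono)
    show "(LINT z|SL L. indicator ?A z * (f z)^2) <= m / real J" using j(3) a(2) by (simp add: R_def)
    have "(LINT z|SL L. norm (f z) ^ 4) <= (1 / L + 2) * (MM f * (MM f + GG fx fy))" by (rule L4_le[OF C])
    also have "\<dots> <= C4" unfolding C4_def a(2) using L m G by (intro mult_left_mono add_left_mono) auto
    finally show "(LINT z|SL L. norm (f z) ^ 4) <= C4" .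
   qed auto
   also have "\<dots> <= e" using J(2)[OF order_refl] Kq by linarith
   finally show ?thesis .
  qed
  have Fsum: "FF f1 f1x f1y + FF f2 f2x f2y <= FF f fx fy + 2 * e"
  proof -
   have "(M / R)^2 * m <= 2 * e" using J(3)[OF j(1)] by (simp add: R_def)
   from order_trans[OF l(4)[unfolded a(2)] add_left_mono[OF this]]
   have g: "1 / 2 * (GG f1x f1y + GG f2x f2y) <= 1 / 2 * GG fx fy + e" by argo
   have "NN f / q <= (NN f1 + NN f2 + e) / q" using l(9) NA q by (intro divide_right_mono) auto
   also have "\<dots> = NN f1 / q + NN f2 / q + e / q" by (simp add: add_divide_distrib)
   also have "e / q <= e / 1" using e q by (intro divide_left_mono) auto
   finally have n: "NN f / q <= NN f1 / q + NN f2 / q + e" by simp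
   have gen: "(1 / 2 * G1 + T - N1) + (1 / 2 * G2 + 0 - N2) <= (1 / 2 * G + T - N) + 2 * e"
    if "1 / 2 * (G1 + G2) <= 1 / 2 * G + e" "N <= N1 + N2 + e" for G1 G2 G T N N1 N2 :: real
    using that by argo
   show ?thesis unfolding FF_def QQ_def l(5,6) using gen[OF g n, of "\<gamma> / 2 * tr f"] by simp
  qed
  have M1: "MM f1 <= m" and M2: "MM f2 <= m" using l(3) a(2) MM_nonneg[of f1] MM_nonneg[of f2] by linarith+
  have box1: "f1 z = f z" if "z \<in> box" for z using l(7)[of z] that R(2) by auto
  have NN1: "c2 <= NN f1"
  proof -
   have "c2 <= (LINT z|SL L. indicator box z * \<bar>f z\<bar> powr q)" by (rule c(4)[OF P F2])
   also have "\<dots> <= NN f1"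
    unfolding NN_def
   proof (rule integral_mono)
    show "integrable (SL L) (%z. indicator box z * \<bar>f z\<bar> powr q)" using iq by (intro ind_integrable box_sets) simp
    show "integrable (SL L) (%z. norm (f1 z) powr q)" by (rule NN_integrable[OF C1cD(1,4)[OF C1]])
    show "indicator box z * \<bar>f z\<bar> powr q <= norm (f1 z) powr q" for z using box1[of z] by (auto simp: indicator_def)
   qed
   finally show ?thesis .
  qed
  have MM1: "0 < MM f1"
  proof -
   have "c1 <= (LINT z|SL L. indicator box z * (f z)^2)" by (rule c(3)[OF P F2])
   also have "\<dots> <= MM f1"
    unfolding MM_def l2_sq
   proof (rule integral_mono)
    show "integrable (SL L) (%z. indicator box z * (f z)^2)" using i2 by (intro ind_integrable box_sets) simp
    show "integrable (SL L) (%z. (norm (f1 z))^2)" by (rule sqi_integrable[OF C1c_sqi(1)[OF C1]])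
    show "indicator box z * (f z)^2 <= (norm (f1 z))^2" for z using box1[of z] by (auto simp: indicator_def)
   qed
   finally show ?thesis using c(1) by linarith
  qed
  define X where "X = (m / MM f1) powr (q / 2 - 1) - 1"
  have X0: "0 <= X" unfolding X_def using M1 MM1 q m by (simp add: ge_one_powr_ge_zero)
  have s1: "MM f1 / m * Einf + X * (NN f1 / q) <= FF f1 f1x f1y" unfolding X_def by (rule FF_ge(2)[OF l(1) M1 MM1])
  have s2: "MM f2 / m * Einf <= FF f2 f2x f2y" by (rule FF_ge(1)[OF l(2) M2])
  have "MM f1 / m * Einf + MM f2 / m * Einf = (MM f1 + MM f2) / m * Einf" by (simp add: add_divide_distrib distrib_right)
  then have s3: "MM f1 / m * Einf + MM f2 / m * Einf = Einf" using l(3) a(2) m by simp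
  have "X * (NN f1 / q) <= 3 * e" using s1 s2 s3 Fsum Fd by linarith
  moreover have "X * (c2 / q) <= X * (NN f1 / q)" using NN1 X0 q by (intro mult_left_mono divide_right_mono) auto
  ultimately have "X * (c2 / q) <= 3 * e" by linarith
  also have "3 * e < 4 * e" using e by simp
  also have "\<dots> = b * (c2 / q)" unfolding e_def by (rule nonzero_mult_div_cancel_left[OF zero_neq_numeral[symmetric], THEN trans[rotated]]) (simp only: times_divide_eq_right)
  finally have Xb: "X < b" by (rule mult_right_less_imp_less) (use c(2) q in simp)
  have "m - t' <= MM f1"
  proof (rule ccontr)
   assume n: "\<not> m - t' <= MM f1"
   have "m / (m - t') <= m / MM f1" using n m MM1 t' by (intro divide_left_mono) auto
   then have "(m / (m - t')) powr (q / 2 - 1) <= (m / MM f1) powr (q / 2 - 1)"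
    using q m t' by (intro powr_mono2) auto
   then show False using Xb by (simp add: X_def b_def)
  qed
  then have M2t: "MM f2 <= t" using l(3) a(2) t' by linarith
  let ?B = "{z::plane. 2 * 2 ^ (2 * J) <= \<bar>fst z\<bar>}"
  have B: "?B \<in> sets borel" by (rule fst_band_sets)
  have "R <= 2 ^ (2 * J)" unfolding R_def using j(2) by (intro power_increasing) auto
  then have eqB: "f2 z = f z" if "z \<in> ?B" for z using l(8)[of z] that by auto
  have "(LINT z|SL L. indicator ?B z * (f z)^2) <= MM f2"
   unfolding MM_def l2_sq
  proof (rule integral_mono)
   show "integrable (SL L) (%z. indicator ?B z * (f z)^2)" using i2 by (intro ind_integrable B) simp
   show "integrable (SL L) (%z. (norm (f2 z))^2)" by (rule sqi_integrable[OF C1c_sqi(1)[OF C2]])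
   show "indicator ?B z * (f z)^2 <= (norm (f2 z))^2" for z using eqB[of z] by (auto simp: indicator_def)
  qed
  then show "(LINT z|SL L. indicator ?B z * (f z)^2) <= t" using M2t by linarith
 qed simp
qed

end

section \<open>Compactness and existence of a minimizer\<close>

lemma integral_Ival_split:
 fixes f :: "real => real"
 assumes "a <= b" "b <= c" and i: "integrable (Ival a c) f"
 shows "integral\<^sup>L (Ival a c) f = integral\<^sup>L (Ival a b) f + integral\<^sup>L (Ival b c) f"
proof -
 have i': "set_integrable lborel {a..c} f" using i by (simp add: integrable_Ival set_integrable_def)
 have s: "set_integrable lborel {a..b} f" "set_integrable lborel {b..c} f"
  by (rule set_integrable_subset[OF i']; use assms in auto)+
 have "(LINT x:{a..b} \<union> {b..c}|lborel. f x) = (LINT x:{a..b}|lborel. f x) + (LINT x:{b..c}|lborel. f x)"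
 proof (rule set_integral_Un_AE[OF _ _ _ s])
  show "AE x in lborel. \<not> (x \<in> {a..b} \<and> x \<in> {b..c})"
   by (rule AE_mp[OF AE_lborel_singleton[of b]]) auto
 qed simp_all
 moreover have "{a..b} \<union> {b..c} = {a..c}" using assms by auto
 ultimately show ?thesis by (simp add: integral_Ival set_lebesgue_integral_def)
qed

lemma integral_box_split_x:
 fixes f :: "plane => real"
 assumes h: "0 <= h" and f: "continuous_on UNIV f"
 shows "(LINT z|(Ival a (a + real n * h) \<Otimes>\<^sub>M Ival c d). f z) =
  (\<Sum>i<n. \<integral>z. f z \<partial>(Ival (a + real i * h) (a + real (Suc i) * h) \<Otimes>\<^sub>M Ival c d))"
proof (induct n)
 case 0
 have "AE x in Ival a a. False"
 proof -
  have "AE x in lborel. x \<in> {a..a} \<longrightarrow> False" by (rule AE_mp[OF AE_lborel_singleton[of a]]) auto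
  then show ?thesis unfolding Ival_def by (subst AE_restrict_space_iff) auto
 qed
 then have "(LINT x|Ival a a. (LINT y|Ival c d. f (x, y))) = (LINT x|Ival a a. 0)"
  using integral_box_fst(2)[OF f, of a a c d] by (intro integral_cong_AE) auto
 then show ?case by (simp add: integral_box_fst(1)[OF f])
next
 case (Suc n)
 have "0 <= real n * h" using h by simp
 then have "(LINT z|(Ival a (a + real (Suc n) * h) \<Otimes>\<^sub>M Ival c d). f z) =
  (LINT z|(Ival a (a + real n * h) \<Otimes>\<^sub>M Ival c d). f z) +
  (LINT z|(Ival (a + real n * h) (a + real (Suc n) * h) \<Otimes>\<^sub>M Ival c d). f z)"
  unfolding integral_box_fst(1)[OF f] using h
  by (intro integral_Ival_split integral_box_fst(2)[OF f]) (auto simp: distrib_right)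
 then show ?case by (simp only: Suc sum.lessThan_Suc)
qed

lemma integral_box_split_y:
 fixes f :: "plane => real"
 assumes h: "0 <= h" and f: "continuous_on UNIV f"
 shows "(LINT z|(Ival a b \<Otimes>\<^sub>M Ival c (c + real n * h)). f z) =
  (\<Sum>i<n. \<integral>z. f z \<partial>(Ival a b \<Otimes>\<^sub>M Ival (c + real i * h) (c + real (Suc i) * h)))"
proof -
 have sw: "(LINT z|(Ival a b \<Otimes>\<^sub>M Ival c' d'). f z) = (LINT z|(Ival c' d' \<Otimes>\<^sub>M Ival a b). f (snd z, fst z))" for c' d'
 proof -
  have "continuous_on UNIV (%z. f (snd z, fst z))"
   by (rule continuous_on_compose2[OF f]) (auto intro!: continuous_intros)
  from integral_box_fst(1)[OF this] show ?thesis by (simp add: integral_box_snd(1)[OF f])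
 qed
 have "continuous_on UNIV (%z. f (snd z, fst z))"
  by (rule continuous_on_compose2[OF f]) (auto intro!: continuous_intros)
 from integral_box_split_x[OF h this] show ?thesis by (simp only: sw)
qed

context strip_width
begin

text \<open>For \<open>i < 2 * N * N\<close> and \<open>j < N\<close> these tile
  \<open>[-N, N]\<close> times \<open>[0, L]\<close>. The box grows with \<open>N\<close> while the
  cells shrink, so one parameter serves tightness and the Poincare constant.\<close>

definition cell :: "nat => nat => nat => (plane) measure" where
 "cell N i j = Ival (- real N + real i * (1 / real N)) (- real N + real (Suc i) * (1 / real N)) \<Otimes>\<^sub>M
  Ival (0 + real j * (L / real N)) (0 + real (Suc j) * (L / real N))"

lemma cells:
 fixes f :: "plane => real"
 assumes N: "0 < N" and f: "continuous_on UNIV f"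
 shows "(LINT z|(Ival (- real N) (real N) \<Otimes>\<^sub>M Ival 0 L). f z) = (\<Sum>i<2 * N * N. \<Sum>j<N. \<integral>z. f z \<partial>cell N i j)"
proof -
 have e: "- real N + real (2 * N * N) * (1 / real N) = real N" "0 + real N * (L / real N) = L" using N by simp_all
 have "(LINT z|(Ival (- real N) (real N) \<Otimes>\<^sub>M Ival 0 L). f z) = (\<Sum>i<2 * N * N. \<integral>z. f z \<partial>(
  Ival (- real N + real i * (1 / real N)) (- real N + real (Suc i) * (1 / real N)) \<Otimes>\<^sub>M Ival 0 L))"
  using integral_box_split_x[OF _ f, of "1 / real N" "- real N" "2 * N * N" 0 L] by (simp only: e) simp
 also have "\<dots> = (\<Sum>i<2 * N * N. \<Sum>j<N. \<integral>z. f z \<partial>cell N i j)"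
  unfolding cell_def using integral_box_split_y[OF _ f, of "L / real N" _ _ 0 N] L
  by (intro sum.cong refl) (simp only: e, simp)
 finally show ?thesis .
qed

lemma cell_sum_bound:
 fixes f :: "plane => real"
 assumes N: "0 < N" and C: "C1c f fx fy"
 shows "(LINT z|(Ival (- real N) (real N) \<Otimes>\<^sub>M Ival 0 L). (f z)^2) <=
  (real N)^2 / L * (\<Sum>i<2 * N * N. \<Sum>j<N. (LINT z|cell N i j. f z)^2) +
  (1 + L^2) / (real N)^2 * (LINT z|(Ival (- real N) (real N) \<Otimes>\<^sub>M Ival 0 L). (fx z)^2 + (fy z)^2)"
proof -
 note F = C1cD[OF C]
 define a where "a = (real N)^2 / L"
 define b where "b = (1 + L^2) / (real N)^2"
 have P: "(LINT z|cell N i j. (f z)^2) <= a * (LINT z|cell N i j. f z)^2 + b * (LINT z|cell N i j. (fx z)^2 + (fy z)^2)" for i j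
 proof -
  have d: "(- real N + real (Suc i) * (1 / real N)) - (- real N + real i * (1 / real N)) = 1 / real N"
   "(0 + real (Suc j) * (L / real N)) - (0 + real j * (L / real N)) = L / real N"
   by (simp_all add: algebra_simps add_divide_distrib)
  have le: "- real N + real i * (1 / real N) <= - real N + real (Suc i) * (1 / real N)"
   "0 + real j * (L / real N) <= 0 + real (Suc j) * (L / real N)"
   using d L N by (smt (verit) divide_nonneg_nonneg of_nat_0_le_iff)+
  have pos: "0 < 1 / real N * (L / real N)" using L N by simp
  have gen: "X <= 1 / v * Y + w * Z" if "v * X <= Y + v * w * Z" "0 < v" for v w X Y Z :: real
   using that by (simp add: field_simps)
  have "(LINT z|cell N i j. (f z)^2) <= 1 / (1 / real N * (L / real N)) * (LINT z|cell N i j. f z)^2 +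
   ((1 / real N)^2 + (L / real N)^2) * (LINT z|cell N i j. (fx z)^2 + (fy z)^2)"
   using Poincare_box[OF C le, unfolded d, folded cell_def] by (rule gen[OF _ pos])
  moreover have "1 / (1 / real N * (L / real N)) = a" using N L by (simp add: a_def power2_eq_square)
  moreover have "(1 / real N)^2 + (L / real N)^2 = b" by (simp add: b_def power_divide add_divide_distrib)
  ultimately show ?thesis by (simp only:)
 qed
 have "(LINT z|(Ival (- real N) (real N) \<Otimes>\<^sub>M Ival 0 L). (f z)^2) = (\<Sum>i<2 * N * N. \<Sum>j<N. \<integral>z. (f z)^2 \<partial>cell N i j)"
  by (rule cells[OF N]) (intro continuous_intros F(1))
 also have "\<dots> <= (\<Sum>i<2 * N * N. \<Sum>j<N. a * (LINT z|cell N i j. f z)^2 + b * (LINT z|cell N i j. (fx z)^2 + (fy z)^2))"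
  by (intro sum_mono P)
 also have "\<dots> = a * (\<Sum>i<2 * N * N. \<Sum>j<N. (LINT z|cell N i j. f z)^2) + b * (\<Sum>i<2 * N * N. \<Sum>j<N. \<integral>z. (fx z)^2 + (fy z)^2 \<partial>cell N i j)"
  by (simp only: sum.distrib sum_distrib_left)
 also have "(\<Sum>i<2 * N * N. \<Sum>j<N. \<integral>z. (fx z)^2 + (fy z)^2 \<partial>cell N i j) = (LINT z|(Ival (- real N) (real N) \<Otimes>\<^sub>M Ival 0 L). (fx z)^2 + (fy z)^2)"
  by (rule cells[OF N, symmetric]) (intro continuous_intros F(2,3))
 finally show ?thesis unfolding a_def b_def .
qed

lemma box_integral_le:
 fixes g :: "plane => real"
 assumes "0 <= c" "d <= L" "integrable (SL L) g" "\<And>z. 0 <= g z"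
 shows "(LINT z|(Ival a b \<Otimes>\<^sub>M Ival c d). g z) <= (LINT z|SL L. g z)"
proof -
 have "(LINT z|(Ival a b \<Otimes>\<^sub>M Ival c d). g z) = (LINT z|SL L. indicator ({a..b} \<times> {c..d}) z * g z)"
  using box_integral_SL[OF assms(1,2), of a b g] by simp
 also have "\<dots> <= (LINT z|SL L. g z)"
  by (rule integral_mono[OF ind_integrable[OF assms(3) box_sets] assms(3)]) (use assms(4) in \<open>auto simp: indicator_def\<close>)
 finally show ?thesis .
qed

lemma cell_integral_bounded:
 fixes f :: "plane => real"
 assumes C: "C1c f fx fy" and j: "j < N"
 shows "\<bar>\<integral>z. f z \<partial>cell N i j\<bar> <= measure (cell N i j) (space (cell N i j)) + (l2 (SL L) f)^2"
proof -
 note F = C1cD[OF C]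
 have c: "0 <= 0 + real j * (L / real N)" "0 + real (Suc j) * (L / real N) <= L"
 proof -
  show "0 <= 0 + real j * (L / real N)" using L by simp
  have "real (Suc j) * (L / real N) <= real N * (L / real N)" using j L by (intro mult_right_mono) auto
  then show "0 + real (Suc j) * (L / real N) <= L" using j by simp
 qed
 have i: "integrable (cell N i j) f" "integrable (cell N i j) (%z. (f z)^2)" "integrable (cell N i j) (%z. 1 + (f z)^2)"
  "integrable (cell N i j) (%z. 1::real)"
  unfolding cell_def by (rule integrable_box, intro continuous_intros F(1))+
 have "norm (LINT z|cell N i j. f z) <= (LINT z|cell N i j. 1 + (f z)^2)"
 proof (rule norm_integral_le[OF i(3)], intro AE_I2)
  fix z show "norm (f z) <= 1 + (f z)^2"
  proof -
   have "0 <= (\<bar>f z\<bar> - 1)^2" by simp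
   then have "2 * \<bar>f z\<bar> <= 1 + (f z)^2" by (simp add: power2_diff)
   then show ?thesis by simp
  qed
 qed
 also have "\<dots> = measure (cell N i j) (space (cell N i j)) + (LINT z|cell N i j. (f z)^2)" using i by simp
 also have "(LINT z|cell N i j. (f z)^2) <= (LINT z|SL L. (f z)^2)"
  unfolding cell_def by (rule box_integral_le[OF c]) (use sqi_integrable[OF C1c_sqi(1)[OF C]] in simp_all)
 finally show ?thesis by (simp add: l2_sq)
qed

text \<open>A diagonal sequence makes the averages over all grid cells converge; the rest is controlled by
 the Poincare inequality on the cells and by tightness.\<close>

lemma Rellich:
 fixes f :: "nat => plane => real"
 assumes C: "\<And>n. C1c (f n) (fx n) (fy n)" and M: "\<And>n. (l2 (SL L) (f n))^2 <= M"
  and G: "\<And>n. (l2 (SL L) (fx n))^2 + (l2 (SL L) (fy n))^2 <= G"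
  and tight: "\<And>t. 0 < t ==> \<exists>R. \<forall>\<^sub>F n in sequentially. (LINT z|SL L. indicator {z. R <= \<bar>fst z\<bar>} z * (f n z)^2) <= t"
 obtains r where "strict_mono (r :: nat => nat)"
  "\<And>e. 0 < e ==> \<exists>N. \<forall>n\<ge>N. \<forall>k\<ge>N. l2 (SL L) (%z. f (r n) z - f (r k) z) < e"
proof -
 \<comment> \<open>One enumeration covers the grids of all sizes, so that a single diagonal sequence
   serves every \<open>N\<close>; indices outside the strip get the value 0.\<close>
 define A where "A k n = (case from_nat k of (N, i, j) => if j < N then \<integral>z. f n z \<partial>cell N i j else 0)" for k n :: nat
 have bA: "bounded (range (A k))" for k
 proof -
  obtain N i j where k: "from_nat k = (N::nat, i::nat, j::nat)" by (metis prod_cases3)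
  have "\<bar>A k n\<bar> <= measure (cell N i j) (space (cell N i j)) + M" for n
  proof (cases "j < N")
   case True
   then show ?thesis using cell_integral_bounded[OF C True, of i n] M[of n] by (simp add: A_def k)
  next
   case False
   have "0 <= M" using M[of 0] zero_le_power2[of "l2 (SL L) (f 0)"] by linarith
   then show ?thesis using False by (simp add: A_def k)
  qed
  then show ?thesis unfolding bounded_iff by (auto intro!: exI)
 qed
 interpret subseqs "%k s. convergent (%n. A k (s n))"
 proof
  fix k and s :: "nat => nat" assume "strict_mono s"
  have "bounded (range (%n. A k (s n)))" by (rule bounded_subset[OF bA[of k]]) auto
  then obtain l r where "strict_mono r" "((%n. A k (s n)) \<circ> r) \<longlonglongrightarrow> l"
   using bounded_imp_convergent_subsequence by blast
  then show "\<exists>r'. strict_mono r' \<and> convergent (%n. A k ((s \<circ> r') n))"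
   by (auto simp: convergent_def o_def)
 qed
 define r where "r = diagseq"
 have r: "strict_mono r" unfolding r_def by (rule subseq_diagseq)
 have conv: "convergent (%n. A k (r n))" for k
 proof -
  have "convergent (%n. A k ((diagseq \<circ> (+) (Suc k)) n))"
  proof (rule diagseq_holds)
   fix r s :: "nat => nat" and n assume "strict_mono r" "convergent (%i. A n (s i))"
   then show "convergent (%i. A n ((s \<circ> r) i))"
    using convergent_subseq_convergent[of "%i. A n (s i)" r] by (simp add: o_def)
  qed
  then have "convergent (%n. A k (r (n + Suc k)))" by (simp add: r_def o_def add.commute)
  then show ?thesis by (rule convergent_ignore_initial_segment[THEN iffD1])
 qed
 have cell_conv: "\<exists>l. (%n. \<integral>z. f (r n) z \<partial>cell N i j) \<longlonglongrightarrow> l" if "j < N" for N i j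
  using conv[of "to_nat (N, i, j)"] that by (simp add: A_def convergent_def)
 show ?thesis
 proof (rule that[OF r])
  fix e :: real assume e: "0 < e"
  \<comment> \<open>The tails contribute at most \<open>4 * t = e^2 / 8\<close>, the averages and
    the gradients \<open>e^2 / 4\<close> each, together less than \<open>e^2\<close>.\<close>
  define t where "t = e^2 / 32"
  have t: "0 < t" using e by (simp add: t_def)
  obtain R where R: "\<forall>\<^sub>F n in sequentially. (LINT z|SL L. indicator {z. R <= \<bar>fst z\<bar>} z * (f n z)^2) <= t"
   using tight[OF t] by blast
  have G0: "0 <= G" using G[of 0] by (smt (verit) zero_le_power2)
  \<comment> \<open>\<open>N\<close> is at once the half-length of the box, beyond the tightness
    radius, and the fineness of the grid.\<close>
  obtain N :: nat where N0: "max (max 1 R) ((1 + L^2) * (4 * G) / (e^2 / 4)) <= real N" using real_arch_simple by blast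
  have N: "0 < N" "R <= real N" "1 <= real N" using N0 by auto
  have NG: "(1 + L^2) / (real N)^2 * (4 * G) <= e^2 / 4"
  proof -
   have "real N * 1 <= real N * real N" using N by (intro mult_left_mono) auto
   then have "real N <= (real N)^2" by (simp only: power2_eq_square mult_1_right)
   moreover have "(1 + L^2) * (4 * G) / (e^2 / 4) <= real N" using N0 unfolding max.bounded_iff by blast
   ultimately have "(1 + L^2) * (4 * G) / (e^2 / 4) <= (real N)^2" by (rule order_trans[rotated])
   then have "(1 + L^2) * (4 * G) <= (real N)^2 * (e^2 / 4)" using e by (subst (asm) pos_divide_le_eq) auto
   then have "(1 + L^2) * (4 * G) / (real N)^2 <= e^2 / 4" using N by (subst pos_divide_le_eq) (auto simp: mult.commute)
   then show ?thesis by simp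
  qed
  define a where "a i j n = (LINT z|cell N i j. f (r n) z)" for i j n
  define l where "l i j = lim (a i j)" for i j
  have l: "a i j \<longlonglongrightarrow> l i j" if "j < N" for i j
  proof -
   have "convergent (a i j)" using cell_conv[OF that, of i] by (auto simp: convergent_def a_def[abs_def])
   then show ?thesis by (simp add: convergent_LIMSEQ_iff l_def)
  qed
  define S where "S n = (\<Sum>i<2 * N * N. \<Sum>j<N. (a i j n - l i j)^2)" for n
  have "S \<longlonglongrightarrow> (\<Sum>i<2 * N * N. \<Sum>j<N. (l i j - l i j)^2)"
   unfolding S_def by (intro tendsto_sum tendsto_power tendsto_diff tendsto_const l) auto
  then have S0: "S \<longlonglongrightarrow> 0" by simp
  define s where "s = e^2 / 16 / ((real N)^2 / L)"
  have s: "0 < s" "(real N)^2 / L * s = e^2 / 16" using e N L by (simp_all add: s_def)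
  have "\<forall>\<^sub>F n in sequentially. S n < s" by (rule order_tendstoD(2)[OF S0 s(1)])
  moreover have "\<forall>\<^sub>F n in sequentially. (LINT z|SL L. indicator {z. R <= \<bar>fst z\<bar>} z * (f (r n) z)^2) <= t"
   using eventually_subseq[OF r R] .
  ultimately have "\<forall>\<^sub>F n in sequentially. S n < s \<and> (LINT z|SL L. indicator {z. R <= \<bar>fst z\<bar>} z * (f (r n) z)^2) <= t"
   by (rule eventually_conj)
  then obtain K where K: "\<And>n. K <= n ==> S n < s" "\<And>n. K <= n ==> (LINT z|SL L. indicator {z. R <= \<bar>fst z\<bar>} z * (f (r n) z)^2) <= t"
   unfolding eventually_sequentially by blast
  show "\<exists>K. \<forall>n\<ge>K. \<forall>k\<ge>K. l2 (SL L) (%z. f (r n) z - f (r k) z) < e"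
  proof (intro exI allI impI)
   fix n k assume n: "K <= n" and k: "K <= k"
   define d where "d = (%z. f (r n) z - f (r k) z)"
   define dx where "dx = (%z. fx (r n) z - fx (r k) z)"
   define dy where "dy = (%z. fy (r n) z - fy (r k) z)"
   have D: "C1c d dx dy" unfolding d_def dx_def dy_def by (rule C1c_diff[OF C C])
   have sqd: "(x - y)^2 <= 2 * x^2 + 2 * y^2" for x y :: real
   proof -
    have "0 <= (x + y)^2" by simp
    then show ?thesis by (simp add: power2_sum power2_diff)
   qed
   let ?B = "Ival (- real N) (real N) \<Otimes>\<^sub>M Ival 0 L"
   let ?T = "{z::plane. R <= \<bar>fst z\<bar>}"
   have T: "?T \<in> sets borel" by (rule fst_band_sets)
   note in2 = sqi_integrable[OF C1c_sqi(1)[OF C]] and ix2 = sqi_integrable[OF C1c_sqi(2)[OF C]]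
    and iy2 = sqi_integrable[OF C1c_sqi(3)[OF C]]
   note id2 = sqi_integrable[OF C1c_sqi(1)[OF D]] sqi_integrable[OF C1c_sqi(2)[OF D]] sqi_integrable[OF C1c_sqi(3)[OF D]]
   have iT: "integrable (SL L) (%z. indicator ?T z * (f i z)^2)" for i using in2[of i] by (intro ind_integrable T) simp
   have iB: "integrable (SL L) (%z. indicator ({- real N..real N} \<times> {0..L}) z * (d z)^2)"
    using id2(1) by (intro ind_integrable box_sets) simp
   have split: "(l2 (SL L) d)^2 <= (LINT z|?B. (d z)^2) + 4 * t"
   proof -
    have "(l2 (SL L) d)^2 <= (LINT z|SL L. indicator ({- real N..real N} \<times> {0..L}) z * (d z)^2 +
      (2 * (indicator ?T z * (f (r n) z)^2) + 2 * (indicator ?T z * (f (r k) z)^2)))"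
     unfolding l2_sq
    proof (rule integral_mono[OF id2(1)])
     show "integrable (SL L) (%z. indicator ({- real N..real N} \<times> {0..L}) z * (d z)^2 +
      (2 * (indicator ?T z * (f (r n) z)^2) + 2 * (indicator ?T z * (f (r k) z)^2)))" using iB iT by simp
     fix z assume "z \<in> space (SL L)"
     then have z: "snd z \<in> {0..L}" by (auto simp: strip_def)
     show "(norm (d z))^2 <= indicator ({- real N..real N} \<times> {0..L}) z * (d z)^2 +
      (2 * (indicator ?T z * (f (r n) z)^2) + 2 * (indicator ?T z * (f (r k) z)^2))"
     proof (cases "\<bar>fst z\<bar> <= real N")
      case True
      then have "z \<in> {- real N..real N} \<times> {0..L}" using z by (auto simp: mem_Times_iff)
      then show ?thesis by simp
     next
      case False
      then have "z \<in> ?T" using N by simp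
      moreover have "z \<notin> {- real N..real N} \<times> {0..L}" using False by (auto simp: mem_Times_iff)
      ultimately show ?thesis using sqd[of "f (r n) z" "f (r k) z"] by (simp only: d_def indicator_simps) simp
     qed
    qed
    also have "\<dots> = (LINT z|SL L. indicator ({- real N..real N} \<times> {0..L}) z * (d z)^2) +
     (2 * (LINT z|SL L. indicator ?T z * (f (r n) z)^2) + 2 * (LINT z|SL L. indicator ?T z * (f (r k) z)^2))"
     using iB iT by simp
    also have "(LINT z|SL L. indicator ({- real N..real N} \<times> {0..L}) z * (d z)^2) = (LINT z|?B. (d z)^2)"
     using box_integral_SL[of 0 L L "- real N" "real N" "%z. (d z)^2"] by simp
    finally show ?thesis using K(2)[OF n] K(2)[OF k] by linarith
   qed
   have grad: "(LINT z|?B. (dx z)^2 + (dy z)^2) <= 4 * G"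
   proof -
    have "(LINT z|?B. (dx z)^2 + (dy z)^2) <= (LINT z|SL L. (dx z)^2 + (dy z)^2)"
     by (rule box_integral_le) (use id2 in simp_all)
    also have "\<dots> <= (LINT z|SL L. (2 * (fx (r n) z)^2 + 2 * (fx (r k) z)^2) + (2 * (fy (r n) z)^2 + 2 * (fy (r k) z)^2))"
    proof (rule integral_mono)
     show "integrable (SL L) (%z. (dx z)^2 + (dy z)^2)" using id2 by simp
     show "integrable (SL L) (%z. (2 * (fx (r n) z)^2 + 2 * (fx (r k) z)^2) + (2 * (fy (r n) z)^2 + 2 * (fy (r k) z)^2))"
      using ix2 iy2 by simp
     show "(dx z)^2 + (dy z)^2 <= (2 * (fx (r n) z)^2 + 2 * (fx (r k) z)^2) + (2 * (fy (r n) z)^2 + 2 * (fy (r k) z)^2)" for z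
      unfolding dx_def dy_def by (intro add_mono sqd)
    qed
    also have "\<dots> = (2 * (l2 (SL L) (fx (r n)))^2 + 2 * (l2 (SL L) (fx (r k)))^2) + (2 * (l2 (SL L) (fy (r n)))^2 + 2 * (l2 (SL L) (fy (r k)))^2)"
     using ix2 iy2 by (simp add: l2_sq)
    also have "\<dots> <= 4 * G" using G[of "r n"] G[of "r k"] by linarith
    finally show ?thesis .
   qed
   have sums: "(\<Sum>i<2 * N * N. \<Sum>j<N. (LINT z|cell N i j. d z)^2) <= 2 * S n + 2 * S k"
   proof -
    have "(LINT z|cell N i j. d z)^2 <= 2 * (a i j n - l i j)^2 + 2 * (a i j k - l i j)^2" for i j
    proof -
     have "integrable (cell N i j) (f i')" for i' unfolding cell_def by (rule integrable_box[OF C1cD(1)[OF C]])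
     then have "(LINT z|cell N i j. d z) = (a i j n - l i j) - (a i j k - l i j)" by (simp add: d_def a_def)
     then show ?thesis using sqd by metis
    qed
    then have "(\<Sum>i<2 * N * N. \<Sum>j<N. (LINT z|cell N i j. d z)^2)
     <= (\<Sum>i<2 * N * N. \<Sum>j<N. 2 * (a i j n - l i j)^2 + 2 * (a i j k - l i j)^2)" by (intro sum_mono)
    also have "\<dots> = 2 * S n + 2 * S k" by (simp only: S_def sum.distrib sum_distrib_left)
    finally show ?thesis .
   qed
   have "(LINT z|?B. (d z)^2) <= (real N)^2 / L * (\<Sum>i<2 * N * N. \<Sum>j<N. (LINT z|cell N i j. d z)^2) +
    (1 + L^2) / (real N)^2 * (LINT z|?B. (dx z)^2 + (dy z)^2)" by (rule cell_sum_bound[OF N(1) D])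
   also have "\<dots> <= (real N)^2 / L * (4 * s) + (1 + L^2) / (real N)^2 * (4 * G)"
    using sums K(1)[OF n] K(1)[OF k] grad L by (intro add_mono mult_left_mono) auto
   also have "\<dots> <= e^2 / 4 + e^2 / 4" using s(2) NG by linarith
   finally have "(l2 (SL L) d)^2 <= e^2 / 2 + 4 * t" using split by linarith
   also have "\<dots> < e^2" using e by (simp add: t_def)
   finally show "l2 (SL L) (%z. f (r n) z - f (r k) z) < e"
    unfolding d_def[symmetric] using e by (intro power_less_imp_less_base[of _ 2 e]) auto
  qed
 qed
qed

end

context nls
begin

section \<open>From convergence in L^2 to convergence in H^1\<close>

lemma NN_bound:
 fixes f :: "plane => 'b::euclidean_space"
 assumes C: "C1c f fx fy" and M: "MM f <= m'" and G: "GG fx fy <= G"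
 shows "NN f <= MM f * (1 + (1 / L + 2) * (m' + G))"
proof -
 have "NN f <= MM f + (LINT z|SL L. norm (f z) ^ 4)" using NN_le_L4[OF C, of 1] by simp
 also have "\<dots> <= MM f + (1 / L + 2) * (MM f * (MM f + GG fx fy))" using L4_le[OF C] by simp
 also have "\<dots> <= MM f + (1 / L + 2) * (MM f * (m' + G))"
  using M G L MM_nonneg[of f] by (intro add_left_mono mult_left_mono add_mono) auto
 also have "\<dots> = MM f * (1 + (1 / L + 2) * (m' + G))"
 proof -
  have "a + k * (a * b) = a * (1 + k * b)" for a b k :: real by (simp add: algebra_simps)
  then show ?thesis .
 qed
 finally show ?thesis .
qed

lemma parallelogram:
 fixes f g :: "'c => real"
 assumes "f \<in> sqi M" "g \<in> sqi M"
 shows "(l2 M (%z. (1 / 2) *\<^sub>R f z + (1 / 2) *\<^sub>R g z))^2 + (l2 M (%z. (1 / 2) *\<^sub>R f z + (- 1 / 2) *\<^sub>R g z))^2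
  = 1 / 2 * (l2 M f)^2 + 1 / 2 * (l2 M g)^2"
proof -
 have s: "(%z. (1 / 2) *\<^sub>R f z) \<in> sqi M" "(%z. (c) *\<^sub>R g z) \<in> sqi M" for c by (rule sqi_scale[OF assms(1)] sqi_scale[OF assms(2)])+
 show ?thesis
  unfolding l2_add_sq[OF s(1) s(2)] l2_scale by (simp add: power_mult_distrib power_divide)
qed

text \<open>Minimizers up to a small error that are close in \<open>L^2\<close> are close in \<open>H\<^sup>1\<close>, because the quadratic
 part of the energy satisfies the parallelogram identity.\<close>

lemma gradient_close:
 assumes e: "0 < e"
 obtains d where "0 < d" "\<And>f fx fy g gx gy. adm f fx fy ==> MM f = m ==> FF f fx fy <= Einf + d ==>
  adm g gx gy ==> MM g = m ==> FF g gx gy <= Einf + d ==> MM (%z. f z - g z) <= d ==>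
  GG (%z. fx z - gx z) (%z. fy z - gy z) <= e"
proof -
 obtain G0 where G0: "0 <= G0" "\<And>f fx fy. adm f fx fy ==> MM f <= m ==> FF f fx fy <= 0 ==> GG fx fy <= G0"
  using GG_bound by blast
 define c where "c = 1 + (1 / L + 2) * (m + G0)"
 have c: "0 < c" using L m G0 by (auto simp: c_def intro!: add_pos_nonneg)
 \<comment> \<open>Spends \<open>e / 32\<close> on the relative error of the nonlinear term; the
   choice of \<open>d\<close> spends another \<open>e / 32\<close> on everything else.\<close>
 define \<delta> where "\<delta> = e / 32 / (m * c)"
 have \<delta>: "0 < \<delta>" "\<delta> * (m * c) = e / 32" using e m c by (simp_all add: \<delta>_def)
 obtain Cp where Cp: "0 <= Cp" "\<And>a b. 0 <= a ==> 0 <= b ==> a powr q <= (1 + \<delta>) * b powr q + Cp * \<bar>a - b\<bar> powr q"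
  using powr_perturbation[OF \<delta>(1), of q] q by (metis less_trans zero_less_numeral)
 define D where "D = 1 + Cp * c + 2 * \<gamma>^2"
 have D: "0 < D" using Cp(1) c by (auto simp: D_def intro!: add_pos_nonneg)
 define d where "d = min (- Einf) (e / 32 / D)"
 have d: "0 < d" "d <= - Einf" "d * D <= e / 32"
 proof -
  show "0 < d" using Einf_neg e D by (simp add: d_def)
  show "d <= - Einf" by (simp add: d_def)
  have "d * D <= e / 32 / D * D" using D by (intro mult_right_mono) (auto simp: d_def)
  then show "d * D <= e / 32" using D by simp
 qed
 show ?thesis
 proof (rule that[OF d(1)])
  fix f fx fy g gx gy
  assume f: "adm f fx fy" "MM f = m" "FF f fx fy <= Einf + d" and g: "adm g gx gy" "MM g = m" "FF g gx gy <= Einf + d"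
   and fg: "MM (%z. f z - g z) <= d"
  have Cf: "C1c f fx fy" and Cg: "C1c g gx gy" using f(1) g(1) by (auto simp: adm_def)
  have Gf: "GG fx fy <= G0" using f d by (intro G0(2)[OF f(1)]) auto
  have Gg: "GG gx gy <= G0" using g d by (intro G0(2)[OF g(1)]) auto
  \<comment> \<open>Midpoint \<open>w\<close> and half-difference \<open>v\<close>. As the midpoint
    has mass at most \<open>m\<close> and \<open>Einf\<close> is negative, the quadratic energy of
    \<open>w\<close> is at least \<open>Einf\<close> plus its nonlinear term, which leaves little
    for \<open>v\<close>.\<close>
  define w wx wy where w: "w = (%z. (1 / 2) *\<^sub>R f z + (1 / 2) *\<^sub>R g z)" "wx = (%z. (1 / 2) *\<^sub>R fx z + (1 / 2) *\<^sub>R gx z)"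
   "wy = (%z. (1 / 2) *\<^sub>R fy z + (1 / 2) *\<^sub>R gy z)"
  define v vx vy where v: "v = (%z. (1 / 2) *\<^sub>R f z + (- 1 / 2) *\<^sub>R g z)" "vx = (%z. (1 / 2) *\<^sub>R fx z + (- 1 / 2) *\<^sub>R gx z)"
   "vy = (%z. (1 / 2) *\<^sub>R fy z + (- 1 / 2) *\<^sub>R gy z)"
  have Cw: "C1c w wx wy" and Cv: "C1c v vx vy" unfolding w v by (rule C1c_lin[OF Cf Cg])+
  have aw: "adm w wx wy" using Cw f(1) g(1) by (auto simp: adm_def w)
  have pM: "MM w + MM v = m" unfolding MM_def w v
   using parallelogram[OF C1c_sqi(1)[OF Cf] C1c_sqi(1)[OF Cg]] f(2) g(2) by (simp add: MM_def)
  have pG: "GG wx wy + GG vx vy = 1 / 2 * GG fx fy + 1 / 2 * GG gx gy" unfolding GG_def w v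
   using parallelogram[OF C1c_sqi(2)[OF Cf] C1c_sqi(2)[OF Cg]] parallelogram[OF C1c_sqi(3)[OF Cf] C1c_sqi(3)[OF Cg]]
   by (simp add: algebra_simps)
  have pt: "tr w + tr v = 1 / 2 * tr f + 1 / 2 * tr g" unfolding tr_def w v
   using parallelogram[OF C1c_slice_sqi[OF Cf] C1c_slice_sqi[OF Cg]] by simp
  have half: "(%z. (1 / 2) *\<^sub>R a z + (- 1 / 2) *\<^sub>R b z) = (%z. (1 / 2) *\<^sub>R (a z - b z))" for a b :: "plane => real"
   by (simp add: fun_eq_iff algebra_simps)
  have Mv: "MM v <= d"
  proof -
   have "MM v = 1 / 4 * MM (%z. f z - g z)" unfolding v half by (simp only: MM_scale) (simp add: power_divide)
   then show ?thesis using fg d(1) MM_nonneg[of "%z. f z - g z"] by linarith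
  qed
  have Gv: "GG vx vy = 1 / 4 * GG (%z. fx z - gx z) (%z. fy z - gy z)"
   unfolding v half GG_def l2_scale by (simp add: power_divide power_mult_distrib)
  have GGw: "GG wx wy <= G0" "GG vx vy <= G0" using pG Gf Gg GG_nonneg[of vx vy] GG_nonneg[of wx wy] by linarith+
  have MMw: "MM w <= m" "MM v <= m" using pM MM_nonneg[of w] MM_nonneg[of v] by linarith+
  have Nw: "NN w <= m * c"
   using NN_bound[OF Cw MMw(1) GGw(1)] MMw(1) c unfolding c_def[symmetric] by (meson mult_right_mono less_imp_le order_trans)
  have Nv: "NN v <= d * c"
   using NN_bound[OF Cv MMw(2) GGw(2)] Mv c unfolding c_def[symmetric] by (meson mult_right_mono less_imp_le order_trans)
  note Iw = NN_integrable[OF C1cD(1,4)[OF Cw]] and Iv = NN_integrable[OF C1cD(1,4)[OF Cv]]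
  have pert: "NN h <= (1 + \<delta>) * NN w + Cp * NN v" if C: "C1c h hx hy" and h: "\<And>z. 0 <= h z" "\<And>z. \<bar>h z - w z\<bar> = \<bar>v z\<bar>" for h hx hy
  proof -
   have "NN h <= (LINT z|SL L. (1 + \<delta>) * norm (w z) powr q + Cp * norm (v z) powr q)"
    unfolding NN_def
   proof (rule integral_mono[OF NN_integrable[OF C1cD(1,4)[OF C]]])
    show "integrable (SL L) (%z. (1 + \<delta>) * norm (w z) powr q + Cp * norm (v z) powr q)" using Iw Iv by simp
    have w0: "0 <= w z" for z using aw unfolding adm_def by blast
    show "norm (h z) powr q <= (1 + \<delta>) * norm (w z) powr q + Cp * norm (v z) powr q" for z
     using Cp(2)[OF h(1)[of z] w0[of z]] h(1)[of z] w0[of z] by (simp add: h(2))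
   qed
   also have "\<dots> = (1 + \<delta>) * NN w + Cp * NN v" using Iw Iv by (simp add: NN_def)
   finally show ?thesis .
  qed
  have f0: "0 <= f z" "0 <= g z" for z using f(1) g(1) unfolding adm_def by blast+
  have Nf: "NN f <= (1 + \<delta>) * NN w + Cp * NN v" by (rule pert[OF Cf f0(1)]) (simp add: w v)
  have Ng: "NN g <= (1 + \<delta>) * NN w + Cp * NN v" by (rule pert[OF Cg f0(2)]) (simp add: w v abs_minus_commute)
  have "MM w / m * Einf <= FF w wx wy" by (rule FF_ge(1)[OF aw MMw(1)])
  moreover have "Einf <= MM w / m * Einf"
  proof -
   have "MM w / m <= 1" using MMw m by simp
   then have "1 * Einf <= MM w / m * Einf" using Einf_neg by (intro mult_right_mono_neg) auto
   then show ?thesis by simp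
  qed
  ultimately have Qw: "Einf + NN w / q <= QQ w wx wy" by (simp add: FF_def)
  have QQp: "QQ w wx wy + QQ v vx vy = 1 / 2 * QQ f fx fy + 1 / 2 * QQ g gx gy"
  proof -
   have gen: "(1 / 2 * Gw + k * tw) + (1 / 2 * Gv + k * tv) = 1 / 2 * (1 / 2 * Gf + k * tf) + 1 / 2 * (1 / 2 * Gg + k * tg)"
    if "Gw + Gv = 1 / 2 * Gf + 1 / 2 * Gg" "tw + tv = 1 / 2 * tf + 1 / 2 * tg" for Gw Gv Gf Gg tw tv tf tg k :: real
   proof -
    have "k * tw + k * tv = k * (1 / 2 * tf + 1 / 2 * tg)" unfolding that(2)[symmetric] by (simp add: distrib_left)
    then show ?thesis using that(1) by (simp add: distrib_left)
   qed
   show ?thesis unfolding QQ_def by (rule gen[OF pG pt])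
  qed
  have Qf: "QQ f fx fy <= Einf + d + NN f / q" and Qg: "QQ g gx gy <= Einf + d + NN g / q" using f(3) g(3) by (simp_all add: FF_def)
  have X: "NN f / q + NN g / q <= 2 * (NN w / q) + 2 * (\<delta> * NN w + Cp * NN v)"
  proof -
   have n: "0 <= \<delta> * NN w + Cp * NN v" using \<delta>(1) Cp(1) NN_nonneg[of w] NN_nonneg[of v] by simp
   have "NN f + NN g <= 2 * NN w + 2 * (\<delta> * NN w + Cp * NN v)" using Nf Ng by (simp add: algebra_simps)
   then have "(NN f + NN g) / q <= (2 * NN w + 2 * (\<delta> * NN w + Cp * NN v)) / q" using q by (intro divide_right_mono) auto
   also have "\<dots> = 2 * (NN w / q) + (2 * (\<delta> * NN w + Cp * NN v)) / q" by (simp add: add_divide_distrib)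
   also have "(2 * (\<delta> * NN w + Cp * NN v)) / q <= (2 * (\<delta> * NN w + Cp * NN v)) / 1"
    using n q by (intro divide_left_mono) auto
   finally show ?thesis by (simp add: add_divide_distrib)
  qed
  have "QQ v vx vy <= d + (\<delta> * NN w + Cp * NN v)"
  proof -
   have "y <= d + s" if "x + y = 1 / 2 * a + 1 / 2 * b" "E + n <= x" "a <= E + d + a'" "b <= E + d + b'" "a' + b' <= 2 * n + 2 * s"
    for x y a b E n a' b' s :: real using that by linarith
   from this[OF QQp Qw Qf Qg X] show ?thesis .
  qed
  moreover have "\<delta> * NN w <= e / 32" using Nw \<delta> by (metis mult_left_mono less_imp_le)
  moreover have "Cp * NN v <= d * (Cp * c)" using mult_left_mono[OF Nv Cp(1)] by (simp add: mult.left_commute)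
  \<comment> \<open>The quadratic form is coercive up to a multiple of the mass, and the mass of
    \<open>v\<close> is small.\<close>
  moreover have "3 / 8 * GG vx vy <= QQ v vx vy + 2 * \<gamma>^2 * MM v"
  proof -
   have "\<bar>\<gamma>\<bar> * tr v = - (\<gamma> * tr v)" using \<gamma> by simp
   then show ?thesis using tr_le[OF Cv] unfolding QQ_def by linarith
  qed
  moreover have "2 * \<gamma>^2 * MM v <= d * (2 * \<gamma>^2)" using mult_left_mono[OF Mv, of "2 * \<gamma>^2"] by (simp add: mult.commute)
  moreover have "d * D = d + d * (Cp * c) + d * (2 * \<gamma>^2)" by (simp add: D_def algebra_simps)
  ultimately have "3 / 8 * GG vx vy <= e / 16" using d(3) by linarith
  then show "GG (%z. fx z - gx z) (%z. fy z - gy z) <= e" unfolding Gv using e by linarith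
 qed
qed

text \<open>The nonnegative C^1 approximants stay part of the notion: they give the sign of the
  trace and the denominators of the logarithmic test functions.\<close>

definition minimizer ::
  "(plane => real) => (plane => real) => (plane => real) => (real => complex) =>
  (nat => plane => real) => (nat => plane => real) => (nat => plane => real) => bool" where
 "minimizer u g1 g2 t f fx fy \<longleftrightarrow> (\<forall>z. 0 <= u z) \<and> (\<forall>n. adm (f n) (fx n) (fy n)) \<and>
  approx (%z. of_real (u z)) (%z. of_real (g1 z)) (%z. of_real (g2 z)) t
   (%n z. of_real (f n z)) (%n z. of_real (fx n z)) (%n z. of_real (fy n z)) \<and>
  MM u = m \<and> 1 / 2 * GG g1 g2 + \<gamma> / 2 * (l2 (Ival 0 L) t)^2 - NN u / q <= Einf"

lemma l2_of_real: "l2 M (%z. complex_of_real (f z)) = l2 M f"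
 by (simp add: l2_def)

lemma sqi_of_real:
 assumes f: "f \<in> sqi M" shows "(%z. complex_of_real (f z)) \<in> sqi M"
proof (rule sqiI)
 note [measurable] = sqiD[OF f]
 show "(%z. complex_of_real (f z)) \<in> borel_measurable M" by measurable
 show "integrable M (%z. (norm (complex_of_real (f z)))^2)" using sqi_integrable[OF f] by simp
qed

lemma exists_minimizer:
 obtains u g1 g2 t f fx fy where "minimizer u g1 g2 t f fx fy"
proof -
 \<comment> \<open>The bound by \<open>- Einf / 2\<close> keeps every energy below
   \<open>Einf / 2\<close>, as required by tightness.\<close>
 define en where "en n = min (1 / real (Suc n)) (- Einf / 2)" for n
 have en: "0 < en n" for n using Einf_neg by (simp add: en_def)
 have "\<exists>F. peaked (fst F) (fst (snd F)) (snd (snd F)) \<and> FF (fst F) (fst (snd F)) (snd (snd F)) < Einf + en n" for n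
  using minimizing[OF en[of n]] by (metis fst_conv snd_conv)
 then obtain F where F: "\<And>n. peaked (fst (F n)) (fst (snd (F n))) (snd (snd (F n)))"
  "\<And>n. FF (fst (F n)) (fst (snd (F n))) (snd (snd (F n))) < Einf + en n" by metis
 define f0 fx0 fy0 where F0: "f0 n = fst (F n)" "fx0 n = fst (snd (F n))" "fy0 n = snd (snd (F n))" for n
 have pk: "peaked (f0 n) (fx0 n) (fy0 n)" and lt: "FF (f0 n) (fx0 n) (fy0 n) < Einf + en n" for n using F by (simp_all add: F0)
 have a0: "adm (f0 n) (fx0 n) (fy0 n)" "MM (f0 n) = m" for n using pk[of n] by (auto simp: peaked_def)
 have C0: "C1c (f0 n) (fx0 n) (fy0 n)" for n using a0 by (simp add: adm_def)
 have half: "FF (f0 n) (fx0 n) (fy0 n) <= Einf / 2" for n using lt[of n] by (simp add: en_def)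
 have en0: "en \<longlonglongrightarrow> 0"
 proof (rule tendsto_sandwich[OF _ _ tendsto_const LIMSEQ_Suc[OF lim_1_over_n]])
  show "\<forall>\<^sub>F n in sequentially. 0 <= en n" using en by (simp add: less_imp_le)
  show "\<forall>\<^sub>F n in sequentially. en n <= 1 / real (Suc n)" by (simp add: en_def)
 qed
 obtain G0 where G0: "0 <= G0" "\<And>f fx fy. adm f fx fy ==> MM f <= m ==> FF f fx fy <= 0 ==> GG fx fy <= G0"
  using GG_bound by blast
 have GG0: "GG (fx0 n) (fy0 n) <= G0" for n using G0(2)[OF a0(1)] a0(2)[of n] half[of n] Einf_neg by simp
 obtain r :: "nat => nat" where r: "strict_mono r"
  "\<And>e. 0 < e ==> \<exists>N. \<forall>n\<ge>N. \<forall>k\<ge>N. l2 (SL L) (%z. f0 (r n) z - f0 (r k) z) < e"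
 proof (rule Rellich[where f = f0 and fx = fx0 and fy = fy0 and M = m and G = G0])
  show "C1c (f0 n) (fx0 n) (fy0 n)" for n by (rule C0)
  show "(l2 (SL L) (f0 n))^2 <= m" for n using a0(2)[of n] by (simp add: MM_def)
  show "(l2 (SL L) (fx0 n))^2 + (l2 (SL L) (fy0 n))^2 <= G0" for n using GG0[of n] by (simp add: GG_def)
  fix t :: real assume t: "0 < t"
  obtain R d where R: "0 < R" "0 < d"
   "\<And>f fx fy. peaked f fx fy ==> FF f fx fy <= Einf / 2 ==> FF f fx fy <= Einf + d ==>
    (LINT z|SL L. indicator {z. R <= \<bar>fst z\<bar>} z * (f z)^2) <= t" using tightness[OF t] by blast
  have "\<forall>\<^sub>F n in sequentially. en n < d" by (rule order_tendstoD(2)[OF en0 R(2)])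
  then have "\<forall>\<^sub>F n in sequentially. (LINT z|SL L. indicator {z. R <= \<bar>fst z\<bar>} z * (f0 n z)^2) <= t"
  proof eventually_elim
   case (elim n)
   show ?case by (rule R(3)[OF pk half]) (use lt[of n] elim in linarith)
  qed
  then show "\<exists>R. \<forall>\<^sub>F n in sequentially. (LINT z|SL L. indicator {z. R <= \<bar>fst z\<bar>} z * (f0 n z)^2) <= t" by blast
 qed (rule that)
 define f fx fy where f: "f n = f0 (r n)" "fx n = fx0 (r n)" "fy n = fy0 (r n)" for n
 define e where "e n = en (r n)" for n
 have a: "adm (f n) (fx n) (fy n)" "MM (f n) = m" "FF (f n) (fx n) (fy n) < Einf + e n" "C1c (f n) (fx n) (fy n)" "GG (fx n) (fy n) <= G0" for n
  using a0 lt C0 GG0 by (simp_all add: f e_def)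
 have e0: "e \<longlonglongrightarrow> 0" using LIMSEQ_subseq_LIMSEQ[OF en0 r(1)] by (simp add: e_def[abs_def] o_def)
 have cau: "\<exists>N. \<forall>n\<ge>N. \<forall>k\<ge>N. l2 (SL L) (%z. f n z - f k z) < b" if "0 < b" for b using r(2)[OF that] by (simp add: f)
 have Gcau: "\<exists>N. \<forall>n\<ge>N. \<forall>k\<ge>N. GG (%z. fx n z - fx k z) (%z. fy n z - fy k z) < b^2" if b: "0 < b" for b
 proof -
  have "0 < b^2 / 2" using b by simp
  from gradient_close[OF this] obtain d where d: "0 < d" "\<And>f fx fy g gx gy. adm f fx fy ==> MM f = m ==> FF f fx fy <= Einf + d ==>
   adm g gx gy ==> MM g = m ==> FF g gx gy <= Einf + d ==> MM (%z. f z - g z) <= d ==>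
   GG (%z. fx z - gx z) (%z. fy z - gy z) <= b^2 / 2" by blast
  have "\<forall>\<^sub>F n in sequentially. e n < d" by (rule order_tendstoD(2)[OF e0 d(1)])
  then obtain N1 where N1: "\<And>n. N1 <= n ==> e n < d" unfolding eventually_sequentially by blast
  obtain N2 where N2: "\<And>n k. N2 <= n ==> N2 <= k ==> l2 (SL L) (%z. f n z - f k z) < sqrt d"
   using cau[of "sqrt d"] d(1) by (auto simp: real_sqrt_gt_zero)
  show ?thesis
  proof (intro exI[of _ "max N1 N2"] allI impI)
   fix n k assume nk: "max N1 N2 <= n" "max N1 N2 <= k"
   have "(l2 (SL L) (%z. f n z - f k z))^2 <= (sqrt d)^2" using N2[of n k] nk by (intro power_mono) auto
   then have "MM (%z. f n z - f k z) <= d" using d(1) by (simp add: MM_def)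
   moreover have "FF (f n) (fx n) (fy n) <= Einf + d" "FF (f k) (fx k) (fy k) <= Einf + d"
    using a(3)[of n] a(3)[of k] N1[of n] N1[of k] nk by auto
   ultimately have "GG (%z. fx n z - fx k z) (%z. fy n z - fy k z) <= b^2 / 2" by (intro d(2)[OF a(1,2) _ a(1,2)])
   then show "GG (%z. fx n z - fx k z) (%z. fy n z - fy k z) < b^2" using zero_less_power[OF b, of 2] by linarith
  qed
 qed
 have xcau: "\<exists>N. \<forall>n\<ge>N. \<forall>k\<ge>N. l2 (SL L) (%z. fx n z - fx k z) < b"
  and ycau: "\<exists>N. \<forall>n\<ge>N. \<forall>k\<ge>N. l2 (SL L) (%z. fy n z - fy k z) < b" if b: "0 < b" for b
 proof -
  obtain N where N: "\<And>n k. N <= n ==> N <= k ==> GG (%z. fx n z - fx k z) (%z. fy n z - fy k z) < b^2" using Gcau[OF b] by blast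
  have "l2 (SL L) (%z. fx n z - fx k z) < b" "l2 (SL L) (%z. fy n z - fy k z) < b" if "N <= n" "N <= k" for n k
  proof -
   have "(l2 (SL L) (%z. fx n z - fx k z))^2 < b^2" "(l2 (SL L) (%z. fy n z - fy k z))^2 < b^2"
    using N[OF that] unfolding GG_def by (smt (verit) zero_le_power2)+
   then show "l2 (SL L) (%z. fx n z - fx k z) < b" "l2 (SL L) (%z. fy n z - fy k z) < b"
    using b by (auto intro: power_less_imp_less_base[of _ 2 b])
  qed
  then show "\<exists>N. \<forall>n\<ge>N. \<forall>k\<ge>N. l2 (SL L) (%z. fx n z - fx k z) < b" "\<exists>N. \<forall>n\<ge>N. \<forall>k\<ge>N. l2 (SL L) (%z. fy n z - fy k z) < b" by blast+
 qed
 note Cs = C1c_sqi[OF a(4)]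
 obtain u0 where u0: "u0 \<in> sqi (SL L)" "(%n. l2 (SL L) (%z. f n z - u0 z)) \<longlonglongrightarrow> 0"
  using L2_complete[OF Cs(1) cau] by blast
 obtain g1 where g1: "g1 \<in> sqi (SL L)" "(%n. l2 (SL L) (%z. fx n z - g1 z)) \<longlonglongrightarrow> 0"
  using L2_complete[OF Cs(2) xcau] by blast
 obtain g2 where g2: "g2 \<in> sqi (SL L)" "(%n. l2 (SL L) (%z. fy n z - g2 z)) \<longlonglongrightarrow> 0"
  using L2_complete[OF Cs(3) ycau] by blast
 \<comment> \<open>Nonnegative everywhere, not just almost everywhere. As \<open>f n\<close> is
   nonnegative, the distance to it does not grow.\<close>
 define u where "u z = \<bar>u0 z\<bar>" for z
 have us: "u \<in> sqi (SL L)" using sqi_norm[OF u0(1)] by (simp add: u_def[abs_def])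
 have u1: "(%n. l2 (SL L) (%z. f n z - u z)) \<longlonglongrightarrow> 0"
 proof (rule tendsto_sandwich[OF _ _ tendsto_const u0(2)])
  have "l2 (SL L) (%z. f n z - u z) <= l2 (SL L) (%z. f n z - u0 z)" for n
  proof (rule sqi_dominated(2)[OF sqi_diff[OF Cs(1) u0(1)]])
   show "(%z. f n z - u z) \<in> borel_measurable (SL L)" using sqiD[OF sqi_diff[OF Cs(1) us]] .
   have "0 <= f n z" for z using a(1)[of n] unfolding adm_def by blast
   then have "norm (f n z - u z) <= norm (f n z - u0 z)" for z unfolding u_def by (smt (verit) real_norm_def)
   then show "AE z in SL L. norm (f n z - u z) <= norm (f n z - u0 z)" by simp
  qed
  then show "\<forall>\<^sub>F n in sequentially. l2 (SL L) (%z. f n z - u z) <= l2 (SL L) (%z. f n z - u0 z)" by simp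
 qed simp
 have of_real_lim: "(%n. l2 (SL L) (%z. complex_of_real (h n z) - complex_of_real (k z))) \<longlonglongrightarrow> 0"
  if "(%n. l2 (SL L) (%z. h n z - k z)) \<longlonglongrightarrow> 0" for h :: "nat => plane => real" and k
  using that by (simp only: of_real_diff[symmetric] l2_of_real)
 note CC = C1c_of_real[OF a(4)]
 obtain t where t: "t \<in> sqi (Ival 0 L)" "(%n. l2 (Ival 0 L) (%y. complex_of_real (f n (0, y)) - t y)) \<longlonglongrightarrow> 0"
  using trace_exists[OF sqi_of_real[OF us] sqi_of_real[OF g1(1)] CC of_real_lim[OF u1] of_real_lim[OF g1(2)]] by blast
 have app: "approx (%z. of_real (u z)) (%z. of_real (g1 z)) (%z. of_real (g2 z)) t
   (%n z. of_real (f n z)) (%n z. of_real (fx n z)) (%n z. of_real (fy n z))"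
  unfolding approx_def using sqi_of_real[OF us] sqi_of_real[OF g1(1)] sqi_of_real[OF g2(1)] t CC
   of_real_lim[OF u1] of_real_lim[OF g1(2)] of_real_lim[OF g2(2)] by blast
 have lu: "(%n. l2 (SL L) (f n)) \<longlonglongrightarrow> l2 (SL L) u" by (rule l2_tendsto[OF Cs(1) us u1])
 have l1: "(%n. l2 (SL L) (fx n)) \<longlonglongrightarrow> l2 (SL L) g1" by (rule l2_tendsto[OF Cs(2) g1])
 have l2': "(%n. l2 (SL L) (fy n)) \<longlonglongrightarrow> l2 (SL L) g2" by (rule l2_tendsto[OF Cs(3) g2])
 have lt: "(%n. l2 (Ival 0 L) (%y. f n (0, y))) \<longlonglongrightarrow> l2 (Ival 0 L) t"
  using l2_tendsto[OF C1c_slice_sqi[OF CC] t] by (simp only: l2_of_real)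
 have Mu: "MM u = m"
 proof -
  have "(%n. MM (f n)) \<longlonglongrightarrow> MM u" unfolding MM_def by (intro tendsto_power lu)
  then show ?thesis unfolding a(2) by (simp add: LIMSEQ_const_iff)
 qed
 let ?Q = "1 / 2 * GG g1 g2 + \<gamma> / 2 * (l2 (Ival 0 L) t)^2"
 have Q: "(%n. QQ (f n) (fx n) (fy n)) \<longlonglongrightarrow> ?Q"
  unfolding QQ_def GG_def tr_def by (intro tendsto_intros l1 l2' lt)
 \<comment> \<open>Masses and gradients of differences are at most four times the bounds for the
   members, so one constant serves all pairs.\<close>
 define c where "c = 1 + (1 / L + 2) * (2 * m + 2 * m + (2 * G0 + 2 * G0))"
 have c: "0 < c" using L m G0 by (auto simp: c_def intro!: add_pos_nonneg)
 have sq2: "(l2 (SL L) (%z. g z - k z))^2 <= 2 * (l2 (SL L) g)^2 + 2 * (l2 (SL L) k)^2"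
  if "g \<in> sqi (SL L)" "k \<in> sqi (SL L)" for g k :: "plane => real"
 proof -
  have "(l2 (SL L) (%z. g z - k z))^2 <= (l2 (SL L) g + l2 (SL L) k)^2"
   using l2_triangle[OF that(1) sqi_minus[OF that(2)]] by (intro power_mono) (auto simp: l2_minus)
  also have "\<dots> <= 2 * (l2 (SL L) g)^2 + 2 * (l2 (SL L) k)^2"
   using zero_le_power2[of "l2 (SL L) g - l2 (SL L) k"] by (simp add: power2_sum power2_diff)
  finally show ?thesis .
 qed
 have Ndiff: "NN (%z. f n z - f k z) <= MM (%z. f n z - f k z) * c" for n k
  unfolding c_def
 proof (rule NN_bound[OF C1c_diff[OF a(4) a(4)]])
  show "MM (%z. f n z - f k z) <= 2 * m + 2 * m" using sq2[OF Cs(1)[of n] Cs(1)[of k]] a(2)[of n] a(2)[of k] by (simp add: MM_def)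
  show "GG (%z. fx n z - fx k z) (%z. fy n z - fy k z) <= 2 * G0 + 2 * G0"
   using sq2[OF Cs(2)[of n] Cs(2)[of k]] sq2[OF Cs(3)[of n] Cs(3)[of k]] a(5)[of n] a(5)[of k] unfolding GG_def by linarith
 qed
 have iu: "integrable (SL L) (%z. norm (u z) powr q)"
 proof -
  have "MM (%z. complex_of_real (u z)) = m" using Mu unfolding MM_def l2_of_real .
  then show ?thesis using key_inequality(1)[OF app] m by simp
 qed
 \<comment> \<open>Fatou in the second index carries the bound on \<open>f n - f k\<close> over to
   \<open>f n - u\<close>, without an embedding theorem for the limit.\<close>
 have ind: "integrable (SL L) (%z. norm (f n z - u z) powr q)"
  and Nlim: "\<forall>\<^sub>F n in sequentially. NN (%z. f n z - u z) <= b" if b: "0 < b" for n b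
 proof -
  obtain N where N: "\<And>n k. N <= n ==> N <= k ==> l2 (SL L) (%z. f n z - f k z) < sqrt (b / c)"
   using cau[of "sqrt (b / c)"] b c by (auto simp: real_sqrt_gt_zero)
  have conv: "(%k. l2 (SL L) (%z. (f n z - f k z) - (f n z - u z))) \<longlonglongrightarrow> 0" for n
   using u1 by (simp add: l2_minus_commute[of _ u])
  have ik: "integrable (SL L) (%z. norm (f n z - f k z) powr q)" for n k
   by (rule NN_integrable[OF C1cD(1,4)[OF C1c_diff[OF a(4) a(4)]]])
  have ds: "(%z. f n z - f k z) \<in> sqi (SL L)" "(%z. f n z - u z) \<in> sqi (SL L)" for n k
   by (rule sqi_diff[OF Cs(1) Cs(1)] sqi_diff[OF Cs(1) us])+
  have "\<forall>\<^sub>F k in sequentially. NN (%z. f n z - f k z) <= (4 * m) * c" for n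
  proof (intro always_eventually allI)
   fix k
   have "MM (%z. f n z - f k z) <= 4 * m" using sq2[OF Cs(1)[of n] Cs(1)[of k]] a(2)[of n] a(2)[of k] by (simp add: MM_def)
   then show "NN (%z. f n z - f k z) <= (4 * m) * c" using Ndiff[of n k] c by (meson mult_right_mono less_imp_le order_trans)
  qed
  from NN_Fatou(1)[OF ds(1) ds(2) conv ik this] show "integrable (SL L) (%z. norm (f n z - u z) powr q)" .
  have "NN (%z. f n z - u z) <= b" if n: "N <= n" for n
  proof (rule NN_Fatou(2)[OF ds(1) ds(2) conv ik])
   show "\<forall>\<^sub>F k in sequentially. NN (%z. f n z - f k z) <= b"
    unfolding eventually_sequentially
   proof (intro exI allI impI)
    fix k assume k: "N <= k"
    have "(l2 (SL L) (%z. f n z - f k z))^2 <= (sqrt (b / c))^2" using N[OF n k] by (intro power_mono) auto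
    then have "MM (%z. f n z - f k z) <= b / c" using b c by (simp add: MM_def)
    then have "MM (%z. f n z - f k z) * c <= b" using c by (simp add: pos_le_divide_eq)
    then show "NN (%z. f n z - f k z) <= b" using Ndiff[of n k] by linarith
   qed
  qed
  then show "\<forall>\<^sub>F n in sequentially. NN (%z. f n z - u z) <= b" unfolding eventually_sequentially by blast
 qed
 \<comment> \<open>The nonlinear term enters the energy with a minus sign, so Fatou points the wrong
   way here; strong convergence gives the upper bound.\<close>
 have Nup: "\<forall>\<^sub>F n in sequentially. NN (f n) <= NN u + b" if b: "0 < b" for b
 proof -
  define \<delta> where "\<delta> = b / 2 / (NN u + 1)"
  have Nu: "0 <= NN u" by (rule NN_nonneg)
  have \<delta>: "0 < \<delta>" "\<delta> * NN u <= b / 2"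
  proof -
   show "0 < \<delta>" using b Nu by (simp add: \<delta>_def)
   then have "\<delta> * NN u <= \<delta> * (NN u + 1)" by simp
   also have "\<dots> = b / 2" unfolding \<delta>_def by (rule nonzero_eq_divide_eq[THEN iffD1, OF _ refl]) (use Nu in simp)
   finally show "\<delta> * NN u <= b / 2" .
  qed
  obtain Cp where Cp: "0 <= Cp" "\<And>a b. 0 <= a ==> 0 <= b ==> a powr q <= (1 + \<delta>) * b powr q + Cp * \<bar>a - b\<bar> powr q"
   using powr_perturbation[OF \<delta>(1), of q] q by (metis less_trans zero_less_numeral)
  define b' where "b' = b / 2 / (Cp + 1)"
  have b': "0 < b'" "Cp * b' <= b / 2"
  proof -
   show "0 < b'" using b Cp by (simp add: b'_def)
   then have "Cp * b' <= (Cp + 1) * b'" by simp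
   also have "\<dots> = b / 2" unfolding b'_def by (subst mult.commute, rule nonzero_eq_divide_eq[THEN iffD1, OF _ refl]) (use Cp(1) in simp)
   finally show "Cp * b' <= b / 2" .
  qed
  from Nlim[OF b'(1)] show ?thesis
  proof eventually_elim
   case (elim n)
   have f0: "0 <= f n z" for z using a(1)[of n] unfolding adm_def by blast
   have "NN (f n) <= (LINT z|SL L. (1 + \<delta>) * norm (u z) powr q + Cp * norm (f n z - u z) powr q)"
    unfolding NN_def
   proof (rule integral_mono[OF NN_integrable[OF C1cD(1,4)[OF a(4)]]])
    show "integrable (SL L) (%z. (1 + \<delta>) * norm (u z) powr q + Cp * norm (f n z - u z) powr q)" using iu ind[OF zero_less_one, of n] by simp
    show "norm (f n z) powr q <= (1 + \<delta>) * norm (u z) powr q + Cp * norm (f n z - u z) powr q" for z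
     using Cp(2)[OF f0[of z], of "u z"] f0[of z] by (simp add: u_def)
   qed
   also have "\<dots> = (1 + \<delta>) * NN u + Cp * NN (%z. f n z - u z)" using iu ind[OF zero_less_one, of n] by (simp add: NN_def)
   also have "\<dots> <= (1 + \<delta>) * NN u + Cp * b'" using elim Cp(1) by (intro add_left_mono mult_left_mono)
   finally show ?case using \<delta>(2) b'(2) by (simp add: distrib_right)
  qed
 qed
 have "?Q - NN u / q <= Einf + b" if b: "0 < b" for b
 proof -
  have "\<forall>\<^sub>F n in sequentially. e n < b / 2" using b by (intro order_tendstoD(2)[OF e0]) simp
  moreover have "\<forall>\<^sub>F n in sequentially. NN (f n) <= NN u + b / 2" using b by (intro Nup) simp
  ultimately have "\<forall>\<^sub>F n in sequentially. QQ (f n) (fx n) (fy n) <= Einf + b + NN u / q"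
  proof eventually_elim
   case (elim n)
   have "NN (f n) / q <= (NN u + b / 2) / q" using elim q by (intro divide_right_mono) auto
   also have "\<dots> = NN u / q + b / 2 / q" by (simp add: add_divide_distrib)
   also have "b / 2 / q <= b / 2 / 1" using b q by (intro divide_left_mono) auto
   finally have nb: "NN (f n) / q <= NN u / q + b / 2 / 1" by simp
   have "Q <= E + b + y" if "x <= y + b / 2 / 1" "Q - x < E + s" "s < b / 2" for Q x y E s :: real
    using that by linarith
   from this[OF nb a(3)[of n, unfolded FF_def] elim(1)] show ?case .
  qed
  then have "?Q <= Einf + b + NN u / q" by (intro tendsto_upperbound[OF Q]) auto
  then show ?thesis by (rule diff_le_eq[THEN iffD2])
 qed
 then have "?Q - NN u / q <= Einf" by (rule field_le_epsilon)
 then have "minimizer u g1 g2 t f fx fy" unfolding minimizer_def using app a(1) Mu by (auto simp: u_def)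
 then show ?thesis by (rule that)
qed

end

section \<open>The Euler-Lagrange equation\<close>

text \<open>The polynomial is nonnegative near 0 and at most 0 at 0, so its derivative there
  vanishes; dividing by \<open>m\<close> exhibits the multiplier.\<close>

lemma cubic_min_derivative:
 fixes A B D P R N J E m q :: real
 assumes m: "0 < m" and q: "0 < q" and d: "0 < d"
  and nn: "\<And>x. \<bar>x\<bar> < d ==> 0 <= m * (A + x * B + x^2 * D) - E * (m + 2 * x * P + x^2 * R)
    - (m + (1 - q / 2) * (2 * x * P + x^2 * R)) * (N / q + x * J)"
  and E: "A - N / q <= E"
 shows "B + (- 2 * E / m + (q - 2) * N / (q * m)) * P = J"
proof -
 define \<phi> where "\<phi> x = m * (A + x * B + x^2 * D) - E * (m + 2 * x * P + x^2 * R)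
    - (m + (1 - q / 2) * (2 * x * P + x^2 * R)) * (N / q + x * J)" for x
 have D: "(\<phi> has_real_derivative m * B - E * (2 * P) - ((1 - q / 2) * (2 * P) * (N / q) + m * J)) (at 0)"
  unfolding \<phi>_def by (auto intro!: derivative_eq_intros)
 have "\<phi> 0 = m * (A - N / q - E)" by (simp add: \<phi>_def algebra_simps)
 also have "\<dots> <= 0" using E m by (simp add: mult_le_0_iff)
 finally have "\<phi> 0 <= \<phi> x" if "\<bar>x\<bar> < d" for x using nn[OF that] by (simp add: \<phi>_def)
 then have "m * B - E * (2 * P) - ((1 - q / 2) * (2 * P) * (N / q) + m * J) = 0"
  using DERIV_local_min[OF D d] by simp
 then have "m * B - E * (2 * P) + (q / 2 - 1) * (2 * P) * (N / q) = m * J" by (simp add: algebra_simps)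
 moreover have "m * (B + (- 2 * E / m + (q - 2) * N / (q * m)) * P) = m * B - E * (2 * P) + (q / 2 - 1) * (2 * P) * (N / q)"
  using m q by (simp add: field_simps)
 ultimately have "m * (B + (- 2 * E / m + (q - 2) * N / (q * m)) * P) = m * J" by simp
 then show ?thesis using m by simp
qed

lemma l2_add_scale_sq:
 assumes "f \<in> sqi M" "g \<in> sqi M"
 shows "(l2 M (%z. f z + c *\<^sub>R g z))^2 = (l2 M f)^2 + 2 * c * (LINT z|M. inner (f z) (g z)) + c^2 * (l2 M g)^2"
 unfolding l2_add_sq[OF assms(1) sqi_scale[OF assms(2)]] l2_scale by (simp add: power_mult_distrib)

lemma L2_mult_cnj:
 assumes "f \<in> sqi M" "g \<in> sqi M"
 shows "integrable M (%z. f z * cnj (g z))" "Re (LINT z|M. f z * cnj (g z)) = (LINT z|M. inner (f z) (g z))"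
proof -
 have "(%z. cnj (g z)) \<in> sqi M"
 proof (rule sqiI)
  show "(%z. cnj (g z)) \<in> borel_measurable M"
   by (rule borel_measurable_continuous_on[OF _ sqiD[OF assms(2)], of cnj]) (intro continuous_intros)
  show "integrable M (%z. (norm (cnj (g z)))^2)" using sqi_integrable[OF assms(2)] by simp
 qed
 from L2_mult_integrable[OF assms(1) this] show i: "integrable M (%z. f z * cnj (g z))" .
 show "Re (LINT z|M. f z * cnj (g z)) = (LINT z|M. inner (f z) (g z))"
  unfolding integral_Re[OF i, symmetric] by (simp add: inner_complex_def)
qed

context nls
begin

text \<open>The Lagrange multiplier in the form produced by the scaled inequality. Both summands are
  nonnegative because \<open>Einf\<close> is negative, which makes the lower bound
  immediate.\<close>

definition omega :: "(plane => complex) => real" where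
 "omega u = - 2 * Einf / m + (q - 2) * NN u / (q * m)"

lemma approx_powr_integrable:
 assumes A: "approx u g1 g2 t f fx fy"
 shows "integrable (SL L) (%z. norm (u z) powr q)"
proof (cases "MM u = 0")
 case True
 note [measurable] = sqiD[OF approxD(1)[OF A]]
 have "AE z in SL L. u z = 0" using True l2_eq_0_iff[OF approxD(1)[OF A]] by (simp add: MM_def)
 then have "AE z in SL L. norm (u z) powr q = 0" by eventually_elim simp
 then have "integrable (SL L) (%z. norm (u z) powr q) \<longleftrightarrow> integrable (SL L) (%z. 0 :: real)"
  by (intro integrable_cong_AE) auto
 then show ?thesis by simp
next
 case False
 then show ?thesis using key_inequality(1)[OF A] MM_nonneg[of u] by linarith
qed

lemma powr_mult_integrable:
 assumes u: "approx u g1 g2 t f fx fy" and v: "approx v h1 h2 s k kx ky"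
 shows "integrable (SL L) (%z. of_real (norm (u z) powr (q - 2)) * (u z * cnj (v z)))"
proof (rule Bochner_Integration.integrable_bound[of _ "%z. norm (u z) powr q + norm (v z) powr q"])
 note [measurable] = sqiD[OF approxD(1)[OF u]] sqiD[OF approxD(1)[OF v]]
 show "integrable (SL L) (%z. norm (u z) powr q + norm (v z) powr q)"
  using approx_powr_integrable[OF u] approx_powr_integrable[OF v] by simp
 show "(%z. of_real (norm (u z) powr (q - 2)) * (u z * cnj (v z))) \<in> borel_measurable (SL L)"
  using L2_mult_cnj(1)[OF approxD(1)[OF u] approxD(1)[OF v], THEN borel_measurable_integrable] by measurable
 show "AE z in SL L. norm (of_real (norm (u z) powr (q - 2)) * (u z * cnj (v z))) <= norm (norm (u z) powr q + norm (v z) powr q)"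
 proof (rule AE_I2)
  fix z
  define a b where "a = norm (u z)" and "b = norm (v z)"
  have ab: "0 <= a" "0 <= b" by (simp_all add: a_def b_def)
  define c where "c = max a b"
  have c: "0 <= c" "a <= c" "b <= c" using ab by (auto simp: c_def)
  have "a powr (q - 2) * (a * b) <= c powr (q - 2) * (c * c)"
   using ab c q by (intro mult_mono powr_mono2) auto
  also have "\<dots> = c powr q"
  proof (cases "c = 0")
   case False
   then have "c powr (q - 2 + 2) = c powr (q - 2) * c^2" unfolding powr_add using c by (simp add: powr_numeral)
   then show ?thesis by (simp add: power2_eq_square add.commute)
  qed (use q in simp)
  also have "\<dots> <= a powr q + b powr q" by (auto simp: c_def max_def)
  finally show "norm (of_real (norm (u z) powr (q - 2)) * (u z * cnj (v z))) <= norm (norm (u z) powr q + norm (v z) powr q)"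
   by (simp add: norm_mult a_def b_def)
 qed
qed

text \<open>No curve on the mass sphere is needed, since \<open>key_inequality\<close> holds at the
  perturbed function whatever its positive mass. Linear lower bounds for the two powers turn it into
  a polynomial inequality in \<open>x\<close>.\<close>

lemma Euler_Lagrange:
 assumes u: "approx u g1 g2 t f fx fy" and v: "approx v h1 h2 s k kx ky"
  and M: "MM u = m" and E: "1 / 2 * GG g1 g2 + \<gamma> / 2 * (l2 (Ival 0 L) t)^2 - NN u / q <= Einf"
 shows "(LINT z|SL L. inner (g1 z) (h1 z)) + (LINT z|SL L. inner (g2 z) (h2 z)) + \<gamma> * (LINT y|Ival 0 L. inner (t y) (s y))
  + omega u * (LINT z|SL L. inner (u z) (v z)) = (LINT z|SL L. norm (u z) powr (q - 2) * inner (u z) (v z))"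
proof -
 note a = approxD[OF u] and b = approxD[OF v]
 define P where "P = (LINT z|SL L. inner (u z) (v z))"
 define J where "J = (LINT z|SL L. norm (u z) powr (q - 2) * inner (u z) (v z))"
 define Bq where "Bq = (LINT z|SL L. inner (g1 z) (h1 z)) + (LINT z|SL L. inner (g2 z) (h2 z)) + \<gamma> * (LINT y|Ival 0 L. inner (t y) (s y))"
 define A where "A = 1 / 2 * GG g1 g2 + \<gamma> / 2 * (l2 (Ival 0 L) t)^2"
 define D where "D = 1 / 2 * GG h1 h2 + \<gamma> / 2 * (l2 (Ival 0 L) s)^2"
 define \<mu> where "\<mu> x = m + 2 * x * P + x^2 * MM v" for x
 \<comment> \<open>The tangent of \<open>r powr (q / 2)\<close> at \<open>r = 1\<close>, taken at
   \<open>r = m / \<mu> x\<close> and multiplied by \<open>\<mu> x\<close>.\<close>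
 define \<kappa> where "\<kappa> x = m + (1 - q / 2) * (2 * x * P + x^2 * MM v)" for x
 have iJ: "integrable (SL L) (%z. norm (u z) powr (q - 2) * inner (u z) (v z))"
  using integrable_Re[OF powr_mult_integrable[OF u v]] by (simp add: inner_complex_def)
 have step: "0 <= m * (A + x * Bq + x^2 * D) - Einf * \<mu> x - \<kappa> x * (NN u / q + x * J)" if x: "0 < \<mu> x" "0 <= \<kappa> x" for x
 proof -
  define w where "w = (%z. u z + x *\<^sub>R v z)"
  note AL = approx_lin[OF u v, of x, folded w_def]
  have Mw: "MM w = \<mu> x" unfolding w_def \<mu>_def MM_def l2_add_scale_sq[OF a(1) b(1)] using M by (simp add: MM_def P_def)
  have Qw: "1 / 2 * GG (%z. g1 z + x *\<^sub>R h1 z) (%z. g2 z + x *\<^sub>R h2 z) + \<gamma> / 2 * (l2 (Ival 0 L) (%y. t y + x *\<^sub>R s y))^2 = A + x * Bq + x^2 * D"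
   unfolding GG_def l2_add_scale_sq[OF a(2) b(2)] l2_add_scale_sq[OF a(3) b(3)] l2_add_scale_sq[OF a(4) b(4)] A_def Bq_def D_def
   by (simp add: algebra_simps)
  have r: "0 < m / \<mu> x" using x m by simp
  have k: "(m / \<mu> x) powr (q / 2) * NN w / q <= m / \<mu> x * (A + x * Bq + x^2 * D) - Einf"
   using key_inequality(2)[OF AL] x(1) unfolding Mw Qw by blast
  have N0: "0 <= NN w / q" using q NN_nonneg[of w] by simp
  have "1 powr (q / 2) + q / 2 * 1 powr (q / 2 - 1) * (m / \<mu> x - 1) <= (m / \<mu> x) powr (q / 2)"
   by (rule powr_tangent) (use r q in auto)
  then have "(1 + q / 2 * (m / \<mu> x - 1)) * (NN w / q) <= (m / \<mu> x) powr (q / 2) * (NN w / q)"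
   using N0 by (intro mult_right_mono) auto
  also have "\<dots> <= m / \<mu> x * (A + x * Bq + x^2 * D) - Einf" using k by simp
  finally have fin: "\<mu> x * ((1 + q / 2 * (m / \<mu> x - 1)) * (NN w / q)) <= \<mu> x * (m / \<mu> x * (A + x * Bq + x^2 * D) - Einf)"
   using x(1) by (intro mult_left_mono) auto
  have e1: "\<mu> x * ((1 + q / 2 * (m / \<mu> x - 1)) * y) = \<kappa> x * y" for y
  proof -
   have "\<mu> x * (1 + b * (m / \<mu> x - 1)) = \<mu> x + b * (m - \<mu> x)" for b using x(1) by (simp add: field_simps)
   then have "\<mu> x * (1 + q / 2 * (m / \<mu> x - 1)) = \<mu> x + q / 2 * (m - \<mu> x)" .
   also have "\<dots> = \<kappa> x" unfolding \<mu>_def \<kappa>_def by (simp add: algebra_simps)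
   finally show ?thesis by (metis mult.assoc)
  qed
  have e2: "\<mu> x * (m / \<mu> x * y - Einf) = m * y - Einf * \<mu> x" for y using x(1) by (simp add: field_simps)
  have 1: "\<kappa> x * (NN w / q) <= m * (A + x * Bq + x^2 * D) - Einf * \<mu> x" using fin unfolding e1 e2 .
  \<comment> \<open>Convexity gives a lower bound only; this is the right direction, as the term
    stands on the smaller side with the nonnegative factor \<open>\<kappa> x\<close>.\<close>
  have "NN u + q * (x * J) <= NN w"
  proof -
   have e: "norm (u z) powr (q - 2) * inner (u z) (x *\<^sub>R v z) = x * (norm (u z) powr (q - 2) * inner (u z) (v z))" for z by simp
   have "(LINT z|SL L. norm (u z) powr q + q * (x * (norm (u z) powr (q - 2) * inner (u z) (v z)))) <= NN w"
    unfolding NN_def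
   proof (rule integral_mono)
    show "integrable (SL L) (%z. norm (u z) powr q + q * (x * (norm (u z) powr (q - 2) * inner (u z) (v z))))"
     by (intro Bochner_Integration.integrable_add approx_powr_integrable[OF u] integrable_mult_right iJ)
    show "integrable (SL L) (%z. norm (w z) powr q)" by (rule approx_powr_integrable[OF AL])
    show "norm (u z) powr q + q * (x * (norm (u z) powr (q - 2) * inner (u z) (v z))) <= norm (w z) powr q" for z
     unfolding w_def e[symmetric] by (rule powr_norm_tangent) (use q in simp)
   qed
   moreover have "(LINT z|SL L. norm (u z) powr q + q * (x * (norm (u z) powr (q - 2) * inner (u z) (v z)))) = NN u + q * (x * J)"
    unfolding NN_def J_def
    by (subst Bochner_Integration.integral_add[OF approx_powr_integrable[OF u]])
     (intro integrable_mult_right iJ, simp only: integral_mult_right_zero)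
   ultimately show ?thesis by linarith
  qed
  then have "(NN u + q * (x * J)) / q <= NN w / q" using q by (intro divide_right_mono) auto
  then have "NN u / q + x * J <= NN w / q" using q by (simp only: add_divide_distrib) simp
  then have "\<kappa> x * (NN u / q + x * J) <= \<kappa> x * (NN w / q)" using x(2) by (rule mult_left_mono)
  from order_trans[OF this 1] show ?thesis by (rule diff_ge_0_iff_ge[THEN iffD2])
 qed
 \<comment> \<open>Both coefficients tend to \<open>m > 0\<close>, so the inequality holds in a
   neighbourhood of 0.\<close>
 have "(\<mu> \<longlongrightarrow> m + 2 * 0 * P + 0^2 * MM v) (at 0)" "(\<kappa> \<longlongrightarrow> m + (1 - q / 2) * (2 * 0 * P + 0^2 * MM v)) (at 0)"
  unfolding \<mu>_def \<kappa>_def by (intro tendsto_intros)+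
 then have "(\<mu> \<longlongrightarrow> m) (at 0)" "(\<kappa> \<longlongrightarrow> m) (at 0)" by simp_all
 then have "\<forall>\<^sub>F x in at 0. 0 < \<mu> x" "\<forall>\<^sub>F x in at 0. 0 < \<kappa> x" using m by (auto intro: order_tendstoD(1))
 then have "\<forall>\<^sub>F x in at 0. 0 < \<mu> x \<and> 0 < \<kappa> x" by (rule eventually_conj)
 then obtain d where d: "0 < d" "\<And>x. x \<noteq> 0 ==> dist x 0 < d ==> 0 < \<mu> x \<and> 0 < \<kappa> x"
  unfolding eventually_at by auto
 have pos: "0 < \<mu> x \<and> 0 < \<kappa> x" if "\<bar>x\<bar> < d" for x
  using d(2)[of x] that m by (cases "x = 0") (auto simp: \<mu>_def \<kappa>_def dist_real_def)
 have q0: "0 < q" using q by simp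
 have "Bq + (- 2 * Einf / m + (q - 2) * NN u / (q * m)) * P = J"
 proof (rule cubic_min_derivative[OF m q0 d(1)])
  fix x assume x: "\<bar>x\<bar> < d"
  show "0 <= m * (A + x * Bq + x^2 * D) - Einf * (m + 2 * x * P + x^2 * MM v)
    - (m + (1 - q / 2) * (2 * x * P + x^2 * MM v)) * (NN u / q + x * J)"
   using step[of x] pos[OF x] unfolding \<mu>_def \<kappa>_def by (meson less_imp_le)
 qed (use E in \<open>simp only: A_def\<close>)
 then show ?thesis unfolding Bq_def P_def J_def omega_def .
qed

section \<open>The multiplier and the ground state property\<close>

lemma NN_pos:
 assumes u: "approx u g1 g2 t f fx fy" and M: "0 < MM u"
 shows "0 < NN u"
proof (rule ccontr)
 assume "\<not> 0 < NN u"
 then have "NN u = 0" using NN_nonneg[of u] by linarith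
 then have "AE z in SL L. norm (u z) powr q = 0"
  using integral_nonneg_eq_0_iff_AE[OF approx_powr_integrable[OF u]] by (simp add: NN_def)
 then have "AE z in SL L. u z = 0" by eventually_elim simp
 then have "MM u = 0" using l2_eq_0_iff[OF approxD(1)[OF u]] by (simp add: MM_def)
 then show False using M by simp
qed

lemma omega_lower:
 assumes u: "approx u g1 g2 t f fx fy" and M: "MM u = m"
 shows "\<gamma>^2 / 4 < omega u"
proof -
 have "0 < (q - 2) * NN u / (q * m)" using q m NN_pos[OF u] M by simp
 moreover have "\<gamma>^2 / 4 <= - 2 * Einf / m"
 proof (rule pos_le_divide_eq[OF m, THEN iffD2])
  show "\<gamma>^2 / 4 * m <= - 2 * Einf" using Einf_upper by linarith
 qed
 ultimately have "\<gamma>^2 / 4 + 0 < - 2 * Einf / m + (q - 2) * NN u / (q * m)" by (intro add_le_less_mono)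
 then show ?thesis unfolding omega_def by simp
qed

text \<open>Every competitor in the Sobolev space is a limit of C^1 functions, so
  \<open>key_inequality\<close> at mass \<open>m\<close> bounds its energy below by
  \<open>Einf\<close>.\<close>

lemma min_energy_eq:
 assumes u: "u \<in> H1 L" "mass L u = m" "energy L \<gamma> p u <= Einf"
 shows "energy_ground_state L \<gamma> p m u"
proof -
 have low: "Einf <= energy L \<gamma> p w" if w: "w \<in> H1 L" "mass L w = m" for w
 proof -
  obtain t f fx fy where A: "approx w (wdx L w) (wdy L w) t f fx fy" using H1_approx[OF w(1)] by blast
  have "MM w = m" using w(2) by (simp add: MM_def mass_l2)
  then show ?thesis using key_inequality(2)[OF A] m unfolding approx_energy[OF A] by (simp add: GG_def NN_def)
 qed
 have "ereal (energy L \<gamma> p u) = min_energy L \<gamma> p m"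
 proof (rule antisym)
  show "ereal (energy L \<gamma> p u) <= min_energy L \<gamma> p m"
   unfolding min_energy_def by (rule INF_greatest) (use low u(3) in \<open>auto intro: order_trans\<close>)
  show "min_energy L \<gamma> p m <= ereal (energy L \<gamma> p u)"
   unfolding min_energy_def by (rule INF_lower) (use u in simp)
 qed
 then show ?thesis using u by (simp add: energy_ground_state_def)
qed

lemma weak_solution_minimizer:
 assumes u: "u \<in> H1 L" "mass L u = m" "energy L \<gamma> p u <= Einf"
 shows "weak_solution L \<gamma> p (omega u) u"
 unfolding weak_solution_def
proof (intro conjI ballI u(1))
 obtain t f fx fy where A: "approx u (wdx L u) (wdy L u) t f fx fy" using H1_approx[OF u(1)] by blast
 have M: "MM u = m" using u(2) by (simp add: MM_def mass_l2)
 have E: "1 / 2 * GG (wdx L u) (wdy L u) + \<gamma> / 2 * (l2 (Ival 0 L) t)^2 - NN u / q <= Einf"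
  using u(3) unfolding approx_energy[OF A] by (simp add: GG_def NN_def)
 fix v assume "v \<in> H1 L"
 then obtain s k kx ky where B: "approx v (wdx L v) (wdy L v) s k kx ky" using H1_approx by blast
 note a = approxD[OF A] and b = approxD[OF B]
 note 1 = L2_mult_cnj[OF a(2) b(2)] and 2 = L2_mult_cnj[OF a(3) b(3)] and 3 = L2_mult_cnj[OF a(1) b(1)]
 define T where "T = (%z. of_real (norm (u z) powr (q - 2)) * (u z * cnj (v z)))"
 have iT: "integrable (SL L) T" unfolding T_def by (rule powr_mult_integrable[OF A B])
 have T: "Re (LINT z|SL L. T z) = (LINT z|SL L. norm (u z) powr (q - 2) * inner (u z) (v z))"
  unfolding integral_Re[OF iT, symmetric] by (simp add: T_def inner_complex_def)
 \<comment> \<open>The chosen traces agree almost everywhere with the limits, and the real part of a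
   product with a conjugate is the real inner product.\<close>
 have tr: "delta0 L u v = (LINT y|Ival 0 L. inner (t y) (s y))"
 proof -
  note [measurable] = sqiD[OF trace0_AE(1)[OF A]] sqiD[OF trace0_AE(1)[OF B]] sqiD[OF a(4)] sqiD[OF b(4)]
  have "delta0 L u v = (LINT y|Ival 0 L. inner (trace0 L u y) (trace0 L v y))"
   by (simp add: delta0_def set_integral_Ival inner_complex_def)
  also have "\<dots> = (LINT y|Ival 0 L. inner (t y) (s y))"
  proof (rule integral_cong_AE)
   show "AE y in Ival 0 L. inner (trace0 L u y) (trace0 L v y) = inner (t y) (s y)"
    using trace0_AE(2)[OF A] trace0_AE(2)[OF B] by eventually_elim simp
  qed measurable
  finally show ?thesis .
 qed
 have "(LINT z|SL L. wdx L u z * cnj (wdx L v z) + wdy L u z * cnj (wdy L v z)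
       + of_real (omega u) * (u z * cnj (v z)) - T z) =
   (LINT z|SL L. wdx L u z * cnj (wdx L v z)) + (LINT z|SL L. wdy L u z * cnj (wdy L v z))
    + of_real (omega u) * (LINT z|SL L. u z * cnj (v z)) - (LINT z|SL L. T z)"
  using 1(1) 2(1) 3(1) iT by simp
 then have "Re (LINT z|SL L. wdx L u z * cnj (wdx L v z) + wdy L u z * cnj (wdy L v z)
       + of_real (omega u) * (u z * cnj (v z)) - T z) + \<gamma> * delta0 L u v = 0"
  using Euler_Lagrange[OF A B M E] 1(2) 2(2) 3(2) T tr by simp
 then show "Re (LINT z:strip L|lborel. wdx L u z * cnj (wdx L v z) + wdy L u z * cnj (wdy L v z)
       + of_real (omega u) * u z * cnj (v z)
       - of_real (cmod (u z) powr (p - 1)) * u z * cnj (v z)) + \<gamma> * delta0 L u v = 0"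
  unfolding set_integral_strip T_def by (simp add: mult.assoc)
qed

section \<open>Positivity\<close>

lemma minimizerD:
 assumes "minimizer u g1 g2 t f fx fy"
 shows "0 <= u z" "C1c (f n) (fx n) (fy n)" "0 <= f n z"
  "approx (%z. of_real (u z)) (%z. of_real (g1 z)) (%z. of_real (g2 z)) t
   (%n z. of_real (f n z)) (%n z. of_real (fx n z)) (%n z. of_real (fy n z))"
  "MM u = m" "1 / 2 * GG g1 g2 + \<gamma> / 2 * (l2 (Ival 0 L) t)^2 - NN u / q <= Einf"
 using assms unfolding minimizer_def adm_def by blast+

lemma of_real_sqiD:
 assumes "(%z. complex_of_real (f z)) \<in> sqi M" shows "f \<in> sqi M"
proof -
 have "(%z. Re (complex_of_real (f z))) \<in> borel_measurable M" by (rule borel_measurable_continuous_on[OF _ sqiD[OF assms], of Re]) (intro continuous_intros)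
 then show ?thesis using sqi_integrable[OF assms] by (intro sqiI) auto
qed

lemma minimizer_lim:
 assumes mi: "minimizer u g1 g2 t f fx fy"
 shows "u \<in> sqi (SL L)" "g1 \<in> sqi (SL L)" "g2 \<in> sqi (SL L)" "(%n. l2 (SL L) (%z. f n z - u z)) \<longlonglongrightarrow> 0"
  "(%n. l2 (SL L) (%z. fx n z - g1 z)) \<longlonglongrightarrow> 0" "(%n. l2 (SL L) (%z. fy n z - g2 z)) \<longlonglongrightarrow> 0"
proof -
 note a = approxD[OF minimizerD(4)[OF mi]]
 show "u \<in> sqi (SL L)" "g1 \<in> sqi (SL L)" "g2 \<in> sqi (SL L)" by (rule of_real_sqiD[OF a(1)] of_real_sqiD[OF a(2)] of_real_sqiD[OF a(3)])+
 show "(%n. l2 (SL L) (%z. f n z - u z)) \<longlonglongrightarrow> 0" "(%n. l2 (SL L) (%z. fx n z - g1 z)) \<longlonglongrightarrow> 0"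
  "(%n. l2 (SL L) (%z. fy n z - g2 z)) \<longlonglongrightarrow> 0"
  using a(6,7,8) by (simp_all only: of_real_diff[symmetric] l2_of_real)
qed

text \<open>The trace term has a sign, since \<open>\<gamma> < 0\<close> and the trace of the minimizer is nonnegative.\<close>

lemma supersolution:
 fixes k :: "plane => real"
 assumes mi: "minimizer u g1 g2 t f fx fy" and k: "C1c k kx ky" "\<And>z. 0 <= k z"
 shows "0 <= (LINT z|SL L. g1 z * kx z + g2 z * ky z + omega (%z. of_real (u z)) * (u z * k z))"
proof -
 note A = minimizerD(4)[OF mi] and lim = minimizer_lim[OF mi]
 have M: "MM (%z. complex_of_real (u z)) = m" using minimizerD(5)[OF mi] by (simp add: MM_def l2_of_real)
 have E: "1 / 2 * GG (%z. complex_of_real (g1 z)) (%z. of_real (g2 z)) + \<gamma> / 2 * (l2 (Ival 0 L) t)^2 - NN (%z. complex_of_real (u z)) / q <= Einf"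
  using minimizerD(6)[OF mi] by (simp add: GG_def NN_def l2_of_real)
 note B = approx_const[OF C1c_of_real[OF k(1)]]
 have inn: "inner (complex_of_real a) (complex_of_real b) = a * b" for a b by (simp add: inner_complex_def)
 have "(%n. \<integral>y. inner (complex_of_real (f n (0, y))) (complex_of_real (k (0, y))) \<partial>Ival 0 L)
  \<longlonglongrightarrow> (LINT y|Ival 0 L. inner (t y) (complex_of_real (k (0, y))))"
  by (rule L2_inner_tendsto[OF C1c_slice_sqi[OF approxD(5)[OF A]] approxD(4,9)[OF A] approxD(4)[OF B] approxD(4)[OF B]])
   (simp add: l2_def)
 then have tr: "0 <= (LINT y|Ival 0 L. inner (t y) (complex_of_real (k (0, y))))"
  by (rule LIMSEQ_le_const) (use minimizerD(3)[OF mi] k(2) in \<open>auto simp: inn intro!: Bochner_Integration.integral_nonneg\<close>)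
 have "0 <= (LINT z|SL L. norm (complex_of_real (u z)) powr (q - 2) * inner (complex_of_real (u z)) (complex_of_real (k z)))"
  using minimizerD(1)[OF mi] k(2) by (intro Bochner_Integration.integral_nonneg) (simp add: inn)
 also note Euler_Lagrange[OF A B M E, symmetric]
 also have "\<gamma> * (LINT y|Ival 0 L. inner (t y) (complex_of_real (k (0, y)))) <= 0"
  using tr \<gamma> by (simp add: mult_le_0_iff)
 finally have 1: "0 <= (LINT z|SL L. g1 z * kx z) + (LINT z|SL L. g2 z * ky z) + omega (%z. of_real (u z)) * (LINT z|SL L. u z * k z)"
  unfolding inn by simp
 have "integrable (SL L) (%z. g1 z * kx z)" "integrable (SL L) (%z. g2 z * ky z)" "integrable (SL L) (%z. u z * k z)"
  using L2_inner_integrable[OF lim(2) C1c_sqi(2)[OF k(1)]] L2_inner_integrable[OF lim(3) C1c_sqi(3)[OF k(1)]]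
   L2_inner_integrable[OF lim(1) C1c_sqi(1)[OF k(1)]] by simp_all
 with 1 show ?thesis by simp
qed

section \<open>The logarithmic gradient estimate\<close>

text \<open>The denominator contains a C^1 approximant, since \<open>u\<close> itself is only a
  Sobolev function; the error of this replacement is handled in
  \<open>log_test_pointwise\<close>.\<close>

lemma C1c_cutoff_quotient:
 fixes f :: "plane => real"
 assumes C: "C1c f fx fy" and f0: "\<And>z. 0 <= f z" and e: "0 < e"
  and D: "\<And>x. (a has_real_derivative a' x) (at x)" and a': "continuous_on UNIV a'"
  and z: "\<And>x. R < \<bar>x\<bar> ==> a x = 0 \<and> a' x = 0"
 shows "C1c (%z. (a (fst z))^2 / (f z + e)) (%z. (2 * a (fst z) * a' (fst z) - (a (fst z))^2 * (fx z / (f z + e))) / (f z + e))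
  (%z. - ((a (fst z))^2 * (fy z / (f z + e))) / (f z + e))"
 unfolding C1c_def
proof (intro conjI allI)
 note F = C1cD[OF C]
 have ca: "continuous_on UNIV a" by (rule continuous_at_imp_continuous_on) (auto intro: DERIV_isCont[OF D])
 have c: "continuous_on UNIV (%z::plane. a (fst z))" "continuous_on UNIV (%z::plane. a' (fst z))"
  by (rule continuous_on_compose2[OF ca] continuous_on_compose2[OF a'], auto intro!: continuous_intros)+
 have ne: "f z + e \<noteq> 0" for z using f0[of z] e by linarith
 show "continuous_on UNIV (%z. (a (fst z))^2 / (f z + e))" by (intro continuous_intros c F(1)) (simp add: ne)
 show "continuous_on UNIV (%z. (2 * a (fst z) * a' (fst z) - (a (fst z))^2 * (fx z / (f z + e))) / (f z + e))"
  by (intro continuous_intros c F(1,2)) (simp_all add: ne)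
 show "continuous_on UNIV (%z. - ((a (fst z))^2 * (fy z / (f z + e))) / (f z + e))"
  by (intro continuous_intros c F(1,3)) (simp_all add: ne)
 show "xsupp (%z. (a (fst z))^2 / (f z + e))"
  "xsupp (%z. (2 * a (fst z) * a' (fst z) - (a (fst z))^2 * (fx z / (f z + e))) / (f z + e))"
  "xsupp (%z. - ((a (fst z))^2 * (fy z / (f z + e))) / (f z + e))"
  unfolding xsupp_def by (rule exI[of _ R], simp add: z)+
 fix x y
 have 1: "((%s. f (s, y)) has_real_derivative fx (x, y)) (at x)"
  using F(7) by (simp add: DERIV_iff_vec)
 have 2: "((%s. f (x, s)) has_real_derivative fy (x, y)) (at y)"
  using F(8) by (simp add: DERIV_iff_vec)
 have q: "(2 * p * p' * h - p^2 * h') / (h * h) = (2 * p * p' - p^2 * (h' / h)) / h" if "h \<noteq> 0" for p p' h h' :: real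
  using that by (simp add: divide_simps)
 have "((%s. (a s)^2 / (f (s, y) + e)) has_real_derivative
  (2 * a x * a' x * (f (x, y) + e) - (a x)^2 * fx (x, y)) / ((f (x, y) + e) * (f (x, y) + e))) (at x)"
  using ne by (auto intro!: derivative_eq_intros 1 D)
 then show "((%s. (a (fst (s, y)))^2 / (f (s, y) + e)) has_vector_derivative
  (2 * a (fst (x, y)) * a' (fst (x, y)) - (a (fst (x, y)))^2 * (fx (x, y) / (f (x, y) + e))) / (f (x, y) + e)) (at x)"
  unfolding DERIV_iff_vec[symmetric] fst_conv q[OF ne] .
 have "((%s. (a x)^2 / (f (x, s) + e)) has_real_derivative
  - ((a x)^2 * (fy (x, y) / (f (x, y) + e))) / (f (x, y) + e)) (at y)"
  using ne by (auto intro!: derivative_eq_intros 2)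
 then show "((%t. (a (fst (x, t)))^2 / (f (x, t) + e)) has_vector_derivative
  - ((a (fst (x, y)))^2 * (fy (x, y) / (f (x, y) + e))) / (f (x, y) + e)) (at y)"
  unfolding DERIV_iff_vec[symmetric] fst_conv .
qed

text \<open>\<open>ln (1 + f / e)\<close> differs from \<open>ln (f + e)\<close> by a constant,
  chosen so that the support stays bounded in the x-direction.\<close>

lemma C1c_ln:
 fixes f :: "plane => real"
 assumes C: "C1c f fx fy" and f0: "\<And>z. 0 <= f z" and e: "0 < e"
 shows "C1c (%z. ln (1 + f z / e)) (%z. fx z / (f z + e)) (%z. fy z / (f z + e))"
 unfolding C1c_def
proof (intro conjI allI)
 note F = C1cD[OF C]
 have ne: "f z + e \<noteq> 0" for z using f0[of z] e by linarith
 have pos: "0 < 1 + f z / e" for z using f0[of z] e by (simp add: add_pos_nonneg)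
 have ne1: "1 + f z / e \<noteq> 0" for z using pos[of z] by linarith
 show "continuous_on UNIV (%z. ln (1 + f z / e))" using e by (intro continuous_intros F(1)) (auto simp: ne1)
 show "continuous_on UNIV (%z. fx z / (f z + e))" "continuous_on UNIV (%z. fy z / (f z + e))"
  by (intro continuous_intros F(1,2,3), simp add: ne)+
 show "xsupp (%z. ln (1 + f z / e))" by (rule xsupp_map[OF F(4)]) simp
 show "xsupp (%z. fx z / (f z + e))" by (rule xsupp_map[OF F(5)]) simp
 show "xsupp (%z. fy z / (f z + e))" by (rule xsupp_map[OF F(6)]) simp
 fix x y
 have 1: "((%s. f (s, y)) has_real_derivative fx (x, y)) (at x)"
  using F(7) by (simp add: DERIV_iff_vec)
 have 2: "((%s. f (x, s)) has_real_derivative fy (x, y)) (at y)"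
  using F(8) by (simp add: DERIV_iff_vec)
 have q: "h' / e * (1 / (1 + h / e)) = h' / (h + e)" if "0 <= h" for h h' :: real
 proof -
  have "1 + h / e = (h + e) / e" using e by (simp add: field_simps)
  then show ?thesis using e by simp
 qed
 have 3: "((%s. 1 + f (s, y) / e) has_real_derivative fx (x, y) / e) (at x)"
  "((%s. 1 + f (x, s) / e) has_real_derivative fy (x, y) / e) (at y)"
  using e by (auto intro!: derivative_eq_intros 1 2)
 show "((%s. ln (1 + f (s, y) / e)) has_vector_derivative fx (x, y) / (f (x, y) + e)) (at x)"
  unfolding DERIV_iff_vec[symmetric]
  using DERIV_chain2[OF DERIV_ln_divide[OF pos] 3(1)] q[OF f0] by (metis mult.commute)
 show "((%t. ln (1 + f (x, t) / e)) has_vector_derivative fy (x, y) / (f (x, y) + e)) (at y)"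
  unfolding DERIV_iff_vec[symmetric]
  using DERIV_chain2[OF DERIV_ln_divide[OF pos] 3(2)] q[OF f0] by (metis mult.commute)
qed

text \<open>The squared gradient of the logarithm appears with a negative sign; the mixed term is
  absorbed by it and by the cutoff derivative. Every error of replacing \<open>u\<close> by the
  approximant is divided by \<open>D\<close>, which is at least \<open>e\<close>.\<close>

lemma log_test_pointwise:
 fixes c c' f f1 f2 g1 g2 u D e w :: real
 assumes c: "0 <= c" "c <= 1" and e: "0 < e" and f: "0 <= f" and w: "0 <= w"
 defines "D \<equiv> f + e"
 shows "g1 * ((2 * c * c' - c^2 * (f1 / D)) / D) + g2 * (- (c^2 * (f2 / D)) / D) + w * (u * (c^2 / D))
  <= 3 * c'^2 + 3 / 2 * w * c^2 - 1 / 4 * (c^2 * ((f1 / D)^2 + (f2 / D)^2))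
   + (2 * (g1 - f1)^2 + (g2 - f2)^2 + w / 2 * (u - f)^2) / e^2"
proof -
 have D: "0 < D" "e <= D" "f <= D" using e f by (auto simp: D_def)
 define a b d1 d2 d0 where d: "a = f1 / D" "b = f2 / D" "d1 = (g1 - f1) / D" "d2 = (g2 - f2) / D" "d0 = (u - f) / D"
 have g: "g1 / D = a + d1" "g2 / D = b + d2" "u / D = f / D + d0" by (simp_all add: d diff_divide_distrib)
 have c2: "0 <= c^2" "c^2 <= 1" using c by (auto simp: power_le_one)
 have s: "(y / D)^2 <= y^2 / e^2" for y
 proof -
  have "y^2 / D^2 <= y^2 / e^2" using D e by (intro divide_left_mono power_mono mult_pos_pos) auto
  then show ?thesis by (simp add: power_divide)
 qed
 have k: "c^2 * y^2 <= y^2" for y using mult_right_mono[OF c2(2), of "y^2"] by simp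
 have 1: "(a + d1) * (2 * c * c' - c^2 * a) <= 3 * c'^2 - 1 / 4 * (c^2 * a^2) + 2 * d1^2"
 proof -
  \<comment> \<open>An explicit sum of squares: the first pairs cutoff derivative and gradient, the
    second cutoff derivative and error, the third gradient and error.\<close>
  have "0 <= 1 / 2 * (2 * c' - c * a)^2 + (c' - c * d1)^2 + (1 / 2 * (c * a) + c * d1)^2" by simp
  also have "\<dots> = 3 * c'^2 - 1 / 4 * (c^2 * a^2) + 2 * (c^2 * d1^2) - (a + d1) * (2 * c * c' - c^2 * a)"
   by (simp add: power2_eq_square field_simps)
  finally show ?thesis using k[of d1] by linarith
 qed
 have 2: "(b + d2) * - (c^2 * b) <= - (1 / 4 * (c^2 * b^2)) + d2^2"
 proof -
  have "0 <= (1 / 2 * (c * b) + c * d2)^2 + 1 / 2 * (c * b)^2" by simp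
  also have "\<dots> = - (1 / 4 * (c^2 * b^2)) + c^2 * d2^2 - (b + d2) * - (c^2 * b)"
   by (simp add: power2_eq_square field_simps)
  finally show ?thesis using k[of d2] by linarith
 qed
 have 3: "(f / D + d0) * c^2 <= 3 / 2 * c^2 + 1 / 2 * d0^2"
 proof -
  have "f / D * c^2 <= 1 * c^2" using D c2 by (intro mult_right_mono) auto
  moreover have "0 <= 1 / 2 * (c - c * d0)^2" by simp
  moreover have "1 / 2 * (c - c * d0)^2 = 1 / 2 * c^2 + 1 / 2 * (c^2 * d0^2) - d0 * c^2" by (simp add: power2_eq_square field_simps)
  ultimately show ?thesis using k[of d0] unfolding distrib_right by linarith
 qed
 have 4: "g1 * ((2 * c * c' - c^2 * (f1 / D)) / D) = (a + d1) * (2 * c * c' - c^2 * a)"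
  "g2 * (- (c^2 * (f2 / D)) / D) = (b + d2) * - (c^2 * b)" "u * (c^2 / D) = (f / D + d0) * c^2"
  unfolding g[symmetric] unfolding d by simp_all
 have 5: "w * ((f / D + d0) * c^2) <= 3 / 2 * w * c^2 + w / 2 * d0^2"
  using mult_left_mono[OF 3 w] by (simp add: algebra_simps)
 have 6: "2 * d1^2 + d2^2 + w / 2 * d0^2 <= (2 * (g1 - f1)^2 + (g2 - f2)^2 + w / 2 * (u - f)^2) / e^2"
 proof -
  have "2 * d1^2 + d2^2 + w / 2 * d0^2 <= 2 * ((g1 - f1)^2 / e^2) + (g2 - f2)^2 / e^2 + w / 2 * ((u - f)^2 / e^2)"
   unfolding d using w by (intro add_mono mult_left_mono s) auto
  then show ?thesis by (simp add: add_divide_distrib)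
 qed
 have 7: "1 / 4 * (c^2 * ((f1 / D)^2 + (f2 / D)^2)) = 1 / 4 * (c^2 * a^2) + 1 / 4 * (c^2 * b^2)"
  by (simp add: d distrib_left)
 have "X1 + X2 + w * X3 <= 3 * p + S - Y + Z" if "X1 = x1" "X2 = x2" "X3 = x3" "w * x3 <= S + U" "2 * e1 + e2 + U <= Z"
  "Y = y1 + y2" "x1 <= 3 * p - y1 + 2 * e1" "x2 <= - y2 + e2" for X1 X2 X3 x1 x2 x3 p S Y Z U e1 e2 y1 y2 :: real
  using that by simp
 from this[OF 4 5 6 7 1 2] show ?thesis .
qed

text \<open>The order of quantifiers is the point: \<open>K\<close> is chosen before
  \<open>e\<close>, and only the index from which the bound holds depends on \<open>e\<close>. The
  errors carry the factor \<open>1 / e^2\<close>, but for fixed \<open>e\<close> they tend to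
  0.\<close>

lemma log_gradient_bound:
 assumes mi: "minimizer u g1 g2 t f fx fy"
 obtains K where "\<And>e. 0 < e ==> \<forall>\<^sub>F n in sequentially.
  (LINT z|SL L. (cutoff R (fst z))^2 * ((fx n z / (f n z + e))^2 + (fy n z / (f n z + e))^2)) <= K"
proof -
 define a where "a = cutoff R"
 define a' where "a' = deriv (cutoff R)"
 define w where "w = omega (%z. of_real (u z))"
 note lim = minimizer_lim[OF mi] and C = minimizerD(2)[OF mi] and f0 = minimizerD(3)[OF mi]
 have w: "0 <= w"
 proof -
  have "\<gamma>^2 / 4 < w" unfolding w_def by (rule omega_lower[OF minimizerD(4)[OF mi]]) (use minimizerD(5)[OF mi] in \<open>simp add: MM_def l2_of_real\<close>)
  then show ?thesis using zero_le_power2[of \<gamma>] by linarith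
 qed
 have Da: "(a has_real_derivative a' x) (at x)" for x unfolding a_def a'_def by (rule smooth_DERIV(1)[OF cutoff_smooth])
 have ca: "continuous_on UNIV a" unfolding a_def by (rule smooth_continuous[OF cutoff_smooth])
 have ca': "continuous_on UNIV a'" unfolding a'_def by (rule smooth_continuous[OF smooth_DERIV(2)[OF cutoff_smooth]])
 have c: "continuous_on UNIV (%z::plane. a (fst z))" "continuous_on UNIV (%z::plane. a' (fst z))"
  by (rule continuous_on_compose2[OF ca] continuous_on_compose2[OF ca'], auto intro!: continuous_intros)+
 have a0: "a x = 0 \<and> a' x = 0" if "\<bar>R\<bar> + 1 < \<bar>x\<bar>" for x
 proof -
  obtain C where "\<And>R x. R + 1 < \<bar>x\<bar> ==> deriv (cutoff R) x = 0" using deriv_cutoff_bound by metis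
  then show ?thesis using that cutoff_zero[of R x] by (simp add: a_def a'_def)
 qed
 define C0 where "C0 = (LINT z|SL L. 3 * (a' (fst z))^2 + 3 / 2 * w * (a (fst z))^2)"
 have i0: "integrable (SL L) (%z. 3 * (a' (fst z))^2 + 3 / 2 * w * (a (fst z))^2)"
 proof (rule integrable_SL_continuous)
  show "continuous_on UNIV (%z::plane. 3 * (a' (fst z))^2 + 3 / 2 * w * (a (fst z))^2)" by (intro continuous_intros c)
  show "xsupp (%z. 3 * (a' (fst z))^2 + 3 / 2 * w * (a (fst z))^2)" unfolding xsupp_def by (rule exI[of _ "\<bar>R\<bar> + 1"]) (simp add: a0)
 qed
 show ?thesis
 proof (rule that[of "4 * (C0 + 1)"])
  fix e :: real assume e: "0 < e"
  define r where "r n = (2 * (l2 (SL L) (%z. fx n z - g1 z))^2 + (l2 (SL L) (%z. fy n z - g2 z))^2 + w / 2 * (l2 (SL L) (%z. f n z - u z))^2) / e^2" for n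
  have "r \<longlonglongrightarrow> (2 * 0^2 + 0^2 + w / 2 * 0^2) / e^2" unfolding r_def using e by (intro tendsto_intros lim) auto
  then have "r \<longlonglongrightarrow> 0" by simp
  then have "\<forall>\<^sub>F n in sequentially. r n < 1" by (rule order_tendstoD(2)) simp
  then show "\<forall>\<^sub>F n in sequentially. (LINT z|SL L. (cutoff R (fst z))^2 * ((fx n z / (f n z + e))^2 + (fy n z / (f n z + e))^2)) <= 4 * (C0 + 1)"
  proof eventually_elim
   case (elim n)
   define k where "k = (%z. (a (fst z))^2 / (f n z + e))"
   define kx where "kx = (%z. (2 * a (fst z) * a' (fst z) - (a (fst z))^2 * (fx n z / (f n z + e))) / (f n z + e))"
   define ky where "ky = (%z. - ((a (fst z))^2 * (fy n z / (f n z + e))) / (f n z + e))"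
   define h where "h = (%z. (a (fst z))^2 * ((fx n z / (f n z + e))^2 + (fy n z / (f n z + e))^2))"
   define rr where "rr = (%z. (2 * (fx n z - g1 z)^2 + (fy n z - g2 z)^2 + w / 2 * (f n z - u z)^2) / e^2)"
   have Ck: "C1c k kx ky" unfolding k_def kx_def ky_def by (rule C1c_cutoff_quotient[OF C f0 e Da ca' a0])
   have k0: "0 <= k z" for z using f0[of n z] e by (simp add: k_def)
   have ne: "f n z + e \<noteq> 0" for z using f0[of n z] e by linarith
   have ih: "integrable (SL L) h"
   proof (rule integrable_SL_continuous)
    show "continuous_on UNIV h" unfolding h_def by (intro continuous_intros c C1cD(1-3)[OF C]) (simp_all add: ne)
    show "xsupp h" unfolding h_def xsupp_def by (rule exI[of _ "\<bar>R\<bar> + 1"]) (simp add: a0)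
   qed
   note d1 = sqi_integrable[OF sqi_diff[OF C1c_sqi(2)[OF C[of n]] lim(2)]]
    and d2 = sqi_integrable[OF sqi_diff[OF C1c_sqi(3)[OF C[of n]] lim(3)]]
    and d0 = sqi_integrable[OF sqi_diff[OF C1c_sqi(1)[OF C[of n]] lim(1)]]
   have irr: "integrable (SL L) rr" unfolding rr_def using d1 d2 d0 by simp
   have Irr: "(LINT z|SL L. rr z) = r n" unfolding rr_def r_def l2_sq using d1 d2 d0 by simp
   have ik: "integrable (SL L) (%z. g1 z * kx z)" "integrable (SL L) (%z. g2 z * ky z)" "integrable (SL L) (%z. u z * k z)"
    using L2_inner_integrable[OF lim(2) C1c_sqi(2)[OF Ck]] L2_inner_integrable[OF lim(3) C1c_sqi(3)[OF Ck]]
     L2_inner_integrable[OF lim(1) C1c_sqi(1)[OF Ck]] by simp_all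
   have "0 <= (LINT z|SL L. g1 z * kx z + g2 z * ky z + w * (u z * k z))"
    unfolding w_def by (rule supersolution[OF mi Ck k0])
   also have "\<dots> <= (LINT z|SL L. (3 * (a' (fst z))^2 + 3 / 2 * w * (a (fst z))^2) - 1 / 4 * h z + rr z)"
   proof (rule integral_mono)
    show "integrable (SL L) (%z. g1 z * kx z + g2 z * ky z + w * (u z * k z))" using ik by simp
    show "integrable (SL L) (%z. (3 * (a' (fst z))^2 + 3 / 2 * w * (a (fst z))^2) - 1 / 4 * h z + rr z)"
     by (intro Bochner_Integration.integrable_add Bochner_Integration.integrable_diff i0 irr integrable_mult_right ih)
    fix z :: "plane"
    have ab: "0 <= a (fst z)" "a (fst z) <= 1" by (simp_all add: a_def cutoff_bounds)
    show "g1 z * kx z + g2 z * ky z + w * (u z * k z) <= (3 * (a' (fst z))^2 + 3 / 2 * w * (a (fst z))^2) - 1 / 4 * h z + rr z"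
     unfolding k_def kx_def ky_def h_def rr_def
      power2_commute[of "fx n z" "g1 z"] power2_commute[of "fy n z" "g2 z"] power2_commute[of "f n z" "u z"]
     by (rule log_test_pointwise[OF ab e f0 w])
   qed
   also have "\<dots> = (C0 - 1 / 4 * (LINT z|SL L. h z)) + r n"
    unfolding C0_def Irr[symmetric]
    by (simp only: Bochner_Integration.integral_add Bochner_Integration.integral_diff i0 irr ih
     Bochner_Integration.integrable_diff integrable_mult_right integral_mult_right_zero)
   finally have "(LINT z|SL L. h z) <= 4 * (C0 + 1)" using elim by argo
   then show ?case by (simp add: h_def a_def)
  qed
 qed
qed

lemma ln_Lipschitz:
 fixes a b e :: real
 assumes "0 <= a" "0 <= b" "0 < e"
 shows "\<bar>ln (1 + a / e) - ln (1 + b / e)\<bar> <= \<bar>a - b\<bar> / e"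
proof -
 have *: "ln (1 + x / e) - ln (1 + y / e) <= (x - y) / e" if "0 <= y" "y <= x" for x y
 proof -
  have p: "0 < 1 + y / e" "0 < 1 + x / e" "1 <= 1 + y / e" using that assms(3) by (auto intro: add_pos_nonneg)
  have "ln (1 + x / e) - ln (1 + y / e) = ln ((1 + x / e) / (1 + y / e))" using p by (simp add: ln_div)
  also have "\<dots> <= (1 + x / e) / (1 + y / e) - 1" using p by (intro ln_le_minus_one divide_pos_pos)
  also have "\<dots> = (x - y) / e / (1 + y / e)" using p by (simp add: diff_divide_distrib field_simps)
  also have "\<dots> <= (x - y) / e / 1" by (rule divide_left_mono[OF p(3)]) (use p(1) that assms(3) in simp_all)
  finally show ?thesis by simp
 qed
 have m: "ln (1 + y / e) <= ln (1 + x / e)" if "0 <= y" "y <= x" for x y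
  using that assms(3) by (intro ln_mono) (auto intro: add_pos_nonneg divide_right_mono)
 show ?thesis
 proof (cases "a <= b")
  case True
  then show ?thesis using *[OF assms(1) True] m[OF assms(1) True] by simp
 next
  case False
  then have "b <= a" by simp
  then show ?thesis using *[OF assms(2)] m[OF assms(2)] by simp
 qed
qed

lemma indicator_box_SL:
 assumes N: "0 < N"
 shows "integrable (SL L) (%z. indicator ({-N..N} \<times> {0..L}) z :: real)" "(LINT z|SL L. indicator ({-N..N} \<times> {0..L}) z) = 2 * N * L"
proof -
 have "integrable (SL L) (%z. indicator ({-N..N} \<times> {0..L}) z * (indicator ({-N..N} \<times> UNIV) z * (1::real)))"
  by (intro ind_integrable box_sets integrable_SL_box_indicator[of UNIV]) simp
 moreover have "indicator ({-N..N} \<times> {0..L}) z * (indicator ({-N..N} \<times> UNIV) z * (1::real)) = indicator ({-N..N} \<times> {0..L}) z" for z :: "plane"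
  by (auto simp: indicator_def)
 ultimately show i: "integrable (SL L) (%z. indicator ({-N..N} \<times> {0..L}) z :: real)" by (simp only:)
 have "(LINT z|SL L. indicator ({-N..N} \<times> {0..L}) z) = (LINT z|(Ival (-N) N \<Otimes>\<^sub>M Ival 0 L). (1::real))"
  using box_integral_SL[of 0 L L "-N" N "%_. 1 :: real"] by simp
 also have "\<dots> = (LINT x|Ival (-N) N. (LINT y|Ival 0 L. 1))" using integral_box_fst(1)[of "%_. 1 :: real" "-N" N 0 L] by simp
 also have "\<dots> = 2 * N * L" using L N by (simp add: measure_Ival)
 finally show "(LINT z|SL L. indicator ({-N..N} \<times> {0..L}) z) = 2 * N * L" .
qed

text \<open>The logarithms \<open>ln (1 + u / e)\<close> have gradients bounded in \<open>L^2\<close> uniformly in \<open>e\<close>, hence bounded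
 variance on boxes; if they vanish on a set of positive measure, they are bounded in \<open>L^2\<close> uniformly in \<open>e\<close>.\<close>

lemma log_variance:
 assumes mi: "minimizer u g1 g2 t f fx fy" and N: "0 < N"
 defines "B \<equiv> {-N..N} \<times> {0..L}"
 obtains K where "\<And>e. 0 < e ==> (2 * N * L - (LINT z|SL L. indicator B z * of_bool (0 < u z))) *
  (LINT z|SL L. indicator B z * (ln (1 + u z / e))^2) <= K"
proof -
 note lim = minimizer_lim[OF mi] and C = minimizerD(2)[OF mi] and f0 = minimizerD(3)[OF mi] and u0 = minimizerD(1)[OF mi]
 have Bs: "B \<in> sets borel" unfolding B_def by (rule box_sets)
 have Bm: "(%z. indicator B z :: real) \<in> borel_measurable (SL L)" by (rule set_SL_sets[OF Bs])
 have um[measurable]: "u \<in> borel_measurable (SL L)" by (rule sqiD[OF lim(1)])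
 obtain K where K: "\<And>e. 0 < e ==> \<forall>\<^sub>F n in sequentially.
  (LINT z|SL L. (cutoff N (fst z))^2 * ((fx n z / (f n z + e))^2 + (fy n z / (f n z + e))^2)) <= K"
  using log_gradient_bound[OF mi, of N] by blast
 define V where "V = 2 * N * L"
 define c where "c = V * ((2 * N)^2 + L^2)"
 have V: "0 < V" using N L by (simp add: V_def)
 have c: "0 <= c" using V by (simp add: c_def)
 show ?thesis
 proof (rule that[of "c * K"])
  fix e :: real assume e: "0 < e"
  define l where "l = (%z. ln (1 + u z / e))"
  define ln' where "ln' n = (%z. ln (1 + f n z / e))" for n
  note Cl = C1c_ln[OF C f0 e, folded ln'_def]
  have ls: "ln' n \<in> sqi (SL L)" for n by (rule C1c_sqi(1)[OF Cl])
  have lm: "l \<in> borel_measurable (SL L)" unfolding l_def by measurable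
  have l0: "0 <= l z" "l z <= u z / e" for z
  proof -
   show "0 <= l z" unfolding l_def using u0[of z] e by (intro ln_ge_zero) simp
   show "l z <= u z / e" unfolding l_def using u0[of z] e by (intro ln_add_one_self_le_self) simp
  qed
  have lsq: "l \<in> sqi (SL L)"
  proof (rule sqi_dominated(1)[OF sqi_scale[OF lim(1), of "1 / e"] lm])
   show "AE z in SL L. norm (l z) <= norm ((1 / e) *\<^sub>R u z)" using l0 u0 e by (auto simp: abs_of_nonneg)
  qed
  have conv: "(%n. l2 (SL L) (%z. ln' n z - l z)) \<longlonglongrightarrow> 0"
  proof (rule tendsto_sandwich[OF _ _ tendsto_const])
   have "l2 (SL L) (%z. ln' n z - l z) <= l2 (SL L) (%z. (1 / e) *\<^sub>R (f n z - u z))" for n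
   proof (rule sqi_dominated(2)[OF sqi_scale[OF sqi_diff[OF C1c_sqi(1)[OF C] lim(1)]]])
    show "(%z. ln' n z - l z) \<in> borel_measurable (SL L)" by (rule sqiD[OF sqi_diff[OF ls lsq]])
    show "AE z in SL L. norm (ln' n z - l z) <= norm ((1 / e) *\<^sub>R (f n z - u z))"
     using ln_Lipschitz[OF f0 u0 e] e by (auto simp: ln'_def l_def abs_mult)
   qed
   then have "l2 (SL L) (%z. ln' n z - l z) <= 1 / e * l2 (SL L) (%z. f n z - u z)" for n
    unfolding l2_scale using e by simp
   then show "\<forall>\<^sub>F n in sequentially. l2 (SL L) (%z. ln' n z - l z) <= 1 / e * l2 (SL L) (%z. f n z - u z)" by simp
   show "(%n. 1 / e * l2 (SL L) (%z. f n z - u z)) \<longlonglongrightarrow> 0" using tendsto_mult_left[OF lim(4), of "1 / e"] by simp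
  qed simp
  define bl where "bl = (%z. indicator B z * l z)"
  define bln where "bln n = (%z. indicator B z * ln' n z)" for n
  have bs: "(%z. indicator B z * g z) \<in> sqi (SL L)" and bnd: "l2 (SL L) (%z. indicator B z * g z) <= l2 (SL L) g"
   if g: "g \<in> sqi (SL L)" for g :: "plane => real"
  proof -
   have m: "(%z. indicator B z * g z) \<in> borel_measurable (SL L)" using Bm sqiD[OF g] by simp
   have "AE z in SL L. norm (indicator B z * g z) <= norm (g z)" by (auto simp: indicator_def)
   from sqi_dominated[OF g m this]
   show "(%z. indicator B z * g z) \<in> sqi (SL L)" "l2 (SL L) (%z. indicator B z * g z) <= l2 (SL L) g" by auto
  qed
  have bls: "bl \<in> sqi (SL L)" "bln n \<in> sqi (SL L)" for n unfolding bl_def bln_def by (rule bs[OF lsq] bs[OF ls])+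
  have bconv: "(%n. l2 (SL L) (%z. bln n z - bl z)) \<longlonglongrightarrow> 0"
  proof (rule tendsto_sandwich[OF _ _ tendsto_const conv])
   have "l2 (SL L) (%z. bln n z - bl z) <= l2 (SL L) (%z. ln' n z - l z)" for n
    using bnd[OF sqi_diff[OF ls[of n] lsq]] by (simp add: bln_def bl_def right_diff_distrib)
   then show "\<forall>\<^sub>F n in sequentially. l2 (SL L) (%z. bln n z - bl z) <= l2 (SL L) (%z. ln' n z - l z)" by simp
  qed simp
  note ind = indicator_box_SL[OF N, folded B_def]
  have one: "(%z. indicator B z :: real) \<in> sqi (SL L)"
  proof (rule sqiI[OF Bm])
   have "(norm (indicator B z :: real))^2 = indicator B z" for z by (simp add: indicator_def)
   then show "integrable (SL L) (%z. (norm (indicator B z :: real))^2)" using ind(1) by simp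
  qed
  have bb: "indicator B z * indicator B z = (indicator B z :: real)" for z by (simp add: indicator_def)
  have lim1: "(%n. \<integral>z. bln n z \<partial>SL L) \<longlonglongrightarrow> (LINT z|SL L. bl z)"
  proof -
   have "(%n. \<integral>z. inner (indicator B z) (bln n z) \<partial>SL L) \<longlonglongrightarrow> (LINT z|SL L. inner (indicator B z) (bl z))"
    by (rule L2_inner_tendsto[OF one one _ bls(2) bls(1) bconv]) (simp add: l2_def)
   then show ?thesis by (simp add: bln_def bl_def mult.assoc[symmetric] bb)
  qed
  have lim2: "(%n. (l2 (SL L) (bln n))^2) \<longlonglongrightarrow> (l2 (SL L) bl)^2"
   by (intro tendsto_power l2_tendsto[OF bls(2) bls(1) bconv])
  define X where "X = (l2 (SL L) bl)^2"
  have "\<forall>\<^sub>F n in sequentially. V * (l2 (SL L) (bln n))^2 - (LINT z|SL L. bln n z)^2 <= c * K"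
   using K[OF e]
  proof eventually_elim
   case (elim n)
   let ?M = "Ival (-N) N \<Otimes>\<^sub>M Ival 0 L"
   let ?g = "%z. (fx n z / (f n z + e))^2 + (fy n z / (f n z + e))^2"
   have box: "(LINT z|?M. g z) = (LINT z|SL L. indicator B z * g z)" for g :: "plane => real"
    using box_integral_SL[of 0 L L "-N" N g] by (simp add: B_def)
   have e: "N - - N = 2 * N" "L - 0 = L" by simp_all
   have P0: "(N - - N) * (L - 0) * (LINT z|?M. (ln' n z)^2) <= (LINT z|?M. ln' n z)^2 +
    (N - - N) * (L - 0) * ((N - - N)^2 + (L - 0)^2) * (LINT z|?M. ?g z)"
    by (rule Poincare_box[OF Cl]) (use N L in auto)
   have P: "V * (LINT z|?M. (ln' n z)^2) <= (LINT z|?M. ln' n z)^2 + c * (LINT z|?M. ?g z)" using P0 unfolding e V_def[symmetric] c_def[symmetric] .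
   have 1: "(LINT z|?M. (ln' n z)^2) = (l2 (SL L) (bln n))^2"
    unfolding box l2_sq bln_def by (intro Bochner_Integration.integral_cong) (auto simp: indicator_def)
   have 2: "(LINT z|?M. ln' n z) = (LINT z|SL L. bln n z)" unfolding box bln_def ..
   have "(LINT z|?M. ?g z) <= (LINT z|SL L. (cutoff N (fst z))^2 * ?g z)"
    unfolding box
   proof (rule integral_mono)
    have gi: "integrable (SL L) ?g" 
     by (rule Bochner_Integration.integrable_add[OF sqi_integrable[OF C1c_sqi(2)[OF Cl[of n]], unfolded real_norm_def power2_abs]
      sqi_integrable[OF C1c_sqi(3)[OF Cl[of n]], unfolded real_norm_def power2_abs]])
    then show "integrable (SL L) (%z. indicator B z * ?g z)" by (rule ind_integrable[OF _ Bs])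
    have cc: "continuous_on UNIV (%z::plane. cutoff N (fst z))"
     by (rule continuous_on_compose2[OF smooth_continuous[OF cutoff_smooth]]) (auto intro!: continuous_intros)
    show "integrable (SL L) (%z. (cutoff N (fst z))^2 * ?g z)"
    proof (rule Bochner_Integration.integrable_bound[OF gi])
     show "(%z. (cutoff N (fst z))^2 * ?g z) \<in> borel_measurable (SL L)"
      using measurable_SL_continuous[OF cc] borel_measurable_integrable[OF gi] by simp
     have "(cutoff N x)^2 * y <= 1 * y" if "0 <= y" for x y using that cutoff_bounds[of N x] by (intro mult_right_mono) (auto simp: power_le_one)
     then show "AE z in SL L. norm ((cutoff N (fst z))^2 * ?g z) <= norm (?g z)" by (auto simp: abs_mult)
    qed
    fix z
    show "indicator B z * ?g z <= (cutoff N (fst z))^2 * ?g z"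
     using cutoff_one[of "fst z" N] by (auto simp: indicator_def B_def mem_Times_iff)
   qed
   then have "c * (LINT z|?M. ?g z) <= c * K" using elim c by (intro mult_left_mono) auto
   then show ?case using P unfolding 1 2 by linarith
  qed
  then have Vb: "V * X - (LINT z|SL L. bl z)^2 <= c * K"
   unfolding X_def by (intro tendsto_upperbound[OF tendsto_diff[OF tendsto_mult_left[OF lim2] tendsto_power[OF lim1]]]) auto
  define ps where "ps = (%z. indicator B z * (of_bool (0 < u z) :: real))"
  have psm: "ps \<in> borel_measurable (SL L)" unfolding ps_def of_bool_def by (rule borel_measurable_times[OF Bm]) measurable
  have pss: "ps \<in> sqi (SL L)"
   by (rule sqi_dominated(1)[OF one psm]) (auto simp: ps_def indicator_def)
  have pl: "(l2 (SL L) ps)^2 = (LINT z|SL L. ps z)"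
   unfolding l2_sq by (intro Bochner_Integration.integral_cong) (auto simp: ps_def indicator_def)
  \<comment> \<open>\<open>bl\<close> vanishes where \<open>u\<close> does, so Cauchy-Schwarz
    applies against the indicator of the positivity set. After subtraction the measure of the zero
    set remains as the factor of \<open>X\<close>.\<close>
  have "(LINT z|SL L. bl z)^2 <= (LINT z|SL L. ps z) * X"
  proof -
   have e1: "inner (ps z) (bl z) = bl z" for z
   proof (cases "0 < u z")
    case False
    then have "u z = 0" using u0[of z] by linarith
    then show ?thesis by (simp add: bl_def l_def)
   qed (simp add: ps_def bl_def indicator_def)
   have "\<bar>\<integral>z. bl z \<partial>SL L\<bar> <= l2 (SL L) ps * l2 (SL L) bl" using L2_inner_le[OF pss bls(1)] unfolding e1 .
   then have "\<bar>\<integral>z. bl z \<partial>SL L\<bar>^2 <= (l2 (SL L) ps * l2 (SL L) bl)^2" by (intro power_mono) auto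
   then show ?thesis by (simp add: power_mult_distrib pl X_def)
  qed
  then have "(V - (LINT z|SL L. ps z)) * X <= c * K" using Vb by (simp add: left_diff_distrib)
  moreover have "X = (LINT z|SL L. indicator B z * (ln (1 + u z / e))^2)"
   unfolding X_def l2_sq bl_def l_def by (intro Bochner_Integration.integral_cong) (auto simp: indicator_def)
  ultimately show "(2 * N * L - (LINT z|SL L. indicator B z * of_bool (0 < u z))) *
   (LINT z|SL L. indicator B z * (ln (1 + u z / e))^2) <= c * K"
   by (simp add: ps_def V_def)
 qed
qed

text \<open>If the zero set in the box has positive measure \<open>Z\<close>, the logarithms are
  bounded in \<open>L^2\<close> uniformly in \<open>e\<close>. Where \<open>u\<close> is at least
  \<open>h > 0\<close> they exceed \<open>ln (1 + h / e)\<close>, which is unbounded as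
  \<open>e\<close> tends to 0, so that set is null.\<close>

lemma positive_or_zero_on_box:
 assumes mi: "minimizer u g1 g2 t f fx fy" and N: "0 < N"
 defines "B \<equiv> {-N..N} \<times> {0..L}"
 shows "(AE z in SL L. z \<in> B \<longrightarrow> 0 < u z) \<or> (AE z in SL L. z \<in> B \<longrightarrow> u z = 0)"
proof -
 note lim = minimizer_lim[OF mi] and u0 = minimizerD(1)[OF mi]
 have Bs: "B \<in> sets borel" unfolding B_def by (rule box_sets)
 have Bm: "(%z. indicator B z :: real) \<in> borel_measurable (SL L)" by (rule set_SL_sets[OF Bs])
 have um[measurable]: "u \<in> borel_measurable (SL L)" by (rule sqiD[OF lim(1)])
 note iB = indicator_box_SL[OF N, folded B_def]
 obtain K where K: "\<And>e. 0 < e ==> (2 * N * L - (LINT z|SL L. indicator B z * of_bool (0 < u z))) *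
  (LINT z|SL L. indicator B z * (ln (1 + u z / e))^2) <= K"
  using log_variance[OF mi N] unfolding B_def by blast
 define ps where "ps = (%z. indicator B z * (of_bool (0 < u z) :: real))"
 define zr where "zr = (%z. indicator B z * (of_bool (u z = 0) :: real))"
 have bnd: "integrable (SL L) (%z. indicator B z * (of_bool (P z) :: real))" if "(%z. of_bool (P z) :: real) \<in> borel_measurable (SL L)" for P
  by (rule Bochner_Integration.integrable_bound[OF iB(1)])
   (use Bm that in \<open>auto intro!: borel_measurable_times simp: indicator_def\<close>)
 have ip: "integrable (SL L) ps" "integrable (SL L) zr" unfolding ps_def zr_def by (rule bnd, measurable)+
 define Z where "Z = (LINT z|SL L. zr z)"
 have Z: "2 * N * L - (LINT z|SL L. ps z) = Z"
 proof -
  have "indicator B z - ps z = zr z" for z using u0[of z] by (auto simp: ps_def zr_def)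
  then have "Z = (LINT z|SL L. indicator B z - ps z)" by (simp add: Z_def)
  then show ?thesis using iB ip by simp
 qed
 have Z0: "0 <= Z" unfolding Z_def by (rule Bochner_Integration.integral_nonneg) (simp add: zr_def)
 show ?thesis
 proof (cases "Z = 0")
  case True
  then have "AE z in SL L. zr z = 0" using integral_nonneg_eq_0_iff_AE[OF ip(2)] by (simp add: Z_def zr_def)
  then have "AE z in SL L. z \<in> B \<longrightarrow> 0 < u z"
  proof eventually_elim
   case (elim z)
   then show ?case using u0[of z] by (auto simp: zr_def)
  qed
  then show ?thesis ..
 next
  case False
  then have Zp: "0 < Z" using Z0 by linarith
  have "AE z in SL L. z \<in> B \<longrightarrow> u z < h" if h: "0 < h" for h
  proof -
   define I where "I = (LINT z|SL L. indicator B z * (of_bool (h <= u z) :: real))"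
   have ii: "integrable (SL L) (%z. indicator B z * (of_bool (h <= u z) :: real))" by (rule bnd) measurable
   have I0: "0 <= I" unfolding I_def by (rule Bochner_Integration.integral_nonneg) simp
   have bound: "Z * (s^2 * I) <= K" if s: "0 < s" for s
   proof -
    \<comment> \<open>Solves \<open>ln (1 + h / e) = s\<close>, so that \<open>s\<close> can be
      taken arbitrarily large.\<close>
    define e where "e = h / (exp s - 1)"
    have e: "0 < e" using h s by (simp add: e_def)
    have lnh: "ln (1 + h / e) = s" using h s by (simp add: e_def)
    have il: "integrable (SL L) (%z. indicator B z * (ln (1 + u z / e))^2)"
    proof (rule ind_integrable[OF _ Bs], rule Bochner_Integration.integrable_bound[of _ "%z. (1 / e)^2 * (norm (u z))^2"])
     show "integrable (SL L) (%z. (1 / e)^2 * (norm (u z))^2)" by (rule integrable_mult_right[OF sqi_integrable[OF lim(1)]])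
     show "(%z. (ln (1 + u z / e))^2) \<in> borel_measurable (SL L)" by measurable
     have "(ln (1 + u z / e))^2 <= (u z / e)^2" for z
      using u0[of z] e by (intro power_mono ln_add_one_self_le_self ln_ge_zero) auto
     then show "AE z in SL L. norm ((ln (1 + u z / e))^2) <= norm ((1 / e)^2 * (norm (u z))^2)" by (simp add: power_divide)
    qed
    have "s^2 * I = (LINT z|SL L. s^2 * (indicator B z * of_bool (h <= u z)))" by (simp add: I_def)
    also have "\<dots> <= (LINT z|SL L. indicator B z * (ln (1 + u z / e))^2)"
    proof (rule integral_mono[OF integrable_mult_right[OF ii] il])
     fix z
     have "s^2 <= (ln (1 + u z / e))^2" if "h <= u z"
     proof -
      have "ln (1 + h / e) <= ln (1 + u z / e)" using that h e by (intro ln_mono) (auto intro: add_pos_nonneg divide_right_mono)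
      then show ?thesis unfolding lnh using s by (intro power_mono) auto
     qed
     then show "s^2 * (indicator B z * of_bool (h <= u z)) <= indicator B z * (ln (1 + u z / e))^2"
      by (auto simp: indicator_def)
    qed
    finally have "Z * (s^2 * I) <= Z * (LINT z|SL L. indicator B z * (ln (1 + u z / e))^2)" using Z0 by (intro mult_left_mono)
    also have "\<dots> <= K" using K[OF e] unfolding Z[symmetric] ps_def .
    finally show ?thesis .
   qed
   have "I = 0"
   proof (rule ccontr)
    assume "I \<noteq> 0"
    then have ZI: "0 < Z * I" using I0 Zp by simp
    \<comment> \<open>Makes \<open>s * (Z * I)\<close> exceed \<open>\<bar>K\<bar>\<close>; since
      \<open>s\<close> is at least 1, its square does so too.\<close>
    define s where "s = \<bar>K\<bar> / (Z * I) + 1"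
    have s: "1 <= s" using ZI by (simp add: s_def)
    have "x < (x / y + 1) * y" if "0 < y" for x y :: real using that by (simp add: distrib_right)
    from this[OF ZI] have "\<bar>K\<bar> < s * (Z * I)" unfolding s_def .
    also have "\<dots> <= s^2 * (Z * I)" using s ZI mult_left_mono[of 1 s s] by (intro mult_right_mono) (auto simp: power2_eq_square)
    also have "\<dots> = Z * (s^2 * I)" by simp
    also have "\<dots> <= K" using s by (intro bound) simp
    finally show False by simp
   qed
   then have "AE z in SL L. indicator B z * (of_bool (h <= u z) :: real) = 0"
    using integral_nonneg_eq_0_iff_AE[OF ii] by (simp add: I_def)
   then show ?thesis by eventually_elim auto
  qed
  then have "AE z in SL L. \<forall>j::nat. z \<in> B \<longrightarrow> u z < inverse (real (Suc j))"
   unfolding AE_all_countable by simp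
  then have "AE z in SL L. z \<in> B \<longrightarrow> u z = 0"
  proof eventually_elim
   case (elim z)
   show ?case
   proof (intro impI, rule ccontr)
    assume z: "z \<in> B" "u z \<noteq> 0"
    then have "0 < u z" using u0[of z] by linarith
    from reals_Archimedean[OF this] obtain j where "inverse (real (Suc j)) < u z" by blast
    then show False using elim z(1) by (meson less_asym)
   qed
  qed
  then show ?thesis ..
 qed
qed

text \<open>The boxes are nested and exhaust the strip. Vanishing on all of them contradicts the
  positive mass, so the zero alternative fails on some box and then on every larger one.\<close>

lemma minimizer_positive:
 assumes mi: "minimizer u g1 g2 t f fx fy"
 shows "AE z in SL L. 0 < u z"
proof -
 let ?B = "%N::nat. {- real (Suc N)..real (Suc N)} \<times> {0..L}"
 have cover: "\<exists>N0. \<forall>N\<ge>N0. z \<in> ?B N" if "z \<in> space (SL L)" for z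
 proof -
  obtain N0 :: nat where "\<bar>fst z\<bar> <= real N0" using real_arch_simple by blast
  show ?thesis
  proof (intro exI[of _ N0] allI impI)
   fix N assume "N0 <= N"
   then have "\<bar>fst z\<bar> <= real (Suc N)" using \<open>\<bar>fst z\<bar> <= real N0\<close> by simp
   then show "z \<in> ?B N" using that by (auto simp: strip_def mem_Times_iff abs_le_iff)
  qed
 qed
 have dich: "(AE z in SL L. z \<in> ?B N \<longrightarrow> 0 < u z) \<or> (AE z in SL L. z \<in> ?B N \<longrightarrow> u z = 0)" for N
  by (rule positive_or_zero_on_box[OF mi]) simp
 have "\<exists>N0. \<not> (AE z in SL L. z \<in> ?B N0 \<longrightarrow> u z = 0)"
 proof (rule ccontr)
  assume "\<not> ?thesis"
  then have "AE z in SL L. \<forall>N. z \<in> ?B N \<longrightarrow> u z = 0" unfolding AE_all_countable by simp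
  then have "AE z in SL L. u z = 0" using AE_space
  proof eventually_elim
   case (elim z)
   then show ?case using cover[of z] by blast
  qed
  then have "MM u = 0" using l2_eq_0_iff[OF minimizer_lim(1)[OF mi]] by (simp add: MM_def)
  then show False using minimizerD(5)[OF mi] m by simp
 qed
 then obtain N0 where N0: "\<not> (AE z in SL L. z \<in> ?B N0 \<longrightarrow> u z = 0)" by blast
 have pos: "AE z in SL L. z \<in> ?B N \<longrightarrow> 0 < u z" if N: "N0 <= N" for N
 proof -
  have sub: "?B N0 \<subseteq> ?B N" using N by auto
  have "\<not> (AE z in SL L. z \<in> ?B N \<longrightarrow> u z = 0)"
  proof
   assume "AE z in SL L. z \<in> ?B N \<longrightarrow> u z = 0"
   then have "AE z in SL L. z \<in> ?B N0 \<longrightarrow> u z = 0" by eventually_elim (use sub in blast)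
   then show False using N0 by blast
  qed
  then show ?thesis using dich[of N] by blast
 qed
 have "AE z in SL L. \<forall>N. N0 <= N \<longrightarrow> z \<in> ?B N \<longrightarrow> 0 < u z" unfolding AE_all_countable using pos by (auto intro: AE_impI)
 then show ?thesis using AE_space
 proof eventually_elim
  case (elim z)
  obtain N1 where "\<forall>N\<ge>N1. z \<in> ?B N" using cover[OF elim(2)] by blast
  then show ?case using elim(1) by (meson max.cobounded1 max.cobounded2)
 qed
qed

lemma positive_ground_state:
 "\<exists>u. energy_ground_state L \<gamma> p m u \<and> (\<forall>z\<in>strip L. u z \<in> \<real> \<and> Re (u z) > 0) \<and>
  (\<exists>\<omega>::real. \<omega> > \<gamma>^2 / 4 \<and> weak_solution L \<gamma> p \<omega> u)"
proof -
 obtain u g1 g2 t f fx fy where mi: "minimizer u g1 g2 t f fx fy" using exists_minimizer by blast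
 \<comment> \<open>Positivity is demanded at every point of the strip; on the null set where
   \<open>u\<close> is not positive the value is set to 1.\<close>
 define w where "w z = complex_of_real (if 0 < u z then u z else 1)" for z
 have [measurable]: "u \<in> borel_measurable (SL L)" by (rule sqiD[OF minimizer_lim(1)[OF mi]])
 have wm: "w \<in> borel_measurable (SL L)" unfolding w_def[abs_def] by measurable
 have AE: "AE z in SL L. complex_of_real (u z) = w z" using minimizer_positive[OF mi] by eventually_elim (simp add: w_def)
 note A = approx_cong_AE[OF minimizerD(4)[OF mi] wm AE]
 have M: "MM w = m"
 proof -
  have "l2 (SL L) (%z. complex_of_real (u z)) = l2 (SL L) w" using AE by (intro l2_cong_AE wm) measurable
  then show ?thesis using minimizerD(5)[OF mi] by (simp add: MM_def l2_of_real)
 qed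
 have N: "NN w = NN u"
 proof -
  have "NN w = NN (%z. complex_of_real (u z))" unfolding NN_def
  proof (rule integral_cong_AE)
   show "AE z in SL L. norm (w z) powr q = norm (complex_of_real (u z)) powr q" using AE by eventually_elim simp
  qed (use wm in measurable)
  then show ?thesis by (simp add: NN_def)
 qed
 have E: "energy L \<gamma> p w <= Einf"
  using minimizerD(6)[OF mi] N unfolding approx_energy[OF A] by (simp add: GG_def NN_def l2_of_real)
 have H: "w \<in> H1 L" "mass L w = m" using approx_H1(1)[OF A] M by (simp_all add: MM_def mass_l2)
 have "energy_ground_state L \<gamma> p m w" by (rule min_energy_eq[OF H E])
 moreover have "\<forall>z\<in>strip L. w z \<in> \<real> \<and> Re (w z) > 0" by (simp add: w_def)
 moreover have "omega w > \<gamma>^2 / 4" by (rule omega_lower[OF A M])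
 moreover have "weak_solution L \<gamma> p (omega w) w" by (rule weak_solution_minimizer[OF H E])
 ultimately show ?thesis by blast
qed

end

theorem theorem1p2:
  fixes L \<gamma> p m :: real
  assumes "L > 0" and "\<gamma> < 0" and "1 < p" and "p < 3" and "m > 0"
  shows "\<exists>u. energy_ground_state L \<gamma> p m u \<and>
             (\<forall>z\<in>strip L. u z \<in> \<real> \<and> Re (u z) > 0) \<and>
             (\<exists>\<omega>::real. \<omega> > \<gamma>\<^sup>2 / 4 \<and> weak_solution L \<gamma> p \<omega> u)"
proof -
  interpret nls L \<gamma> p m using assms by unfold_locales
  show ?thesis by (rule positive_ground_state)
qed

end
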